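(* Let $B>0$. Then $(q,1/2,B)$ does not satisfy the Northcott property for $\zeta_K(1/2)$, i.e. there are infinitely many isomorphism classes $[K]$ with $|\zeta_K(1/2)|\le B$.
   Context: $q\equiv1\pmod4$. $K$ ranges over global function fields in one variable with constant field $\mathbb F_q$, with zeta function $\zeta_K$; here one works with the value $\zeta_K(1/2)$ itself rather than the leading Taylor coefficient $\zeta_K^*(1/2)$. Notation $\sigma=\operatorname{Re}(s)$. *)

theory Defs
  imports
    "HOL-Algebra.Algebra"
    "HOL-Number_Theory.Prime_Powers"
    "HOL-Complex_Analysis.Complex_Analysis"
begin

text \<open>
  \<open>K\<close> is a function field in one variable over \<open>F\<close>, the field of constants being exactly \<open>F\<close>:
  \<open>K\<close> is a finite extension of \<open>F(x)\<close> for some \<open>x\<close> transcendental over \<open>F\<close>, and \<open>F\<close> is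
  algebraically closed in \<open>K\<close>.
\<close>

definition function_field_over :: "'a set \<Rightarrow> 'a ring \<Rightarrow> bool" where
  "function_field_over F K \<longleftrightarrow>
     field K \<and> subfield F K \<and>
     (\<exists>x \<in> carrier K. ring.transcendental K F x \<and>
        ring.finite_dimension K (generate_field K (insert x F)) (carrier K)) \<and>
     (\<forall>y \<in> carrier K. ring.algebraic K F y \<longrightarrow> y \<in> F)"

text \<open>
  The constant field \<open>F\<close> is determined by \<open>K\<close> when it is finite (it consists of the elements
  algebraic over the prime field), so carrying it along adds no structure to \<open>K\<close>.
\<close>

definition global_function_field :: "nat \<Rightarrow> 'a set \<Rightarrow> 'a ring \<Rightarrow> bool" where
  "global_function_field q F K \<longleftrightarrow> function_field_over F K \<and> finite F \<and> card F = q"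

text \<open>
  A prime of \<open>K\<close> is represented by its valuation ring \<open>V\<close>, with \<open>F \<subset> V \<subset> K\<close>; the primes
  include the ones at infinity. In a function field these valuation rings are discrete.
\<close>

definition places :: "'a set \<Rightarrow> 'a ring \<Rightarrow> 'a set set" where
  "places F K = {V. subring V K \<and> F \<subset> V \<and> V \<subset> carrier K \<and>
     (\<forall>z \<in> carrier K - {\<zero>\<^bsub>K\<^esub>}. z \<in> V \<or> inv\<^bsub>K\<^esub> z \<in> V)}"

definition place_ideal :: "'a ring \<Rightarrow> 'a set \<Rightarrow> 'a set" where
  "place_ideal K V = V - Units (K\<lparr>carrier := V\<rparr>)"

text \<open>The norm of a prime is \<open>q\<close> to its degree, i.e. the cardinality of its residue field.\<close>

definition place_norm :: "'a ring \<Rightarrow> 'a set \<Rightarrow> nat" where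
  "place_norm K V = card (carrier ((K\<lparr>carrier := V\<rparr>) Quot (place_ideal K V)))"

text \<open>Effective divisors are finite multisets of primes.\<close>

definition effective_divisors :: "'a set \<Rightarrow> 'a ring \<Rightarrow> 'a set multiset set" where
  "effective_divisors F K = {D. set_mset D \<subseteq> places F K}"

definition divisor_norm :: "'a ring \<Rightarrow> 'a set multiset \<Rightarrow> nat" where
  "divisor_norm K D = (\<Prod>V\<in>#D. place_norm K V)"

text \<open>
  The zeta function is the meromorphic continuation to \<open>\<complex>\<close> of the Dirichlet series over the
  effective divisors, which converges absolutely for \<open>Re s > 1\<close>. Nicely meromorphic functions are
  continuous at every point that is not a pole, so that there is at most one such continuation, as
  a function on all of \<open>\<complex>\<close>; their value at a pole is 0 by convention.
\<close>

definition zeta_K :: "'a set \<Rightarrow> 'a ring \<Rightarrow> complex \<Rightarrow> complex" where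
  "zeta_K F K = (THE f. f nicely_meromorphic_on UNIV \<and>
     (\<forall>s. Re s > 1 \<longrightarrow>
        f s = (\<Sum>\<^sub>\<infinity>D \<in> effective_divisors F K. of_nat (divisor_norm K D) powr (- s))))"

definition field_iso_class :: "'a ring \<Rightarrow> 'a ring set" where
  "field_iso_class K = {L. field L \<and> K \<simeq> L}"

text \<open>
  Every global function field is countably infinite, hence isomorphic to one whose carrier is a
  set of natural numbers; so the isomorphism classes among fields of type \<open>nat ring\<close> are all of
  them. Isomorphisms are field isomorphisms, not required to fix the constants.
  The condition is about the value of zeta at \<open>s\<close>, so it is meaningful where \<open>s\<close> is not a pole;
  the poles all have real part 0 or 1.
\<close>

definition northcott_set :: "nat \<Rightarrow> complex \<Rightarrow> real \<Rightarrow> nat ring set set" where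
  "northcott_set q s B =
     {field_iso_class K |F K. global_function_field q F K \<and> cmod (zeta_K F K s) \<le> B}"

definition northcott_property :: "nat \<Rightarrow> complex \<Rightarrow> real \<Rightarrow> bool" where
  "northcott_property q s B \<longleftrightarrow> finite (northcott_set q s B)"

end

theory Submission
  imports Defs "HOL-Number_Theory.Cong" "Berlekamp_Zassenhaus.Finite_Field" "HOL-Algebra.Algebraic_Closure_Type"
begin

hide_const (open) Polynomials.degree Polynomials.lead_coeff up_ring.coeff up_ring.monom
  Divisibility.prime Divisibility.irreducible Coset.order

text \<open>
  Let \<open>p\<close> be the characteristic. The fields are the Artin--Schreier extensions
  \<open>w\<^sup>p - w = a x\<^sup>N\<close> of \<open>F\<^sub>q(x)\<close> with \<open>N = 2M\<close>, \<open>M\<close> odd and prime to \<open>p\<close>. Up to the factor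
  \<open>1 / ((1 - u) (1 - q u))\<close>, \<open>u = q powr (- s)\<close>, the zeta function is the product over \<open>0 < c < p\<close> of
  the polynomials in \<open>u\<close> of degree \<open>N - 1\<close> attached to the characters
  \<open>f \<mapsto> \<psi> (c a \<Sum> \<alpha>\<^sup>N)\<close>, the sum being over the roots \<open>\<alpha>\<close> of \<open>f\<close>. As \<open>q mod 4 = 1\<close>, \<open>- 1\<close> is a
  square and these polynomials are real, so that their functional equation has a sign. The sign is
  read off from the leading coefficient, a quadratic Gauss sum that changes sign when \<open>a\<close> is
  multiplied by a nonsquare. For a suitable \<open>a\<close> the sign is \<open>- 1\<close>, which forces a zero at \<open>s = 1/2\<close>.
  The degree \<open>(p - 1) (N - 1)\<close> of the numerator tells the fields for different \<open>N\<close> apart.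
\<close>

section \<open>Finite fields and their additive characters\<close>

text \<open>The functional equation pairs an L-polynomial with its complex conjugate, so it has a
  sign only for real coefficients. This dictates the shape of \<open>N\<close>: if
  \<open>e ^ 2 = - 1\<close>, replacing X by e X multiplies N-th power sums by (- 1)^M, and this
  must be - 1 to produce the conjugate character; evenness of \<open>N\<close> is what makes the
  leading coefficient quadratic. That both signs occur comes from averaging, as the leading
  coefficients over all nonzero \<open>a\<close> add up to 0. A zero of the single factor c = 1
  suffices, and the value 0 lies below every bound. Turning these sums into a zeta function requires
  the complete list of places. They are found as Frobenius orbits of points on the affine curve,
  together with one place at infinity. Since \<open>p\<close> does not divide \<open>N\<close>, that
  place is totally ramified, and pole orders there are weights: \<open>p\<close> for x and
  \<open>N\<close> for \<open>w\<close>. Above an orbit of x-coordinates the fiber splits or is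
  inert according to the trace of \<open>a\<close> times the power sum, and the identity 1 - z^p =
  \<Prod> (1 - \<rho>^c z) turns both cases into the same product of p character factors.\<close>

lemma card_subspace_eq_power:
  fixes C S :: "'b::field set"
  assumes "finite S" and Cfin: "finite C" and C0: "0 \<in> C" and C1: "1 \<in> C"
    and Cminus: "\<And>a b. a \<in> C \<Longrightarrow> b \<in> C \<Longrightarrow> a - b \<in> C"
    and Cmult: "\<And>a b. a \<in> C \<Longrightarrow> b \<in> C \<Longrightarrow> a * b \<in> C"
    and Cinv: "\<And>a. a \<in> C \<Longrightarrow> inverse a \<in> C"
    and S0: "0 \<in> S" and Sadd: "\<And>a b. a \<in> S \<Longrightarrow> b \<in> S \<Longrightarrow> a + b \<in> S"
    and Sscale: "\<And>c a. c \<in> C \<Longrightarrow> a \<in> S \<Longrightarrow> c * a \<in> S"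
  obtains e where "card S = card C ^ e"
proof -
  define subsp where "subsp T \<longleftrightarrow> 0 \<in> T \<and> (\<forall>a\<in>T. \<forall>b\<in>T. a + b \<in> T) \<and>
      (\<forall>c\<in>C. \<forall>a\<in>T. c * a \<in> T)" for T :: "'b set"
  define P where "P k \<longleftrightarrow> (\<exists>T\<subseteq>S. subsp T \<and> card T = card C ^ k)" for k
  have "card {0::'b,1} \<le> card C"
    using C0 C1 Cfin by (intro card_mono) auto
  hence C2: "card C \<ge> 2" by simp
  have "P 0"
    unfolding P_def subsp_def using S0 by (intro exI[of _ "{0}"]) auto
  moreover have "k \<le> card S" if "P k" for k
  proof -
    from that obtain T where "T \<subseteq> S" "card T = card C ^ k" unfolding P_def by blast
    hence "card C ^ k \<le> card S" using card_mono[OF assms(1)] by metis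
    moreover have "k < 2 ^ k" by simp
    moreover have "2 ^ k \<le> card C ^ k" using C2 by (intro power_mono) auto
    ultimately show ?thesis by linarith
  qed
  ultimately obtain k where k: "P k" "\<And>j. P j \<Longrightarrow> j \<le> k"
    using Nat.ex_has_greatest_nat[of P 0 "card S"] by blast
  then obtain T where T: "T \<subseteq> S" "subsp T" "card T = card C ^ k" unfolding P_def by blast
  \<comment> \<open>\<open>T\<close> is the largest subspace whose size is a power of
    \<open>card C\<close>. A vector \<open>v\<close> outside would give the subspace T + C v, larger
    by exactly one factor \<open>card C\<close>.\<close>
  have "T = S"
  proof (rule ccontr)
    assume "T \<noteq> S"
    then obtain v where v: "v \<in> S" "v \<notin> T" using T by blast
    have neg: "- c \<in> C" if "c \<in> C" for c using Cminus[OF C0 that] by simp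
    have Cadd: "a + b \<in> C" if "a \<in> C" "b \<in> C" for a b
      using Cminus[OF that(1) neg[OF that(2)]] by simp
    have Tneg: "- t \<in> T" if "t \<in> T" for t
      using T(2) neg[OF C1] that unfolding subsp_def by fastforce
    define T' where "T' = (\<lambda>(t,c). t + c * v) ` (T \<times> C)"
    have inj: "inj_on (\<lambda>(t,c). t + c * v) (T \<times> C)"
    proof (intro inj_onI, clarify)
      fix t c t' c' assume h: "t \<in> T" "c \<in> C" "t' \<in> T" "c' \<in> C" "t + c * v = t' + c' * v"
      have eq: "(c - c') * v = t' + (- t)" using h(5) by (simp add: algebra_simps)
      have "c = c'"
      proof (rule ccontr)
        assume "c \<noteq> c'"
        have "t' + (- t) \<in> T" using T(2) h Tneg unfolding subsp_def by blast
        moreover have "inverse (c - c') \<in> C" using Cinv Cminus h by blast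
        ultimately have "inverse (c - c') * ((c - c') * v) \<in> T"
          using T(2) eq unfolding subsp_def by metis
        moreover have "inverse (c - c') * ((c - c') * v) = v" using \<open>c \<noteq> c'\<close> by simp
        ultimately show False using v by simp
      qed
      thus "t = t' \<and> c = c'" using h(5) by simp
    qed
    have "card T' = card C ^ Suc k"
      unfolding T'_def using card_image[OF inj] T(3) by (simp add: card_cartesian_product)
    moreover have "T' \<subseteq> S" using T v Sadd Sscale unfolding T'_def by auto
    moreover have "subsp T'"
      unfolding subsp_def
    proof (intro conjI ballI)
      show "0 \<in> T'" unfolding T'_def using T(2) C0
        by (intro image_eqI[of _ _ "(0,0)"]) (auto simp: subsp_def)
      fix a b assume "a \<in> T'" "b \<in> T'"
      then obtain t c s d where h: "t \<in> T" "c \<in> C" "s \<in> T" "d \<in> C" "a = t + c * v" "b = s + d * v"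
        unfolding T'_def by auto
      show "a + b \<in> T'" unfolding T'_def
        using h T(2) Cadd by (intro image_eqI[of _ _ "(t+s,c+d)"]) (auto simp: subsp_def algebra_simps)
    next
      fix c a assume h: "c \<in> C" "a \<in> T'"
      then obtain t d where h2: "t \<in> T" "d \<in> C" "a = t + d * v"
        unfolding T'_def by auto
      show "c * a \<in> T'" unfolding T'_def
        using h h2 T(2) Cmult by (intro image_eqI[of _ _ "(c*t,c*d)"]) (auto simp: subsp_def algebra_simps)
    qed
    ultimately have "P (Suc k)" unfolding P_def by blast
    thus False using k(2) by fastforce
  qed
  thus ?thesis using T that by blast
qed

text \<open>The device by which subfields are recognised throughout: once n fixed points are
  exhibited, there are no others.\<close>

lemma card_fixed_points_power_le:
  fixes n :: nat
  assumes "n \<ge> 2"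
  shows "finite {y::'b::idom. y ^ n = y}" "card {y::'b::idom. y ^ n = y} \<le> n"
proof -
  define f :: "'b poly" where "f = Polynomial.monom 1 n - Polynomial.monom 1 1"
  have c: "Polynomial.coeff f n = 1" using assms by (auto simp: f_def)
  hence "f \<noteq> 0" by auto
  have "degree f \<le> n" unfolding f_def using assms
    by (intro degree_diff_le) (auto simp: degree_monom_eq)
  have eq: "{y. y ^ n = y} = {y. poly f y = 0}"
    by (auto simp: f_def poly_monom)
  show "finite {y::'b. y ^ n = y}" unfolding eq by (rule poly_roots_finite[OF \<open>f \<noteq> 0\<close>])
  show "card {y::'b. y ^ n = y} \<le> n" unfolding eq
    using card_poly_roots_bound[OF \<open>f \<noteq> 0\<close>] \<open>degree f \<le> n\<close> by linarith
qed

lemma inj_on_of_nat_CHAR: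
  "inj_on (of_nat :: nat \<Rightarrow> 'b::idom_prime_char) {..<CHAR('b)}"
proof (intro inj_onI)
  fix m n assume h: "m \<in> {..<CHAR('b)}" "n \<in> {..<CHAR('b)}" "(of_nat m :: 'b) = of_nat n"
  hence "[m = n] (mod CHAR('b))" by (simp add: of_nat_eq_iff_cong_CHAR)
  thus "m = n" using h by (simp add: cong_less_modulus_unique_nat)
qed

lemma of_nat_power_CHAR: "(of_nat n :: 'b::idom_prime_char) ^ CHAR('b) = of_nat n"
proof (induction n)
  case (Suc n)
  thus ?case by (simp add: freshmans_dream[OF CHAR_prime refl])
qed (simp add: CHAR_pos)

text \<open>The multiples of 1 are p distinct roots of X^p - X, hence all of them. As the fixed set
  of a ring endomorphism, the prime field is then visibly closed under the operations.\<close>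

lemma fixed_points_CHAR:
  "{y::'b::idom_prime_char. y ^ CHAR('b) = y} = of_nat ` {..<CHAR('b)}"
proof -
  have p2: "CHAR('b) \<ge> 2" using CHAR_prime[where ?'a='b] prime_ge_2_nat by blast
  have "of_nat ` {..<CHAR('b)} \<subseteq> {y::'b. y ^ CHAR('b) = y}" by (auto simp: of_nat_power_CHAR)
  moreover have "card (of_nat ` {..<CHAR('b)} :: 'b set) = CHAR('b)"
    using card_image[OF inj_on_of_nat_CHAR] by simp
  ultimately show ?thesis
    using card_fixed_points_power_le[OF p2, where ?'b='b] card_subset_eq by (metis card_mono le_antisym)
qed

lemma card_finite_field:
  obtains m where "CARD('a::finite_field) = CHAR('a) ^ m" "m > 0"
proof -
  let ?C = "of_nat ` {..<CHAR('a)} :: 'a set"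
  have C: "?C = {y. y ^ CHAR('a) = y}" by (rule fixed_points_CHAR[symmetric])
  have "- y \<in> ?C" if "y \<in> ?C" for y
  proof -
    have "0 = (y + (-y)) ^ CHAR('a)" by (simp add: CHAR_pos zero_power)
    also have "\<dots> = y ^ CHAR('a) + (-y) ^ CHAR('a)" by (rule freshmans_dream[OF CHAR_prime refl])
    finally show ?thesis using that unfolding C by (simp add: eq_neg_iff_add_eq_0 add.commute)
  qed
  moreover have "a + b \<in> ?C" if "a \<in> ?C" "b \<in> ?C" for a b
    using that unfolding C by (simp add: freshmans_dream[OF CHAR_prime refl])
  ultimately have minus: "a - b \<in> ?C" if "a \<in> ?C" "b \<in> ?C" for a b
    using that by (metis diff_conv_add_uminus)
  obtain m where m: "CARD('a) = card ?C ^ m"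
  proof (rule card_subspace_eq_power[of "UNIV::'a set" ?C])
    show "0 \<in> ?C" "1 \<in> ?C" unfolding C by (auto simp: CHAR_pos zero_power)
    show "a * b \<in> ?C" if "a \<in> ?C" "b \<in> ?C" for a b
      using that unfolding C by (simp add: power_mult_distrib)
    show "inverse a \<in> ?C" if "a \<in> ?C" for a
      using that unfolding C by (simp add: power_inverse)
  qed (use minus in auto)
  have "CARD('a) > 1"
    using card_mono[of UNIV "{0::'a,1}"] by simp
  hence "m \<noteq> 0" using m by (intro notI) auto
  moreover have "card ?C = CHAR('a)" using card_image[OF inj_on_of_nat_CHAR] by simp
  ultimately show ?thesis using m that by auto
qed

lemma CARD_gt_1: "CARD('a::finite_field) > 1"
  using card_mono[of UNIV "{0::'a,1}"] by simp

text \<open>The degree over the prime field, that is, the number of conjugates summed in the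
  absolute trace.\<close>

definition finite_field_dim :: "'a::finite_field itself \<Rightarrow> nat" where
  "finite_field_dim _ = (SOME m. CARD('a) = CHAR('a) ^ m \<and> m > 0)"

lemma finite_field_dim:
  "CARD('a::finite_field) = CHAR('a) ^ finite_field_dim TYPE('a)" "finite_field_dim TYPE('a) > 0"
proof -
  have "\<exists>m. CARD('a) = CHAR('a) ^ m \<and> m > 0" using card_finite_field[where ?'a='a] by blast
  from someI_ex[OF this] show "CARD('a::finite_field) = CHAR('a) ^ finite_field_dim TYPE('a)" "finite_field_dim TYPE('a) > 0"
    unfolding finite_field_dim_def by auto
qed

text \<open>The trace to the prime field, kept as an element of \<open>'a\<close>; membership in the
  prime field is expressed by invariance under the p-th power.\<close>

definition abs_trace :: "'a::finite_field \<Rightarrow> 'a" where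
  "abs_trace y = (\<Sum>j<finite_field_dim TYPE('a). y ^ (CHAR('a) ^ j))"

lemma abs_trace_add: "abs_trace (x + y) = abs_trace x + abs_trace y"
  unfolding abs_trace_def by (simp add: freshmans_dream'[OF CHAR_prime refl] sum.distrib)

text \<open>The p-th power moves each conjugate to the next, and the last one returns to
  \<open>y\<close> because \<open>y ^ CARD('a) = y\<close>.\<close>

lemma abs_trace_power_CHAR: "abs_trace (y::'a::finite_field) ^ CHAR('a) = abs_trace y"
proof -
  let ?m = "finite_field_dim TYPE('a)"
  have "abs_trace y ^ CHAR('a) = (\<Sum>j<?m. y ^ (CHAR('a) ^ Suc j))"
    unfolding abs_trace_def
    by (simp add: freshmans_dream_sum[OF CHAR_prime refl] mult.commute flip: power_mult)
  also have "\<dots> = (\<Sum>j<Suc ?m. y ^ (CHAR('a) ^ j)) - y ^ CHAR('a) ^ 0"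
    by (subst sum.lessThan_Suc_shift) simp
  also have "\<dots> = abs_trace y"
    using finite_field_dim[where ?'a='a] by (simp add: abs_trace_def finite_field_power_card_eq_same flip: finite_field_dim(1))
  finally show ?thesis .
qed

lemma abs_trace_of_nat_mult: "abs_trace (of_nat n * y) = of_nat n * abs_trace y"
  by (induction n) (auto simp: abs_trace_add algebra_simps, simp add: abs_trace_def zero_power CHAR_pos)

text \<open>The trace is a nonzero polynomial function of degree at most p^(m-1), too small to
  vanish at all p^m elements.\<close>

lemma abs_trace_nontrivial: "\<exists>y::'a::finite_field. abs_trace y \<noteq> 0"
proof (rule ccontr)
  assume h: "\<not> ?thesis"
  let ?m = "finite_field_dim TYPE('a)"
  define f :: "'a poly" where "f = (\<Sum>j<?m. Polynomial.monom 1 (CHAR('a) ^ j))"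
  have p2: "CHAR('a) \<ge> 2" using CHAR_prime[where ?'a='a] prime_ge_2_nat by blast
  have "Polynomial.coeff f (CHAR('a) ^ 0) = (\<Sum>j<?m. if j = 0 then 1 else 0)"
    unfolding f_def coeff_sum using p2 by (intro sum.cong) (auto simp: coeff_monom)
  also have "\<dots> = 1" using finite_field_dim(2)[where ?'a='a] by (simp add: sum.delta')
  finally have f0: "f \<noteq> 0" by auto
  have deg: "degree f \<le> CHAR('a) ^ (?m - 1)"
    unfolding f_def using p2
    by (intro degree_sum_le) (auto simp: degree_monom_eq intro!: power_increasing)
  have "poly f y = abs_trace y" for y
    by (simp add: f_def abs_trace_def poly_sum poly_monom)
  hence "{y. poly f y = 0} = UNIV" using h by auto
  hence "CARD('a) \<le> degree f" using card_poly_roots_bound[OF f0] by simp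
  also have "\<dots> < CHAR('a) ^ ?m"
    using deg p2 finite_field_dim(2)[where ?'a='a] power_strict_increasing[of "?m - 1" ?m "CHAR('a)"] by linarith
  finally show False using finite_field_dim(1)[where ?'a='a] by simp
qed

text \<open>The canonical character y \<mapsto> exp (2 pi i Tr y / p). Any natural number that
  reduces to the trace may serve as exponent, and \<open>add_char_eq\<close> shows that the choice
  does not matter.\<close>

definition add_char :: "'a::finite_field \<Rightarrow> complex" where
  "add_char y = cis (2 * pi / real CHAR('a)) ^ (SOME n. of_nat n = abs_trace y)"

lemma cis_root_power_eq_1_iff:
  assumes "p > 0"
  shows "cis (2 * pi / real p) ^ n = 1 \<longleftrightarrow> p dvd n"
proof
  assume "cis (2 * pi / real p) ^ n = 1"
  hence "cis (real n * (2 * pi / real p)) = 1" by (metis Complex.DeMoivre)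
  hence "cos (real n * (2 * pi / real p)) = 1" by (metis cis.sel(1) one_complex.sel(1))
  then obtain k :: int where "real n * (2 * pi / real p) = of_int k * 2 * pi"
    using cos_one_2pi_int by auto
  hence "real n = of_int k * real p" using assms by (simp add: field_simps)
  hence "int n = k * int p" by (metis of_int_eq_iff of_int_mult of_int_of_nat_eq)
  thus "p dvd n" by (metis dvd_triv_right int_dvd_int_iff)
next
  assume "p dvd n"
  then obtain k where "n = p * k" by auto
  thus "cis (2 * pi / real p) ^ n = 1"
    using assms by (simp add: power_mult Complex.DeMoivre cis_multiple_2pi)
qed

lemma cis_root_power_cong:
  assumes "p > 0" "[m = n] (mod p)"
  shows "cis (2 * pi / real p) ^ m = cis (2 * pi / real p) ^ n"
  using assms(2)
proof (induction m n rule: linorder_wlog)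
  case (le m n)
  then obtain k where k: "n = m + k" using le_Suc_ex by blast
  hence "p dvd k" using le by (metis cong_add_lcancel_0_nat cong_0_iff cong_sym)
  hence "cis (2 * pi / real p) ^ k = 1" using cis_root_power_eq_1_iff[OF assms(1)] by blast
  thus ?case by (simp add: k power_add)
next
  case (sym m n)
  thus ?case by (simp add: cong_sym_eq)
qed

lemma add_char_eq:
  assumes "of_nat n = abs_trace (y::'a::finite_field)"
  shows "add_char y = cis (2 * pi / real CHAR('a)) ^ n"
proof -
  have "of_nat (SOME n. of_nat n = abs_trace y) = abs_trace y" by (rule someI[of _ n]) fact
  hence "[(SOME n. of_nat n = abs_trace y) = n] (mod CHAR('a))"
    using assms by (metis of_nat_eq_iff_cong_CHAR)
  thus ?thesis unfolding add_char_def by (intro cis_root_power_cong CHAR_pos)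
qed

lemma abs_trace_prime_subfield: obtains n where "of_nat n = abs_trace (y::'a::finite_field)"
proof -
  have "abs_trace y \<in> of_nat ` {..<CHAR('a)}"
    using abs_trace_power_CHAR[of y] unfolding fixed_points_CHAR[symmetric] by simp
  thus ?thesis using that by auto
qed

lemma add_char_add: "add_char (x + y) = add_char x * add_char y"
proof -
  obtain m n where mn: "of_nat m = abs_trace x" "of_nat n = abs_trace y" by (metis abs_trace_prime_subfield)
  hence "of_nat (m + n) = abs_trace (x + y)" by (simp add: abs_trace_add)
  from add_char_eq[OF this] add_char_eq[OF mn(1)] add_char_eq[OF mn(2)] show ?thesis
    by (simp add: power_add)
qed

lemma add_char_eq_1_iff: "add_char y = 1 \<longleftrightarrow> abs_trace (y::'a::finite_field) = 0"
proof -
  obtain m where m: "of_nat m = abs_trace y" by (metis abs_trace_prime_subfield)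
  show ?thesis using add_char_eq[OF m] m
    by (metis cis_root_power_eq_1_iff CHAR_pos of_nat_eq_0_iff_char_dvd)
qed

lemma add_char_0 [simp]: "add_char 0 = 1"
  using add_char_add[of 0 0] by (metis add_0 add_char_eq_1_iff abs_trace_of_nat_mult mult_zero_left of_nat_0)

lemma norm_add_char [simp]: "norm (add_char y) = 1"
  unfolding add_char_def by (simp add: norm_power)

lemma add_char_uminus: "add_char (- y) = cnj (add_char y)"
proof -
  have "add_char y * add_char (-y) = 1" using add_char_add[of y "-y"] by simp
  moreover have "add_char y * cnj (add_char y) = 1"
    by (simp add: complex_norm_square[symmetric])
  ultimately show ?thesis by (metis mult_cancel_left mult_zero_left zero_neq_one)
qed

lemma add_char_of_nat_mult: "add_char (of_nat n * y) = add_char y ^ n"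
  by (induction n) (simp_all add: algebra_simps add_char_add)

lemma add_char_power_CHAR: "add_char (y::'a::finite_field) ^ CHAR('a) = 1"
  by (simp flip: add_char_of_nat_mult)

lemma add_char_nontrivial: "a \<noteq> 0 \<Longrightarrow> \<exists>y::'a::finite_field. add_char (a * y) \<noteq> 1"
proof -
  assume a: "a \<noteq> 0"
  obtain y :: 'a where "abs_trace y \<noteq> 0" using abs_trace_nontrivial by blast
  hence "add_char (a * (y / a)) \<noteq> 1" using a by (simp add: add_char_eq_1_iff)
  thus ?thesis by blast
qed

text \<open>Translation by \<open>g\<close> permutes \<open>H\<close> and multiplies the sum by
  \<open>z \<noteq> 1\<close>. Only this twisted invariance under one translation is asked of
  \<theta>, so that affine sets such as \<open>unit_fps\<close> and nonlinear exponents such as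
  power sums are covered.\<close>

lemma sum_character_eq_0:
  fixes \<theta> :: "'g::ab_group_add \<Rightarrow> complex"
  assumes "\<And>h. h \<in> H \<Longrightarrow> g + h \<in> H" "\<And>h. h \<in> H \<Longrightarrow> h - g \<in> H"
    and "\<And>h. h \<in> H \<Longrightarrow> \<theta> (g + h) = z * \<theta> h" "z \<noteq> 1"
  shows "sum \<theta> H = 0"
proof -
  have "sum \<theta> H = (\<Sum>h\<in>H. \<theta> (g + h))"
    by (rule sum.reindex_bij_witness[of _ "\<lambda>h. g + h" "\<lambda>h. h - g"]) (use assms in auto)
  also have "\<dots> = z * sum \<theta> H" using assms by (simp add: sum_distrib_left)
  finally show ?thesis using \<open>z \<noteq> 1\<close> by (simp add: mult_cancel_right1)
qed

lemma sum_add_char: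
  "(\<Sum>y\<in>UNIV. add_char (a * (y::'a::finite_field))) = (if a = 0 then of_nat CARD('a) else 0)"
proof (cases "a = 0")
  case False
  then obtain g where "add_char (a * g) \<noteq> 1" using add_char_nontrivial by blast
  hence "(\<Sum>y\<in>UNIV. add_char (a * y)) = 0"
    by (intro sum_character_eq_0[where g=g and z="add_char (a*g)"])
       (auto simp: algebra_simps add_char_add)
  thus ?thesis using False by simp
qed simp


section \<open>Power sums of roots and the functional equation\<close>

text \<open>For a polynomial $\prod (1 - \alpha_i X)$ this is the power sum $\sum \alpha_i^N$.\<close>
definition power_sum :: "nat \<Rightarrow> 'a::field fps \<Rightarrow> 'a" where
  "power_sum N f = - fps_nth (fps_X * fps_deriv f * inverse f) N"

text \<open>Logarithmic derivatives turn products into sums.\<close>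

lemma power_sum_mult:
  assumes "fps_nth f 0 \<noteq> 0" "fps_nth g 0 \<noteq> 0"
  shows "power_sum N (f * g) = power_sum N f + power_sum N g"
proof -
  have "fps_X * fps_deriv (f * g) * inverse (f * g) =
      fps_X * fps_deriv f * inverse f * (g * inverse g) + fps_X * fps_deriv g * inverse g * (f * inverse f)"
    by (simp add: fps_inverse_mult algebra_simps)
  thus ?thesis using assms by (simp add: power_sum_def inverse_mult_eq_1')
qed

lemma power_sum_1 [simp]: "power_sum N 1 = 0"
  by (simp add: power_sum_def)

lemma power_sum_const [simp]: "power_sum N (fps_const c) = 0"
  by (simp add: power_sum_def)

text \<open>For y of order at least k, the logarithmic derivative of 1 + y times X is X y' up to the
  correction X y y' / (1 + y), which is divisible by X^(2k). In this range the power sum is linear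
  in the series, and this is what makes the character sums computable.\<close>

lemma power_sum_one_plus:
  assumes "N < 2 * k" "k > 0"
  shows "power_sum N (1 + fps_X ^ k * g) = - of_nat N * fps_nth (fps_X ^ k * g) N"
proof -
  define y where "y = fps_X ^ k * g"
  have i: "inverse (1 + y) = 1 - y * inverse (1 + y)"
  proof -
    have "(1 + y) * inverse (1 + y) = 1" using assms
      by (intro inverse_mult_eq_1') (simp add: y_def)
    thus ?thesis by (simp add: algebra_simps)
  qed
  obtain h where h: "fps_X * fps_deriv y = fps_X ^ k * h"
  proof
    have "fps_X * fps_deriv y = of_nat k * (fps_X * fps_X ^ (k - 1)) * g + fps_X ^ k * (fps_X * fps_deriv g)"
      by (simp add: y_def fps_deriv_power fps_of_nat algebra_simps)
    also have "fps_X * fps_X ^ (k - 1) = (fps_X ^ k :: 'a fps)" using assms(2) by (metis power_Suc Suc_diff_1)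
    finally show "fps_X * fps_deriv y = fps_X ^ k * (of_nat k * g + fps_X * fps_deriv g)"
      by (simp add: algebra_simps)
  qed
  have X2k: "fps_X ^ (2 * k) = (fps_X ^ k * fps_X ^ k :: 'a fps)" by (simp only: mult_2 power_add)
  have "fps_X * fps_deriv (1 + y) * inverse (1 + y) = fps_X * fps_deriv y * (1 - y * inverse (1 + y))"
    using i by simp
  also have "\<dots> = fps_X * fps_deriv y - (fps_X * fps_deriv y) * y * inverse (1 + y)"
    by (simp add: algebra_simps)
  also have "(fps_X * fps_deriv y) * y * inverse (1 + y) = fps_X ^ (2 * k) * (h * g * inverse (1 + y))"
    unfolding h unfolding y_def X2k by (simp only: mult_ac)
  finally have "power_sum N (1 + y) = - fps_nth (fps_X * fps_deriv y) N"
    unfolding power_sum_def using assms by (simp add: fps_X_power_mult_nth)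
  also have "\<dots> = - of_nat N * fps_nth y N"
    by (cases N) (simp_all add: algebra_simps)
  finally show ?thesis by (simp add: y_def)
qed

text \<open>Two such series differ by a factor 1 + O(X^(N+1)), whose power sum is 0. The character
  built from it is therefore one of units modulo X^(N+1).\<close>

lemma power_sum_cong:
  assumes "\<And>i. i \<le> N \<Longrightarrow> fps_nth f i = fps_nth g i" "fps_nth f 0 \<noteq> 0"
  shows "power_sum N f = power_sum N g"
proof -
  define h where "h = fps_shift (Suc N) (g - f)"
  have "fps_cutoff (Suc N) (g - f) = 0" using assms by (intro fps_ext) auto
  hence gf: "g = f + fps_X ^ Suc N * h"
    using fps_shift_cutoff'[of "Suc N" "g - f"] by (simp add: h_def algebra_simps)
  have "f * (1 + fps_X ^ Suc N * (h * inverse f)) = f + fps_X ^ Suc N * h * (f * inverse f)"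
    by (simp add: algebra_simps)
  also have "\<dots> = g" using assms(2) gf by (simp add: inverse_mult_eq_1')
  finally have "power_sum N g = power_sum N f + power_sum N (1 + fps_X ^ Suc N * (h * inverse f))"
    using assms(2) by (metis power_sum_mult fps_add_nth fps_X_power_mult_nth fps_one_nth add_cancel_right_right zero_less_Suc one_neq_zero)
  also have "power_sum N (1 + fps_X ^ Suc N * (h * inverse f)) = 0"
    by (subst power_sum_one_plus) (simp_all only: fps_X_power_mult_nth, simp_all)
  finally show ?thesis by simp
qed

text \<open>Replacing X by c X multiplies every root by c. The substitution \<open>s\<close> is a
  ring homomorphism commuting with X d/dX, which gives the claim for arbitrary series.\<close>

lemma power_sum_scale_arg:
  fixes f :: "'a::field fps"
  assumes "fps_nth f 0 \<noteq> 0"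
  shows "power_sum N (Abs_fps (\<lambda>i. c ^ i * fps_nth f i)) = c ^ N * power_sum N f"
proof -
  define s where "s g = Abs_fps (\<lambda>i. c ^ i * fps_nth g i)" for g :: "'a fps"
  have s_mult: "s (g * h) = s g * s h" for g h
    by (rule fps_ext) (auto simp: s_def fps_mult_nth sum_distrib_left power_add[symmetric] mult_ac intro!: sum.cong)
  have s_one: "s 1 = 1" by (rule fps_ext) (auto simp: s_def)
  have s_inv: "s (inverse f) = inverse (s f)"
  proof -
    have "s f * s (inverse f) = 1" using assms by (simp add: s_mult[symmetric] inverse_mult_eq_1' s_one)
    thus ?thesis by (metis fps_inverse_unique)
  qed
  have s_der: "fps_X * fps_deriv (s f) = s (fps_X * fps_deriv f)"
  proof (rule fps_ext)
    fix n show "fps_nth (fps_X * fps_deriv (s f)) n = fps_nth (s (fps_X * fps_deriv f)) n"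
      by (cases n) (simp_all add: s_def mult_ac)
  qed
  show ?thesis unfolding power_sum_def s_def[symmetric]
    by (simp only: s_der s_inv[symmetric] s_mult[symmetric]) (simp add: s_def)
qed

section \<open>Spaces of polynomials and orthogonality of characters\<close>

text \<open>Polynomials are kept as power series, so that inverses and logarithmic derivatives are
  at hand.\<close>

definition fps_supp :: "nat set \<Rightarrow> 'a::zero fps set" where
  "fps_supp I = {f. \<forall>i. i \<notin> I \<longrightarrow> fps_nth f i = 0}"

lemma card_fps_supp:
  assumes "finite I"
  shows "finite (fps_supp I :: 'a::{finite,zero} fps set)" "card (fps_supp I :: 'a fps set) = CARD('a) ^ card I"
proof -
  have bij: "bij_betw (\<lambda>f. restrict (fps_nth f) I) (fps_supp I :: 'a fps set) (PiE I (\<lambda>_. UNIV))"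
    by (rule bij_betwI[where g = "\<lambda>h. Abs_fps (\<lambda>i. if i \<in> I then h i else 0)"])
       (auto simp: fps_supp_def fps_eq_iff fun_eq_iff PiE_def extensional_def)
  show "finite (fps_supp I :: 'a fps set)"
    using bij_betw_finite[OF bij] assms by (simp add: finite_PiE)
  show "card (fps_supp I :: 'a fps set) = CARD('a) ^ card I"
    using bij_betw_same_card[OF bij] assms by (simp add: card_PiE)
qed

text \<open>If some coefficient of the linear form is nonzero, a monomial in that position can be
  added whose character value is not 1, and the sum cancels.\<close>

lemma sum_add_char_fps_supp:
  fixes g :: "'a::finite_field fps" and c :: "nat \<Rightarrow> 'a"
  assumes "finite I" and \<theta>: "\<And>f. f \<in> fps_supp I \<Longrightarrow> \<theta> f = (\<Sum>i\<in>I. c i * fps_nth f i)"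
  shows "(\<Sum>f\<in>fps_supp I. add_char (\<theta> f)) = (if \<forall>i\<in>I. c i = 0 then of_nat (CARD('a) ^ card I) else 0)"
proof (cases "\<forall>i\<in>I. c i = 0")
  case True
  have "add_char (\<theta> f) = 1" if "f \<in> fps_supp I" for f using that True by (simp add: \<theta>)
  thus ?thesis using True card_fps_supp[OF assms(1), where ?'a='a] by simp
next
  case False
  then obtain i where i: "i \<in> I" "c i \<noteq> 0" by blast
  then obtain y where y: "add_char (c i * y) \<noteq> 1" using add_char_nontrivial by blast
  define h where "h = fps_const y * fps_X ^ i"
  have hn: "fps_nth h j = (if j = i then y else 0)" for j by (simp add: h_def)
  have hI: "h + f \<in> fps_supp I" "f - h \<in> fps_supp I" if "f \<in> fps_supp I" for f
    using that i by (auto simp: fps_supp_def hn)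
  have "(\<Sum>f\<in>fps_supp I. add_char (\<theta> f)) = 0"
  proof (rule sum_character_eq_0[where g=h and z="add_char (c i * y)"])
    fix f :: "'a fps" assume f: "f \<in> fps_supp I"
    have "\<theta> (h + f) = (\<Sum>j\<in>I. c j * fps_nth h j) + \<theta> f"
      using f hI by (simp add: \<theta> algebra_simps sum.distrib)
    also have "(\<Sum>j\<in>I. c j * fps_nth h j) = c i * y"
      using assms(1) i by (simp add: hn if_distrib sum.delta cong: if_cong)
    finally show "add_char (\<theta> (h + f)) = add_char (c i * y) * add_char (\<theta> f)" by (simp add: add_char_add)
  qed (use hI y in auto)
  thus ?thesis using False by simp
qed

text \<open>The reversals of the monic polynomials of degree \<open>d\<close>. The coefficient of
  X^d may vanish, namely when the polynomial is divisible by x; hence \<open>d\<close> cannot be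
  recovered from the series.\<close>

definition unit_fps :: "nat \<Rightarrow> 'a::zero_neq_one fps set" where
  "unit_fps d = {f. fps_nth f 0 = 1 \<and> (\<forall>i>d. fps_nth f i = 0)}"

text \<open>The coefficient of u^d in the L-series of the character that sends a monic polynomial to
  \<open>add_char\<close> of \<open>a\<close> times the sum of the N-th powers of its roots.\<close>

definition char_sum :: "nat \<Rightarrow> 'a::finite_field \<Rightarrow> nat \<Rightarrow> complex" where
  "char_sum N a d = (\<Sum>f\<in>unit_fps d. add_char (a * power_sum N f))"

lemma unit_fps_finite: "finite (unit_fps d :: 'a::finite_field fps set)"
proof -
  have "unit_fps d \<subseteq> (fps_supp {..d} :: 'a fps set)" by (auto simp: unit_fps_def fps_supp_def)
  thus ?thesis using card_fps_supp(1)[of "{..d}", where ?'a='a] finite_subset by blast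
qed

lemma card_unit_fps: "card (unit_fps d :: 'a::finite_field fps set) = CARD('a) ^ d"
proof -
  have "bij_betw (\<lambda>f. f + 1) (fps_supp {1..d}) (unit_fps d :: 'a fps set)"
    by (rule bij_betwI[where g="\<lambda>f. f - 1"]) (auto simp: unit_fps_def fps_supp_def Suc_le_eq)
  from bij_betw_same_card[OF this] show ?thesis using card_fps_supp(2)[of "{1..d}", where ?'a='a] by simp
qed

lemma char_sum_0: "char_sum N (0::'a::finite_field) d = of_nat (CARD('a) ^ d)"
  unfolding char_sum_def by (simp add: card_unit_fps)

section \<open>The Gauss sum and the functional equation of one character\<close>

locale additive_L =
  fixes N :: nat and a :: "'a::finite_field"
  assumes N: "of_nat N * a \<noteq> 0"
begin

lemma N_pos: "N > 0" using N by (cases N) auto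

text \<open>Adding y X^N lowers the N-th power sum by N y, whatever the series, so this translation
  multiplies every summand by the same nontrivial constant. The L-series is thereby a polynomial of
  degree less than N.\<close>

lemma char_sum_eq_0:
  assumes "d \<ge> N"
  shows "char_sum N a d = 0"
proof -
  obtain y where y: "add_char ((- (of_nat N * a)) * y) \<noteq> 1" using add_char_nontrivial N by (metis neg_equal_0_iff_equal)
  define h where "h = fps_const y * fps_X ^ N"
  have hn: "fps_nth h j = (if j = N then y else 0)" for j by (simp add: h_def)
  show ?thesis unfolding char_sum_def
  proof (rule sum_character_eq_0[where g=h and z="add_char ((- (of_nat N * a)) * y)"])
    fix f :: "'a fps" assume f: "f \<in> unit_fps d"
    show "h + f \<in> unit_fps d" "f - h \<in> unit_fps d"
      using f N_pos assms by (auto simp: unit_fps_def hn)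
    have f0: "fps_nth f 0 = 1" using f by (simp add: unit_fps_def)
    have "h + f = f * (1 + fps_X ^ N * (fps_const y * inverse f))"
    proof -
      have "f * (1 + fps_X ^ N * (fps_const y * inverse f)) = f + h * (f * inverse f)"
        by (simp add: h_def algebra_simps)
      thus ?thesis using f0 by (simp add: inverse_mult_eq_1')
    qed
    hence "power_sum N (h + f) = power_sum N f + power_sum N (1 + fps_X ^ N * (fps_const y * inverse f))"
      using f0 N_pos by (subst power_sum_mult[symmetric]) (auto simp: fps_X_power_mult_nth)
    also have "power_sum N (1 + fps_X ^ N * (fps_const y * inverse f)) = - of_nat N * y"
      using N_pos f0 by (subst power_sum_one_plus) (auto simp: fps_X_power_mult_nth)
    finally have e: "power_sum N (h + f) = power_sum N f + - of_nat N * y" .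
    have "a * power_sum N (h + f) = (- (of_nat N * a)) * y + a * power_sum N f"
      unfolding e by (simp add: algebra_simps)
    thus "add_char (a * power_sum N (h + f)) = add_char ((- (of_nat N * a)) * y) * add_char (a * power_sum N f)"
      by (simp only: add_char_add)
  qed (use y in auto)
qed

text \<open>A character of the units modulo X^(N+1), trivial on constants and extended by 0 to the
  nonunits.\<close>

definition chi :: "'a fps \<Rightarrow> complex" where
  "chi f = (if fps_nth f 0 = 0 then 0 else add_char (a * power_sum N f))"

definition residues :: "'a fps set" where "residues = {f \<in> fps_supp {..N}. fps_nth f 0 \<noteq> 0}"

text \<open>The twisted Gauss sum modulo X^(N+1). Its additive character is taken at the coefficient
  of X^N of a product, a perfect pairing that matches degree i with degree N - i.\<close>

definition gauss :: "'a fps \<Rightarrow> complex" where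
  "gauss f = (\<Sum>g\<in>residues. cnj (chi g) * add_char (fps_nth (f * g) N))"

lemma finite_residues: "finite residues"
  unfolding residues_def by (simp add: card_fps_supp)

lemma chi_cong: "(\<And>i. i \<le> N \<Longrightarrow> fps_nth f i = fps_nth g i) \<Longrightarrow> chi f = chi g"
  unfolding chi_def using power_sum_cong[of N f g] by auto

text \<open>Separability of a primitive character. For a unit \<open>f\<close> the summation
  variable absorbs \<open>f\<close>. For a nonunit the sum is 0: multiplying \<open>g\<close> by 1 +
  y X^N does not affect the additive factor, as \<open>f\<close> has no constant term, but changes
  \<open>chi g\<close> by a constant other than 1.\<close>

lemma gauss_eq: "gauss f = chi f * gauss 1"
proof (cases "fps_nth f 0 = 0")
  case False
  have cut: "fps_nth (fps_cutoff (Suc N) h) i = fps_nth h i" if "i \<le> N" for h :: "'a fps" and i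
    using that by simp
  have inv: "inverse f * f = 1" using False by (simp add: inverse_mult_eq_1)
  have mem: "fps_cutoff (Suc N) (g * h) \<in> residues" if "g \<in> residues" "fps_nth h 0 \<noteq> 0" for g h :: "'a fps"
    using that by (auto simp: residues_def fps_supp_def)
  have cc: "fps_cutoff (Suc N) (fps_cutoff (Suc N) (g * h) * k) = fps_cutoff (Suc N) (g * h * k)" for g h k :: "'a fps"
    by (rule fps_ext) (simp add: fps_cutoff_left_mult_nth)
  have cg: "fps_cutoff (Suc N) g = g" if "g \<in> residues" for g
    using that by (intro fps_ext) (auto simp: residues_def fps_supp_def)
  have "gauss f = (\<Sum>g\<in>residues. chi f * (cnj (chi g) * add_char (fps_nth (1 * g) N)))"
    unfolding gauss_def
  proof (rule sum.reindex_bij_witness[of _ "\<lambda>g. fps_cutoff (Suc N) (g * inverse f)" "\<lambda>g. fps_cutoff (Suc N) (g * f)"])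
    fix g assume g: "g \<in> residues"
    have "g * f * inverse f = g" using inv by (metis mult.assoc mult.commute mult_1_right)
    thus "fps_cutoff (Suc N) (fps_cutoff (Suc N) (g * f) * inverse f) = g" by (simp only: cc cg[OF g])
    show "fps_cutoff (Suc N) (g * f) \<in> residues" using g False by (rule mem)
    have "chi (fps_cutoff (Suc N) (g * f)) = chi (g * f)" by (rule chi_cong) simp
    also have "\<dots> = chi g * chi f" using False g
      by (auto simp: chi_def power_sum_mult residues_def algebra_simps add_char_add)
    finally have "chi (fps_cutoff (Suc N) (g * f)) = chi g * chi f" .
    moreover have "chi f * cnj (chi f) = 1"
      using False by (simp add: chi_def complex_norm_square[symmetric])
    ultimately show "chi f * (cnj (chi (fps_cutoff (Suc N) (g * f))) * add_char (fps_nth (1 * fps_cutoff (Suc N) (g * f)) N)) =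
      cnj (chi g) * add_char (fps_nth (f * g) N)"
      by (simp add: mult_ac)
  next
    fix g assume g: "g \<in> residues"
    have "g * inverse f * f = g" using inv by (metis mult.assoc mult_1_right)
    thus "fps_cutoff (Suc N) (fps_cutoff (Suc N) (g * inverse f) * f) = g" by (simp only: cc cg[OF g])
    show "fps_cutoff (Suc N) (g * inverse f) \<in> residues" using g False by (intro mem) auto
  qed
  thus ?thesis by (simp add: gauss_def sum_distrib_left)
next
  case True
  obtain y where y: "add_char ((of_nat N * a) * y) \<noteq> 1" using add_char_nontrivial N by blast
  define m where "m g = g * (1 + fps_X ^ N * fps_const y)" for g :: "'a fps"
  have m: "m g = g + fps_X ^ N * (fps_const y * g)" for g by (simp add: m_def algebra_simps)
  \<comment> \<open>Multiplication by 1 + s X^N modulo X^(N+1) alters only the coefficient of X^N.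
    \<open>T\<close> is this reduced map, a bijection of \<open>residues\<close> with inverse
    \<open>T (- s)\<close>.\<close>
  define T where "T s g = g + fps_const (s * fps_nth g 0) * fps_X ^ N" for s and g :: "'a fps"
  have Tn: "fps_nth (T s g) i = fps_nth g i + (if i = N then s * fps_nth g 0 else 0)" for s g i
    by (simp add: T_def)
  have T0: "fps_nth (T s g) 0 = fps_nth g 0" for s g using N_pos by (simp add: Tn)
  have Tmem: "T s g \<in> residues" if "g \<in> residues" for s g
    using that T0 by (auto simp: residues_def fps_supp_def Tn)
  have Tinv: "T (- s) (T s g) = g" for s g using N_pos by (intro fps_ext) (simp add: Tn)
  have "gauss f = (\<Sum>g\<in>residues. cnj (chi (T y g)) * add_char (fps_nth (f * T y g) N))"
    unfolding gauss_def
    by (rule sum.reindex_bij_witness[of _ "T y" "T (- y)"])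
       (use Tmem Tinv Tinv[of "-y"] in auto)
  also have "\<dots> = (\<Sum>g\<in>residues. add_char ((of_nat N * a) * y) * (cnj (chi g) * add_char (fps_nth (f * g) N)))"
  proof (intro sum.cong refl)
    fix g assume g: "g \<in> residues"
    have g0: "fps_nth g 0 \<noteq> 0" using g by (simp add: residues_def)
    have "fps_nth (f * T y g) N = fps_nth (f * g) N + fps_nth (fps_X ^ N * (fps_const (y * fps_nth g 0) * f)) N"
      by (simp add: T_def algebra_simps)
    hence 1: "fps_nth (f * T y g) N = fps_nth (f * g) N" using True by (simp add: fps_X_power_mult_nth)
    have Tm: "chi (T y g) = chi (m g)" by (rule chi_cong) (auto simp: Tn m fps_X_power_mult_nth)
    have e: "power_sum N (m g) = power_sum N g - of_nat N * y"
      unfolding m_def using g0 N_pos by (subst power_sum_mult) (auto simp: power_sum_one_plus fps_X_power_mult_nth)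
    have "a * power_sum N (m g) = a * power_sum N g + - ((of_nat N * a) * y)"
      unfolding e by (simp add: algebra_simps)
    hence "chi (m g) = chi g * add_char (- ((of_nat N * a) * y))"
      using g0 N_pos unfolding chi_def by (simp add: m fps_X_power_mult_nth add_char_add[symmetric])
    hence "cnj (chi (T y g)) = cnj (chi g) * add_char ((of_nat N * a) * y)"
      using Tm by (simp add: add_char_uminus)
    thus "cnj (chi (T y g)) * add_char (fps_nth (f * T y g) N) =
      add_char ((of_nat N * a) * y) * (cnj (chi g) * add_char (fps_nth (f * g) N))"
      using 1 by simp
  qed
  also have "\<dots> = add_char ((of_nat N * a) * y) * gauss f" by (simp add: gauss_def sum_distrib_left)
  finally have "gauss f = 0" using y by (simp add: mult_cancel_right1)
  thus ?thesis using True by (simp add: chi_def)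
qed

text \<open>Nonunits contribute 0, and the units are sorted by their q - 1 possible constant terms,
  on which \<open>chi\<close> does not depend. The passage from \<open>unit_fps\<close> to a vector
  space prepares for orthogonality.\<close>

lemma sum_chi:
  "(\<Sum>f\<in>fps_supp {..d}. chi f) = (of_nat CARD('a) - 1) * char_sum N a d"
proof -
  have "(\<Sum>f\<in>fps_supp {..d}. chi f) = (\<Sum>f\<in>{f \<in> fps_supp {..d}. fps_nth f 0 \<noteq> 0}. chi f)"
    by (rule sum.mono_neutral_right) (auto simp: card_fps_supp chi_def)
  also have "\<dots> = (\<Sum>(c,f)\<in>(UNIV - {0::'a}) \<times> unit_fps d. add_char (a * power_sum N f))"
  proof (rule sum.reindex_bij_witness[where i = "\<lambda>(c,f). fps_const c * (f :: 'a fps)" and j = "\<lambda>f :: 'a fps. (fps_nth f 0, fps_const (inverse (fps_nth f 0)) * f)"])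
    fix f :: "'a fps" assume f: "f \<in> {f \<in> fps_supp {..d}. fps_nth f 0 \<noteq> 0}"
    show "(\<lambda>(c, f). fps_const c * f) (fps_nth f 0, fps_const (inverse (fps_nth f 0)) * f) = f"
      using f by (auto intro!: fps_ext)
    show "(fps_nth f 0, fps_const (inverse (fps_nth f 0)) * f) \<in> (UNIV - {0}) \<times> unit_fps d"
      using f by (auto simp: unit_fps_def fps_supp_def)
    show "(case (fps_nth f 0, fps_const (inverse (fps_nth f 0)) * f) of (c, f) \<Rightarrow> add_char (a * power_sum N f)) = chi f"
      using f by (simp add: chi_def power_sum_mult)
  qed (auto simp: unit_fps_def fps_supp_def intro!: fps_ext)
  also have "\<dots> = (\<Sum>c\<in>UNIV - {0::'a}. char_sum N a d)"
    unfolding char_sum_def by (rule sum.cartesian_product[symmetric])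
  also have "\<dots> = (of_nat CARD('a) - 1) * char_sum N a d"
    by (simp add: of_nat_diff Suc_leI)
  finally show ?thesis .
qed

text \<open>The sum of \<open>gauss f\<close> over the polynomials of degree at most
  \<open>d\<close> is computed twice. By \<open>gauss_eq\<close> it is a multiple of the sum for
  \<open>d\<close>. By orthogonality in \<open>f\<close>, only those \<open>g\<close> survive whose
  top d + 1 coefficients vanish, that is, those of degree at most N - 1 - d, and they produce the
  conjugate sum.\<close>

theorem functional_equation:
  assumes "d < N"
  shows "gauss 1 * char_sum N a d = of_nat CARD('a) ^ Suc d * cnj (char_sum N a (N - 1 - d))"
proof -
  let ?q = "of_nat CARD('a) :: complex"
  have "CARD('a) > 1" using card_mono[of UNIV "{0::'a,1}"] by simp
  hence q1: "?q - 1 \<noteq> 0" by (metis of_nat_1 of_nat_eq_iff less_irrefl right_minus_eq)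
  have "(?q - 1) * (gauss 1 * char_sum N a d) = (\<Sum>f\<in>fps_supp {..d}. gauss f)"
    by (subst gauss_eq) (simp add: sum_chi sum_distrib_right[symmetric])
  also have "\<dots> = (\<Sum>g\<in>residues. cnj (chi g) * (\<Sum>f\<in>fps_supp {..d}. add_char (fps_nth (f * g) N)))"
    unfolding gauss_def by (subst sum.swap) (simp add: sum_distrib_left)
  also have "\<dots> = (\<Sum>g\<in>residues. cnj (chi g) * (if \<forall>i\<in>{..d}. fps_nth g (N - i) = 0 then ?q ^ Suc d else 0))"
  proof (intro sum.cong refl arg_cong2[where f="(*)"])
    fix g :: "'a fps"
    have "(\<Sum>f\<in>fps_supp {..d}. add_char (fps_nth (f * g) N)) =
      (if \<forall>i\<in>{..d}. fps_nth g (N - i) = 0 then of_nat (CARD('a) ^ card {..d}) else 0)"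
    proof (rule sum_add_char_fps_supp)
      fix f :: "'a fps" assume f: "f \<in> fps_supp {..d}"
      have "fps_nth (f * g) N = (\<Sum>i\<in>{0..N}. fps_nth g (N - i) * fps_nth f i)"
        by (simp add: fps_mult_nth mult.commute)
      also have "\<dots> = (\<Sum>i\<in>{..d}. fps_nth g (N - i) * fps_nth f i)"
        using f assms by (intro sum.mono_neutral_right) (auto simp: fps_supp_def)
      finally show "fps_nth (f * g) N = (\<Sum>i\<in>{..d}. fps_nth g (N - i) * fps_nth f i)" .
    qed simp
    thus "(\<Sum>f\<in>fps_supp {..d}. add_char (fps_nth (f * g) N)) = (if \<forall>i\<in>{..d}. fps_nth g (N - i) = 0 then ?q ^ Suc d else 0)"
      by simp
  qed
  also have "\<dots> = (\<Sum>g\<in>fps_supp {..N - 1 - d}. ?q ^ Suc d * cnj (chi g))"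
  proof (rule sum.mono_neutral_cong)
    show "finite residues" by (rule finite_residues)
    have key: "(\<forall>i\<in>{..d}. fps_nth g (N - i) = 0) \<longleftrightarrow> g \<in> fps_supp {..N-1-d}" if "g \<in> fps_supp {..N}" for g :: "'a fps"
    proof
      assume h: "\<forall>i\<in>{..d}. fps_nth g (N - i) = 0"
      show "g \<in> fps_supp {..N-1-d}" unfolding fps_supp_def
      proof (intro CollectI allI impI)
        fix i assume i: "i \<notin> {..N - 1 - d}"
        show "fps_nth g i = 0"
        proof (cases "i \<le> N")
          case True
          hence "N - i \<in> {..d}" "N - (N - i) = i" using i by auto
          thus ?thesis using h by metis
        qed (use that in \<open>auto simp: fps_supp_def\<close>)
      qed
    qed (use assms in \<open>auto simp: fps_supp_def\<close>)
    have sub: "fps_supp {..N-1-d} \<subseteq> (fps_supp {..N} :: 'a fps set)" by (auto simp: fps_supp_def)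
    show "cnj (chi g) * (if \<forall>i\<in>{..d}. fps_nth g (N - i) = 0 then ?q ^ Suc d else 0) = 0"
      if "g \<in> residues - fps_supp {..N - 1 - d}" for g
      using that key[of g] by (auto simp: residues_def)
    show "?q ^ Suc d * cnj (chi g) = 0" if "g \<in> fps_supp {..N - 1 - d} - residues" for g
      using that sub by (auto simp: residues_def chi_def)
    show "cnj (chi g) * (if \<forall>i\<in>{..d}. fps_nth g (N - i) = 0 then ?q ^ Suc d else 0) = ?q ^ Suc d * cnj (chi g)"
      if "g \<in> residues \<inter> fps_supp {..N - 1 - d}" for g
      using that key[of g] by (auto simp: residues_def)
  qed (simp add: card_fps_supp)
  also have "\<dots> = ?q ^ Suc d * cnj (\<Sum>g\<in>fps_supp {..N - 1 - d}. chi g)"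
    by (simp add: sum_distrib_left cnj_sum)
  also have "\<dots> = (?q - 1) * (?q ^ Suc d * cnj (char_sum N a (N - 1 - d)))"
    by (simp add: sum_chi)
  finally show ?thesis using q1 by (metis mult_cancel_left)
qed

end


section \<open>Real character sums, their sign and the central zero\<close>

text \<open>With q = 4 k + 1, the polynomial X^(2k) - 1 has too few roots to cover all nonzero
  elements. An element y that is not a root has y^(2k) = - 1, and y^k is the square root.\<close>

lemma sqrt_minus_one:
  assumes "CARD('a::finite_field) mod 4 = 1"
  obtains e where "(e::'a) ^ 2 = - 1"
proof -
  define k where "k = CARD('a) div 4"
  have q: "CARD('a) = 4 * k + 1" using assms by (simp add: k_def) presburger
  have k: "k > 0" using q CARD_gt_1[where ?'a='a] by simp
  define f :: "'a poly" where "f = Polynomial.monom 1 (2 * k) - 1"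
  have d: "degree f \<le> 2 * k" unfolding f_def by (intro degree_diff_le) (auto simp: degree_monom_eq)
  have "Polynomial.coeff f (2 * k) = 1" using k by (simp add: f_def coeff_monom)
  hence f0: "f \<noteq> 0" by auto
  have "\<not> UNIV - {0} \<subseteq> {y. poly f y = 0}"
  proof
    assume "UNIV - {0} \<subseteq> {y. poly f y = 0}"
    hence "card (UNIV - {0::'a}) \<le> card {y. poly f y = 0}"
      by (intro card_mono poly_roots_finite f0)
    also have "\<dots> \<le> 2 * k" using card_poly_roots_bound[OF f0] d by simp
    finally show False using q k by simp
  qed
  then obtain y where y: "y \<noteq> 0" "poly f y \<noteq> 0" by blast
  define z where "z = y ^ (2 * k)"
  have "y * z ^ 2 = y ^ CARD('a)" by (simp add: z_def q power_mult[symmetric] mult.commute)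
  hence "z ^ 2 = 1" using y finite_field_power_card_eq_same[of y] by simp
  moreover have "z \<noteq> 1" using y by (simp add: f_def z_def poly_monom)
  ultimately have "z = - 1" by (simp add: power2_eq_1_iff)
  hence "(y ^ k) ^ 2 = - 1" by (simp add: z_def power_mult[symmetric] mult.commute)
  thus ?thesis using that by blast
qed

text \<open>Used in both directions, for a series and for its inverse, when
  \<open>char_sum_top\<close> determines where a linear form vanishes.\<close>

lemma fps_inverse_low_coeffs:
  fixes h :: "'a::field fps"
  assumes "fps_nth h 0 = 1" "\<And>j. 1 \<le> j \<Longrightarrow> j < M \<Longrightarrow> fps_nth h j = 0" "1 \<le> j" "j < M"
  shows "fps_nth (inverse h) j = 0"
proof -
  define k where "k = fps_shift M (h - 1)"
  have "fps_cutoff M (h - 1) = 0"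
  proof (rule fps_ext)
    fix n show "fps_nth (fps_cutoff M (h - 1)) n = fps_nth 0 n"
      using assms(1,2) by (cases n) auto
  qed
  hence h: "h = 1 + fps_X ^ M * k" using fps_shift_cutoff'[of M "h - 1"] by (simp add: k_def algebra_simps)
  have "h * inverse h = 1" using assms(1) by (intro inverse_mult_eq_1') auto
  hence "inverse h = 1 - fps_X ^ M * (k * inverse h)"
    by (subst (asm) (1) h) (simp add: algebra_simps)
  hence "fps_nth (inverse h) j = fps_nth (1 - fps_X ^ M * (k * inverse h)) j" by simp
  thus ?thesis using assms(3,4) by (simp add: fps_X_power_mult_nth)
qed

text \<open>The reversed polynomial x^M + c has M roots with \<alpha>^M = - c, each contributing
  c^2. On the level of series, only the term y^2 in the expansion of y / (1 + y) meets the exponent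
  2 M.\<close>

lemma power_sum_binomial:
  assumes "M > 0"
  shows "power_sum (2 * M) (1 + fps_const c * fps_X ^ M) = (of_nat M * c ^ 2 :: 'a::field)"
proof -
  define y :: "'a fps" where "y = fps_const c * fps_X ^ M"
  have "(1 + y) * inverse (1 + y) = 1" using assms by (intro inverse_mult_eq_1') (simp add: y_def)
  hence i: "inverse (1 + y) = 1 - y * inverse (1 + y)" by (simp add: algebra_simps)
  have i2: "y * inverse (1 + y) = y - y * y + y * y * y * inverse (1 + y)"
    by (subst i, subst i) (simp add: algebra_simps)
  have "fps_X * fps_deriv y = of_nat M * (fps_const c * (fps_X * fps_X ^ (M - 1)))"
    by (simp add: y_def fps_deriv_power fps_of_nat algebra_simps)
  also have "fps_X * fps_X ^ (M - 1) = (fps_X ^ M :: 'a fps)" using assms by (metis power_Suc Suc_diff_1)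
  finally have d: "fps_X * fps_deriv y = fps_const (of_nat M) * y" by (simp add: y_def fps_of_nat)
  have X2: "fps_X ^ (2 * M) = (fps_X ^ M * fps_X ^ M :: 'a fps)" by (simp only: mult_2 power_add)
  have X3: "fps_X ^ (3 * M) = (fps_X ^ M * fps_X ^ M * fps_X ^ M :: 'a fps)"
    by (simp only: power_add[symmetric]) (simp add: numeral_3_eq_3)
  have y2: "y * y = fps_X ^ (2 * M) * fps_const (c ^ 2)"
  proof -
    have "fps_const (c ^ 2) = fps_const c * fps_const c" by (simp add: power2_eq_square)
    thus ?thesis unfolding y_def X2 by (simp only: mult_ac)
  qed
  have y3: "y * y * y * inverse (1 + y) = fps_X ^ (3 * M) * (fps_const c * fps_const c * fps_const c * inverse (1 + y))"
    unfolding X3 by (subst (1 2 3) y_def) (simp only: mult_ac)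
  have "fps_X * fps_deriv (1 + y) * inverse (1 + y) = fps_const (of_nat M) * (y - y * y + y * y * y * inverse (1 + y))"
    unfolding i2[symmetric] using d by (simp add: mult_ac)
  hence "power_sum (2 * M) (1 + y) = - (of_nat M * (fps_nth y (2*M) - fps_nth (y * y) (2*M) + fps_nth (y * y * y * inverse (1 + y)) (2 * M)))"
    unfolding power_sum_def by simp
  also have "fps_nth y (2*M) = 0" using assms by (simp add: y_def)
  also have "fps_nth (y * y) (2*M) = c ^ 2" unfolding y2 by (simp add: fps_X_power_mult_nth)
  also have "fps_nth (y * y * y * inverse (1 + y)) (2 * M) = 0" unfolding y3
    using assms by (subst fps_X_power_mult_nth) simp
  finally show ?thesis by (simp add: y_def)
qed

locale central_zero =
  fixes N M :: nat and ty :: "'a::finite_field itself"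
  assumes NM: "N = 2 * M" and odd: "odd M" and char: "\<not> CHAR('a) dvd N" and q4: "CARD('a) mod 4 = 1"
begin

lemma M_pos: "M > 0" using odd by (cases M) auto
lemma N_pos: "N > 0" using M_pos NM by simp
lemma of_nat_N: "(of_nat N :: 'a) \<noteq> 0" using char by (simp add: of_nat_eq_0_iff_char_dvd)
lemma of_nat_M: "(of_nat M :: 'a) \<noteq> 0" using of_nat_N NM by auto

lemma additive_L: "a \<noteq> 0 \<Longrightarrow> additive_L N (a::'a)"
  using of_nat_N by unfold_locales simp

text \<open>The substitution of e X for X permutes \<open>unit_fps d\<close> and negates the power
  sums, which amounts to conjugating each summand.\<close>

lemma char_sum_real: "cnj (char_sum N (a::'a) d) = char_sum N a d"
proof -
  obtain e :: 'a where e: "e ^ 2 = - 1" using sqrt_minus_one[OF q4] by blast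
  have e0: "e \<noteq> 0" using e by auto
  have eN: "e ^ N = - 1" using odd by (simp add: NM power_mult e)
  define s where "s c f = Abs_fps (\<lambda>i. c ^ i * fps_nth f i)" for c and f :: "'a fps"
  have "char_sum N a d = (\<Sum>f\<in>unit_fps d. add_char (a * power_sum N (s e f)))"
  proof -
    have inv: "s e (s (inverse e) f) = f" "s (inverse e) (s e f) = f" for f
      using e0 by (auto simp: s_def fps_eq_iff power_inverse)
    show ?thesis unfolding char_sum_def
      by (rule sum.reindex_bij_witness[of _ "s e" "s (inverse e)"])
        (simp_all only: inv, auto simp: s_def unit_fps_def)
  qed
  also have "\<dots> = (\<Sum>f\<in>unit_fps d. cnj (add_char (a * power_sum N f)))"
  proof (intro sum.cong refl)
    fix f :: "'a fps" assume "f \<in> unit_fps d"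
    hence "power_sum N (s e f) = - power_sum N f"
      using power_sum_scale_arg[of f N e] eN by (simp add: unit_fps_def s_def)
    thus "add_char (a * power_sum N (s e f)) = cnj (add_char (a * power_sum N f))"
      by (simp flip: add_char_uminus)
  qed
  finally show ?thesis by (simp add: char_sum_def cnj_sum)
qed

lemma char_sum_at_0 [simp]: "char_sum N (a::'a) 0 = 1"
proof -
  have "unit_fps 0 = {1 :: 'a fps}" by (auto simp: unit_fps_def fps_eq_iff)
  thus ?thesis by (simp add: char_sum_def)
qed

text \<open>The extreme case d = 0 of the functional equation, where the sum on the left is
  1.\<close>

lemma gauss_eq_char_sum:
  assumes "a \<noteq> (0::'a)"
  shows "additive_L.gauss N a 1 = of_nat CARD('a) * char_sum N a (N - 1)"
  using additive_L.functional_equation[OF additive_L[OF assms], of 0] N_pos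
  by (simp add: char_sum_real)

text \<open>The other extreme case d = N - 1. The top coefficient is therefore a square root of
  q^(N-1), and its sign is the sign of the functional equation.\<close>

lemma char_sum_top_square:
  assumes "a \<noteq> (0::'a)"
  shows "char_sum N a (N - 1) ^ 2 = of_nat CARD('a) ^ (N - 1)"
proof -
  have "of_nat CARD('a) * char_sum N a (N - 1) * char_sum N a (N - 1) = of_nat CARD('a) ^ N"
    using additive_L.functional_equation[OF additive_L[OF assms], of "N - 1"] N_pos
    unfolding gauss_eq_char_sum[OF assms] by simp
  also have "\<dots> = of_nat CARD('a) * of_nat CARD('a) ^ (N - 1)" using N_pos by (cases N) simp_all
  finally show ?thesis by (simp add: power2_eq_square)
qed

text \<open>Write f = g + X^(M+1) r with g of degree at most M. As N < 2 (M + 1), the power sum is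
  affine linear in r, so the sum over r vanishes unless the coefficients of X, ..., X^(M-1) in 1 / g
  do. This forces g = 1 + c X^M, with power sum M c^2, and a quadratic Gauss sum remains.\<close>

lemma char_sum_top:
  assumes "a \<noteq> (0::'a)"
  shows "char_sum N a (N - 1) = of_nat CARD('a) ^ (M - 1) * (\<Sum>c\<in>UNIV. add_char (a * of_nat M * c ^ 2))"
proof -
  let ?q = "of_nat CARD('a) :: complex"
  define S where "S = (fps_supp {..<M-1} :: 'a fps set)"
  \<comment> \<open>The linear form in r. It stems from the coefficient of X^N in X^(M+1) r / g,
    that is, of X^(M-1) in r / g, since N - (M + 1) = M - 1.\<close>
  define c where "c g i = - (a * of_nat N) * fps_nth (inverse g) (M - 1 - i)" for g :: "'a fps" and i
  have finS: "finite S" by (simp add: S_def card_fps_supp)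
  have "char_sum N a (N - 1) = (\<Sum>(g,r)\<in>unit_fps M \<times> S. add_char (a * power_sum N (g + fps_X ^ Suc M * r)))"
    unfolding char_sum_def
  proof (rule sum.reindex_bij_witness[where i = "\<lambda>(g, r). g + fps_X ^ Suc M * (r :: 'a fps)"
        and j = "\<lambda>f :: 'a fps. (fps_cutoff (Suc M) f, fps_shift (Suc M) f)"])
    fix f :: "'a fps" assume f: "f \<in> unit_fps (N - 1)"
    show 1: "(case (fps_cutoff (Suc M) f, fps_shift (Suc M) f) of (g, r) \<Rightarrow> g + fps_X ^ Suc M * r) = f"
      using fps_shift_cutoff'[of "Suc M" f] by (simp add: add.commute)
    show "(fps_cutoff (Suc M) f, fps_shift (Suc M) f) \<in> unit_fps M \<times> S"
      using f NM by (auto simp: unit_fps_def S_def fps_supp_def)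
    show "(case (fps_cutoff (Suc M) f, fps_shift (Suc M) f) of (g, r) \<Rightarrow> add_char (a * power_sum N (g + fps_X ^ Suc M * r)))
      = add_char (a * power_sum N f)" using 1 by simp
  next
    fix b :: "'a fps \<times> 'a fps" assume b: "b \<in> unit_fps M \<times> S"
    obtain g r where gr: "b = (g, r)" by (cases b)
    show "(fps_cutoff (Suc M) (case b of (g, r) \<Rightarrow> g + fps_X ^ Suc M * r),
           fps_shift (Suc M) (case b of (g, r) \<Rightarrow> g + fps_X ^ Suc M * r)) = b"
      using b unfolding gr
      by (auto simp: fps_eq_iff fps_X_power_mult_nth unit_fps_def simp del: power_Suc)
    show "(case b of (g, r) \<Rightarrow> g + fps_X ^ Suc M * r) \<in> unit_fps (N - 1)"
      using b NM M_pos unfolding gr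
      by (auto simp: fps_X_power_mult_nth unit_fps_def S_def fps_supp_def simp del: power_Suc)
  qed
  also have "\<dots> = (\<Sum>g\<in>unit_fps M. \<Sum>r\<in>S. add_char (a * power_sum N g) * add_char (\<Sum>i\<in>{..<M-1}. c g i * fps_nth r i))"
    unfolding sum.cartesian_product
  proof (intro sum.cong refl, clarify)
    fix g r :: "'a fps" assume g: "g \<in> unit_fps M" and r: "r \<in> S"
    have g0: "fps_nth g 0 = 1" using g by (simp add: unit_fps_def)
    hence ginv: "g * inverse g = 1" by (intro inverse_mult_eq_1') auto
    have "g + fps_X ^ Suc M * r = g * (1 + fps_X ^ Suc M * (r * inverse g))"
    proof -
      have "g * (1 + fps_X ^ Suc M * (r * inverse g)) = g + fps_X ^ Suc M * r * (g * inverse g)"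
        by (simp only: ring_distribs mult_ac mult_1_right mult_1_left)
      thus ?thesis using ginv by simp
    qed
    hence "power_sum N (g + fps_X ^ Suc M * r) = power_sum N g + power_sum N (1 + fps_X ^ Suc M * (r * inverse g))"
      using g0 by (simp add: power_sum_mult fps_X_power_mult_nth del: power_Suc)
    also have "power_sum N (1 + fps_X ^ Suc M * (r * inverse g)) = - of_nat N * fps_nth (r * inverse g) (M - 1)"
      using NM by (subst power_sum_one_plus) (auto simp: fps_X_power_mult_nth simp del: power_Suc)
    also have "fps_nth (r * inverse g) (M - 1) = (\<Sum>i\<in>{..<M-1}. fps_nth r i * fps_nth (inverse g) (M - 1 - i))"
      unfolding fps_mult_nth using r by (intro sum.mono_neutral_right) (auto simp: S_def fps_supp_def)
    finally have "a * power_sum N (g + fps_X ^ Suc M * r) = a * power_sum N g + (\<Sum>i\<in>{..<M-1}. c g i * fps_nth r i)"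
      by (simp add: c_def ring_distribs sum_distrib_left sum_negf mult_ac)
    thus "add_char (a * power_sum N (g + fps_X ^ Suc M * r)) = add_char (a * power_sum N g) * add_char (\<Sum>i\<in>{..<M-1}. c g i * fps_nth r i)"
      by (simp only: add_char_add)
  qed
  also have "\<dots> = (\<Sum>g\<in>unit_fps M. add_char (a * power_sum N g) * (if \<forall>i\<in>{..<M-1}. c g i = 0 then ?q ^ (M - 1) else 0))"
  proof (intro sum.cong refl)
    fix g :: "'a fps"
    have "(\<Sum>r\<in>S. add_char (\<Sum>i\<in>{..<M-1}. c g i * fps_nth r i)) = (if \<forall>i\<in>{..<M-1}. c g i = 0 then of_nat (CARD('a) ^ card {..<M-1}) else 0)"
      unfolding S_def by (rule sum_add_char_fps_supp) auto
    thus "(\<Sum>r\<in>S. add_char (a * power_sum N g) * add_char (\<Sum>i\<in>{..<M-1}. c g i * fps_nth r i)) =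
       add_char (a * power_sum N g) * (if \<forall>i\<in>{..<M-1}. c g i = 0 then ?q ^ (M - 1) else 0)"
      by (simp add: sum_distrib_left[symmetric])
  qed
  also have "\<dots> = (\<Sum>g\<in>(\<lambda>c. 1 + fps_const c * fps_X ^ M) ` UNIV. add_char (a * power_sum N g) * ?q ^ (M - 1))"
  proof (rule sum.mono_neutral_cong_right)
    show "finite (unit_fps M :: 'a fps set)" by (rule unit_fps_finite)
    show "(\<lambda>c. 1 + fps_const c * fps_X ^ M) ` UNIV \<subseteq> (unit_fps M :: 'a fps set)"
      using M_pos by (auto simp: unit_fps_def)
    have iff: "(\<forall>i\<in>{..<M-1}. c g i = 0) \<longleftrightarrow> g \<in> (\<lambda>c. 1 + fps_const c * fps_X ^ M) ` UNIV" if g: "g \<in> unit_fps M" for g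
    proof -
      have g0: "fps_nth g 0 = 1" using g by (simp add: unit_fps_def)
      have "(\<forall>i\<in>{..<M-1}. c g i = 0) \<longleftrightarrow> (\<forall>j. 1 \<le> j \<longrightarrow> j < M \<longrightarrow> fps_nth (inverse g) j = 0)"
      proof (safe)
        fix j assume h: "\<forall>i\<in>{..<M-1}. c g i = 0" "1 \<le> j" "j < M"
        have "M - 1 - j \<in> {..<M-1}" "M - 1 - (M - 1 - j) = j" using h by auto
        hence "- (a * of_nat N) * fps_nth (inverse g) j = 0" using h(1) unfolding c_def by metis
        thus "fps_nth (inverse g) j = 0" using assms of_nat_N by simp
      qed (auto simp: c_def)
      also have "\<dots> \<longleftrightarrow> (\<forall>j. 1 \<le> j \<longrightarrow> j < M \<longrightarrow> fps_nth g j = 0)"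
        using fps_inverse_low_coeffs[of g M] fps_inverse_low_coeffs[of "inverse g" M] g0 by (auto simp: fps_inverse_idempotent)
      also have "\<dots> \<longleftrightarrow> g \<in> (\<lambda>c. 1 + fps_const c * fps_X ^ M) ` UNIV"
      proof
        assume h: "\<forall>j. 1 \<le> j \<longrightarrow> j < M \<longrightarrow> fps_nth g j = 0"
        have "g = 1 + fps_const (fps_nth g M) * fps_X ^ M"
        proof (rule fps_ext)
          fix n
          consider "n = 0" | "1 \<le> n" "n < M" | "n = M" | "n > M" by linarith
          thus "fps_nth g n = fps_nth (1 + fps_const (fps_nth g M) * fps_X ^ M) n"
            using h g M_pos by cases (auto simp: unit_fps_def)
        qed
        thus "g \<in> (\<lambda>c. 1 + fps_const c * fps_X ^ M) ` UNIV" by blast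
      qed (use M_pos in auto)
      finally show ?thesis .
    qed
    show "\<forall>g\<in>unit_fps M - (\<lambda>c. 1 + fps_const c * fps_X ^ M) ` UNIV.
       add_char (a * power_sum N g) * (if \<forall>i\<in>{..<M-1}. c g i = 0 then ?q ^ (M - 1) else 0) = 0"
      using iff by auto
    fix g :: "'a fps" assume g: "g \<in> (\<lambda>c. 1 + fps_const c * fps_X ^ M) ` UNIV"
    hence "g \<in> unit_fps M" using M_pos by (auto simp: unit_fps_def)
    thus "add_char (a * power_sum N g) * (if \<forall>i\<in>{..<M-1}. c g i = 0 then ?q ^ (M - 1) else 0) = add_char (a * power_sum N g) * ?q ^ (M - 1)"
      using iff[of g] g by simp
  qed
  also have "\<dots> = (\<Sum>c\<in>UNIV. add_char (a * power_sum N (1 + fps_const c * fps_X ^ M)) * ?q ^ (M - 1))"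
  proof (subst sum.reindex)
    show "inj (\<lambda>c::'a. 1 + fps_const c * fps_X ^ M)"
    proof (rule injI)
      fix x y :: 'a assume "1 + fps_const x * fps_X ^ M = 1 + fps_const y * fps_X ^ M"
      hence "fps_nth (1 + fps_const x * fps_X ^ M) M = fps_nth (1 + fps_const y * fps_X ^ M) M" by simp
      thus "x = y" using M_pos by simp
    qed
  qed simp
  also have "\<dots> = (\<Sum>c\<in>UNIV. add_char (a * (of_nat M * c ^ 2)) * ?q ^ (M - 1))"
    unfolding NM by (simp only: power_sum_binomial[OF M_pos])
  finally show ?thesis by (simp add: sum_distrib_left mult_ac)
qed

text \<open>For fixed c the quadratic terms sum to q - 1 over nonzero \<open>a\<close> if c = 0 and
  to - 1 otherwise, so the grand total is 0. All top coefficients being plus or minus one positive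
  number, some are negative.\<close>

theorem exists_negative_sign:
  obtains a :: 'a where "a \<noteq> 0" "char_sum N a (N - 1) = - of_real (sqrt (real CARD('a)) ^ (N - 1))"
proof -
  let ?q = "of_nat CARD('a) :: complex"
  define s where "s = sqrt (real CARD('a))"
  have s: "s > 0" "s * s = real CARD('a)" using CARD_gt_1[where ?'a='a] by (auto simp: s_def)
  have sq: "(of_real s :: complex) ^ 2 = ?q"
    unfolding power2_eq_square of_real_mult[symmetric] s(2) by simp
  have "(\<Sum>a\<in>UNIV - {0::'a}. \<Sum>c\<in>UNIV. add_char (a * of_nat M * c ^ 2)) =
    (\<Sum>c\<in>UNIV. (\<Sum>a\<in>UNIV - {0::'a}. add_char (of_nat M * c ^ 2 * a)))"
    by (subst sum.swap) (simp add: mult_ac)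
  also have "\<dots> = (\<Sum>c\<in>UNIV. (\<Sum>a\<in>(UNIV::'a set). add_char (of_nat M * c ^ 2 * a)) - 1)"
    by (intro sum.cong refl) (simp add: sum_diff1)
  also have "\<dots> = (\<Sum>c\<in>(UNIV::'a set). (if c = 0 then ?q else 0) - 1)"
    using of_nat_M by (intro sum.cong refl) (simp add: sum_add_char)
  also have "\<dots> = 0" by (simp add: sum_subtractf)
  finally have z: "(\<Sum>a\<in>UNIV - {0::'a}. char_sum N a (N - 1)) = 0"
    using char_sum_top by (simp add: sum_distrib_left[symmetric])
  have "\<exists>a::'a. a \<noteq> 0 \<and> char_sum N a (N - 1) = - of_real (s ^ (N - 1))"
  proof (rule ccontr)
    assume contra: "\<nexists>a::'a. a \<noteq> 0 \<and> char_sum N a (N - 1) = - of_real (s ^ (N - 1))"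
    have "char_sum N a (N - 1) = of_real (s ^ (N - 1))" if "a \<noteq> 0" for a :: 'a
    proof -
      have "char_sum N a (N - 1) ^ 2 = (of_real s ^ 2) ^ (N - 1)"
        unfolding sq by (rule char_sum_top_square[OF that])
      also have "\<dots> = (of_real (s ^ (N - 1))) ^ 2"
        by (simp only: of_real_power power_mult[symmetric] mult.commute)
      finally have "char_sum N a (N - 1) = of_real (s ^ (N - 1)) \<or> char_sum N a (N - 1) = - of_real (s ^ (N - 1))"
        by (simp add: power2_eq_iff)
      thus ?thesis using contra that by blast
    qed
    hence "(\<Sum>a\<in>UNIV - {0::'a}. char_sum N a (N - 1)) = of_nat (CARD('a) - 1) * of_real (s ^ (N - 1))"
      by simp
    thus False using z s CARD_gt_1[where ?'a='a] by simp
  qed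
  thus ?thesis using that unfolding s_def by blast
qed

definition L_poly :: "'a \<Rightarrow> complex poly" where
  "L_poly a = (\<Sum>d<N. Polynomial.monom (char_sum N a d) d)"

lemma coeff_L_poly:
  assumes "a \<noteq> 0"
  shows "Polynomial.coeff (L_poly a) d = char_sum N a d"
proof (cases "d < N")
  case True
  thus ?thesis unfolding L_poly_def coeff_sum coeff_monom by (subst sum.delta) auto
next
  case False
  thus ?thesis using additive_L.char_sum_eq_0[OF additive_L[OF assms], of d]
    by (simp add: L_poly_def coeff_sum coeff_monom)
qed

lemma degree_L_poly:
  assumes "a \<noteq> 0"
  shows "degree (L_poly a) = N - 1"
proof (rule antisym)
  show "degree (L_poly a) \<le> N - 1"
    using additive_L.char_sum_eq_0[OF additive_L[OF assms]]
    by (intro degree_le allI impI) (simp add: coeff_L_poly[OF assms])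
  have "char_sum N a (N - 1) ^ 2 \<noteq> 0" unfolding char_sum_top_square[OF assms] by simp
  thus "N - 1 \<le> degree (L_poly a)" by (intro le_degree) (auto simp: coeff_L_poly[OF assms])
qed

text \<open>With sign - 1 the terms of index d and N - 1 - d are opposite at u = 1 / sqrt q, so the
  value there equals its own negative.\<close>

theorem L_poly_central_zero:
  obtains a :: 'a where "a \<noteq> 0" "poly (L_poly a) (1 / of_real (sqrt (real CARD('a)))) = 0"
proof -
  define s :: complex where "s = of_real (sqrt (real CARD('a)))"
  have "\<exists>a::'a. a \<noteq> 0 \<and> char_sum N a (N - 1) = - (s ^ (N - 1))"
    using exists_negative_sign unfolding s_def of_real_power[symmetric] by metis
  then obtain a :: 'a where a: "a \<noteq> 0" and top: "char_sum N a (N - 1) = - (s ^ (N - 1))"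
    by blast
  have s0: "s \<noteq> 0" by (simp add: s_def)
  have "s ^ 2 = of_real (real CARD('a))"
    unfolding s_def of_real_power[symmetric] by simp
  hence sq: "of_nat CARD('a) = s ^ 2" by simp
  have key: "char_sum N a d / s ^ d = - (char_sum N a (N - Suc d) / s ^ (N - Suc d))" if d: "d < N" for d
  proof -
    define x y D E where "x = char_sum N a d" and "y = char_sum N a (N - Suc d)"
      and "D = s ^ d" and "E = s ^ (N - Suc d)"
    have DE: "D \<noteq> 0" "E \<noteq> 0" using s0 by (auto simp: D_def E_def)
    have "N - 1 = d + (N - Suc d)" using d by simp
    hence t: "s ^ (N - 1) = D * E" unfolding D_def E_def power_add[symmetric] by (rule arg_cong)
    have e: "(s ^ 2) ^ Suc d = s ^ 2 * (D * D)"
      unfolding D_def by (simp only: power_Suc power2_eq_square power_mult_distrib)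
    have i: "N - 1 - d = N - Suc d" by simp
    have "s ^ 2 * (- (D * E)) * x = s ^ 2 * (D * D) * y"
      using additive_L.functional_equation[OF additive_L[OF a] d]
      unfolding gauss_eq_char_sum[OF a] char_sum_real top sq e t i x_def y_def .
    hence "(s ^ 2 * D) * (- (E * x)) = (s ^ 2 * D) * (D * y)" by (simp only: mult_minus_left mult_minus_right mult_ac)
    hence "- (E * x) = D * y" using s0 DE by (subst (asm) mult_cancel_left) simp
    hence "E * x = - (D * y)" by (metis minus_minus)
    hence "x / D = - (y / E)" using DE by (simp add: divide_simps mult_ac)
    thus ?thesis unfolding x_def y_def D_def E_def .
  qed
  have 1: "poly (L_poly a) (1 / s) = (\<Sum>d<N. char_sum N a d / s ^ d)"
    unfolding L_poly_def poly_sum poly_monom by (simp add: power_divide)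
  have "(\<Sum>d<N. char_sum N a d / s ^ d) = (\<Sum>d<N. - (char_sum N a (N - Suc d) / s ^ (N - Suc d)))"
    by (intro sum.cong refl key) simp
  also have "\<dots> = - (\<Sum>d<N. char_sum N a (N - Suc d) / s ^ (N - Suc d))" by (rule sum_negf)
  also have "(\<Sum>d<N. char_sum N a (N - Suc d) / s ^ (N - Suc d)) = (\<Sum>d<N. char_sum N a d / s ^ d)"
    by (rule sum.nat_diff_reindex)
  finally have "2 * (\<Sum>d<N. char_sum N a d / s ^ d) = 0" by (metis add.right_inverse mult_2)
  hence "poly (L_poly a) (1 / s) = 0" unfolding 1 by simp
  thus ?thesis using that[OF a] unfolding s_def by blast
qed

end


section \<open>Frobenius orbits\<close>

text \<open>Forward iterates suffice, since the maps in question are periodic. The notions are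
  abstract because they serve Frobenius both on the algebraic closure and on points of the
  curve.\<close>

definition orb :: "('x \<Rightarrow> 'x) \<Rightarrow> 'x \<Rightarrow> 'x set" where
  "orb f x = range (\<lambda>n. (f ^^ n) x)"

definition period :: "('x \<Rightarrow> 'x) \<Rightarrow> 'x \<Rightarrow> nat" where
  "period f x = (LEAST n. n > 0 \<and> (f ^^ n) x = x)"

locale periodic_map =
  fixes f :: "'x \<Rightarrow> 'x"
  assumes periodic: "\<exists>n>0. (f ^^ n) x = x"
begin

lemma period: "period f x > 0" "(f ^^ period f x) x = x"
proof -
  from LeastI_ex[OF periodic[of x]]
  show "period f x > 0" "(f ^^ period f x) x = x" unfolding period_def by auto
qed

text \<open>Both points have a common period \<open>n\<close>, so each is recovered from its image
  by the same n - 1 further steps.\<close>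

lemma inj: "inj f"
proof (rule injI)
  fix x y assume eq: "f x = f y"
  define n where "n = period f x * period f y"
  have n: "n > 0" using period(1) by (simp add: n_def)
  have per: "(f ^^ (period f x * k)) x = x" for x k
    by (induction k) (simp_all add: funpow_add period(2))
  have "(f ^^ n) x = x" "(f ^^ n) y = y"
    unfolding n_def using per[of x "period f y"] per[of y "period f x"] by (simp_all only: mult.commute)
  moreover have "(f ^^ n) x = (f ^^ (n - 1)) (f x)" "(f ^^ n) y = (f ^^ (n - 1)) (f y)"
    using n by (metis Suc_diff_1 funpow_Suc_right o_apply)+
  ultimately show "x = y" using eq by simp
qed

lemma funpow_eq_iff: "(f ^^ n) x = x \<longleftrightarrow> period f x dvd n"
proof
  assume "period f x dvd n"
  then obtain k where n: "n = period f x * k" by auto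
  show "(f ^^ n) x = x" unfolding n
    by (induction k) (simp_all add: funpow_add period(2))
next
  assume h: "(f ^^ n) x = x"
  define d where "d = period f x"
  have "(f ^^ (d * k)) x = x" for k
    unfolding d_def by (induction k) (simp_all add: funpow_add period(2))
  hence "(f ^^ (n mod d)) x = (f ^^ (n mod d)) ((f ^^ (d * (n div d))) x)" by simp
  also have "\<dots> = (f ^^ n) x" by (simp flip: funpow_add[THEN fun_cong, simplified o_apply])
  finally have "(f ^^ (n mod d)) x = x" using h by simp
  moreover have "n mod d < d" using period(1) by (simp add: d_def)
  ultimately have "n mod d = 0"
    using not_less_Least[of "n mod d" "\<lambda>n. n > 0 \<and> (f ^^ n) x = x"] unfolding d_def period_def by auto
  thus "period f x dvd n" unfolding d_def by auto
qed

lemma funpow_mod: "(f ^^ (n mod period f x)) x = (f ^^ n) x"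
proof -
  have "(f ^^ n) x = (f ^^ (n mod period f x + period f x * (n div period f x))) x" by simp
  also have "\<dots> = (f ^^ (n mod period f x)) ((f ^^ (period f x * (n div period f x))) x)"
    by (simp only: funpow_add o_apply)
  also have "(f ^^ (period f x * (n div period f x))) x = x" by (simp add: funpow_eq_iff)
  finally show ?thesis by simp
qed

lemma orb_eq: "orb f x = (\<lambda>n. (f ^^ n) x) ` {..<period f x}"
proof
  show "orb f x \<subseteq> (\<lambda>n. (f ^^ n) x) ` {..<period f x}"
  proof
    fix y assume "y \<in> orb f x"
    then obtain n where "y = (f ^^ n) x" by (auto simp: orb_def)
    thus "y \<in> (\<lambda>n. (f ^^ n) x) ` {..<period f x}"
      using funpow_mod[of n x] period(1)[of x] by (intro image_eqI[of _ _ "n mod period f x"]) auto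
  qed
qed (auto simp: orb_def)

lemma inj_funpow: "inj (f ^^ n)"
  using inj by (rule inj_fn)

lemma inj_on_orb: "inj_on (\<lambda>n. (f ^^ n) x) {..<period f x}"
proof (rule linorder_inj_onI)
  fix i j assume h: "i < j" "i \<in> {..<period f x}" "j \<in> {..<period f x}"
  show "(f ^^ i) x \<noteq> (f ^^ j) x"
  proof
    assume "(f ^^ i) x = (f ^^ j) x"
    also have "(f ^^ j) x = (f ^^ (i + (j - i))) x" using h by simp
    also have "\<dots> = (f ^^ i) ((f ^^ (j - i)) x)" by (simp only: funpow_add o_apply)
    finally have "(f ^^ (j - i)) x = x" using inj_funpow by (metis injD)
    hence "period f x dvd j - i" by (simp add: funpow_eq_iff)
    thus False using h by (auto dest: dvd_imp_le)
  qed
qed auto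

lemma finite_orb [simp]: "finite (orb f x)" by (simp add: orb_eq)

lemma card_orb: "card (orb f x) = period f x"
  unfolding orb_eq using card_image[OF inj_on_orb] by simp

lemma self_in_orb [simp]: "x \<in> orb f x"
  unfolding orb_def by (rule image_eqI[of _ _ 0]) auto

lemma orb_closed: "y \<in> orb f x \<Longrightarrow> (f ^^ n) y \<in> orb f x"
  unfolding orb_def by (auto simp: funpow_add[symmetric, THEN fun_cong, simplified o_apply])

lemma orb_sym: "y \<in> orb f x \<Longrightarrow> x \<in> orb f y"
proof -
  assume "y \<in> orb f x"
  then obtain n where n: "n < period f x" "y = (f ^^ n) x" by (auto simp: orb_eq)
  have "(f ^^ (period f x - n)) y = (f ^^ (period f x - n + n)) x" by (simp only: funpow_add o_apply n(2))
  also have "\<dots> = x" using n period(2) by simp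
  finally show ?thesis unfolding orb_def by (metis rangeI)
qed

lemma orb_eqI: "y \<in> orb f x \<Longrightarrow> orb f y = orb f x"
proof -
  have sub: "orb f y \<subseteq> orb f x" if "y \<in> orb f x" for x y
    using orb_closed[OF that] by (auto simp: orb_def)
  assume "y \<in> orb f x"
  thus ?thesis using sub sub orb_sym by blast
qed

lemma image_orb: "f ` orb f x = orb f x"
proof (rule card_subset_eq[OF finite_orb])
  show "f ` orb f x \<subseteq> orb f x" using orb_closed[of _ x 1] by auto
  show "card (f ` orb f x) = card (orb f x)" using inj by (intro card_image inj_on_subset[OF inj]) auto
qed

end

section \<open>Frobenius on the algebraic closure\<close>

abbreviation frob :: "'a::finite_field alg_closure \<Rightarrow> 'a alg_closure" where
  "frob y \<equiv> y ^ CARD('a)"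

interpretation to_ac: inj_idom_hom "to_ac :: 'a::field \<Rightarrow> 'a alg_closure"
  by unfold_locales auto

interpretation map_to_ac: map_poly_inj_idom_hom "to_ac :: 'a::field \<Rightarrow> 'a alg_closure" ..

lemma prime_CHAR_ac: "prime CHAR('a::finite_field alg_closure)"
  by simp

lemma power_CARD_add:
  "(x + y :: 'a::finite_field alg_closure) ^ (CARD('a) ^ n) = x ^ (CARD('a) ^ n) + y ^ (CARD('a) ^ n)"
  by (rule freshmans_dream'[OF prime_CHAR_ac, where n = "finite_field_dim TYPE('a) * n"])
     (simp add: finite_field_dim(1) power_mult)

lemma power_CHAR_add:
  "(x + y :: 'a::finite_field alg_closure) ^ (CHAR('a) ^ n) = x ^ (CHAR('a) ^ n) + y ^ (CHAR('a) ^ n)"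
  by (rule freshmans_dream'[OF prime_CHAR_ac]) simp

lemma frob_to_ac [simp]: "frob (to_ac (c::'a::finite_field)) = to_ac c"
  by (simp flip: to_ac_power add: finite_field_power_card_eq_same)

interpretation frob: inj_idom_hom "frob :: 'a::finite_field alg_closure \<Rightarrow> 'a alg_closure"
proof -
  have *: "CARD('a) > 0" by simp
  interpret idom_hom "frob :: 'a::finite_field alg_closure \<Rightarrow> 'a alg_closure"
    by unfold_locales (use power_CARD_add[where n=1 and ?'a='a] in \<open>auto simp: power_mult_distrib zero_power\<close>)
  show "inj_idom_hom (frob :: 'a::finite_field alg_closure \<Rightarrow> 'a alg_closure)"
    by unfold_locales (use * in auto)
qed

interpretation map_frob: map_poly_inj_idom_hom "frob :: 'a::finite_field alg_closure \<Rightarrow> 'a alg_closure" ..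

lemma funpow_frob: "(frob ^^ n) (y::'a::finite_field alg_closure) = y ^ (CARD('a) ^ n)"
  by (induction n) (simp_all add: power_mult[symmetric] mult.commute)

lemma frob_poly:
  fixes f :: "'a::finite_field poly"
  shows "frob (poly (map_poly to_ac f) y) = poly (map_poly to_ac f) (frob y)"
proof -
  have "map_poly frob (map_poly to_ac f) = map_poly to_ac f"
    by (rule poly_eqI) (simp add: coeff_map_poly)
  thus ?thesis using frob.poly_map_poly[of "map_poly to_ac f" y] by metis
qed

text \<open>The iterates of an element stay among the finitely many roots of a polynomial over the
  base field. Two of them coincide, and injectivity moves the coincidence back to the start.\<close>

interpretation frob: periodic_map "frob :: 'a::finite_field alg_closure \<Rightarrow> 'a alg_closure"
proof
  fix y :: "'a alg_closure"
  obtain p :: "'a poly" where p: "p \<noteq> 0" "poly (map_poly to_ac p) y = 0" by (rule alg_closure_algebraic)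
  define P where "P = map_poly to_ac p"
  have P0: "P \<noteq> 0" using p(1) by (simp add: P_def)
  have "poly P ((frob ^^ n) y) = 0" for n
  proof (induction n)
    case (Suc n)
    thus ?case unfolding P_def by (simp add: frob_poly[symmetric] zero_power)
  qed (use p in \<open>simp add: P_def\<close>)
  hence "range (\<lambda>n. (frob ^^ n) y) \<subseteq> {z. poly P z = 0}" by auto
  hence "finite (range (\<lambda>n. (frob ^^ n) y))" using poly_roots_finite[OF P0] finite_subset by blast
  hence "\<not> inj (\<lambda>n. (frob ^^ n) y)" using finite_imageD infinite_UNIV_nat by blast
  then obtain i j where ij: "i < j" "(frob ^^ i) y = (frob ^^ j) y"
    by (metis linorder_injI)
  have "(frob ^^ j) y = (frob ^^ (i + (j - i))) y" using ij by simp
  also have "\<dots> = (frob ^^ i) ((frob ^^ (j - i)) y)" by (simp only: funpow_add o_apply)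
  finally have "(frob ^^ i) y = (frob ^^ i) ((frob ^^ (j - i)) y)" using ij by simp
  moreover have "inj ((frob :: 'a alg_closure \<Rightarrow> 'a alg_closure) ^^ i)"
    by (intro inj_fn injI) (use frob.injectivity in blast)
  ultimately have "(frob ^^ (j - i)) y = y" by (metis injD)
  thus "\<exists>n>0. (frob ^^ n) y = y" using ij by (intro exI[of _ "j - i"]) auto
qed

text \<open>The q elements of the base field exhaust the roots of X^q - X.\<close>

lemma fixed_by_frob: 
  assumes "frob (y::'a::finite_field alg_closure) = y" 
  obtains c where "y = to_ac c"
proof -
  have "range (to_ac :: 'a \<Rightarrow> _) \<subseteq> {y. frob y = y}" by auto
  moreover have "card (range (to_ac :: 'a \<Rightarrow> 'a alg_closure)) = CARD('a)"
    using card_image[OF inj_to_ac] by simp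
  ultimately have "range (to_ac :: 'a \<Rightarrow> _) = {y. frob y = y}"
    using card_fixed_points_power_le[of "CARD('a)", where ?'b="'a alg_closure"] CARD_gt_1[where ?'a='a]
    by (intro card_seteq) auto
  thus ?thesis using that assms by blast
qed

lemma frob_fixed_poly:
  assumes "map_poly frob (P :: 'a::finite_field alg_closure poly) = P"
  obtains f where "P = map_poly to_ac f"
proof -
  have "\<exists>c. Polynomial.coeff P i = to_ac c" for i
  proof -
    have "frob (Polynomial.coeff P i) = Polynomial.coeff P i"
      using arg_cong[OF assms, of "\<lambda>p. Polynomial.coeff p i"] by (simp add: coeff_map_poly)
    thus ?thesis using fixed_by_frob by metis
  qed
  hence "P = map_poly to_ac (map_poly of_ac P)"
    by (intro poly_eqI) (metis coeff_map_poly of_ac_0 of_ac_to_ac to_ac_0)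
  thus ?thesis using that by blast
qed

section \<open>Monic polynomials as multisets of Frobenius orbits\<close>

text \<open>Orbits stand for the monic irreducible polynomials, in other words for the finite places
  of the rational function field; the size of an orbit is its degree.\<close>

definition orbs :: "'a::finite_field alg_closure set set" where
  "orbs = range (orb frob)"

definition orb_poly :: "'a::finite_field alg_closure set \<Rightarrow> 'a alg_closure poly" where
  "orb_poly Q = (\<Prod>y\<in>Q. [:- y, 1:])"

lemma orb_eq_of_mem: "Q \<in> orbs \<Longrightarrow> y \<in> Q \<Longrightarrow> Q = orb frob y"
  unfolding orbs_def using frob.orb_eqI by blast

lemma orbs_nonempty: "Q \<in> orbs \<Longrightarrow> \<exists>y. y \<in> Q \<and> Q = orb frob y"
  unfolding orbs_def by force

lemma finite_orbs: "Q \<in> orbs \<Longrightarrow> finite Q" unfolding orbs_def by auto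

lemma card_orbs_pos: "Q \<in> orbs \<Longrightarrow> card Q > 0"
  using orbs_nonempty finite_orbs card_gt_0_iff by blast

lemma frob_orb_poly:
  assumes "Q \<in> orbs"
  shows "map_poly frob (orb_poly Q) = orb_poly (Q :: 'a::finite_field alg_closure set)"
proof -
  have im: "frob ` Q = Q" using assms frob.image_orb unfolding orbs_def by auto
  have "map_poly frob (orb_poly Q) = (\<Prod>y\<in>Q. map_poly frob [:- y, 1:])"
    unfolding orb_poly_def by (rule map_frob.hom_prod)
  also have "\<dots> = (\<Prod>y\<in>Q. [:- frob y, 1:])"
    by (simp add: map_poly_pCons frob.hom_uminus)
  also have "\<dots> = (\<Prod>y\<in>frob ` Q. [:- y, 1:])"
    by (subst prod.reindex) (auto intro: inj_on_subset[OF frob.inj])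
  finally show ?thesis unfolding im orb_poly_def .
qed

lemma proots_orb_poly: "finite Q \<Longrightarrow> proots (orb_poly Q) = mset_set Q"
  unfolding orb_poly_def by (subst proots_prod) (auto simp: sum_unfold_sum_mset)

lemma monic_orb_poly: "lead_coeff (orb_poly Q) = 1"
  unfolding orb_poly_def by (rule monic_prod) auto

lemma degree_orb_poly: "degree (orb_poly Q) = card Q"
  unfolding orb_poly_def by (subst degree_prod_eq_sum_degree) auto

lemma orb_poly_nz [simp]: "orb_poly Q \<noteq> 0"
  using monic_orb_poly[of Q] by auto

definition orb_div_poly :: "'a::finite_field alg_closure set multiset \<Rightarrow> 'a alg_closure poly" where
  "orb_div_poly D = (\<Prod>Q\<in>#D. orb_poly Q)"

definition orb_div_degree :: "'a::finite_field alg_closure set multiset \<Rightarrow> nat" where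
  "orb_div_degree D = (\<Sum>Q\<in>#D. card Q)"

lemma monic_orb_div_poly: "lead_coeff (orb_div_poly D) = 1"
  unfolding orb_div_poly_def by (induction D) (simp_all add: monic_orb_poly lead_coeff_mult)

lemma degree_orb_div_poly: "degree (orb_div_poly D) = orb_div_degree D"
  unfolding orb_div_degree_def orb_div_poly_def
proof (induction D)
  case (add Q D)
  have "prod_mset (image_mset orb_poly D) \<noteq> 0" by (auto simp: prod_mset_zero_iff)
  thus ?case using add by (simp add: degree_mult_eq degree_orb_poly)
qed simp

lemma orb_div_poly_descends:
  assumes "set_mset D \<subseteq> orbs"
  obtains f :: "'a::finite_field poly" where "orb_div_poly D = map_poly to_ac f"
proof -
  have "map_poly frob (orb_div_poly D) = orb_div_poly D" using assms
    unfolding orb_div_poly_def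
    by (induction D) (simp_all add: map_frob.hom_mult frob_orb_poly)
  thus ?thesis using frob_fixed_poly that by blast
qed

lemma proots_orb_div_poly:
  assumes "set_mset D \<subseteq> orbs"
  shows "proots (orb_div_poly D) = (\<Sum>Q\<in>#D. mset_set Q)"
  using assms unfolding orb_div_poly_def
proof (induction D)
  case (add Q D)
  have "prod_mset (image_mset orb_poly D) \<noteq> 0" by (auto simp: prod_mset_zero_iff)
  thus ?case using add by (simp add: proots_mult proots_orb_poly finite_orbs)
qed simp

lemma count_proots_orb_div_poly:
  assumes "set_mset D \<subseteq> orbs" "Q \<in> orbs" "y \<in> Q"
  shows "count (proots (orb_div_poly D)) y = count D Q"
  unfolding proots_orb_div_poly[OF assms(1)] using assms
proof (induction D)
  case (add P D)
  have "count (mset_set P) y = (if Q = P then 1 else 0)"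
    using add.prems finite_orbs[of P] orb_eq_of_mem[of P y] orb_eq_of_mem[of Q y] by (auto simp: count_mset_set')
  thus ?case using add by auto
qed simp

text \<open>Frobenius on the coefficients fixes \<open>p\<close> and moves the linear factor at
  \<open>y\<close> to the one at \<open>frob y\<close>. Once around the orbit, the inequality
  becomes an equality.\<close>

lemma order_frob_le:
  assumes "p = map_poly to_ac (f :: 'a::finite_field poly)" "p \<noteq> 0"
  shows "Polynomial.order y p \<le> Polynomial.order (frob y) p"
proof -
  have p: "map_poly frob p = p" unfolding assms by (rule poly_eqI) (simp add: coeff_map_poly)
  obtain q where "p = [:- y, 1:] ^ Polynomial.order y p * q"
    using order_1[of y p] by (elim dvdE)
  hence "map_poly frob p = map_poly frob ([:- y, 1:] ^ Polynomial.order y p * q)" by (rule arg_cong)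
  also have "\<dots> = map_poly frob [:- y, 1:] ^ Polynomial.order y p * map_poly frob q"
    by (simp only: map_frob.hom_mult map_frob.hom_power)
  also have "map_poly frob [:- y, 1:] = [:- frob y, 1:]"
    by (simp add: map_poly_pCons frob.hom_uminus)
  finally have "[:- frob y, 1:] ^ Polynomial.order y p dvd p" unfolding p by (rule dvdI)
  thus ?thesis using assms(2) by (rule order_max)
qed

text \<open>Factorisation read off from the roots: multiplicities are constant on orbits and so
  define a multiset of orbits, and monic polynomials over an algebraically closed field are
  determined by their roots with multiplicity.\<close>

lemma monic_eq_orb_div_poly:
  fixes f :: "'a::finite_field poly"
  assumes "lead_coeff f = 1"
  obtains D where "set_mset D \<subseteq> orbs" "orb_div_poly D = map_poly to_ac f"
proof -
  define p where "p = map_poly to_ac f"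
  have p1: "lead_coeff p = 1" using assms by (simp add: p_def)
  hence p0: "p \<noteq> 0" by auto
  have le: "Polynomial.order y p \<le> Polynomial.order ((frob ^^ n) y) p" for y n
    by (induction n) (auto intro: order_trans order_frob_le[OF p_def p0])
  have ord: "Polynomial.order z p = Polynomial.order y p" if "z \<in> orb frob y" for y z
  proof (rule antisym)
    have "y \<in> orb frob z" using that by (rule frob.orb_sym)
    thus "Polynomial.order z p \<le> Polynomial.order y p" using le[of z] by (auto simp: orb_def)
    show "Polynomial.order y p \<le> Polynomial.order z p" using le[of y] that by (auto simp: orb_def)
  qed
  define R where "R = {Q \<in> orbs. \<exists>y\<in>Q. poly p y = 0}"
  define g where "g Q = Polynomial.order (SOME y. y \<in> Q) p" for Q
  have gO: "g Q = Polynomial.order y p" if "Q \<in> orbs" "y \<in> Q" for Q y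
  proof -
    have "(SOME z. z \<in> Q) \<in> Q" using that(2) by (rule someI)
    thus ?thesis unfolding g_def using ord orb_eq_of_mem[OF that] by metis
  qed
  have "R \<subseteq> orb frob ` {y. poly p y = 0}"
    unfolding R_def using orb_eq_of_mem by blast
  hence finR: "finite R" using poly_roots_finite[OF p0] finite_surj by blast
  have "\<exists>D. count D = (\<lambda>Q. if Q \<in> R then g Q else 0)"
  proof -
    have "finite {Q. 0 < (if Q \<in> R then g Q else 0)}" using finR by (rule rev_finite_subset) auto
    from count_Abs_multiset[OF this] show ?thesis by (rule exI)
  qed
  then obtain D where D: "count D Q = (if Q \<in> R then g Q else 0)" for Q by metis
  have Dorbs: "set_mset D \<subseteq> orbs"
  proof
    fix Q assume "Q \<in># D"
    hence "count D Q \<noteq> 0" by simp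
    thus "Q \<in> orbs" unfolding D R_def by (auto split: if_splits)
  qed
  have "proots (orb_div_poly D) = proots p"
  proof (rule multiset_eqI)
    fix y :: "'a alg_closure"
    have Q: "orb frob y \<in> orbs" "y \<in> orb frob y" by (auto simp: orbs_def)
    have "count (proots (orb_div_poly D)) y = count D (orb frob y)"
      by (rule count_proots_orb_div_poly[OF Dorbs Q])
    also have "\<dots> = Polynomial.order y p"
    proof (cases "orb frob y \<in> R")
      case True thus ?thesis by (simp add: D gO[OF Q])
    next
      case False
      hence "poly p y \<noteq> 0" using Q unfolding R_def by blast
      thus ?thesis using False by (simp add: D order_0I)
    qed
    finally show "count (proots (orb_div_poly D)) y = count (proots p) y" using p0 by simp
  qed
  hence pr: "proots (orb_div_poly D) = proots p" .
  have split: "q = (\<Prod>x\<in>#proots q. [:- x, 1:])" if q: "lead_coeff q = 1" for q :: "'a alg_closure poly"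
  proof -
    have "q \<noteq> 0" using q by auto
    then obtain A where A: "q = smult (lead_coeff q) (\<Prod>x\<in>#A. [:-x, 1:])"
      using alg_closed_imp_factorization[of q] by blast
    hence qA: "q = (\<Prod>x\<in>#A. [:-x, 1:])" unfolding q by simp
    have "proots (\<Prod>x\<in>#A. [:-x, 1:]) = A"
    proof (induction A)
      case (add x A)
      have nz: "prod_mset (image_mset (\<lambda>x. [:- x, 1:]) A) \<noteq> 0" by (auto simp: prod_mset_zero_iff)
      have "proots (\<Prod>x\<in>#add_mset x A. [:-x, 1:]) = proots ([:-x,1:] * (\<Prod>x\<in>#A. [:-x, 1:]))"
        by (simp only: image_mset_add_mset prod_mset.add_mset)
      also have "\<dots> = proots [:-x,1:] + proots (\<Prod>x\<in>#A. [:-x, 1:])"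
        by (rule proots_mult) (use nz in auto)
      also have "\<dots> = add_mset x A" unfolding add.IH proots_linear_factor by simp
      finally show ?case .
    qed simp
    thus ?thesis unfolding qA by (simp only:)
  qed
  have "orb_div_poly D = (\<Prod>x\<in>#proots (orb_div_poly D). [:- x, 1:])"
    by (rule split[OF monic_orb_div_poly])
  also have "\<dots> = p" unfolding pr by (rule split[OF p1, symmetric])
  finally show ?thesis using that Dorbs by (simp only: p_def)
qed


section \<open>The L-series as sums over orbit divisors\<close>

text \<open>Reversal turns the factor x - y into 1 - y X, whose logarithmic derivative generates the
  powers of y. A factor x is lost.\<close>

definition rev_fps :: "'b::field poly \<Rightarrow> 'b fps" where
  "rev_fps f = fps_of_poly (reflect_poly f)"

lemma rev_fps_mult: "rev_fps (f * g) = rev_fps f * rev_fps g"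
  by (simp add: rev_fps_def reflect_poly_mult fps_of_poly_mult)

lemma rev_fps_nth: "fps_nth (rev_fps f) i = (if i \<le> degree f then Polynomial.coeff f (degree f - i) else 0)"
  by (simp add: rev_fps_def coeff_reflect_poly)

lemma power_sum_linear:
  assumes "N > 0"
  shows "power_sum N (rev_fps [:- y, 1:]) = (y::'b::field) ^ N"
proof -
  have "rev_fps [:- y, 1:] = 1 - fps_const y * fps_X"
    by (rule fps_ext) (auto simp: rev_fps_nth coeff_pCons split: nat.splits)
  moreover have "inverse (1 - fps_const y * fps_X) = Abs_fps (\<lambda>i. y ^ i)"
  proof (rule fps_inverse_unique)
    show "(1 - fps_const y * fps_X) * Abs_fps (\<lambda>i. y ^ i) = 1"
    proof (rule fps_ext)
      fix n show "fps_nth ((1 - fps_const y * fps_X) * Abs_fps (\<lambda>i. y ^ i)) n = fps_nth 1 n"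
        by (cases n) (simp_all add: left_diff_distrib mult.assoc)
    qed
  qed
  ultimately show ?thesis using assms
    by (cases N) (simp_all add: power_sum_def mult.assoc)
qed

lemma rev_fps_at_0: "fps_nth (rev_fps f) 0 = lead_coeff f"
  by (simp add: rev_fps_nth)

lemma power_sum_prod_mset:
  assumes "\<And>f. f \<in># A \<Longrightarrow> lead_coeff f \<noteq> 0"
  shows "power_sum N (rev_fps (\<Prod>\<^sub># A)) = (\<Sum>f\<in>#A. power_sum N (rev_fps (f::'b::field poly)))"
  using assms
proof (induction A)
  case (add f A)
  have "lead_coeff (\<Prod>\<^sub># A) \<noteq> 0" using add.prems by (auto simp: prod_mset_zero_iff)
  thus ?case using add by (simp add: rev_fps_mult power_sum_mult rev_fps_at_0)
next
  case empty
  have "rev_fps (1 :: 'b poly) = 1" by (simp add: rev_fps_def)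
  thus ?case by simp
qed

lemma power_sum_orb_poly:
  assumes "finite Q" "N > 0"
  shows "power_sum N (rev_fps (orb_poly Q)) = (\<Sum>y\<in>Q. y ^ N)"
proof -
  have "orb_poly Q = \<Prod>\<^sub># (image_mset (\<lambda>y. [:- y, 1:]) (mset_set Q))"
    by (simp add: orb_poly_def prod_unfold_prod_mset)
  hence "power_sum N (rev_fps (orb_poly Q)) = (\<Sum>f\<in>#image_mset (\<lambda>y. [:- y, 1:]) (mset_set Q). power_sum N (rev_fps f))"
    by (simp only:) (rule power_sum_prod_mset, auto)
  also have "\<dots> = (\<Sum>y\<in>Q. y ^ N)"
    by (simp add: image_mset.compositionality o_def power_sum_linear[OF assms(2)] sum_unfold_sum_mset)
  finally show ?thesis .
qed

text \<open>The sum is invariant under Frobenius, so \<open>of_ac\<close> brings it down to the base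
  field.\<close>

definition orb_trace :: "nat \<Rightarrow> 'a::finite_field alg_closure set \<Rightarrow> 'a" where
  "orb_trace N Q = of_ac (\<Sum>y\<in>Q. y ^ N)"

lemma to_ac_orb_trace:
  assumes "Q \<in> orbs"
  shows "to_ac (orb_trace N Q) = (\<Sum>y\<in>Q. y ^ N)"
proof -
  have im: "frob ` Q = Q" using assms frob.image_orb unfolding orbs_def by auto
  have "frob (\<Sum>y\<in>Q. y ^ N) = (\<Sum>y\<in>Q. frob y ^ N)"
    unfolding frob.hom_sum by (simp only: frob.hom_power)
  also have "\<dots> = (\<Sum>y\<in>frob ` Q. y ^ N)"
    by (subst sum.reindex) (auto intro: inj_on_subset[OF frob.inj])
  finally have "frob (\<Sum>y\<in>Q. y ^ N) = (\<Sum>y\<in>Q. y ^ N)" unfolding im .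
  then obtain c where "(\<Sum>y\<in>Q. y ^ N) = to_ac c" by (rule fixed_by_frob)
  thus ?thesis by (simp add: orb_trace_def)
qed

text \<open>The coefficientwise embedding \<open>m\<close> is a ring homomorphism commuting with
  derivative, inverse and reversal.\<close>

lemma power_sum_map_to_ac:
  assumes "lead_coeff f = 1"
  shows "power_sum N (rev_fps (map_poly to_ac f)) = to_ac (power_sum N (rev_fps (f :: 'a::field poly)))"
proof -
  define m where "m g = Abs_fps (\<lambda>i. to_ac (fps_nth g i))" for g :: "'a fps"
  have m_mult: "m (g * h) = m g * m h" for g h
    by (rule fps_ext) (simp add: m_def fps_mult_nth to_ac_sum)
  have m_X: "m fps_X = fps_X" "m 1 = 1" by (rule fps_ext; simp add: m_def)+
  have m_deriv: "m (fps_deriv g) = fps_deriv (m g)" for g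
    by (rule fps_ext) (simp add: m_def)
  have m_rev: "m (rev_fps f) = rev_fps (map_poly to_ac f)"
    by (rule fps_ext) (simp add: m_def rev_fps_nth coeff_map_poly)
  have "rev_fps f * inverse (rev_fps f) = 1"
    using assms by (intro inverse_mult_eq_1') (simp add: rev_fps_at_0)
  hence "m (rev_fps f) * m (inverse (rev_fps f)) = 1" by (simp flip: m_mult add: m_X)
  hence m_inv: "m (inverse (rev_fps f)) = inverse (m (rev_fps f))" by (metis fps_inverse_unique)
  show ?thesis unfolding power_sum_def m_rev[symmetric]
    by (simp only: m_inv[symmetric] m_deriv[symmetric] m_X(1)[symmetric] m_mult[symmetric])
       (simp add: m_def)
qed

definition base_poly :: "'a::finite_field alg_closure set multiset \<Rightarrow> 'a poly" where
  "base_poly D = map_poly of_ac (orb_div_poly D)"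

lemma base_poly:
  assumes "set_mset D \<subseteq> orbs"
  shows "map_poly to_ac (base_poly D) = orb_div_poly (D :: 'a::finite_field alg_closure set multiset)"
proof -
  obtain f :: "'a poly" where f: "orb_div_poly D = map_poly to_ac f" by (rule orb_div_poly_descends[OF assms])
  have "base_poly D = f" unfolding base_poly_def f by (rule poly_eqI) (simp add: coeff_map_poly)
  thus ?thesis using f by simp
qed

lemma monic_base_poly:
  assumes "set_mset D \<subseteq> orbs"
  shows "lead_coeff (base_poly D) = 1"
  using monic_orb_div_poly[of D] unfolding base_poly[OF assms, symmetric] by simp

lemma degree_base_poly:
  assumes "set_mset D \<subseteq> orbs"
  shows "degree (base_poly D) = orb_div_degree D"
  using degree_orb_div_poly[of D] unfolding base_poly[OF assms, symmetric] by simp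

lemma power_sum_base_poly:
  assumes "set_mset D \<subseteq> orbs" "N > 0"
  shows "power_sum N (rev_fps (base_poly D)) = (\<Sum>Q\<in>#D. orb_trace N Q)"
proof -
  have "to_ac (power_sum N (rev_fps (base_poly D))) = power_sum N (rev_fps (\<Prod>\<^sub># (image_mset orb_poly D)))"
    unfolding power_sum_map_to_ac[OF monic_base_poly[OF assms(1)], symmetric] base_poly[OF assms(1)]
    by (simp only: orb_div_poly_def)
  also have "\<dots> = (\<Sum>f\<in>#image_mset orb_poly D. power_sum N (rev_fps f))"
    by (rule power_sum_prod_mset) auto
  also have "\<dots> = (\<Sum>Q\<in>#D. power_sum N (rev_fps (orb_poly Q)))"
    by (simp add: image_mset.compositionality o_def)
  also have "\<dots> = (\<Sum>Q\<in>#D. to_ac (orb_trace N Q))"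
    using assms(1) by (intro arg_cong[where f=sum_mset] image_mset_cong)
      (auto simp: power_sum_orb_poly[OF _ assms(2)] finite_orbs to_ac_orb_trace)
  also have "\<dots> = to_ac (\<Sum>Q\<in>#D. orb_trace N Q)"
    by (simp add: to_ac_sum_mset image_mset.compositionality o_def)
  finally show ?thesis unfolding to_ac_eq_iff .
qed

text \<open>Effective divisors of the affine line are the monic polynomials, and these are the
  reversed series once the degree is recorded beside them.\<close>

lemma bij_orb_divisors:
  "bij_betw (\<lambda>D. (orb_div_degree D, rev_fps (base_poly D))) {D. set_mset D \<subseteq> orbs}
     (SIGMA d:UNIV. (unit_fps d :: 'a::finite_field fps set))"
proof (rule bij_betw_imageI)
  show "inj_on (\<lambda>D. (orb_div_degree D, rev_fps (base_poly D))) {D. set_mset D \<subseteq> (orbs :: 'a alg_closure set set)}"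
  proof (rule inj_onI, clarify)
    fix D E :: "'a alg_closure set multiset"
    assume D: "set_mset D \<subseteq> orbs" and E: "set_mset E \<subseteq> orbs"
      and eq: "orb_div_degree D = orb_div_degree E" "rev_fps (base_poly D) = rev_fps (base_poly E)"
    have deg: "degree (base_poly D) = degree (base_poly E)" using eq(1) by (simp add: degree_base_poly D E)
    have "Polynomial.coeff (base_poly D) i = Polynomial.coeff (base_poly E) i" for i
    proof (cases "i \<le> degree (base_poly D)")
      case True
      hence "degree (base_poly D) - (degree (base_poly D) - i) = i" by simp
      thus ?thesis using arg_cong[OF eq(2), of "\<lambda>f. fps_nth f (degree (base_poly D) - i)"] deg
        by (simp add: rev_fps_nth)
    next
      case False
      thus ?thesis using deg by (simp add: coeff_eq_0)
    qed
    hence "base_poly D = base_poly E" by (rule poly_eqI)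
    hence pe: "orb_div_poly D = orb_div_poly E" using base_poly[OF D] base_poly[OF E] by metis
    show "D = E"
    proof (rule multiset_eqI)
      fix Q show "count D Q = count E Q"
      proof (cases "Q \<in> orbs")
        case True
        then obtain y where y: "y \<in> Q" using orbs_nonempty by blast
        show ?thesis using count_proots_orb_div_poly[OF D True y] count_proots_orb_div_poly[OF E True y] pe by simp
      next
        case False
        thus ?thesis using D E by (metis count_eq_zero_iff subset_iff)
      qed
    qed
  qed
  show "(\<lambda>D. (orb_div_degree D, rev_fps (base_poly D))) ` {D. set_mset D \<subseteq> orbs} = (SIGMA d:UNIV. (unit_fps d :: 'a fps set))"
  proof (intro equalityI subsetI)
    fix z assume "z \<in> (\<lambda>D. (orb_div_degree D, rev_fps (base_poly D))) ` {D. set_mset D \<subseteq> (orbs :: 'a alg_closure set set)}"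
    then obtain D where D: "set_mset D \<subseteq> orbs" "z = (orb_div_degree D, rev_fps (base_poly D))" by auto
    have "fps_nth (rev_fps (base_poly D)) 0 = 1" using monic_base_poly[OF D(1)] by (simp add: rev_fps_at_0)
    thus "z \<in> (SIGMA d:UNIV. (unit_fps d :: 'a fps set))"
      by (auto simp: D(2) unit_fps_def rev_fps_nth degree_base_poly[OF D(1)])
  next
    fix z assume "z \<in> (SIGMA d:UNIV. (unit_fps d :: 'a fps set))"
    then obtain d g where z: "z = (d, g)" and g: "g \<in> unit_fps d" by auto
    define f where "f = (\<Sum>i\<le>d. Polynomial.monom (fps_nth g (d - i)) i)"
    have cf: "Polynomial.coeff f i = (if i \<le> d then fps_nth g (d - i) else 0)" for i
      by (simp add: f_def coeff_sum coeff_monom sum.delta)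
    have "degree f = d"
      using g by (intro antisym degree_le le_degree) (auto simp: cf unit_fps_def)
    hence lc: "lead_coeff f = 1" and revf: "rev_fps f = g"
      using g by (auto simp: cf unit_fps_def rev_fps_nth fps_eq_iff)
    obtain D where D: "set_mset D \<subseteq> orbs" "orb_div_poly D = map_poly to_ac f"
      by (rule monic_eq_orb_div_poly[OF lc])
    have "base_poly D = f" using base_poly[OF D(1)] D(2) map_to_ac.injectivity by metis
    hence "z = (orb_div_degree D, rev_fps (base_poly D))"
      using degree_base_poly[OF D(1)] revf \<open>degree f = d\<close> by (simp add: z)
    thus "z \<in> (\<lambda>D. (orb_div_degree D, rev_fps (base_poly D))) ` {D. set_mset D \<subseteq> orbs}"
      using D(1) by blast
  qed
qed

text \<open>There are q^d series for each d, which leaves a geometric series of ratio |u| q.\<close>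

lemma abs_summable_unit_fps:
  fixes u :: complex and c :: "nat \<Rightarrow> 'a::finite_field fps \<Rightarrow> complex"
  assumes "norm u * real CARD('a) < 1" "\<And>d f. norm (c d f) \<le> 1"
  shows "(\<lambda>(d, f). norm (c d f * u ^ d)) summable_on (SIGMA d:UNIV. unit_fps d)"
proof -
  let ?q = "real CARD('a)"
  have "(\<lambda>(d, f). norm (u ^ d)) summable_on (SIGMA d:UNIV. (unit_fps d :: 'a fps set))"
  proof (rule summable_on_SigmaI[where g = "\<lambda>d. (norm u * ?q) ^ d"])
    fix d
    have "((\<lambda>f. norm (u ^ d)) has_sum (\<Sum>f\<in>(unit_fps d :: 'a fps set). norm (u ^ d))) (unit_fps d :: 'a fps set)"
      by (rule has_sum_finite) (rule unit_fps_finite)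
    thus "((\<lambda>f. case (d, f) of (d, f) \<Rightarrow> norm (u ^ d)) has_sum (norm u * ?q) ^ d) (unit_fps d :: 'a fps set)"
      by (simp add: card_unit_fps norm_power power_mult_distrib mult.commute)
  next
    show "(\<lambda>d. (norm u * ?q) ^ d) summable_on UNIV"
      using assms(1) by (intro norm_summable_imp_summable_on) (simp add: norm_power norm_mult summable_geometric)
  qed auto
  thus ?thesis
    by (rule summable_on_comparison_test)
       (use assms(2) in \<open>auto simp: norm_mult mult_left_le_one_le\<close>)
qed

lemma orb_divisor_term:
  assumes "set_mset D \<subseteq> orbs" "N > 0"
  shows "(\<Prod>Q\<in>#D. add_char (a * orb_trace N Q) * u ^ card Q) =
    add_char (a * power_sum N (rev_fps (base_poly D))) * u ^ orb_div_degree D"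
  unfolding power_sum_base_poly[OF assms] unfolding orb_div_degree_def
  by (induction D) (simp_all add: ring_distribs add_char_add power_add)

text \<open>The absolutely convergent L-series, indexed by divisors instead of grouped by degree.
  Each term is now a product over the points of the divisor, as an Euler product requires.\<close>

theorem L_series_orbits:
  fixes u :: complex and a :: "'a::finite_field"
  assumes u: "norm u * real CARD('a) < 1" and "N > 0"
    and S: "((\<lambda>d. char_sum N a d * u ^ d) has_sum S) UNIV"
  shows "((\<lambda>D. \<Prod>Q\<in>#D. add_char (a * orb_trace N Q) * u ^ card Q) has_sum S) {D. set_mset D \<subseteq> orbs}"
proof -
  have "((\<lambda>(d, f). add_char (a * power_sum N f) * u ^ d) has_sum S) (SIGMA d:UNIV. unit_fps d)"
  proof (rule has_sum_SigmaI[where g = "\<lambda>d. char_sum N a d * u ^ d"])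
    fix d
    have "((\<lambda>f. add_char (a * power_sum N f) * u ^ d) has_sum (\<Sum>f\<in>unit_fps d. add_char (a * power_sum N f) * u ^ d)) (unit_fps d)"
      by (rule has_sum_finite) (rule unit_fps_finite)
    thus "((\<lambda>f. case (d, f) of (d, f) \<Rightarrow> add_char (a * power_sum N f) * u ^ d) has_sum char_sum N a d * u ^ d) (unit_fps d)"
      by (simp add: char_sum_def sum_distrib_right)
  next
    show "(\<lambda>(d, f). add_char (a * power_sum N f) * u ^ d) summable_on (SIGMA d:UNIV. unit_fps d)"
    proof (rule abs_summable_summable)
      show "(\<lambda>x. norm (case x of (d, f) \<Rightarrow> add_char (a * power_sum N f) * u ^ d)) summable_on (SIGMA d:UNIV. unit_fps d)"
        using abs_summable_unit_fps[OF u, of "\<lambda>d f. add_char (a * power_sum N f)"]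
        by (simp add: case_prod_unfold)
    qed
  qed (use S in auto)
  hence "((\<lambda>D. case (orb_div_degree D, rev_fps (base_poly D)) of (d, f) \<Rightarrow> add_char (a * power_sum N f) * u ^ d) has_sum S) {D. set_mset D \<subseteq> orbs}"
    using has_sum_reindex_bij_betw[OF bij_orb_divisors] by blast
  thus ?thesis
    by (rule has_sum_cong[THEN iffD1, rotated]) (simp add: orb_divisor_term[OF _ assms(2)])
qed

text \<open>An orbit is a divisor with a single point, so this is a subsum of an absolutely
  convergent sum.\<close>

lemma abs_summable_orbs:
  fixes u :: complex and ty :: "'a::finite_field itself"
  assumes u: "norm u * real CARD('a) < 1"
  shows "(\<lambda>Q. norm u ^ card Q) summable_on (orbs :: 'a alg_closure set set)"
proof -
  have "(\<lambda>(d, f). norm (1 * u ^ d)) summable_on (SIGMA d:UNIV. (unit_fps d :: 'a fps set))"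
    by (rule abs_summable_unit_fps) (use u in auto)
  hence "(\<lambda>D. case (orb_div_degree D, rev_fps (base_poly D)) of (d, f) \<Rightarrow> norm (1 * u ^ d)) summable_on {D. set_mset D \<subseteq> (orbs :: 'a alg_closure set set)}"
    using summable_on_reindex_bij_betw[OF bij_orb_divisors[where ?'a='a]] by blast
  hence "(\<lambda>D. norm u ^ orb_div_degree D) summable_on {D. set_mset D \<subseteq> (orbs :: 'a alg_closure set set)}"
    by (simp add: norm_power)
  hence "(\<lambda>D. norm u ^ orb_div_degree D) summable_on (\<lambda>Q. {#Q#}) ` (orbs :: 'a alg_closure set set)"
    by (rule summable_on_subset_banach) auto
  hence "((\<lambda>D. norm u ^ orb_div_degree D) \<circ> (\<lambda>Q. {#Q#})) summable_on (orbs :: 'a alg_closure set set)"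
    by (subst (asm) summable_on_reindex) (auto simp: inj_on_def)
  thus ?thesis by (simp add: o_def orb_div_degree_def)
qed


section \<open>Artin--Schreier function fields\<close>

text \<open>At each root \<open>y\<close>, the linear factor is cancelled from \<open>G\<close> if
  \<open>G\<close> vanishes there, and from the cofactor otherwise.\<close>

lemma monic_dvd_prod_linear:
  fixes G :: "'b::field poly"
  assumes "finite Y" "lead_coeff G = 1" "G dvd (\<Prod>y\<in>Y. [:- y, 1:])"
  shows "\<exists>S\<subseteq>Y. G = (\<Prod>y\<in>S. [:- y, 1:])"
  using assms
proof (induction Y arbitrary: G rule: finite_induct)
  case empty
  hence "G dvd 1" by simp
  hence "degree G = 0" by (metis is_unit_iff_degree dvd_0_left_iff zero_neq_one)
  thus ?case using empty by (auto elim!: degree_eq_zeroE)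
next
  case (insert y Y)
  let ?l = "[:- y, 1:]"
  obtain H where "(\<Prod>y\<in>insert y Y. [:- y, 1:]) = G * H" using insert.prems(2) by (elim dvdE)
  hence H: "?l * (\<Prod>y\<in>Y. [:- y, 1:]) = G * H" unfolding prod.insert[OF insert.hyps] .
  have l0: "?l \<noteq> 0" by simp
  show ?case
  proof (cases "poly G y = 0")
    case True
    then obtain G' where G': "G = ?l * G'" unfolding poly_eq_0_iff_dvd by (elim dvdE)
    have "lead_coeff ?l * lead_coeff G' = 1" using insert.prems(1) unfolding G' lead_coeff_mult .
    hence "lead_coeff G' = 1" by simp
    moreover have "?l * (\<Prod>y\<in>Y. [:- y, 1:]) = ?l * (G' * H)" using H unfolding G' by (simp only: mult.assoc)
    hence "(\<Prod>y\<in>Y. [:- y, 1:]) = G' * H" by (rule mult_left_cancel[OF l0, THEN iffD1])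
    ultimately obtain S where S: "S \<subseteq> Y" "G' = (\<Prod>y\<in>S. [:- y, 1:])"
      using insert.IH[of G'] dvdI by blast
    have "G = (\<Prod>y\<in>insert y S. [:- y, 1:])"
      unfolding G' S(2) using S(1) insert.hyps by (subst prod.insert) (auto intro: finite_subset)
    thus ?thesis using S by (intro exI[of _ "insert y S"]) auto
  next
    case False
    have "poly (G * H) y = 0" unfolding H[symmetric] by simp
    hence "poly H y = 0" using False by simp
    then obtain H' where H': "H = ?l * H'" unfolding poly_eq_0_iff_dvd by (elim dvdE)
    have "?l * (\<Prod>y\<in>Y. [:- y, 1:]) = ?l * (G * H')" using H unfolding H' by (simp only: mult_ac)
    hence "(\<Prod>y\<in>Y. [:- y, 1:]) = G * H'" by (rule mult_left_cancel[OF l0, THEN iffD1])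
    hence "G dvd (\<Prod>y\<in>Y. [:- y, 1:])" by (rule dvdI)
    from insert.IH[OF insert.prems(1) this] show ?thesis by blast
  qed
qed

lemma coeff_prod_linear:
  fixes S :: "'b::field set"
  assumes "finite S" "S \<noteq> {}"
  shows "Polynomial.coeff (\<Prod>y\<in>S. [:- y, 1:]) (card S - 1) = - (\<Sum>y\<in>S. y)"
  using assms
proof (induction S rule: finite_ne_induct)
  case (insert y S)
  let ?P = "\<Prod>y\<in>S. [:- y, 1:]"
  have deg: "degree ?P = card S" by (subst degree_prod_eq_sum_degree) auto
  have "lead_coeff ?P = 1" by (rule monic_prod) auto
  hence "Polynomial.coeff ?P (card S) = 1" using deg by simp
  moreover have "card S > 0" using insert by (simp add: card_gt_0_iff)
  ultimately show ?case using insert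
    by (cases "card S") (simp_all add: coeff_pCons)
qed simp

lemma map_poly_pCons_0: "h 0 = 0 \<Longrightarrow> map_poly h (pCons c U) = pCons (h c) (map_poly h U)"
  by (rule poly_eqI) (simp add: coeff_map_poly coeff_pCons split: nat.split)

section \<open>Evaluation homomorphisms\<close>

text \<open>Evaluation at \<open>y\<close> after mapping the coefficients by \<open>h\<close>.
  Iterated, it evaluates elements of F_q[x][w] at points as well as inside the function
  field.\<close>

definition ev2 :: "('b::comm_ring_1 \<Rightarrow> 'c::comm_ring_1) \<Rightarrow> 'c \<Rightarrow> 'b poly \<Rightarrow> 'c" where
  "ev2 h y U = poly (map_poly h U) y"

lemma ev2_hom:
  assumes "comm_ring_hom h"
  shows "comm_ring_hom (ev2 h y)"
proof -
  interpret comm_ring_hom h by fact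
  interpret m: map_poly_comm_ring_hom h ..
  show ?thesis by unfold_locales (simp_all add: ev2_def hom_distribs)
qed

lemma ev2_pCons:
  assumes "comm_ring_hom h"
  shows "ev2 h y (pCons c U) = h c + y * ev2 h y U"
proof -
  interpret comm_ring_hom h by fact
  show ?thesis by (simp add: ev2_def map_poly_pCons_0)
qed

lemma ev2_0 [simp]: "comm_ring_hom h \<Longrightarrow> ev2 h y 0 = 0" by (simp add: ev2_def)

lemma ev2_const [simp]: "comm_ring_hom h \<Longrightarrow> ev2 h y [:c:] = h c" by (simp add: ev2_pCons)

lemma ev2_monom:
  assumes "comm_ring_hom h"
  shows "ev2 h y (Polynomial.monom c n) = h c * y ^ n"
proof -
  interpret comm_ring_hom h by fact
  show ?thesis by (simp add: ev2_def map_poly_monom poly_monom)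
qed

definition ev1 :: "'a::field alg_closure \<Rightarrow> 'a poly \<Rightarrow> 'a alg_closure" where
  "ev1 \<alpha> = ev2 to_ac \<alpha>"

interpretation ev1: comm_ring_hom "ev1 \<alpha>"
  unfolding ev1_def by (rule ev2_hom) (rule to_ac.comm_ring_hom_axioms)

lemma ev1_monom [simp]: "ev1 \<alpha> (Polynomial.monom c n) = to_ac c * \<alpha> ^ n"
  unfolding ev1_def by (rule ev2_monom) (rule to_ac.comm_ring_hom_axioms)

lemma ev1_const [simp]: "ev1 \<alpha> [:c:] = to_ac c"
  unfolding ev1_def by (rule ev2_const) (rule to_ac.comm_ring_hom_axioms)

lemma frob_ev1: "frob (ev1 \<alpha> f) = ev1 (frob \<alpha>) (f :: 'a::finite_field poly)"
  unfolding ev1_def ev2_def by (rule frob_poly)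

text \<open>The value of a polynomial in x and w at the point \<open>P\<close>, with w as the outer
  variable.\<close>

definition evp :: "'a::field alg_closure \<times> 'a alg_closure \<Rightarrow> 'a poly poly \<Rightarrow> 'a alg_closure" where
  "evp P = ev2 (ev1 (fst P)) (snd P)"

interpretation evp: comm_ring_hom "evp P"
  unfolding evp_def by (rule ev2_hom) (rule ev1.comm_ring_hom_axioms)

lemma evp_const [simp]: "evp P [:f:] = ev1 (fst P) f"
  unfolding evp_def by (rule ev2_const) (rule ev1.comm_ring_hom_axioms)

lemma evp_monom [simp]: "evp P (Polynomial.monom f n) = ev1 (fst P) f * snd P ^ n"
  unfolding evp_def by (rule ev2_monom) (rule ev1.comm_ring_hom_axioms)

lemma to_fract_power: "to_fract (x ^ n) = to_fract x ^ n"
  by (induction n) (simp_all add: to_fract_mult)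

lemma clear_denominators:
  fixes H :: "'b::idom fract poly"
  obtains U f where "f \<noteq> 0" "map_poly to_fract U = smult (to_fract f) H"
proof -
  have "\<exists>U f. f \<noteq> 0 \<and> map_poly to_fract U = smult (to_fract f) H"
  proof (induction H)
    case 0
    show ?case by (intro exI[of _ 0] exI[of _ 1]) auto
  next
    case (pCons c H)
    then obtain U f where h: "f \<noteq> 0" "map_poly to_fract U = smult (to_fract f) H" by blast
    obtain r s where rs: "c = Fract r s" "s \<noteq> 0" by (cases c)
    have c: "to_fract s * c = to_fract r" using rs by (simp add: to_fract_def eq_fract)
    have "map_poly to_fract (pCons (r * f) (smult s U)) = pCons (to_fract (r * f)) (map_poly to_fract (smult s U))"
      by (rule map_poly_pCons_0) simp
    also have "map_poly to_fract (smult s U) = smult (to_fract s) (map_poly to_fract U)"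
      by (rule map_poly_smult) auto
    also have "pCons (to_fract (r * f)) (smult (to_fract s) (map_poly to_fract U)) = smult (to_fract (s * f)) (pCons c H)"
      using c h(2) by (simp add: mult_ac)
    finally show ?case using h(1) rs(2)
      by (intro exI[of _ "pCons (r * f) (smult s U)"] exI[of _ "s * f"]) simp
  qed
  thus ?thesis using that by blast
qed

section \<open>The Artin-Schreier extension\<close>

text \<open>Everything happens inside a field \<open>'k\<close> that contains the rational functions
  through \<kappa> and a root \<open>w\<close>. The function field is the subset \<open>K\<close> of
  \<open>'k\<close>; an algebraic closure is substituted for \<open>'k\<close> at the end.\<close>

locale artin_schreier = additive_L N a + kappa: inj_idom_hom \<kappa>
  for N and a :: "'a::finite_field" and \<kappa> :: "'a poly fract \<Rightarrow> 'k::field" +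
  fixes w :: 'k and p :: nat
  assumes p_def: "p = CHAR('a)" and w: "w ^ p - w = \<kappa> (to_fract (Polynomial.monom a N))"
begin

lemma p: "prime p" "p \<ge> 2" by (auto simp: p_def intro: prime_ge_2_nat)

lemma not_dvd_N: "\<not> p dvd N" using N of_nat_eq_0_iff_char_dvd[of N, where ?'a='a] by (auto simp: p_def)

lemma a0: "a \<noteq> 0" using N by auto

lemma CHAR_k: "CHAR('k) = p"
proof -
  have "(of_nat n :: 'k) = 0 \<longleftrightarrow> p dvd n" for n
  proof -
    have "(of_nat n :: 'k) = \<kappa> (of_nat n)" by (simp add: kappa.hom_of_nat)
    also have "\<dots> = 0 \<longleftrightarrow> (of_nat n :: 'a poly fract) = 0" by simp
    also have "(of_nat n :: 'a poly fract) = to_fract (of_nat n)"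
      by (induction n) (simp_all add: to_fract_add flip: to_fract_1)
    also have "\<dots> = 0 \<longleftrightarrow> p dvd n" by (simp add: p_def of_nat_eq_0_iff_char_dvd)
    finally show ?thesis .
  qed
  thus ?thesis by (intro CHAR_eqI) (auto simp: of_nat_eq_0_iff_char_dvd)
qed

definition \<iota> :: "'a poly \<Rightarrow> 'k" where "\<iota> f = \<kappa> (to_fract f)"

sublocale \<iota>: inj_idom_hom \<iota>
  by unfold_locales (simp_all add: \<iota>_def to_fract_add to_fract_mult kappa.hom_add kappa.hom_mult)

definition h :: "'a poly" where "h = Polynomial.monom a N"

lemma w': "w ^ p = w + \<iota> h" using w by (simp add: h_def \<iota>_def algebra_simps)

definition ev :: "'a poly poly \<Rightarrow> 'k" where "ev = ev2 \<iota> w"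
definition evK :: "'a poly fract poly \<Rightarrow> 'k" where "evK = ev2 \<kappa> w"

sublocale ev: comm_ring_hom ev
  unfolding ev_def by (rule ev2_hom) (rule \<iota>.comm_ring_hom_axioms)
sublocale evK: comm_ring_hom evK
  unfolding evK_def by (rule ev2_hom) (rule kappa.comm_ring_hom_axioms)

lemma ev_const [simp]: "ev [:f:] = \<iota> f"
  unfolding ev_def by (rule ev2_const) (rule \<iota>.comm_ring_hom_axioms)
lemma ev_monom [simp]: "ev (Polynomial.monom f n) = \<iota> f * w ^ n"
  unfolding ev_def by (rule ev2_monom) (rule \<iota>.comm_ring_hom_axioms)
lemma evK_const [simp]: "evK [:f:] = \<kappa> f"
  unfolding evK_def by (rule ev2_const) (rule kappa.comm_ring_hom_axioms)
lemma evK_monom [simp]: "evK (Polynomial.monom f n) = \<kappa> f * w ^ n"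
  unfolding evK_def by (rule ev2_monom) (rule kappa.comm_ring_hom_axioms)

lemma ev_eq_evK: "ev U = evK (map_poly to_fract U)"
  unfolding ev_def evK_def ev2_def by (simp add: map_poly_map_poly o_def \<iota>_def[abs_def])

text \<open>Write r = f / g and compare degrees in h g^p = f^p - f g^(p-1). If deg f > deg g, the
  term f^p dominates and N + p deg g = p deg f makes p a divisor of N. Otherwise the right side has
  degree at most p deg g, less than the left side.\<close>

lemma h_not_as: "to_fract h \<noteq> r ^ p - r"
proof
  assume eq: "to_fract h = r ^ p - r"
  obtain f g where fg: "r = Fract f g" "g \<noteq> 0" by (cases r)
  have r: "r * to_fract g = to_fract f" using fg by (simp add: to_fract_def eq_fract)
  have "to_fract (h * g ^ p) = (r ^ p - r) * to_fract g ^ p"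
    unfolding to_fract_mult to_fract_power eq by simp
  also have "\<dots> = (r * to_fract g) ^ p - (r * to_fract g) * to_fract g ^ (p - 1)"
    using p by (cases p) (simp_all add: power_mult_distrib algebra_simps)
  also have "\<dots> = to_fract (f ^ p - f * g ^ (p - 1))"
    unfolding r by (simp only: to_fract_diff to_fract_mult to_fract_power)
  finally have E: "h * g ^ p = f ^ p - f * g ^ (p - 1)" by (simp only: to_fract_eq_iff)
  have dh: "degree h = N" "h \<noteq> 0" using a0 by (auto simp: h_def degree_monom_eq)
  have dl: "degree (h * g ^ p) = N + p * degree g" using dh fg by (simp add: degree_mult_eq degree_power_eq)
  have d2: "degree (f * g ^ (p - 1)) \<le> degree f + (p - 1) * degree g"
    using degree_mult_le[of f "g ^ (p - 1)"] degree_power_le[of g "p - 1"] by (simp add: mult.commute)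
  show False
  proof (cases "degree f > degree g")
    case True
    hence f0: "f \<noteq> 0" by auto
    have "degree f + (p - 1) * degree g < degree f + (p - 1) * degree f" using True p by simp
    also have "\<dots> = p * degree f" using p by (cases p) auto
    also have "\<dots> = degree (f ^ p)" using f0 by (simp add: degree_power_eq)
    finally have "degree (- (f * g ^ (p - 1))) < degree (f ^ p)" using d2 by simp
    hence "degree (f ^ p + - (f * g ^ (p - 1))) = degree (f ^ p)" by (rule degree_add_eq_left)
    hence "degree (h * g ^ p) = degree (f ^ p)" unfolding E by simp
    hence "N + p * degree g = p * degree f" unfolding dl using f0 by (simp add: degree_power_eq)
    hence "p dvd N" by (metis dvd_add_left_iff dvd_triv_left)
    thus False using not_dvd_N by simp
  next
    case False
    have "degree (f ^ p) \<le> p * degree g"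
    proof -
      have "degree f * p \<le> degree g * p" using False by (intro mult_le_mono1) simp
      thus ?thesis using degree_power_le[of f p] by (metis mult.commute order_trans)
    qed
    moreover have "degree f + (p - 1) * degree g \<le> degree g + (p - 1) * degree g" using False by simp
    moreover have "degree g + (p - 1) * degree g = p * degree g" using p by (cases p) auto
    ultimately have "degree (f ^ p - f * g ^ (p - 1)) \<le> p * degree g"
      using d2 by (intro degree_diff_le) linarith+
    thus False using E dl N_pos by simp
  qed
qed

text \<open>The roots of an Artin-Schreier polynomial differ by elements of the prime field, so one
  root yields all p of them.\<close>

lemma as_factorization:
  "Polynomial.monom 1 p - Polynomial.monom 1 1 - [:w ^ p - w:] = (\<Prod>y\<in>(\<lambda>i. w + of_nat i) ` {..<p}. [:- y, 1:])"
  (is "?M = ?P")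
proof -
  let ?Y = "(\<lambda>i. w + of_nat i) ` {..<p} :: 'k set"
  have inj: "inj_on (\<lambda>i. w + of_nat i) {..<p}"
  proof (rule inj_onI)
    fix i j assume h: "i \<in> {..<p}" "j \<in> {..<p}" "w + of_nat i = w + of_nat j"
    hence "[i = j] (mod CHAR('k))" by (simp add: of_nat_eq_iff_cong_CHAR)
    thus "i = j" using h unfolding CHAR_k by (simp add: cong_less_modulus_unique_nat)
  qed
  have card: "card ?Y = p" using card_image[OF inj] by simp
  have "degree ?P = card ?Y" by (subst degree_prod_eq_sum_degree) auto
  hence dP: "degree ?P = p" using card by simp
  have lP: "lead_coeff ?P = 1" by (rule monic_prod) auto
  have prk: "prime CHAR('k)" unfolding CHAR_k by (rule p)
  have fd: "(x + y) ^ p = x ^ p + y ^ p" for x y :: 'k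
    by (rule freshmans_dream[OF prk CHAR_k[symmetric]])
  have ofp: "(of_nat i :: 'k) ^ p = of_nat i" for i
    using p by (induction i) (simp_all add: fd zero_power)
  have root: "poly ?M y = 0" if "y \<in> ?Y" for y
  proof -
    obtain i where i: "y = w + of_nat i" using \<open>y \<in> ?Y\<close> by blast
    show ?thesis unfolding i by (simp add: poly_monom fd ofp)
  qed
  have Psplit: "poly ?P y = 0" if "y \<in> ?Y" for y
  proof -
    have "\<exists>z\<in>?Y. poly [:- z, 1:] y = 0" using that by (intro bexI[of _ y]) simp_all
    thus ?thesis unfolding poly_prod by (intro prod_zero) simp_all
  qed
  have p1: "p > 1" using p(2) by simp
  have cM: "Polynomial.coeff ?M p = 1"
    using p1 unfolding coeff_diff coeff_monom by (simp add: coeff_eq_0)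
  have cP: "Polynomial.coeff ?P p = 1" using lP unfolding dP .
  have dM: "degree ?M \<le> p"
    using p1 by (intro degree_diff_le) (simp_all add: degree_monom_eq)
  show ?thesis
  proof (rule poly_eqI_degree_lead_coeff[where A = ?Y and n = p])
    show "Polynomial.coeff ?M p = Polynomial.coeff ?P p" unfolding cM cP ..
    show "p \<le> card ?Y" unfolding card ..
    show "degree ?P \<le> p" unfolding dP ..
    show "poly ?M y = poly ?P y" if "y \<in> ?Y" for y
      unfolding root[OF that] Psplit[OF that] ..
  qed (rule dM)
qed

definition as_poly :: "'a poly fract poly" where
  "as_poly = Polynomial.monom 1 p - Polynomial.monom 1 1 - [:to_fract h:]"

lemma evK_as_poly: "evK as_poly = 0"
  using w by (simp add: as_poly_def evK.hom_minus h_def)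

lemma map_as_poly: "map_poly \<kappa> as_poly = (\<Prod>y\<in>(\<lambda>i. w + of_nat i) ` {..<p}. [:- y, 1:])"
proof -
  interpret m: map_poly_inj_idom_hom \<kappa> ..
  show ?thesis unfolding as_poly_def as_factorization[symmetric]
    by (simp add: m.hom_minus w h_def map_poly_pCons_0)
qed

text \<open>The subleading coefficient of a monic factor of degree e is, up to sign, e w plus an
  element of the prime field. For 0 < e < p this would place \<open>w\<close> among the rational
  functions, against \<open>h_not_as\<close>.\<close>

lemma as_poly_irreducible:
  assumes lc: "lead_coeff G = 1" and dvd: "G dvd as_poly" and deg: "0 < degree G" "degree G < p"
  shows False
proof -
  interpret m: map_poly_inj_idom_hom \<kappa> ..
  have "map_poly \<kappa> G dvd map_poly \<kappa> as_poly" using dvd by (rule m.hom_dvd)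
  hence dvd': "map_poly \<kappa> G dvd (\<Prod>y\<in>(\<lambda>i. w + of_nat i) ` {..<p}. [:- y, 1:])" unfolding map_as_poly .
  have lc': "lead_coeff (map_poly \<kappa> G) = 1" using lc by simp
  from monic_dvd_prod_linear[OF finite_imageI[OF finite_lessThan] lc' dvd']
  obtain S where S: "S \<subseteq> (\<lambda>i. w + of_nat i) ` {..<p}" "map_poly \<kappa> G = (\<Prod>y\<in>S. [:- y, 1:])"
    by blast
  have finS: "finite S" using S(1) finite_subset by blast
  have "degree (\<Prod>y\<in>S. [:- y, 1:]) = card S" by (subst degree_prod_eq_sum_degree) auto
  hence cS: "card S = degree G" unfolding S(2)[symmetric] kappa.degree_map_poly_hom by (rule sym)
  have S0: "S \<noteq> {}" using cS deg(1) by auto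
  have "\<forall>y\<in>S. \<exists>i. y = w + of_nat i" using S(1) by blast
  from bchoice[OF this] obtain I where I: "\<forall>y\<in>S. y = w + of_nat (I y)" by blast
  define s where "s = (\<Sum>y\<in>S. I y)"
  define c where "c = Polynomial.coeff G (degree G - 1)"
  have "(\<Sum>y\<in>S. y) = (\<Sum>y\<in>S. w + of_nat (I y))"
    by (intro sum.cong refl) (rule I[rule_format])
  also have "\<dots> = of_nat (degree G) * w + of_nat s" unfolding s_def sum.distrib of_nat_sum by (simp add: cS)
  finally have sum: "(\<Sum>y\<in>S. y) = of_nat (degree G) * w + of_nat s" .
  have "\<kappa> c = - (\<Sum>y\<in>S. y)"
    using coeff_prod_linear[OF finS S0] unfolding S(2)[symmetric] cS c_def by (simp only: kappa.coeff_map_poly_hom)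
  hence kc: "\<kappa> c = - (of_nat (degree G) * w + of_nat s)" unfolding sum .
  have ew: "\<kappa> (- c - of_nat s) = of_nat (degree G) * w"
    unfolding kappa.hom_minus kappa.hom_uminus kappa.hom_of_nat kc by simp
  have "\<not> p dvd degree G" using deg dvd_imp_le[of p "degree G"] by linarith
  hence e0: "(of_nat (degree G) :: 'k) \<noteq> 0" by (simp add: of_nat_eq_0_iff_char_dvd CHAR_k)
  hence "\<kappa> (of_nat (degree G)) \<noteq> 0" unfolding kappa.hom_of_nat .
  hence e1: "(of_nat (degree G) :: 'a poly fract) \<noteq> 0" using kappa.hom_zero by force
  define r where "r = (- c - of_nat s) / of_nat (degree G)"
  have "of_nat (degree G) * r = - c - of_nat s" unfolding r_def using e1 by simp
  hence "\<kappa> (of_nat (degree G) * r) = of_nat (degree G) * w" unfolding ew[symmetric] by (rule arg_cong)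
  hence "\<kappa> r = w" unfolding kappa.hom_mult kappa.hom_of_nat using e0 by simp
  hence "\<kappa> (r ^ p - r) = \<kappa> (to_fract h)" unfolding kappa.hom_minus kappa.hom_power h_def using w by simp
  hence "r ^ p - r = to_fract h" by (rule kappa.injectivity)
  thus False using h_not_as[of r] by simp
qed

text \<open>A polynomial of least degree that vanishes at \<open>w\<close> divides
  \<open>as_poly\<close>, so irreducibility keeps its degree from being less than p.\<close>

lemma evK_independent:
  assumes "degree G < p" "evK G = 0"
  shows "G = 0"
proof (rule ccontr)
  assume G0: "G \<noteq> 0"
  define P where "P n \<longleftrightarrow> (\<exists>G. G \<noteq> 0 \<and> evK G = 0 \<and> degree G = n)" for n
  define e where "e = (LEAST n. P n)"
  have PG: "P (degree G)" unfolding P_def using G0 assms(2) by blast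
  have e: "P e" "e \<le> degree G" unfolding e_def using PG by (rule LeastI, rule Least_le)
  have less: "\<not> P m" if "m < e" for m using that unfolding e_def by (rule not_less_Least)
  obtain G1 where G1: "G1 \<noteq> 0" "evK G1 = 0" "degree G1 = e" using e(1) unfolding P_def by blast
  define c where "c = inverse (lead_coeff G1)"
  have c: "c * lead_coeff G1 = 1" "c \<noteq> 0" unfolding c_def using G1(1) by simp_all
  define G2 where "G2 = smult c G1"
  have lc: "lead_coeff G2 = 1" unfolding G2_def lead_coeff_smult by (rule c(1))
  have dg: "degree G2 = e" using c(2) G1(3) unfolding G2_def by simp
  have "G2 = [:c:] * G1" by (simp add: G2_def)
  hence ev2: "evK G2 = 0" using G1(2) by (simp only: evK.hom_mult mult_zero_right)
  have G20: "G2 \<noteq> 0" using lc by auto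
  have eq: "as_poly mod G2 = as_poly - (as_poly div G2) * G2" by (simp add: minus_div_mult_eq_mod)
  have ev0: "evK (as_poly mod G2) = 0"
    unfolding eq evK.hom_minus evK.hom_mult evK_as_poly ev2 by simp
  have "as_poly mod G2 = 0"
  proof (rule ccontr)
    assume nz: "as_poly mod G2 \<noteq> 0"
    hence "degree (as_poly mod G2) < e" using degree_mod_less[OF G20, of as_poly] dg by blast
    thus False using less ev0 nz unfolding P_def by blast
  qed
  hence dvd: "G2 dvd as_poly" by (simp add: mod_eq_0_iff_dvd)
  have "degree G2 \<noteq> 0"
  proof
    assume "degree G2 = 0"
    then obtain c where c: "G2 = [:c:]" by (rule degree_eq_zeroE)
    hence "c = 1" using lc by simp
    thus False using ev2 c by simp
  qed
  thus False using as_poly_irreducible[OF lc dvd] dg e(2) assms(1) by simp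
qed

lemma ev_independent:
  assumes "degree U < p" "ev U = 0"
  shows "U = 0"
proof -
  have "degree (map_poly to_fract U) < p" using assms(1) degree_map_poly_le le_less_trans by blast
  hence "map_poly to_fract U = 0" by (rule evK_independent) (use assms(2) in \<open>simp only: ev_eq_evK\<close>)
  hence "Polynomial.coeff (map_poly to_fract U) i = 0" for i by simp
  thus ?thesis by (intro poly_eqI) (simp add: coeff_map_poly)
qed

text \<open>The polynomials whose value at \<open>w\<close> is a multiple of \<open>evK G\<close>
  form an ideal containing \<open>as_poly\<close>. Its element of least degree divides
  \<open>as_poly\<close> and must be a constant, which exhibits the inverse.\<close>

lemma evK_inverse:
  assumes "evK G \<noteq> 0"
  obtains H where "evK G * evK H = 1"
proof -
  define M1 where "M1 = as_poly"
  have M1: "evK M1 = 0" unfolding M1_def by (rule evK_as_poly)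
  have c1: "Polynomial.coeff M1 p = 1" using p(2) unfolding M1_def as_poly_def coeff_diff coeff_monom by (simp add: coeff_eq_0)
  have dM: "degree M1 = p"
  proof (rule antisym)
    show "degree M1 \<le> p" unfolding M1_def as_poly_def using p by (intro degree_diff_le) (auto simp: degree_monom_eq)
    show "p \<le> degree M1" using c1 by (intro le_degree) simp
  qed
  have M10: "M1 \<noteq> 0" using c1 by auto
  define J where "J G' \<longleftrightarrow> (\<exists>H. evK G' = evK G * evK H)" for G'
  define P where "P n \<longleftrightarrow> (\<exists>D. D \<noteq> 0 \<and> J D \<and> degree D = n)" for n
  have "J M1" unfolding J_def using M1 by (intro exI[of _ 0]) simp
  hence "P p" using M10 dM by (auto simp: P_def)
  define e where "e = (LEAST n. P n)"
  have e: "P e" "\<And>m. m < e \<Longrightarrow> \<not> P m"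
    using \<open>P p\<close> unfolding e_def by (auto intro: LeastI dest: not_less_Least)
  then obtain D where D: "D \<noteq> 0" "J D" "degree D = e" by (auto simp: P_def)
  have dvd: "D dvd E" if JE: "J E" for E
  proof -
    have eq: "E mod D = E - (E div D) * D" by (simp add: minus_div_mult_eq_mod)
    obtain H1 where H1: "evK E = evK G * evK H1" using JE by (auto simp: J_def)
    obtain H2 where H2: "evK D = evK G * evK H2" using D(2) by (auto simp: J_def)
    have "evK (E mod D) = evK G * evK (H1 - (E div D) * H2)"
      unfolding eq by (simp add: evK.hom_minus evK.hom_mult H1 H2 algebra_simps)
    hence "J (E mod D)" by (auto simp: J_def)
    hence "E mod D = 0" using e(2) degree_mod_less[OF D(1), of E] D(3) unfolding P_def by blast
    thus ?thesis by (simp add: mod_eq_0_iff_dvd)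
  qed
  obtain E where E: "M1 = D * E" using dvd[OF \<open>J M1\<close>] by (elim dvdE)
  have E0: "E \<noteq> 0" using E M10 by auto
  have deg: "e + degree E = p" using E dM D E0 by (simp add: degree_mult_eq)
  have "e = 0"
  proof (rule ccontr)
    assume "e \<noteq> 0"
    hence "degree E < p" using deg by simp
    hence "evK E \<noteq> 0" using evK_independent E0 by blast
    hence D0: "evK D = 0" using M1 unfolding E by (simp add: evK.hom_mult)
    have "\<not> degree D < p" using evK_independent[of D] D0 D(1) by blast
    hence "degree E = 0" using deg D(3) by simp
    have "J G" unfolding J_def by (intro exI[of _ 1]) simp
    from dvd[OF this] obtain F where "G = D * F" by (elim dvdE)
    thus False using assms D0 by (simp add: evK.hom_mult)
  qed
  then obtain c where c: "D = [:c:]" "c \<noteq> 0" using D by (auto elim!: degree_eq_zeroE)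
  obtain H where "evK D = evK G * evK H" using D(2) by (auto simp: J_def)
  hence "evK G * evK ([:inverse c:] * H) = \<kappa> c * \<kappa> (inverse c)"
    unfolding evK.hom_mult c by (simp add: mult_ac)
  also have "\<dots> = 1" using c by (simp flip: kappa.hom_mult)
  finally show ?thesis using that by blast
qed

text \<open>Denominators are free of \<open>w\<close>, the form in which places are analysed. By
  \<open>K_eq\<close> this is the ring generated by \<open>w\<close> over the rational functions,
  and by \<open>evK_inverse\<close> a field.\<close>

definition K :: "'k set" where "K = {ev U / \<iota> f | U f. f \<noteq> 0}"

lemma K_eq: "K = range evK"
proof
  show "K \<subseteq> range evK"
  proof
    fix z assume "z \<in> K"
    then obtain U f where z: "z = ev U / \<iota> f" "f \<noteq> 0" unfolding K_def by blast
    have "\<kappa> (to_fract f) * \<kappa> (inverse (to_fract f)) = \<kappa> 1"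
      unfolding kappa.hom_mult[symmetric] using z(2) by (intro arg_cong[where f=\<kappa>] right_inverse) simp
    hence inv: "inverse (\<iota> f) = \<kappa> (inverse (to_fract f))"
      unfolding \<iota>_def kappa.hom_one by (rule inverse_unique)
    have "evK ([:inverse (to_fract f):] * map_poly to_fract U) = z"
      unfolding evK.hom_mult ev_eq_evK[symmetric] evK_const inv[symmetric] z(1)
      by (simp only: divide_inverse mult.commute)
    thus "z \<in> range evK" by blast
  qed
  show "range evK \<subseteq> K"
  proof
    fix z assume "z \<in> range evK"
    then obtain H where H: "z = evK H" by blast
    obtain U f where Uf: "f \<noteq> 0" "map_poly to_fract U = smult (to_fract f) H" by (rule clear_denominators)
    have "ev U = evK ([:to_fract f:] * H)" unfolding ev_eq_evK Uf by simp
    also have "\<dots> = \<iota> f * z" unfolding evK.hom_mult H by (simp add: \<iota>_def)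
    finally have "z = ev U / \<iota> f" using Uf(1) by (simp only: nonzero_mult_div_cancel_left \<iota>.hom_0_iff not_False_eq_True)
    thus "z \<in> K" using Uf(1) unfolding K_def by blast
  qed
qed

lemma K_closed:
  "0 \<in> K" "1 \<in> K" "x \<in> K \<Longrightarrow> y \<in> K \<Longrightarrow> x + y \<in> K" "x \<in> K \<Longrightarrow> y \<in> K \<Longrightarrow> x - y \<in> K"
  "x \<in> K \<Longrightarrow> y \<in> K \<Longrightarrow> x * y \<in> K" "x \<in> K \<Longrightarrow> - x \<in> K"
  unfolding K_eq image_iff
  by (auto simp flip: evK.hom_zero evK.hom_one evK.hom_add evK.hom_minus evK.hom_mult evK.hom_uminus)

lemma K_inverse: "x \<in> K \<Longrightarrow> inverse x \<in> K"
proof (cases "x = 0")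
  case False
  assume "x \<in> K"
  then obtain G where G: "x = evK G" unfolding K_eq by blast
  then obtain H where "evK G * evK H = 1" using evK_inverse[of G] False by blast
  hence "inverse x = evK H" using G by (metis inverse_unique)
  thus ?thesis unfolding K_eq by blast
qed (simp add: K_closed)

lemma K_divide: "x \<in> K \<Longrightarrow> y \<in> K \<Longrightarrow> x / y \<in> K"
  unfolding divide_inverse by (intro K_closed K_inverse)

lemma ev_in_K: "ev U \<in> K" unfolding K_eq ev_eq_evK by blast
lemma \<iota>_in_K: "\<iota> f \<in> K" using ev_in_K[of "[:f:]"] by simp
lemma w_in_K: "w \<in> K" using ev_in_K[of "Polynomial.monom 1 1"] by simp

lemma K_cases:
  assumes "z \<in> K"
  obtains U f where "z = ev U / \<iota> f" "f \<noteq> 0"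
  using assms unfolding K_def by blast

text \<open>Obtained by writing the inverse with a denominator in F_q[x]; it takes the role of the
  norm to F_q[x].\<close>

lemma ev_denominator:
  assumes "ev U \<noteq> 0"
  obtains U' f where "ev U * ev U' = \<iota> f" "f \<noteq> 0"
proof -
  have "inverse (ev U) \<in> K" by (intro K_inverse ev_in_K)
  then obtain U' f where eq: "inverse (ev U) = ev U' / \<iota> f" and f: "f \<noteq> 0" by (rule K_cases)
  have "ev U' = inverse (ev U) * \<iota> f" unfolding eq using f by simp
  hence "ev U * ev U' = (ev U * inverse (ev U)) * \<iota> f" by (simp only: mult.assoc)
  also have "\<dots> = \<iota> f" unfolding right_inverse[OF assms] by (rule mult_1_left)
  finally show ?thesis using f by (rule that)
qed

end


section \<open>Finite places as points of the curve\<close>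

locale valuation_subring =
  fixes K V :: "'k::field set"
  assumes sub: "V \<subseteq> K" and one: "1 \<in> V"
    and diff: "\<And>x y. x \<in> V \<Longrightarrow> y \<in> V \<Longrightarrow> x - y \<in> V"
    and mult: "\<And>x y. x \<in> V \<Longrightarrow> y \<in> V \<Longrightarrow> x * y \<in> V"
    and val: "\<And>z. z \<in> K \<Longrightarrow> z \<noteq> 0 \<Longrightarrow> z \<in> V \<or> inverse z \<in> V"
    and divK: "\<And>x y. x \<in> K \<Longrightarrow> y \<in> K \<Longrightarrow> x / y \<in> K"
begin

text \<open>The nonunits. Zero is listed separately because \<open>inverse 0 = 0\<close>.\<close>

definition m :: "'k set" where "m = {z \<in> V. z = 0 \<or> inverse z \<notin> V}"

lemma zero: "0 \<in> V" using diff[OF one one] by simp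
lemma uminus: "x \<in> V \<Longrightarrow> - x \<in> V" using diff[OF zero] by simp
lemma add: "x \<in> V \<Longrightarrow> y \<in> V \<Longrightarrow> x + y \<in> V" using diff[of x "- y"] uminus by simp
lemma power: "x \<in> V \<Longrightarrow> x ^ n \<in> V" by (induction n) (simp_all add: one mult)

lemma m_sub: "x \<in> m \<Longrightarrow> x \<in> V" unfolding m_def by blast
lemma zero_m: "0 \<in> m" unfolding m_def using zero by blast
lemma one_m: "1 \<notin> m" unfolding m_def using one by simp

lemma unit: "x \<in> V \<Longrightarrow> x \<notin> m \<Longrightarrow> x \<noteq> 0 \<and> inverse x \<in> V" unfolding m_def by blast

lemma m_mult:
  assumes "v \<in> V" "z \<in> m"
  shows "v * z \<in> m"
proof (rule ccontr)
  assume h: "v * z \<notin> m"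
  have "v * z \<in> V" using mult assms m_sub by blast
  hence nz: "v * z \<noteq> 0" and i: "inverse (v * z) \<in> V" using unit h by blast+
  have "v * inverse (v * z) \<in> V" using mult assms(1) i by blast
  moreover have "v * inverse (v * z) = inverse z" using nz by simp
  ultimately have "inverse z \<in> V" by (simp only:)
  thus False using assms(2) nz unfolding m_def by auto
qed

text \<open>Of x / y and y / x one lies in \<open>V\<close>, so the sum is a multiple of y or of
  x.\<close>

lemma m_add:
  assumes "x \<in> m" "y \<in> m"
  shows "x + y \<in> m"
proof (cases "x = 0 \<or> y = 0")
  case False
  have xy: "x \<in> K" "y \<in> K" using assms m_sub sub by blast+
  hence "x / y \<in> K" "x / y \<noteq> 0" using divK False by auto
  hence "x / y \<in> V \<or> y / x \<in> V" using val[of "x / y"] by simp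
  thus ?thesis
  proof
    assume "x / y \<in> V"
    hence "(x / y + 1) * y \<in> m" using m_mult add one assms(2) by blast
    thus ?thesis using False by (simp add: distrib_right)
  next
    assume "y / x \<in> V"
    hence "(y / x + 1) * x \<in> m" using m_mult add one assms(1) by blast
    thus ?thesis using False by (simp add: distrib_right add.commute)
  qed
qed (use assms in auto)

lemma m_uminus: "x \<in> m \<Longrightarrow> - x \<in> m" using m_mult[of "- 1" x] uminus one by simp

lemma m_prime:
  assumes "x \<in> V" "y \<in> V" "x * y \<in> m"
  shows "x \<in> m \<or> y \<in> m"
proof (rule ccontr)
  assume h: "\<not> ?thesis"
  hence ix: "inverse x \<in> V" "inverse y \<in> V" "x * y \<noteq> 0" using assms unit by auto
  hence "inverse (x * y) \<in> V" using mult by (simp add: mult.commute)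
  thus False using assms(3) ix(3) unfolding m_def by blast
qed

lemma m_prod:
  assumes "finite I" "\<And>i. i \<in> I \<Longrightarrow> f i \<in> V" "(\<Prod>i\<in>I. f i) \<in> m"
  shows "\<exists>i\<in>I. f i \<in> m"
  using assms
proof (induction I rule: finite_induct)
  case empty
  thus ?case using one_m by simp
next
  case (insert i I)
  have pV: "(\<Prod>i\<in>I. f i) \<in> V" if "\<And>i. i \<in> I \<Longrightarrow> f i \<in> V"
    using insert.hyps(1) that by (induction I rule: finite_induct) (simp_all add: one mult)
  have "f i * (\<Prod>i\<in>I. f i) \<in> m" using insert.prems(2) insert.hyps by simp
  hence "f i \<in> m \<or> (\<Prod>i\<in>I. f i) \<in> m" using m_prime pV insert.prems(1) by blast
  thus ?case using insert.IH insert.prems(1) by blast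
qed

lemma m_power: "x \<in> V \<Longrightarrow> x ^ n \<in> m \<Longrightarrow> x \<in> m"
proof (induction n)
  case (Suc n)
  thus ?case using m_prime[of x "x ^ n"] power by auto
qed (use one_m in simp)

lemma not_m_inverse: "z \<in> m \<Longrightarrow> z \<noteq> 0 \<Longrightarrow> inverse z \<notin> V" unfolding m_def by blast

lemma inverse_m: "z \<in> K \<Longrightarrow> z \<notin> V \<Longrightarrow> inverse z \<in> m"
  using val[of z] zero unfolding m_def by auto

end

text \<open>An element of W outside V has its inverse in the maximal ideal of V, hence in that of W,
  where no inverse of an element of W can be.\<close>

lemma valuation_subring_eqI:
  assumes "valuation_subring K V" "valuation_subring K W" "V \<subseteq> W"
    and "\<And>z. z \<in> valuation_subring.m V \<Longrightarrow> z \<in> valuation_subring.m W"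
  shows "V = W"
proof (rule antisym[OF assms(3)], rule subsetI)
  interpret V: valuation_subring K V by fact
  interpret W: valuation_subring K W by fact
  fix z assume z: "z \<in> W"
  show "z \<in> V"
  proof (rule ccontr)
    assume n: "z \<notin> V"
    have zK: "z \<in> K" using z W.sub by blast
    have "inverse z \<in> W.m" using V.inverse_m[OF zK n] assms(4) by blast
    moreover have "z \<noteq> 0" using n V.zero by blast
    ultimately show False using z W.not_m_inverse[of "inverse z"] by simp
  qed
qed

definition frob2 :: "'a::finite_field alg_closure \<times> 'a alg_closure \<Rightarrow> 'a alg_closure \<times> 'a alg_closure" where
  "frob2 P = (frob (fst P), frob (snd P))"

lemma funpow_frob2: "(frob2 ^^ n) P = ((frob ^^ n) (fst P), (frob ^^ n) (snd P))"
  by (induction n) (simp_all add: frob2_def)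

interpretation frob2: periodic_map "frob2 :: 'a::finite_field alg_closure \<times> 'a alg_closure \<Rightarrow> _"
proof
  fix P :: "'a alg_closure \<times> 'a alg_closure"
  let ?n = "period frob (fst P) * period frob (snd P)"
  have "(frob ^^ ?n) (fst P) = fst P" unfolding frob.funpow_eq_iff by simp
  moreover have "(frob ^^ ?n) (snd P) = snd P" unfolding frob.funpow_eq_iff by simp
  ultimately have "(frob2 ^^ ?n) P = P" unfolding funpow_frob2 by simp
  moreover have "?n > 0" by (intro mult_pos_pos frob.period(1))
  ultimately show "\<exists>n>0. (frob2 ^^ n) P = P" by blast
qed

lemma evp_pCons: "evp P (pCons c U) = ev1 (fst P) c + snd P * evp P U"
  unfolding evp_def by (rule ev2_pCons) (rule ev1.comm_ring_hom_axioms)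

lemma frob_evp: "frob (evp P U) = evp (frob2 P) (U :: 'a::finite_field poly poly)"
proof (induction U)
  case (pCons c U)
  have "frob (evp P (pCons c U)) = frob (ev1 (fst P) c) + frob (snd P) * frob (evp P U)"
    unfolding evp_pCons frob.hom_add frob.hom_mult ..
  also have "\<dots> = evp (frob2 P) (pCons c U)"
    unfolding frob_ev1 pCons.IH evp_pCons by (simp add: frob2_def)
  finally show ?case .
qed (simp add: zero_power)

lemma funpow_frob_evp: "(frob ^^ n) (evp P U) = evp ((frob2 ^^ n) P) (U :: 'a::finite_field poly poly)"
  by (induction n) (simp_all add: frob_evp del: evp.hom_power)

text \<open>The minimal polynomial, up to a constant factor.\<close>

definition minpol :: "'a::finite_field alg_closure \<Rightarrow> 'a poly \<Rightarrow> bool" where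
  "minpol \<alpha> P \<longleftrightarrow> P \<noteq> 0 \<and> ev1 \<alpha> P = 0 \<and> (\<forall>g. ev1 \<alpha> g = 0 \<longrightarrow> P dvd g) \<and> degree P > 0"

lemma min_poly_exists:
  fixes \<alpha> :: "'a::finite_field alg_closure"
  obtains P where "minpol \<alpha> P"
proof -
  define S where "S n \<longleftrightarrow> (\<exists>P. P \<noteq> 0 \<and> ev1 \<alpha> P = 0 \<and> degree P = n)" for n
  obtain p :: "'a poly" where p: "p \<noteq> 0" "poly (map_poly to_ac p) \<alpha> = 0" by (rule alg_closure_algebraic)
  have Sp: "S (degree p)" unfolding S_def ev1_def ev2_def using p by blast
  define e where "e = (LEAST n. S n)"
  have e: "S e" unfolding e_def using Sp by (rule LeastI)
  have less: "\<not> S m" if "m < e" for m using that unfolding e_def by (rule not_less_Least)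
  obtain P where P: "P \<noteq> 0" "ev1 \<alpha> P = 0" "degree P = e" using e unfolding S_def by blast
  have dvd: "P dvd g" if g: "ev1 \<alpha> g = 0" for g
  proof -
    have eq: "g mod P = g - (g div P) * P" by (simp add: minus_div_mult_eq_mod)
    have "ev1 \<alpha> (g mod P) = 0" unfolding eq ev1.hom_minus ev1.hom_mult g P(2) by simp
    hence "g mod P = 0" using less degree_mod_less[OF P(1), of g] P(3) unfolding S_def by blast
    thus ?thesis by (simp add: mod_eq_0_iff_dvd)
  qed
  have "degree P \<noteq> 0"
  proof
    assume "degree P = 0"
    then obtain c where c: "P = [:c:]" by (rule degree_eq_zeroE)
    thus False using P(1,2) by simp
  qed
  thus ?thesis using that P(1,2) dvd unfolding minpol_def by blast
qed

lemma minpolD: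
  assumes "minpol \<alpha> P"
  shows "P \<noteq> 0" "ev1 \<alpha> P = 0" "degree P > 0"
  using assms unfolding minpol_def by blast+

lemma minpol_dvd: "minpol \<alpha> P \<Longrightarrow> ev1 \<alpha> g = 0 \<Longrightarrow> P dvd g"
  unfolding minpol_def by blast

section \<open>The affine curve and evaluation at its points\<close>

context artin_schreier
begin

definition asP :: "'a poly poly" where
  "asP = Polynomial.monom 1 p - Polynomial.monom 1 1 - [:h:]"

lemma ev_asP [simp]: "ev asP = 0"
  unfolding asP_def ev.hom_minus using w' by simp

text \<open>x has weight p and w has weight N, their pole orders at infinity; then w^p and a x^N
  have equal weight p N.\<close>

definition wt :: "'a poly poly \<Rightarrow> nat \<Rightarrow> bool" where
  "wt U n \<longleftrightarrow> (\<forall>j. Polynomial.coeff U j \<noteq> 0 \<longrightarrow> p * degree (Polynomial.coeff U j) + N * j \<le> n)"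

lemma wt_0 [simp]: "wt 0 n" by (simp add: wt_def)

lemma wt_add:
  assumes "wt U n" "wt T n"
  shows "wt (U + T) n"
  unfolding wt_def
proof (intro allI impI)
  fix j assume nz: "Polynomial.coeff (U + T) j \<noteq> 0"
  let ?u = "Polynomial.coeff U j" and ?t = "Polynomial.coeff T j"
  have u: "?u \<noteq> 0 \<Longrightarrow> p * degree ?u + N * j \<le> n" and t: "?t \<noteq> 0 \<Longrightarrow> p * degree ?t + N * j \<le> n"
    using assms unfolding wt_def by blast+
  show "p * degree (Polynomial.coeff (U + T) j) + N * j \<le> n"
  proof (cases "?u = 0 \<or> ?t = 0")
    case True
    thus ?thesis using u t nz by auto
  next
    case False
    have "degree (?u + ?t) \<le> max (degree ?u) (degree ?t)" by (rule degree_add_le_max)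
    hence "degree (?u + ?t) \<le> degree ?u \<or> degree (?u + ?t) \<le> degree ?t" by linarith
    hence "p * degree (?u + ?t) \<le> p * degree ?u \<or> p * degree (?u + ?t) \<le> p * degree ?t"
      using mult_le_mono2 by blast
    thus ?thesis using u t False unfolding coeff_add by linarith
  qed
qed

lemma wt_uminus: "wt (- U) n \<longleftrightarrow> wt U n" unfolding wt_def by simp

lemma wt_diff: "wt U n \<Longrightarrow> wt T n \<Longrightarrow> wt (U - T) n"
  using wt_add[of U n "- T"] wt_uminus[of T n] by simp

lemma wt_monom: "wt (Polynomial.monom c j) n \<longleftrightarrow> c = 0 \<or> p * degree c + N * j \<le> n"
  unfolding wt_def by auto

lemma wt_exists: obtains n where "wt U n"
proof
  show "wt U (\<Sum>j\<le>degree U. p * degree (Polynomial.coeff U j) + N * j)"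
    unfolding wt_def
  proof (intro allI impI)
    fix j assume "Polynomial.coeff U j \<noteq> 0"
    hence "j \<in> {..degree U}" using le_degree by simp
    thus "p * degree (Polynomial.coeff U j) + N * j \<le> (\<Sum>j\<le>degree U. p * degree (Polynomial.coeff U j) + N * j)"
      by (intro member_le_sum[of j "{..degree U}" "\<lambda>j. p * degree (Polynomial.coeff U j) + N * j"]) simp_all
  qed
qed

lemma degree_h: "degree h = N" "h \<noteq> 0"
  using a0 by (simp_all add: h_def degree_monom_eq)

text \<open>Division by \<open>asP\<close> replaces w^p by w + a x^N. The weight does not grow,
  since x^N weighs as much as w^p and w weighs less.\<close>

lemma reduce:
  assumes "wt U n"
  shows "\<exists>Q R. U = asP * Q + R \<and> degree R < p \<and> wt R n"
  using assms
proof (induction "degree U" arbitrary: U rule: less_induct)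
  case less
  show ?case
  proof (cases "degree U < p")
    case True
    thus ?thesis using less.prems by (intro exI[of _ 0] exI[of _ U]) simp
  next
    case False
    define d where "d = degree U"
    define c where "c = Polynomial.coeff U d"
    have dp: "d \<ge> p" using False by (simp add: d_def)
    have p2: "p \<ge> 2" by (rule p(2))
    have c0: "c \<noteq> 0" unfolding c_def d_def using False p2 by (metis degree_0 leading_coeff_0_iff not_less_iff_gr_or_eq zero_less_iff_neq_zero le_zero_eq not_le p(2) pos2 less_le_trans)
    have wd: "p * degree c + N * d \<le> n" using less.prems c0 unfolding wt_def c_def by blast
    define T where "T = Polynomial.monom c (d - p)"
    have aT: "asP * T = Polynomial.monom c d - Polynomial.monom c (Suc (d - p)) - Polynomial.monom (h * c) (d - p)"
    proof -
      have "[:h:] * T = Polynomial.monom (h * c) (d - p)" unfolding T_def by (simp add: smult_monom)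
      moreover have "Polynomial.monom 1 p * T = Polynomial.monom c d" unfolding T_def mult_monom using dp by simp
      moreover have "Polynomial.monom 1 1 * T = Polynomial.monom c (Suc (d - p))" unfolding T_def mult_monom by simp
      ultimately show ?thesis unfolding asP_def by (simp only: left_diff_distrib)
    qed
    define U' where "U' = U - asP * T"
    have U': "U' = (U - Polynomial.monom c d) + (Polynomial.monom c (Suc (d - p)) + Polynomial.monom (h * c) (d - p))"
      unfolding U'_def aT by simp
    have w2: "wt (Polynomial.monom c (Suc (d - p))) n"
    proof -
      have "Suc (d - p) \<le> d" using dp p2 by simp
      hence "N * Suc (d - p) \<le> N * d" by (rule mult_le_mono2)
      thus ?thesis unfolding wt_monom using wd by linarith
    qed
    have w3: "wt (Polynomial.monom (h * c) (d - p)) n"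
    proof -
      have "degree (h * c) = N + degree c" using degree_h c0 by (simp add: degree_mult_eq)
      moreover have "p * (N + degree c) + N * (d - p) = p * degree c + N * (p + (d - p))"
        by (simp only: distrib_left mult.commute add_ac)
      moreover have "p + (d - p) = d" using dp by simp
      ultimately show ?thesis unfolding wt_monom using wd by simp
    qed
    have "wt (Polynomial.monom c d) n" unfolding wt_monom using wd by simp
    hence wU': "wt U' n" unfolding U' by (intro wt_add wt_diff w2 w3 less.prems)
    have "degree U' < d"
    proof (rule degree_lessI)
      show "U' \<noteq> 0 \<or> d > 0" using dp p2 by simp
      show "\<forall>k\<ge>d. Polynomial.coeff U' k = 0"
      proof (intro allI impI)
        fix k assume k: "d \<le> k"
        have "Polynomial.coeff U k = (if k = d then c else 0)"
          using k by (auto simp: c_def d_def coeff_eq_0)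
        moreover have "Suc (d - p) \<noteq> k" "d - p \<noteq> k" using k dp p2 by linarith+
        ultimately show "Polynomial.coeff U' k = 0" unfolding U' coeff_add coeff_diff coeff_monom by simp
      qed
    qed
    hence "degree U' < degree U" by (simp add: d_def)
    from less.hyps[OF this wU'] obtain Q R where QR: "U' = asP * Q + R" "degree R < p" "wt R n" by blast
    have "U = asP * (Q + T) + R" using QR(1) unfolding U'_def by (simp add: algebra_simps)
    thus ?thesis using QR by blast
  qed
qed

definition curve :: "('a alg_closure \<times> 'a alg_closure) set" where
  "curve = {P. snd P ^ p - snd P = to_ac a * fst P ^ N}"

lemma evp_asP: "P \<in> curve \<Longrightarrow> evp P asP = 0"
  unfolding asP_def evp.hom_minus curve_def by (simp add: h_def)

text \<open>By \<open>ev_independent\<close>, a polynomial vanishing at \<open>w\<close> is a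
  multiple of \<open>asP\<close>, which vanishes on the curve. Evaluation at a point is therefore
  well defined on the subring F_q[x, w] of \<open>K\<close>.\<close>

lemma evp_zero:
  assumes "P \<in> curve" "ev U = 0"
  shows "evp P U = 0"
proof -
  obtain n where "wt U n" by (rule wt_exists)
  then obtain Q R where QR: "U = asP * Q + R" "degree R < p" using reduce by blast
  have "ev R = 0" using assms(2) unfolding QR(1) ev.hom_add ev.hom_mult by simp
  hence "R = 0" using ev_independent QR(2) by blast
  thus ?thesis unfolding QR(1) evp.hom_add evp.hom_mult using evp_asP[OF assms(1)] by simp
qed

lemma evp_cong:
  assumes "P \<in> curve" "ev U = ev T"
  shows "evp P U = evp P T"
  using evp_zero[OF assms(1), of "U - T"] assms(2) by (simp add: ev.hom_minus evp.hom_minus)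

lemma evp_nonzero: "P \<in> curve \<Longrightarrow> evp P U \<noteq> 0 \<Longrightarrow> ev U \<noteq> 0"
  using evp_zero by blast

text \<open>The Galois group of the extension, which is the prime field acting by translation of
  w.\<close>

definition shift :: "nat \<Rightarrow> 'a alg_closure \<times> 'a alg_closure \<Rightarrow> 'a alg_closure \<times> 'a alg_closure" where
  "shift i P = (fst P, snd P + of_nat i)"

lemma CHAR_ac: "CHAR('a alg_closure) = p" by (simp add: p_def)

lemma power_p_add: "(x + y :: 'a alg_closure) ^ p = x ^ p + y ^ p"
  unfolding p_def using power_CHAR_add[of x y 1] by simp

lemma of_nat_power_p: "(of_nat i :: 'a alg_closure) ^ p = of_nat i"
  using p(2) by (induction i) (simp_all add: power_p_add zero_power)

lemma shift_curve: "P \<in> curve \<Longrightarrow> shift i P \<in> curve"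
  unfolding curve_def shift_def by (simp add: power_p_add of_nat_power_p)

lemma frob_of_nat: "frob (of_nat i :: 'a alg_closure) = of_nat i"
  using frob_to_ac[of "of_nat i"] by simp

lemma funpow_frob_of_nat: "(frob ^^ n) (of_nat i :: 'a alg_closure) = of_nat i"
  by (induction n) (simp_all add: frob_of_nat)

lemma funpow_frob_add: "(frob ^^ n) (x + y :: 'a alg_closure) = (frob ^^ n) x + (frob ^^ n) y"
  unfolding funpow_frob by (rule power_CARD_add)

lemma frob2_shift: "(frob2 ^^ n) (shift i P) = shift i ((frob2 ^^ n) P)"
  unfolding funpow_frob2 shift_def by (simp add: funpow_frob_add funpow_frob_of_nat)

lemma funpow_frob2_fst_snd: "fst ((frob2 ^^ n) P) = (frob ^^ n) (fst P)" "snd ((frob2 ^^ n) P) = (frob ^^ n) (snd P)"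
  by (simp_all add: funpow_frob2)

lemma frob2_curve: "P \<in> curve \<Longrightarrow> (frob2 ^^ n) P \<in> curve"
proof (induction n)
  case (Suc n)
  define Q where "Q = (frob2 ^^ n) P"
  have "snd Q ^ p - snd Q = to_ac a * fst Q ^ N" using Suc by (simp add: curve_def Q_def)
  hence "frob (snd Q ^ p - snd Q) = frob (to_ac a * fst Q ^ N)" by (rule arg_cong)
  hence "frob (snd Q) ^ p - frob (snd Q) = frob (to_ac a) * frob (fst Q) ^ N"
    unfolding frob.hom_minus frob.hom_mult by (simp only: frob.hom_power)
  moreover have "(frob2 ^^ Suc n) P = (frob (fst Q), frob (snd Q))"
    by (simp add: Q_def frob2_def[of "(frob2 ^^ n) P"])
  ultimately show ?case unfolding curve_def by simp
qed simp

lemma inj_shift: "inj_on (\<lambda>i. snd P + of_nat i :: 'a alg_closure) {..<p}"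
proof (rule inj_onI)
  fix i j assume h: "i \<in> {..<p}" "j \<in> {..<p}" "snd P + of_nat i = snd P + of_nat j"
  hence "(of_nat i :: 'a alg_closure) = of_nat j" by simp
  moreover have "inj_on (of_nat :: nat \<Rightarrow> 'a) {..<p}" unfolding p_def by (rule inj_on_of_nat_CHAR)
  ultimately show "i = j" using h(1,2) by (metis inj_onD to_ac_eq_iff to_ac_of_nat)
qed

text \<open>Reduced to degree below p in w and specialised at the x-coordinate, the polynomial has p
  distinct roots and is zero, so \<open>Q\<close> divides all its coefficients. This expresses that
  the cover is unramified at the finite points.\<close>

lemma zero_on_fiber:
  assumes "P \<in> curve" and z: "\<And>i. i < p \<Longrightarrow> evp (shift i P) U = 0"
    and mp: "minpol (fst P) Q"
  obtains U' where "ev U = \<iota> Q * ev U'"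
proof -
  obtain n where "wt U n" by (rule wt_exists)
  then obtain S R where QR: "U = asP * S + R" "degree R < p" using reduce by blast
  have zR: "evp (shift i P) R = 0" if "i < p" for i
    using z[OF that] evp_asP[OF shift_curve[OF assms(1)], of i] unfolding QR(1) evp.hom_add evp.hom_mult by simp
  define f where "f = map_poly (ev1 (fst P)) R"
  have "poly f y = 0" if "y \<in> (\<lambda>i. snd P + of_nat i) ` {..<p}" for y
    using that zR unfolding f_def evp_def ev2_def shift_def by auto
  moreover have "card ((\<lambda>i. snd P + of_nat i :: 'a alg_closure) ` {..<p}) = p"
    using card_image[OF inj_shift] by simp
  moreover have df: "degree f < p" unfolding f_def using degree_map_poly_le QR(2) le_less_trans by blast
  ultimately have "f = 0"
    by (intro poly_eqI_degree[of "(\<lambda>i. snd P + of_nat i) ` {..<p}"]) simp_all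
  hence "Polynomial.coeff f j = 0" for j by simp
  hence "ev1 (fst P) (Polynomial.coeff R j) = 0" for j by (simp add: f_def coeff_map_poly)
  hence "Q dvd Polynomial.coeff R j" for j by (rule minpol_dvd[OF mp])
  hence "R = [:Q:] * map_poly (\<lambda>c. c div Q) R"
    by (intro poly_eqI) (simp add: coeff_map_poly)
  hence "ev R = \<iota> Q * ev (map_poly (\<lambda>c. c div Q) R)" by (metis ev.hom_mult ev_const)
  hence "ev U = \<iota> Q * ev (map_poly (\<lambda>c. c div Q) R)" unfolding QR(1) ev.hom_add ev.hom_mult by simp
  thus ?thesis by (rule that)
qed

text \<open>The order of the multiplicative group of the field with q^n elements, n being the period
  of \<open>P\<close>. This power of Frobenius fixes all shifts of \<open>P\<close> as well, so
  raising to \<open>e01 P\<close> replaces the values on the whole fiber by 0 or 1.\<close>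

definition e01 :: "('a alg_closure \<times> 'a alg_closure) \<Rightarrow> nat" where
  "e01 P = CARD('a) ^ period frob2 P - 1"

lemma e01_pos: "e01 P > 0"
proof -
  have "CARD('a) ^ 1 \<le> CARD('a) ^ period frob2 P"
    using frob2.period(1)[of P] by (intro power_increasing) auto
  thus ?thesis using CARD_gt_1[where ?'a='a] unfolding e01_def by simp
qed

lemma evp_e01:
  assumes "evp (shift i P) U \<noteq> 0"
  shows "evp (shift i P) (U ^ e01 P) = 1"
proof -
  have "(frob2 ^^ period frob2 P) (shift i P) = shift i P" unfolding frob2_shift frob2.period(2) ..
  hence "(evp (shift i P) U) ^ (CARD('a) ^ period frob2 P) = evp (shift i P) U"
    using funpow_frob_evp[of "period frob2 P" "shift i P" U] unfolding funpow_frob by metis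
  moreover have "CARD('a) ^ period frob2 P = Suc (e01 P)" using e01_pos[of P] unfolding e01_def by simp
  ultimately have "evp (shift i P) U * evp (shift i P) U ^ e01 P = evp (shift i P) U" by simp
  hence "evp (shift i P) U ^ e01 P = 1" using assms by (metis mult.right_neutral mult_left_cancel)
  thus ?thesis by (simp add: evp.hom_power)
qed

lemma shift_0 [simp]: "shift 0 P = P" by (simp add: shift_def)

text \<open>The function T = 1 - U^e01 is 1 at \<open>P\<close> and vanishes at the points of the
  fiber where \<open>U\<close> does not, so U T vanishes on the whole fiber. Hence the minimal
  polynomial of the x-coordinate is a uniformizer at \<open>P\<close>.\<close>

lemma uniformizer_step:
  assumes P: "P \<in> curve" and U: "evp P U = 0" and mp: "minpol (fst P) Q"
  obtains U' T where "evp P T \<noteq> 0" "ev U * ev T = \<iota> Q * ev U'"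
proof -
  define T where "T = 1 - U ^ e01 P"
  have T: "evp P T = 1" unfolding T_def evp.hom_minus evp.hom_power U evp.hom_one using e01_pos[of P] by simp
  have "evp (shift i P) (U * T) = 0" if "i < p" for i
  proof (cases "evp (shift i P) U = 0")
    case False
    have "evp (shift i P) T = 0" unfolding T_def evp.hom_minus evp_e01[OF False] by simp
    thus ?thesis by (simp add: evp.hom_mult)
  qed (simp add: evp.hom_mult)
  then obtain U' where "ev (U * T) = \<iota> Q * ev U'" using zero_on_fiber[OF P _ mp] by blast
  thus ?thesis using that[of T U'] T by (simp add: ev.hom_mult)
qed

text \<open>As \<open>T\<close> does not vanish at \<open>P\<close>, each factor \<open>Q\<close> on
  the right makes f vanish at the x-coordinate and has to be paid for by a factor \<open>Q\<close>
  of f.\<close>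

lemma uniformizer_bound:
  assumes P: "P \<in> curve" and mp: "minpol (fst P) Q"
    and T: "evp P T \<noteq> 0"
  shows "f \<noteq> 0 \<Longrightarrow> \<iota> f * ev T = \<iota> Q ^ k * ev W \<Longrightarrow> k \<le> degree f"
proof (induction k arbitrary: f)
  case (Suc k)
  note Q = minpolD[OF mp]
  have "ev ([:f:] * T) = ev ([:Q:] * ([:Q:] ^ k * W))"
    using Suc.prems(2) by (simp only: ev.hom_mult ev.hom_power ev_const power_Suc mult.assoc)
  hence "evp P ([:f:] * T) = evp P ([:Q:] * ([:Q:] ^ k * W))" by (rule evp_cong[OF P])
  hence "ev1 (fst P) f * evp P T = 0" by (simp only: evp.hom_mult evp_const Q(2) mult_zero_left)
  hence "ev1 (fst P) f = 0" using T by simp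
  hence "Q dvd f" by (rule minpol_dvd[OF mp])
  then obtain g where g: "f = Q * g" by (elim dvdE)
  have g0: "g \<noteq> 0" using Suc.prems(1) g by auto
  have "\<iota> Q * (\<iota> g * ev T) = \<iota> Q * (\<iota> Q ^ k * ev W)"
    using Suc.prems(2) unfolding g \<iota>.hom_mult power_Suc by (simp only: mult.assoc)
  hence "\<iota> g * ev T = \<iota> Q ^ k * ev W" using Q(1) by simp
  hence "k \<le> degree g" by (rule Suc.IH[OF g0])
  moreover have "degree f = degree Q + degree g" unfolding g using Q(1) g0 by (rule degree_mult_eq)
  ultimately show ?case using Q(3) by simp
qed simp

text \<open>Extracting factors \<open>Q\<close> with \<open>uniformizer_step\<close> has to stop,
  because some multiple of \<open>ev U\<close> is a nonzero polynomial in x, whose degree bounds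
  their number.\<close>

lemma uniformizer_factor:
  assumes P: "P \<in> curve" and mp: "minpol (fst P) Q"
    and U: "ev U \<noteq> 0"
  obtains k U' T where "evp P U' \<noteq> 0" "evp P T \<noteq> 0" "ev U * ev T = \<iota> Q ^ k * ev U'"
proof -
  obtain U0 f where f: "ev U * ev U0 = \<iota> f" "f \<noteq> 0" using ev_denominator[OF U] by blast
  have "(\<exists>k U' T. evp P U' \<noteq> 0 \<and> evp P T \<noteq> 0 \<and> ev U * ev T = \<iota> Q ^ k * ev U') \<or>
        (\<exists>U' T. evp P T \<noteq> 0 \<and> ev U * ev T = \<iota> Q ^ n * ev U')" for n
  proof (induction n)
    case 0
    have "evp P 1 \<noteq> 0 \<and> ev U * ev 1 = \<iota> Q ^ 0 * ev U" by (simp add: ev.hom_one)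
    thus ?case by blast
  next
    case (Suc n)
    show ?case
    proof (cases "\<exists>k U' T. evp P U' \<noteq> 0 \<and> evp P T \<noteq> 0 \<and> ev U * ev T = \<iota> Q ^ k * ev U'")
      case False
      then obtain U' T where h: "evp P T \<noteq> 0" "ev U * ev T = \<iota> Q ^ n * ev U'" using Suc by blast
      hence "evp P U' = 0" using False by blast
      then obtain U'' T' where h': "evp P T' \<noteq> 0" "ev U' * ev T' = \<iota> Q * ev U''"
        using uniformizer_step[OF P _ mp] by blast
      have "ev U * ev (T * T') = \<iota> Q ^ n * (ev U' * ev T')" unfolding ev.hom_mult using h(2) by (simp add: mult.assoc[symmetric])
      also have "\<dots> = \<iota> Q ^ Suc n * ev U''" unfolding h'(2) by (simp add: mult_ac)
      finally have "evp P (T * T') \<noteq> 0 \<and> ev U * ev (T * T') = \<iota> Q ^ Suc n * ev U''"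
        using h(1) h'(1) by (simp add: evp.hom_mult)
      thus ?thesis by blast
    qed blast
  qed
  moreover have "\<not> (\<exists>U' T. evp P T \<noteq> 0 \<and> ev U * ev T = \<iota> Q ^ Suc (degree f) * ev U')"
  proof
    assume "\<exists>U' T. evp P T \<noteq> 0 \<and> ev U * ev T = \<iota> Q ^ Suc (degree f) * ev U'"
    then obtain U' T where h: "evp P T \<noteq> 0" "ev U * ev T = \<iota> Q ^ Suc (degree f) * ev U'" by blast
    have "\<iota> f * ev T = (ev U * ev T) * ev U0" unfolding f(1)[symmetric] by (simp only: mult_ac)
    also have "\<dots> = \<iota> Q ^ Suc (degree f) * ev (U' * U0)" unfolding h(2) ev.hom_mult by (simp only: mult.assoc)
    finally have "Suc (degree f) \<le> degree f" by (rule uniformizer_bound[OF P mp h(1) f(2)])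
    thus False by simp
  qed
  ultimately show ?thesis using that by blast
qed

section \<open>Local rings at the points of the curve\<close>

definition pt_ring :: "('a alg_closure \<times> 'a alg_closure) \<Rightarrow> 'k set" where
  "pt_ring P = {ev U / ev T | U T. evp P T \<noteq> 0}"

lemma pt_ringI: "evp P T \<noteq> 0 \<Longrightarrow> ev U / ev T \<in> pt_ring P"
  unfolding pt_ring_def by blast

lemma ev_in_pt_ring: "ev U \<in> pt_ring P"
  using pt_ringI[of P 1 U] by (simp add: ev.hom_one)

text \<open>Numerator and denominator of z are powers of the uniformizer times quotients of
  functions not vanishing at \<open>P\<close>. Comparing the exponents decides whether z or its
  inverse is regular.\<close>

lemma pt_ring_valuation:
  assumes P: "P \<in> curve"
  shows "valuation_subring K (pt_ring P)"
proof
  show "pt_ring P \<subseteq> K" unfolding pt_ring_def using K_divide ev_in_K by blast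
  show "1 \<in> pt_ring P" using ev_in_pt_ring[of 1] by (simp add: ev.hom_one)
  show "x / y \<in> K" if "x \<in> K" "y \<in> K" for x y using that by (rule K_divide)
  fix x y assume "x \<in> pt_ring P" "y \<in> pt_ring P"
  then obtain U T U' T' where h: "x = ev U / ev T" "y = ev U' / ev T'" "evp P T \<noteq> 0" "evp P T' \<noteq> 0"
    unfolding pt_ring_def by blast
  have nz: "ev T \<noteq> 0" "ev T' \<noteq> 0" using evp_nonzero[OF P] h by blast+
  have TT: "evp P (T * T') \<noteq> 0" using h by (simp add: evp.hom_mult)
  have "x - y = ev (U * T' - U' * T) / ev (T * T')"
    unfolding h(1,2) diff_frac_eq[OF nz] ev.hom_minus ev.hom_mult by (simp only: mult.commute)
  thus "x - y \<in> pt_ring P" using pt_ringI[OF TT] by simp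
  have "x * y = ev (U * U') / ev (T * T')" unfolding h(1,2) ev.hom_mult by simp
  thus "x * y \<in> pt_ring P" using pt_ringI[OF TT] by simp
next
  fix z assume z: "z \<in> K" "z \<noteq> 0"
  obtain Q where mp: "minpol (fst P) Q" by (rule min_poly_exists)
  obtain U f where zf: "z = ev U / \<iota> f" "f \<noteq> 0" using z(1) by (rule K_cases)
  have U0: "ev U \<noteq> 0" using z(2) zf by auto
  have f0: "ev [:f:] \<noteq> 0" using zf(2) by simp
  obtain k A B where A: "evp P A \<noteq> 0" "evp P B \<noteq> 0" "ev U * ev B = \<iota> Q ^ k * ev A"
    by (rule uniformizer_factor[OF P mp U0])
  obtain l C D where C: "evp P C \<noteq> 0" "evp P D \<noteq> 0" "ev [:f:] * ev D = \<iota> Q ^ l * ev C"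
    by (rule uniformizer_factor[OF P mp f0])
  have nz: "ev A \<noteq> 0" "ev B \<noteq> 0" "ev C \<noteq> 0" "ev D \<noteq> 0"
    by (rule evp_nonzero[OF P], rule A C)+
  have nz5: "\<iota> Q \<noteq> 0" using minpolD(1)[OF mp] by simp
  have eU: "ev U = \<iota> Q ^ k * ev A / ev B"
    by (rule nonzero_eq_divide_eq[OF nz(2), THEN iffD2]) (rule A(3))
  have ef: "\<iota> f = \<iota> Q ^ l * ev C / ev D"
    by (rule nonzero_eq_divide_eq[OF nz(4), THEN iffD2]) (use C(3) in \<open>simp only: ev_const\<close>)
  have zz: "z = (\<iota> Q ^ k * (ev A * ev D)) / (\<iota> Q ^ l * (ev B * ev C))"
    unfolding zf(1) eU ef by (simp only: divide_divide_times_eq divide_divide_eq_left divide_divide_eq_right times_divide_eq_left times_divide_eq_right mult_ac)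
  have AD: "evp P (A * D) \<noteq> 0" "evp P (B * C) \<noteq> 0" using A C by (simp_all add: evp.hom_mult)
  show "z \<in> pt_ring P \<or> inverse z \<in> pt_ring P"
  proof (cases "l \<le> k")
    case True
    hence "\<iota> Q ^ k = \<iota> Q ^ l * \<iota> Q ^ (k - l)" by (simp flip: power_add)
    hence "z = ev ([:Q:] ^ (k - l) * (A * D)) / ev (B * C)"
      unfolding zz ev.hom_mult ev.hom_power ev_const using nz5 by (simp add: mult.assoc)
    thus ?thesis using pt_ringI[OF AD(2)] by simp
  next
    case False
    hence "\<iota> Q ^ l = \<iota> Q ^ k * \<iota> Q ^ (l - k)" by (simp flip: power_add)
    hence "inverse z = ev ([:Q:] ^ (l - k) * (B * C)) / ev (A * D)"
      unfolding zz ev.hom_mult ev.hom_power ev_const using nz5 by (simp add: mult.assoc)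
    thus ?thesis using pt_ringI[OF AD(1)] by simp
  qed
qed

lemma pt_ring_m:
  assumes P: "P \<in> curve" and T: "evp P T \<noteq> 0"
  shows "ev U / ev T \<in> valuation_subring.m (pt_ring P) \<longleftrightarrow> evp P U = 0"
proof -
  interpret V: valuation_subring K "pt_ring P" by (rule pt_ring_valuation[OF P])
  have T0: "ev T \<noteq> 0" using evp_nonzero[OF P T] .
  show ?thesis
  proof
    assume h: "ev U / ev T \<in> V.m"
    show "evp P U = 0"
    proof (rule ccontr)
      assume U: "evp P U \<noteq> 0"
      hence "ev U \<noteq> 0" using evp_nonzero[OF P] by blast
      hence "inverse (ev U / ev T) \<notin> pt_ring P" using h T0 by (intro V.not_m_inverse) simp_all
      thus False using pt_ringI[OF U, of T] by simp
    qed
  next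
    assume U: "evp P U = 0"
    have "inverse (ev U / ev T) \<notin> pt_ring P" if "ev U / ev T \<noteq> 0"
    proof
      assume "inverse (ev U / ev T) \<in> pt_ring P"
      then obtain A B where AB: "inverse (ev U / ev T) = ev A / ev B" "evp P B \<noteq> 0" unfolding pt_ring_def by blast
      have B0: "ev B \<noteq> 0" using evp_nonzero[OF P AB(2)] .
      have U0: "ev U \<noteq> 0" using that by auto
      have "ev T / ev U = ev A / ev B" using AB(1) by simp
      hence "ev T * ev B = ev A * ev U" using B0 U0 by (simp add: frac_eq_eq)
      hence "evp P (T * B) = evp P (A * U)" by (intro evp_cong[OF P]) (simp add: ev.hom_mult)
      thus False using U T AB(2) by (simp add: evp.hom_mult)
    qed
    thus "ev U / ev T \<in> V.m" unfolding V.m_def using pt_ringI[OF T] by blast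
  qed
qed

end


section \<open>Residue fields\<close>

text \<open>Carries a subset of a field type over to the records in which the theorem is stated;
  applied to residue fields and later to \<open>K\<close> itself.\<close>

definition sub_rec :: "'b::field set \<Rightarrow> 'b ring" where
  "sub_rec S = \<lparr>carrier = S, monoid.mult = (\<lambda>x y. x * y), one = 1, ring.zero = 0, add = (\<lambda>x y. x + y)\<rparr>"

lemma sub_rec_simps [simp]:
  "carrier (sub_rec S) = S" "x \<otimes>\<^bsub>sub_rec S\<^esub> y = x * y" "\<one>\<^bsub>sub_rec S\<^esub> = 1"
  "\<zero>\<^bsub>sub_rec S\<^esub> = 0" "x \<oplus>\<^bsub>sub_rec S\<^esub> y = x + y"
  by (simp_all add: sub_rec_def)

lemma sub_rec_field:
  fixes S :: "'b::field set"
  assumes "0 \<in> S" "1 \<in> S" "\<And>x y. x \<in> S \<Longrightarrow> y \<in> S \<Longrightarrow> x + y \<in> S" "\<And>x. x \<in> S \<Longrightarrow> - x \<in> S"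
    "\<And>x y. x \<in> S \<Longrightarrow> y \<in> S \<Longrightarrow> x * y \<in> S" "\<And>x. x \<in> S \<Longrightarrow> inverse x \<in> S"
  shows "field (sub_rec S)"
proof (rule cring.cring_fieldI2)
  show "cring (sub_rec S)"
  proof (rule cringI)
    show "abelian_group (sub_rec S)"
    proof (rule abelian_groupI)
      fix x assume x: "x \<in> carrier (sub_rec S)"
      show "\<exists>y\<in>carrier (sub_rec S). y \<oplus>\<^bsub>sub_rec S\<^esub> x = \<zero>\<^bsub>sub_rec S\<^esub>"
        using assms(4)[of x] x by (intro bexI[of _ "- x"]) simp_all
    qed (use assms in \<open>simp_all add: add_ac\<close>)
    show "comm_monoid (sub_rec S)"
      by (rule comm_monoidI) (use assms in \<open>simp_all add: mult_ac\<close>)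
  qed (simp add: distrib_right)
  show "\<zero>\<^bsub>sub_rec S\<^esub> \<noteq> \<one>\<^bsub>sub_rec S\<^esub>" by simp
  fix x assume "x \<in> carrier (sub_rec S)" "x \<noteq> \<zero>\<^bsub>sub_rec S\<^esub>"
  thus "\<exists>y\<in>carrier (sub_rec S). x \<otimes>\<^bsub>sub_rec S\<^esub> y = \<one>\<^bsub>sub_rec S\<^esub>"
    using assms(6)[of x] by (intro bexI[of _ "inverse x"]) simp_all
qed

lemma sub_rec_nat_pow: "x [^]\<^bsub>sub_rec S\<^esub> (n::nat) = x ^ n"
  by (induction n) (simp_all add: nat_pow_def mult.commute)

locale finite_subfield =
  fixes E :: "'b::field set"
  assumes finE: "finite E" and E0: "0 \<in> E" and E1: "1 \<in> E"
    and Eadd: "\<And>x y. x \<in> E \<Longrightarrow> y \<in> E \<Longrightarrow> x + y \<in> E" and Eneg: "\<And>x. x \<in> E \<Longrightarrow> - x \<in> E"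
    and Emult: "\<And>x y. x \<in> E \<Longrightarrow> y \<in> E \<Longrightarrow> x * y \<in> E"
begin

lemma power_card_pred:
  assumes "y \<in> E" "y \<noteq> 0"
  shows "y ^ (card E - 1) = 1"
proof -
  have sub: "(\<lambda>x. y * x) ` (E - {0}) \<subseteq> E - {0}" using assms Emult by auto
  have inj: "inj_on (\<lambda>x. y * x) (E - {0})" using assms(2) by (intro inj_onI) simp
  have im: "(\<lambda>x. y * x) ` (E - {0}) = E - {0}"
    using finE sub card_image[OF inj] by (intro card_subset_eq) simp_all
  have "(\<Prod>x\<in>E - {0}. x) = (\<Prod>x\<in>(\<lambda>x. y * x) ` (E - {0}). x)" unfolding im ..
  also have "\<dots> = (\<Prod>x\<in>E - {0}. y * x)" by (subst prod.reindex[OF inj]) simp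
  also have "\<dots> = y ^ card (E - {0}) * (\<Prod>x\<in>E - {0}. x)" by (simp add: prod.distrib)
  finally have "(\<Prod>x\<in>E - {0}. x) = y ^ card (E - {0}) * (\<Prod>x\<in>E - {0}. x)" .
  moreover have "(\<Prod>x\<in>E - {0}. x) \<noteq> 0" using finE by (simp add: prod_zero_iff)
  ultimately have "y ^ card (E - {0}) = 1" by (metis mult_cancel_right1)
  thus ?thesis using finE E0 by simp
qed

lemma card_ge_2: "card E \<ge> 2"
proof -
  have "card {0::'b, 1} \<le> card E" using finE E0 E1 by (intro card_mono) auto
  thus ?thesis by simp
qed

lemma power_card: "y \<in> E \<Longrightarrow> y ^ card E = y"
proof (cases "y = 0")
  case False
  assume "y \<in> E"
  moreover have "card E = Suc (card E - 1)" using card_ge_2 by simp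
  ultimately show ?thesis using power_card_pred[OF _ False] by (metis mult.right_neutral power_Suc)
qed (use card_ge_2 in simp)

lemma Einv: "y \<in> E \<Longrightarrow> inverse y \<in> E"
proof (cases "y = 0")
  case False
  assume y: "y \<in> E"
  have pw: "y ^ n \<in> E" for n using y by (induction n) (simp_all add: E1 Emult)
  have "card E - 1 = Suc (card E - 2)" using card_ge_2 by simp
  hence "y * y ^ (card E - 2) = 1" using power_card_pred[OF y False] by simp
  hence "inverse y = y ^ (card E - 2)" by (rule inverse_unique)
  thus ?thesis using pw by simp
qed (simp add: E0)

lemma cyclic: obtains g where "g \<in> E" "g \<noteq> 0" "\<And>y. y \<in> E \<Longrightarrow> y \<noteq> 0 \<Longrightarrow> \<exists>k. y = g ^ k"
proof -
  interpret F: field "sub_rec E"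
    by (rule sub_rec_field) (rule E0 E1 Eadd Eneg Emult Einv; assumption?)+
  obtain g where g: "g \<in> carrier (mult_of (sub_rec E))"
    "carrier (mult_of (sub_rec E)) = {g [^]\<^bsub>sub_rec E\<^esub> i | i::nat. i \<in> UNIV}"
    using F.finite_field_mult_group_has_gen finE by auto
  have "\<exists>k. y = g ^ k" if "y \<in> E" "y \<noteq> 0" for y
  proof -
    have "y \<in> carrier (mult_of (sub_rec E))" using that by simp
    thus ?thesis unfolding g(2) sub_rec_nat_pow by blast
  qed
  thus ?thesis using that[of g] g(1) by simp
qed

end

lemma card_image_same_kernel:
  assumes "\<And>x y. f x = f y \<longleftrightarrow> g x = g y"
  shows "card (range f) = card (range g)"
proof -
  have "inj_on (\<lambda>z. g (SOME x. f x = z)) (range f)"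
  proof (rule inj_onI)
    fix z z' assume h: "z \<in> range f" "z' \<in> range f" "g (SOME x. f x = z) = g (SOME x. f x = z')"
    have "f (SOME x. f x = z) = z" "f (SOME x. f x = z') = z'"
      using h(1,2) by (metis (mono_tags, lifting) rangeE someI)+
    thus "z = z'" using h(3) assms by metis
  qed
  moreover have "(\<lambda>z. g (SOME x. f x = z)) ` range f = range g"
  proof -
    have "g (SOME x. f x = f y) = g y" for y
      using someI[of "\<lambda>x. f x = f y" y] assms by blast
    thus ?thesis unfolding image_image by simp
  qed
  ultimately show ?thesis using card_image by metis
qed

text \<open>Cosets are sets of sums y + z with y in the ideal, the shape they have in the carrier of
  the quotient ring, which makes the comparison with \<open>place_norm\<close> immediate.\<close>

definition residue_card :: "'k::field set \<Rightarrow> nat" where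
  "residue_card V = card ((\<lambda>z. (\<lambda>y. y + z) ` valuation_subring.m V) ` V)"

lemma (in valuation_subring) coset_eq_iff:
  assumes "x \<in> V" "z \<in> V"
  shows "(\<lambda>y. y + x) ` m = (\<lambda>y. y + z) ` m \<longleftrightarrow> x - z \<in> m"
proof
  assume "(\<lambda>y. y + x) ` m = (\<lambda>y. y + z) ` m"
  moreover have "0 + x \<in> (\<lambda>y. y + x) ` m" using zero_m by (intro imageI)
  ultimately obtain y where "0 + x = y + z" "y \<in> m" by auto
  thus "x - z \<in> m" by simp
next
  have sub: "(\<lambda>y. y + x) ` m \<subseteq> (\<lambda>y. y + z) ` m" if "x - z \<in> m" for x z
  proof (rule image_subsetI)
    fix y assume "y \<in> m"
    hence "y + (x - z) \<in> m" using m_add that by blast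
    moreover have "y + x = (y + (x - z)) + z" by simp
    ultimately show "y + x \<in> (\<lambda>y. y + z) ` m" by (rule rev_image_eqI)
  qed
  assume h: "x - z \<in> m"
  hence "z - x \<in> m" using m_uminus[of "x - z"] by simp
  thus "(\<lambda>y. y + x) ` m = (\<lambda>y. y + z) ` m" using sub h by blast
qed

context artin_schreier
begin

definition F :: "'k set" where "F = range (\<lambda>c. \<iota> [:c:])"
definition xx :: 'k where "xx = \<iota> [:0, 1:]"
definition is_place :: "'k set \<Rightarrow> bool" where
  "is_place V \<longleftrightarrow> valuation_subring K V \<and> F \<subseteq> V \<and> V \<noteq> K"

lemma \<iota>_pCons: "\<iota> (pCons c f) = \<iota> [:c:] + xx * \<iota> f"
proof -
  have "pCons c f = [:c:] + [:0, 1:] * f" by simp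
  thus ?thesis unfolding xx_def by (metis \<iota>.hom_add \<iota>.hom_mult)
qed

lemma ev_pCons: "ev (pCons f U) = \<iota> f + w * ev U"
  unfolding ev_def by (rule ev2_pCons) (rule \<iota>.comm_ring_hom_axioms)

text \<open>As a vector space over the constants the set of values has q^e elements, and counting
  roots gives e \<le> n for the period n of \<open>P\<close>. The e-th power of Frobenius fixes all
  values, in particular both coordinates, so n divides e.\<close>

lemma range_evp_subfield:
  assumes "P \<in> curve"
  shows "finite_subfield (range (evp P))" "card (range (evp P)) = CARD('a) ^ period frob2 P"
proof -
  let ?E = "range (evp P)" and ?n = "period frob2 P"
  have fx: "(evp P U) ^ (CARD('a) ^ ?n) = evp P U" for U
    using funpow_frob_evp[of ?n P U] unfolding frob2.period(2) unfolding funpow_frob .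
  have q2: "CARD('a) ^ ?n \<ge> 2"
    using e01_pos[of P] unfolding e01_def by simp
  have sub: "?E \<subseteq> {y. y ^ (CARD('a) ^ ?n) = y}" using fx by auto
  have fin: "finite ?E" using card_fixed_points_power_le(1)[OF q2] sub finite_subset by blast
  show sf: "finite_subfield ?E"
  proof
    show "finite ?E" by fact
    show "0 \<in> ?E" by (rule range_eqI[of _ _ 0]) simp
    show "1 \<in> ?E" by (rule range_eqI[of _ _ 1]) (simp add: evp.hom_one)
    fix x y assume "x \<in> ?E" "y \<in> ?E"
    then obtain U T where h: "x = evp P U" "y = evp P T" by blast
    show "x + y \<in> ?E" "x * y \<in> ?E" unfolding h by (simp_all flip: evp.hom_add evp.hom_mult)
  next
    fix x assume "x \<in> ?E"
    then obtain U where h: "x = evp P U" by blast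
    show "- x \<in> ?E" unfolding h by (simp flip: evp.hom_uminus)
  qed
  interpret E: finite_subfield ?E by fact
  let ?C = "range (to_ac :: 'a \<Rightarrow> 'a alg_closure)"
  have cC: "card ?C = CARD('a)" using card_image[OF inj_to_ac] by simp
  have Csub: "?C \<subseteq> ?E"
  proof
    fix y assume "y \<in> ?C"
    then obtain c where "y = to_ac c" by blast
    hence "y = evp P [:[:c:]:]" by simp
    thus "y \<in> ?E" by blast
  qed
  obtain e where e: "card ?E = card ?C ^ e"
  proof (rule card_subspace_eq_power[of ?E ?C])
    show "finite ?C" by simp
    show "0 \<in> ?C" by (rule range_eqI[of _ _ 0]) simp
    show "1 \<in> ?C" by (rule range_eqI[of _ _ 1]) simp
    fix x y assume "x \<in> ?C" "y \<in> ?C"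
    then obtain c d where h: "x = to_ac c" "y = to_ac d" by blast
    show "x - y \<in> ?C" "x * y \<in> ?C" unfolding h by (simp_all flip: to_ac_diff to_ac_mult)
  next
    fix x assume "x \<in> ?C"
    then obtain c where h: "x = to_ac c" by blast
    show "inverse x \<in> ?C" unfolding h by (simp flip: to_ac_inverse)
  next
    fix x y assume "x \<in> ?C" "y \<in> ?E"
    thus "x * y \<in> ?E" using Csub E.Emult by blast
  qed (use fin E.E0 E.Eadd in blast)+
  have e: "card ?E = CARD('a) ^ e" using e cC by simp
  have q1: "CARD('a) > 1" by (rule CARD_gt_1)
  have "card ?E \<le> CARD('a) ^ ?n"
    using card_mono[OF card_fixed_points_power_le(1)[OF q2] sub] card_fixed_points_power_le(2)[OF q2, where ?'b="'a alg_closure"] by simp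
  hence le: "e \<le> ?n" unfolding e using q1 by (rule power_le_imp_le_exp[rotated])
  have fe: "(frob ^^ e) y = y" if "y \<in> ?E" for y
    using E.power_card[OF that] unfolding funpow_frob e .
  have xE: "fst P \<in> ?E"
  proof (rule range_eqI[of _ _ "[:Polynomial.monom 1 1:]"])
    show "fst P = evp P [:Polynomial.monom 1 1:]" by simp
  qed
  have yE: "snd P \<in> ?E"
  proof (rule range_eqI[of _ _ "Polynomial.monom 1 1"])
    show "snd P = evp P (Polynomial.monom 1 1)" by (simp add: ev1.hom_one)
  qed
  have "(frob2 ^^ e) P = P" unfolding funpow_frob2 using fe xE yE by simp
  hence "?n dvd e" unfolding frob2.funpow_eq_iff .
  moreover have "e > 0" using E.card_ge_2 unfolding e by (cases e) simp_all
  ultimately have "?n \<le> e" by (rule dvd_imp_le)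
  thus "card ?E = CARD('a) ^ ?n" using e le by simp
qed

lemma pt_ring_is_place:
  assumes "P \<in> curve"
  shows "is_place (pt_ring P)" "xx \<in> pt_ring P"
proof -
  interpret V: valuation_subring K "pt_ring P" by (rule pt_ring_valuation[OF assms])
  have \<iota>V: "\<iota> f \<in> pt_ring P" for f using ev_in_pt_ring[of "[:f:]" P] by simp
  thus "xx \<in> pt_ring P" unfolding xx_def .
  obtain Q where mp: "minpol (fst P) Q" by (rule min_poly_exists)
  have "evp P [:Q:] = 0" using minpolD(2)[OF mp] by simp
  hence "ev [:Q:] / ev 1 \<in> V.m" by (intro pt_ring_m[OF assms, THEN iffD2]) (simp_all add: evp.hom_one)
  hence m: "\<iota> Q \<in> V.m" by (simp add: ev.hom_one)
  have "inverse (\<iota> Q) \<notin> pt_ring P" using V.not_m_inverse[OF m] minpolD(1)[OF mp] by simp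
  moreover have "inverse (\<iota> Q) \<in> K" by (intro K_inverse \<iota>_in_K)
  ultimately have "pt_ring P \<noteq> K" by blast
  thus "is_place (pt_ring P)" unfolding is_place_def F_def using \<iota>V V.valuation_subring_axioms by blast
qed

text \<open>Modulo the maximal ideal, division by \<open>T\<close> is multiplication by T^(e01 P -
  1). Every residue class is thus represented in F_q[x, w], and classes correspond to values at
  \<open>P\<close>.\<close>

lemma pt_ring_residue_card:
  assumes P: "P \<in> curve"
  shows "residue_card (pt_ring P) = CARD('a) ^ period frob2 P"
proof -
  interpret V: valuation_subring K "pt_ring P" by (rule pt_ring_valuation[OF P])
  let ?c = "\<lambda>z. (\<lambda>y. y + z) ` V.m"
  have evm: "ev U \<in> V.m \<longleftrightarrow> evp P U = 0" for U
    using pt_ring_m[OF P, of 1 U] by (simp add: evp.hom_one ev.hom_one)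
  have "?c ` pt_ring P = range (\<lambda>U. ?c (ev U))"
  proof
    show "?c ` pt_ring P \<subseteq> range (\<lambda>U. ?c (ev U))"
    proof (rule image_subsetI)
      fix z assume z: "z \<in> pt_ring P"
      then obtain U T where zUT: "z = ev U / ev T" and T: "evp P T \<noteq> 0" unfolding pt_ring_def by blast
      have T0: "ev T \<noteq> 0" using evp_nonzero[OF P T] .
      define S where "S = U * T ^ (e01 P - 1)"
      have Te: "T ^ (e01 P - 1) * T = T ^ e01 P" using e01_pos[of P] by (metis power_minus_mult)
      have "evp P (U - S * T) = evp P U * (1 - evp P (T ^ e01 P))"
        unfolding S_def mult.assoc Te evp.hom_minus evp.hom_mult by (simp add: right_diff_distrib)
      also have "\<dots> = 0" using evp_e01[of 0 P T] T by simp
      finally have "ev (U - S * T) / ev T \<in> V.m" using pt_ring_m[OF P T] by simp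
      moreover have "ev (U - S * T) / ev T = z - ev S"
        unfolding zUT ev.hom_minus ev.hom_mult diff_divide_distrib using T0 by simp
      ultimately have "?c z = ?c (ev S)" using V.coset_eq_iff[OF z ev_in_pt_ring] by simp
      thus "?c z \<in> range (\<lambda>U. ?c (ev U))" by blast
    qed
    show "range (\<lambda>U. ?c (ev U)) \<subseteq> ?c ` pt_ring P" using ev_in_pt_ring by blast
  qed
  hence "residue_card (pt_ring P) = card (range (\<lambda>U. ?c (ev U)))" unfolding residue_card_def by simp
  also have "\<dots> = card (range (evp P))"
  proof (rule card_image_same_kernel)
    fix U T
    have "?c (ev U) = ?c (ev T) \<longleftrightarrow> ev (U - T) \<in> V.m"
      unfolding ev.hom_minus by (rule V.coset_eq_iff[OF ev_in_pt_ring ev_in_pt_ring])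
    also have "\<dots> \<longleftrightarrow> evp P U = evp P T" unfolding evm evp.hom_minus by simp
    finally show "?c (ev U) = ?c (ev T) \<longleftrightarrow> evp P U = evp P T" .
  qed
  finally show ?thesis using range_evp_subfield(2)[OF P] by simp
qed

lemma cc_hom: "comm_ring_hom (\<lambda>c::'a. [:[:c:]:])"
  by unfold_locales (simp_all add: one_pCons)

text \<open>Allows a polynomial relation satisfied by a value at one point to be moved into the
  ring, and from there to another point.\<close>

lemma evp_compose:
  fixes f :: "'a poly"
  shows "evp P (ev2 (\<lambda>c. [:[:c:]:]) G f) = poly (map_poly to_ac f) (evp P G)"
proof (induction f)
  case (pCons c f)
  have mp: "map_poly to_ac (pCons c f) = pCons (to_ac c) (map_poly to_ac f)" by (rule map_poly_pCons_0) simp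
  show ?case unfolding ev2_pCons[OF cc_hom] mp evp.hom_add evp.hom_mult pCons.IH by simp
next
  case 0
  show ?case unfolding ev2_0[OF cc_hom] by simp
qed

text \<open>Equal rings have the same functions vanishing at both points. Take G whose value g at
  \<open>P\<close> generates the nonzero residues. Its value at \<open>P'\<close> satisfies the same
  equation over F_q and is a Frobenius conjugate of g. All nonzero values at \<open>P\<close> being
  powers of g, that power of Frobenius carries \<open>P\<close> to \<open>P'\<close>.\<close>

lemma pt_ring_orbit:
  assumes P: "P \<in> curve" and P': "P' \<in> curve"
  shows "pt_ring P = pt_ring P' \<longleftrightarrow> P' \<in> orb frob2 P"
proof
  assume "P' \<in> orb frob2 P"
  then obtain j where j: "P' = (frob2 ^^ j) P" unfolding orb_def by blast
  have "evp P' T = 0 \<longleftrightarrow> evp P T = 0" for T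
    unfolding j funpow_frob_evp[symmetric] funpow_frob by simp
  thus "pt_ring P = pt_ring P'" unfolding pt_ring_def by simp
next
  assume eq: "pt_ring P = pt_ring P'"
  have ker: "evp P U = 0 \<longleftrightarrow> evp P' U = 0" for U
    using pt_ring_m[OF P, of 1 U] pt_ring_m[OF P', of 1 U] unfolding eq by (simp add: evp.hom_one)
  interpret E: finite_subfield "range (evp P)" by (rule range_evp_subfield(1)[OF P])
  obtain g where g: "g \<in> range (evp P)" "g \<noteq> 0" "\<And>y. y \<in> range (evp P) \<Longrightarrow> y \<noteq> 0 \<Longrightarrow> \<exists>k. y = g ^ k"
    using E.cyclic by metis
  obtain G where G: "g = evp P G" using g(1) by blast
  define g' where "g' = evp P' G"
  have Oo: "orb frob g \<in> orbs" by (simp add: orbs_def)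
  have mO: "map_poly frob (orb_poly (orb frob g)) = orb_poly (orb frob g)" by (rule frob_orb_poly[OF Oo])
  obtain f where f: "orb_poly (orb frob g) = map_poly to_ac f" using frob_fixed_poly[OF mO] by blast
  have root: "poly (orb_poly (orb frob g)) y = 0 \<longleftrightarrow> y \<in> orb frob g" for y
    unfolding orb_poly_def poly_prod by (simp add: prod_zero_iff)
  have "evp P (ev2 (\<lambda>c. [:[:c:]:]) G f) = 0" unfolding evp_compose f[symmetric] G[symmetric] root by simp
  hence "evp P' (ev2 (\<lambda>c. [:[:c:]:]) G f) = 0" using ker by blast
  hence "g' \<in> orb frob g" unfolding evp_compose f[symmetric] g'_def root .
  then obtain j where j: "g' = (frob ^^ j) g" unfolding orb_def by blast
  have transfer: "evp P' U = (frob ^^ j) (evp P U)" for U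
  proof (cases "evp P U = 0")
    case True
    thus ?thesis using ker[of U] unfolding funpow_frob by simp
  next
    case False
    obtain k where k: "evp P U = g ^ k" using g(3)[OF rangeI False] by blast
    hence "evp P (U - G ^ k) = 0" unfolding evp.hom_minus evp.hom_power G by simp
    hence "evp P' (U - G ^ k) = 0" using ker by blast
    hence "evp P' U = g' ^ k" unfolding evp.hom_minus evp.hom_power g'_def by simp
    also have "\<dots> = (frob ^^ j) (g ^ k)" unfolding j funpow_frob by (simp only: power_mult[symmetric] mult.commute)
    finally show ?thesis unfolding k .
  qed
  have "fst P' = (frob ^^ j) (fst P)" using transfer[of "[:Polynomial.monom 1 1:]"] by simp
  moreover have "snd P' = (frob ^^ j) (snd P)" using transfer[of "Polynomial.monom 1 1"] by (simp add: ev1.hom_one)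
  ultimately have "P' = (frob2 ^^ j) P" unfolding funpow_frob2 by (simp add: prod_eq_iff)
  thus "P' \<in> orb frob2 P" unfolding orb_def by blast
qed

lemma curve_point_exists:
  obtains \<beta> where "(\<alpha>, \<beta>) \<in> curve"
proof -
  define f :: "'a alg_closure poly" where "f = Polynomial.monom 1 p - Polynomial.monom 1 1 - [:to_ac a * \<alpha> ^ N:]"
  have "Polynomial.coeff f p = 1" using p(2) unfolding f_def coeff_diff coeff_monom by (simp add: coeff_eq_0)
  hence "degree f \<ge> p" by (intro le_degree) simp
  hence "degree f > 0" using p(2) by simp
  then obtain \<beta> where "poly f \<beta> = 0" using alg_closed_imp_poly_has_root by blast
  hence "(\<alpha>, \<beta>) \<in> curve" unfolding curve_def by (simp add: f_def poly_monom)
  thus ?thesis by (rule that)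
qed

text \<open>V lies over the minimal polynomial Q of some \<alpha>. Suppose that at each of the p
  points over \<alpha> some function vanishes that is a unit of V. The product of these functions
  vanishes on the fiber, is divisible by Q and lies in the ideal of V, which is prime, a
  contradiction. So all functions vanishing at a suitable point lie in that ideal.\<close>

lemma finite_place:
  assumes pl: "is_place V" and xV: "xx \<in> V"
  obtains P where "P \<in> curve" "V = pt_ring P"
proof -
  interpret V: valuation_subring K V using pl unfolding is_place_def by blast
  have FV: "\<iota> [:c:] \<in> V" for c using pl unfolding is_place_def F_def by blast
  have \<iota>V: "\<iota> f \<in> V" for f
  proof (induction f)
    case (pCons c f)
    thus ?case unfolding \<iota>_pCons[of c f] by (intro V.add V.mult FV xV)
  qed (simp add: V.zero)
  \<comment> \<open>\<open>w\<close> is integral over F_q[x]: if v = 1 / w were in V, then so would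
    be w = w^p v^(p-1) = (w + \<iota> h) v^(p-1).\<close>
  have wV: "w \<in> V"
  proof (rule ccontr)
    assume n: "w \<notin> V"
    have w0: "w \<noteq> 0" using n V.zero by metis
    define v where "v = inverse w"
    have vV: "v \<in> V" unfolding v_def using V.val[OF w_in_K w0] n by blast
    have vw: "w * v = 1" unfolding v_def using w0 by simp
    have "w ^ (p - 1) * v ^ (p - 1) = 1" unfolding power_mult_distrib[symmetric] vw by simp
    hence "w = w * (w ^ (p - 1) * v ^ (p - 1))" by simp
    also have "\<dots> = w ^ p * v ^ (p - 1)" using p(2) by (cases p) (simp_all add: mult.assoc)
    also have "\<dots> = (w * v) * v ^ (p - 2) + \<iota> h * v ^ (p - 1)"
    proof -
      have "p - 1 = Suc (p - 2)" using p(2) by simp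
      thus ?thesis unfolding w' distrib_right by (simp add: mult.assoc)
    qed
    also have "\<dots> \<in> V" unfolding vw by (intro V.add V.mult V.one V.power vV \<iota>V)
    finally show False using n by blast
  qed
  have evV: "ev U \<in> V" for U
  proof (induction U)
    case (pCons f U)
    thus ?case unfolding ev_pCons by (intro V.add V.mult \<iota>V wV)
  qed (simp add: V.zero)
  have "\<exists>f. f \<noteq> 0 \<and> \<iota> f \<in> V.m"
  proof (rule ccontr)
    assume h: "\<nexists>f. f \<noteq> 0 \<and> \<iota> f \<in> V.m"
    have "K \<subseteq> V"
    proof
      fix z assume "z \<in> K"
      then obtain U f where z: "z = ev U / \<iota> f" "f \<noteq> 0" by (rule K_cases)
      have "inverse (\<iota> f) \<in> V" using h z(2) V.unit[OF \<iota>V] by blast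
      thus "z \<in> V" unfolding z(1) divide_inverse by (intro V.mult evV)
    qed
    thus False using pl V.sub unfolding is_place_def by blast
  qed
  then obtain f0 where f0: "f0 \<noteq> 0" "\<iota> f0 \<in> V.m" by blast
  define S where "S n \<longleftrightarrow> (\<exists>f. f \<noteq> 0 \<and> \<iota> f \<in> V.m \<and> degree f = n)" for n
  have S0: "S (degree f0)" unfolding S_def using f0 by blast
  define e where "e = (LEAST n. S n)"
  have "S e" unfolding e_def using S0 by (rule LeastI)
  then obtain f where f: "f \<noteq> 0" "\<iota> f \<in> V.m" "degree f = e" unfolding S_def by blast
  have less: "\<iota> g \<notin> V.m" if "g \<noteq> 0" "degree g < e" for g
    using that not_less_Least[of "degree g" S] unfolding e_def S_def by blast
  have e0: "e \<noteq> 0"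
  proof
    assume "e = 0"
    then obtain c where c: "f = [:c:]" using f(3) by (auto elim!: degree_eq_zeroE)
    hence c0: "c \<noteq> 0" using f(1) by simp
    have "\<iota> [:inverse c:] * \<iota> f \<in> V.m" using V.m_mult[OF \<iota>V f(2)] .
    moreover have "\<iota> [:inverse c:] * \<iota> f = 1"
      unfolding c \<iota>.hom_mult[symmetric] using c0 by (simp add: one_pCons[symmetric])
    ultimately show False using V.one_m by simp
  qed
  have "degree (map_poly to_ac f) > 0" using e0 f(3) by simp
  then obtain \<alpha> where "poly (map_poly to_ac f) \<alpha> = 0" using alg_closed_imp_poly_has_root by blast
  hence \<alpha>: "ev1 \<alpha> f = 0" unfolding ev1_def ev2_def .
  obtain \<beta> where P: "(\<alpha>, \<beta>) \<in> curve" by (rule curve_point_exists)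
  obtain Q where mp: "minpol \<alpha> Q" by (rule min_poly_exists)
  obtain g where g: "f = Q * g" using minpol_dvd[OF mp \<alpha>] by (elim dvdE)
  have g0: "g \<noteq> 0" using g f(1) by auto
  have "degree f = degree Q + degree g" unfolding g by (rule degree_mult_eq[OF minpolD(1)[OF mp] g0])
  hence "degree g < e" using minpolD(3)[OF mp] f(3) by simp
  hence "\<iota> g \<notin> V.m" by (rule less[OF g0])
  moreover have "\<iota> Q \<in> V.m \<or> \<iota> g \<in> V.m" using f(2) unfolding g \<iota>.hom_mult by (rule V.m_prime[OF \<iota>V \<iota>V])
  ultimately have Qm: "\<iota> Q \<in> V.m" by blast
  have "\<exists>i<p. \<forall>U. evp (shift i (\<alpha>, \<beta>)) U = 0 \<longrightarrow> ev U \<in> V.m"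
  proof (rule ccontr)
    assume "\<not> ?thesis"
    hence "\<forall>i\<in>{..<p}. \<exists>U. evp (shift i (\<alpha>, \<beta>)) U = 0 \<and> ev U \<notin> V.m" by blast
    from bchoice[OF this] obtain U where U: "\<forall>i\<in>{..<p}. evp (shift i (\<alpha>, \<beta>)) (U i) = 0 \<and> ev (U i) \<notin> V.m" by blast
    have z: "evp (shift i (\<alpha>, \<beta>)) (\<Prod>j<p. U j) = 0" if "i < p" for i
    proof -
      have "evp (shift i (\<alpha>, \<beta>)) (\<Prod>j<p. U j) = (\<Prod>j<p. evp (shift i (\<alpha>, \<beta>)) (U j))" by (rule evp.hom_prod)
      also have "\<dots> = 0" using that U by (intro prod_zero) auto
      finally show ?thesis .
    qed
    have mp': "minpol (fst (\<alpha>, \<beta>)) Q" using mp by simp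
    obtain U' where U': "ev (\<Prod>j<p. U j) = \<iota> Q * ev U'" using zero_on_fiber[OF P z mp'] by blast
    have "(\<Prod>j<p. ev (U j)) = ev U' * \<iota> Q" using U' by (simp only: ev.hom_prod mult.commute)
    also have "\<dots> \<in> V.m" by (rule V.m_mult[OF evV Qm])
    finally have "(\<Prod>j<p. ev (U j)) \<in> V.m" .
    hence "\<exists>j\<in>{..<p}. ev (U j) \<in> V.m" by (intro V.m_prod) (simp_all add: evV)
    thus False using U by blast
  qed
  then obtain i where i: "\<And>U. evp (shift i (\<alpha>, \<beta>)) U = 0 \<Longrightarrow> ev U \<in> V.m" by blast
  define P where "P = shift i (\<alpha>, \<beta>)"
  have Pc: "P \<in> curve" unfolding P_def using P by (rule shift_curve)
  have ker: "ev U \<in> V.m" if "evp P U = 0" for U using that i unfolding P_def by blast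
  \<comment> \<open>T^(e01 P) takes the value 1 at \<open>P\<close>, so it is congruent to 1 modulo
    the ideal of V.\<close>
  have unit: "inverse (ev T) \<in> V" if T: "evp P T \<noteq> 0" for T
  proof -
    have "evp P (T ^ e01 P) = 1" using evp_e01[of 0 P T] T by simp
    hence "evp P (1 - T ^ e01 P) = 0" unfolding evp.hom_minus evp.hom_one by simp
    hence m1: "1 - ev T ^ e01 P \<in> V.m" using ker unfolding ev.hom_minus[symmetric] ev.hom_one[symmetric] ev.hom_power[symmetric] by blast
    have "ev T \<notin> V.m"
    proof
      assume "ev T \<in> V.m"
      hence "ev T ^ (e01 P - 1) * ev T \<in> V.m" by (intro V.m_mult V.power evV)
      moreover have "ev T ^ (e01 P - 1) * ev T = ev T ^ e01 P" using e01_pos[of P] by (rule power_minus_mult)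
      ultimately have "ev T ^ e01 P \<in> V.m" by simp
      hence "(1 - ev T ^ e01 P) + ev T ^ e01 P \<in> V.m" by (rule V.m_add[OF m1])
      thus False using V.one_m by simp
    qed
    thus ?thesis using V.unit[OF evV] by blast
  qed
  have "pt_ring P = V"
  proof (rule valuation_subring_eqI[OF pt_ring_valuation[OF Pc] V.valuation_subring_axioms])
    show "pt_ring P \<subseteq> V" unfolding pt_ring_def divide_inverse using unit evV V.mult by blast
    fix z assume z: "z \<in> valuation_subring.m (pt_ring P)"
    interpret W: valuation_subring K "pt_ring P" by (rule pt_ring_valuation[OF Pc])
    obtain U T where UT: "z = ev U / ev T" "evp P T \<noteq> 0" using W.m_sub[OF z] unfolding pt_ring_def by blast
    have "evp P U = 0" using z unfolding UT(1) pt_ring_m[OF Pc UT(2)] .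
    hence "inverse (ev T) * ev U \<in> V.m" by (intro V.m_mult unit[OF UT(2)] ker)
    thus "z \<in> V.m" unfolding UT(1) divide_inverse by (simp only: mult.commute)
  qed
  thus ?thesis using that[OF Pc] by simp
qed

end


section \<open>The place at infinity\<close>

context artin_schreier
begin

text \<open>The elements of F_q[x, w] of pole order below n at infinity. The strict bound makes
  \<open>Bd 0\<close> the zero space, where inductions start.\<close>

definition Bd :: "nat \<Rightarrow> 'k set" where
  "Bd n = {ev R | R. \<forall>j. Polynomial.coeff R j \<noteq> 0 \<longrightarrow> p * degree (Polynomial.coeff R j) + N * j < n}"

lemma Bd_Suc: "Bd (Suc n) = {ev R | R. wt R n}"
  unfolding Bd_def wt_def less_Suc_eq_le ..

lemma Bd_0: "Bd 0 = {0}"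
proof -
  have "(\<forall>j. Polynomial.coeff R j \<noteq> 0 \<longrightarrow> p * degree (Polynomial.coeff R j) + N * j < 0) \<longleftrightarrow> R = 0" for R :: "'a poly poly"
    by (simp add: poly_eq_iff)
  thus ?thesis unfolding Bd_def by simp
qed

lemma zero_Bd: "0 \<in> Bd n" unfolding Bd_def by (auto intro!: exI[of _ 0])

lemma Bd_mono: "u \<in> Bd m \<Longrightarrow> m \<le> n \<Longrightarrow> u \<in> Bd n"
  unfolding Bd_def using order.strict_trans2 by blast

lemma Bd_add:
  assumes "u \<in> Bd n" "v \<in> Bd n"
  shows "u + v \<in> Bd n"
proof (cases n)
  case 0
  thus ?thesis using assms by (simp add: Bd_0)
next
  case (Suc k)
  then obtain U T where "u = ev U" "v = ev T" "wt U k" "wt T k" using assms Bd_Suc by auto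
  hence "u + v = ev (U + T) \<and> wt (U + T) k" using wt_add ev.hom_add[of U T] by simp
  thus ?thesis unfolding Suc Bd_Suc by blast
qed

lemma Bd_uminus:
  assumes "u \<in> Bd n"
  shows "- u \<in> Bd n"
proof (cases n)
  case 0
  thus ?thesis using assms by (simp add: Bd_0)
next
  case (Suc k)
  then obtain U where "u = ev U" "wt U k" using assms Bd_Suc by auto
  hence "- u = ev (- U) \<and> wt (- U) k" using wt_uminus[of U k] ev.hom_uminus[of U] by simp
  thus ?thesis unfolding Suc Bd_Suc by blast
qed

lemma Bd_diff: "u \<in> Bd n \<Longrightarrow> v \<in> Bd n \<Longrightarrow> u - v \<in> Bd n"
  using Bd_add[of u n "- v"] Bd_uminus by simp

lemma wt_sum: "finite I \<Longrightarrow> (\<And>i. i \<in> I \<Longrightarrow> wt (f i) n) \<Longrightarrow> wt (\<Sum>i\<in>I. f i) n"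
  by (induction I rule: finite_induct) (simp_all add: wt_add)

lemma wt_mult:
  assumes "wt U m" "wt T n"
  shows "wt (U * T) (m + n)"
proof -
  have m: "wt (Polynomial.monom (Polynomial.coeff U j) j * T) (m + n)" for j
    unfolding wt_def
  proof (intro allI impI)
    fix k
    let ?c = "Polynomial.coeff U j" and ?d = "Polynomial.coeff T (k - j)"
    assume "Polynomial.coeff (Polynomial.monom ?c j * T) k \<noteq> 0"
    hence k: "j \<le> k" "?c \<noteq> 0" "?d \<noteq> 0" and e: "Polynomial.coeff (Polynomial.monom ?c j * T) k = ?c * ?d"
      by (auto simp: coeff_monom_mult split: if_splits)
    have "p * degree ?c + N * j \<le> m" "p * degree ?d + N * (k - j) \<le> n"
      using assms k unfolding wt_def by blast+
    moreover have "N * k = N * j + N * (k - j)" using k(1) by (simp flip: distrib_left)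
    ultimately show "p * degree (Polynomial.coeff (Polynomial.monom ?c j * T) k) + N * k \<le> m + n"
      unfolding e degree_mult_eq[OF k(2,3)] distrib_left by linarith
  qed
  have "U * T = (\<Sum>j\<le>degree U. Polynomial.monom (Polynomial.coeff U j) j) * T" by (simp add: poly_as_sum_of_monoms)
  also have "\<dots> = (\<Sum>j\<le>degree U. Polynomial.monom (Polynomial.coeff U j) j * T)" by (rule sum_distrib_right)
  finally show ?thesis using wt_sum[of "{..degree U}", OF finite_atMost m] by simp
qed

lemma Bd_mult:
  assumes "u \<in> Bd (Suc m)" "v \<in> Bd n"
  shows "u * v \<in> Bd (m + n)"
proof (cases n)
  case 0
  thus ?thesis using assms zero_Bd by (simp add: Bd_0)
next
  case (Suc k)
  obtain U where U: "u = ev U" "wt U m" using assms Bd_Suc by auto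
  obtain T where T: "v = ev T" "wt T k" using assms unfolding Suc Bd_Suc by auto
  have "u * v = ev (U * T)" unfolding U T ev.hom_mult ..
  moreover have "wt (U * T) (m + k)" using wt_mult U T by blast
  ultimately show ?thesis unfolding Suc add_Suc_right Bd_Suc by blast
qed

lemma Bd_range: "u \<in> Bd n \<Longrightarrow> u \<in> range ev" unfolding Bd_def by blast

lemma range_ev_Bd: "\<exists>n. ev U \<in> Bd (Suc n)" unfolding Bd_Suc using wt_exists[of U] by blast

lemma Bd_normal:
  assumes "u \<in> Bd (Suc n)"
  obtains R where "u = ev R" "degree R < p" "wt R n"
proof -
  obtain U where U: "u = ev U" "wt U n" using assms Bd_Suc by auto
  obtain Q R where QR: "U = asP * Q + R" "degree R < p" "wt R n" using reduce[OF U(2)] by blast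
  have "u = ev R" unfolding U QR(1) ev.hom_add ev.hom_mult by simp
  thus ?thesis using that QR by blast
qed

section \<open>Leading terms and the valuation ring at infinity\<close>

definition mono :: "'a \<Rightarrow> nat \<Rightarrow> nat \<Rightarrow> 'k" where "mono c r s = \<iota> [:c:] * xx ^ r * w ^ s"

lemma \<iota>_monom: "\<iota> (Polynomial.monom c r) = \<iota> [:c:] * xx ^ r"
proof -
  have "Polynomial.monom c r = [:c:] * [:0, 1:] ^ r" by (simp add: monom_altdef)
  thus ?thesis unfolding xx_def by (simp only: \<iota>.hom_mult \<iota>.hom_power)
qed

lemma mono_ev: "mono c r s = ev (Polynomial.monom (Polynomial.monom c r) s)"
  unfolding mono_def by (simp add: \<iota>_monom)

lemma mono_Bd: "p * r + N * s \<le> n \<Longrightarrow> mono c r s \<in> Bd (Suc n)"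
proof -
  assume "p * r + N * s \<le> n"
  hence "wt (Polynomial.monom (Polynomial.monom c r) s) n"
    unfolding wt_monom by (cases "c = 0") (auto simp: degree_monom_eq)
  thus ?thesis unfolding Bd_Suc mono_ev by blast
qed

lemma mono_mult: "mono c r s * mono d r' s' = mono (c * d) (r + r') (s + s')"
proof -
  have "\<iota> [:c * d:] = \<iota> [:c:] * \<iota> [:d:]" by (simp flip: \<iota>.hom_mult)
  thus ?thesis unfolding mono_def power_add by (simp only: mult_ac)
qed

text \<open>Pole order exactly n, witnessed by a leading monomial in which the exponent of w is
  below p.\<close>

definition lead :: "'k \<Rightarrow> nat \<Rightarrow> bool" where
  "lead t n \<longleftrightarrow> (\<exists>c r s. c \<noteq> 0 \<and> s < p \<and> n = p * r + N * s \<and> t - mono c r s \<in> Bd n)"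

lemma lead_add: "lead t n \<Longrightarrow> u \<in> Bd n \<Longrightarrow> lead (t + u) n"
proof -
  assume "lead t n" "u \<in> Bd n"
  then obtain c r s where h: "c \<noteq> 0" "s < p" "n = p * r + N * s" "t - mono c r s \<in> Bd n" "u \<in> Bd n"
    unfolding lead_def by blast
  have "t + u - mono c r s = (t - mono c r s) + u" by simp
  also have "\<dots> \<in> Bd n" using h by (intro Bd_add)
  finally show ?thesis unfolding lead_def using h by blast
qed

text \<open>Replacing w^p by a x^N + w splits the monomial into one of the same weight, with nonzero
  coefficient c a, and one of smaller weight.\<close>

lemma lead_mono: "c \<noteq> 0 \<Longrightarrow> lead (mono c r s) (p * r + N * s)"
proof (induction s arbitrary: c r rule: less_induct)
  case (less s)
  show ?case
  proof (cases "s < p")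
    case True
    thus ?thesis unfolding lead_def using less.prems zero_Bd by (intro exI[of _ c] exI[of _ r] exI[of _ s]) simp
  next
    case False
    have "w ^ s = w ^ (s - p) * w ^ p" using False by (simp flip: power_add)
    also have "\<dots> = w ^ (s - p) * \<iota> h + w ^ Suc (s - p)" unfolding w' by (simp add: distrib_left mult.commute)
    finally have ws: "w ^ s = w ^ (s - p) * \<iota> h + w ^ Suc (s - p)" .
    have ih: "\<iota> h = mono a N 0" unfolding h_def \<iota>_monom mono_def by simp
    have "mono c r s = mono c r (s - p) * mono a N 0 + mono c r (Suc (s - p))"
      unfolding mono_def[of c] ws ih by (simp only: distrib_left mult.assoc)
    hence eq: "mono c r s = mono (c * a) (r + N) (s - p) + mono c r (Suc (s - p))" unfolding mono_mult by simp
    have n: "p * (r + N) + N * (s - p) = p * r + N * s"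
    proof -
      have "N * s = N * p + N * (s - p)" using False by (simp flip: distrib_left)
      thus ?thesis by (simp add: distrib_left mult.commute)
    qed
    have "s - p < s" using False p(2) by simp
    moreover have "c * a \<noteq> 0" using less.prems a0 by simp
    ultimately have l: "lead (mono (c * a) (r + N) (s - p)) (p * r + N * s)" using less.IH[of "s - p" "c * a" "r + N"] n by simp
    have "Suc (s - p) < s" using False p(2) by simp
    hence lt: "N * Suc (s - p) < N * s" using N_pos by (rule mult_less_mono2)
    have "mono c r (Suc (s - p)) \<in> Bd (Suc (p * r + N * Suc (s - p)))" by (rule mono_Bd) simp
    hence "mono c r (Suc (s - p)) \<in> Bd (p * r + N * s)" using lt by (elim Bd_mono) linarith
    thus ?thesis unfolding eq using l lead_add by blast
  qed
qed

lemma lead_Bd: "lead t n \<Longrightarrow> t \<in> Bd (Suc n)"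
proof -
  assume "lead t n"
  then obtain c r s where h: "n = p * r + N * s" "t - mono c r s \<in> Bd n" unfolding lead_def by blast
  have "t - mono c r s \<in> Bd (Suc n)" using h(2) by (rule Bd_mono) simp
  moreover have "mono c r s \<in> Bd (Suc n)" using h(1) by (intro mono_Bd) simp
  ultimately have "(t - mono c r s) + mono c r s \<in> Bd (Suc n)" by (rule Bd_add)
  thus ?thesis by simp
qed

lemma lead_mult:
  assumes "lead t m" "lead u n"
  shows "lead (t * u) (m + n)"
proof -
  obtain c r s where h: "c \<noteq> 0" "m = p * r + N * s" "t - mono c r s \<in> Bd m" using assms(1) unfolding lead_def by blast
  obtain d r' s' where h': "d \<noteq> 0" "n = p * r' + N * s'" "u - mono d r' s' \<in> Bd n" using assms(2) unfolding lead_def by blast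
  have "mono c r s \<in> Bd (Suc m)" using h(2) by (intro mono_Bd) simp
  hence 1: "mono c r s * (u - mono d r' s') \<in> Bd (m + n)" using h'(3) by (rule Bd_mult)
  have 2: "u * (t - mono c r s) \<in> Bd (n + m)" using lead_Bd[OF assms(2)] h(3) by (rule Bd_mult)
  have "lead (mono c r s * mono d r' s') (m + n)"
    using lead_mono[of "c * d" "r + r'" "s + s'"] h h' unfolding mono_mult by (simp add: distrib_left add_ac)
  hence "lead (mono c r s * mono d r' s' + (mono c r s * (u - mono d r' s') + u * (t - mono c r s))) (m + n)"
    using 1 2 by (intro lead_add Bd_add) (simp_all add: add.commute)
  thus ?thesis by (simp add: right_diff_distrib mult.commute)
qed

text \<open>The powers of w below p are independent, so the reduced form is unique; the monomial is
  its own reduced form and has weight exactly p r + N s.\<close>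

lemma mono_not_Bd: 
  assumes "c \<noteq> 0" "s < p"
  shows "mono c r s \<notin> Bd (p * r + N * s)"
proof
  assume h: "mono c r s \<in> Bd (p * r + N * s)"
  let ?M = "Polynomial.monom (Polynomial.monom c r) s"
  have nz: "?M \<noteq> 0" using assms(1) by (simp add: monom_eq_0_iff)
  have dM: "degree ?M < p" using assms(2) degree_monom_le le_less_trans by blast
  show False
  proof (cases "p * r + N * s")
    case 0
    hence "ev ?M = 0" using h unfolding mono_ev by (simp only: Bd_0 singleton_iff)
    thus False using ev_independent[OF dM] nz by blast
  next
    case (Suc k)
    obtain R where R: "mono c r s = ev R" "degree R < p" "wt R k" using h unfolding Suc by (rule Bd_normal)
    have "ev (?M - R) = 0" unfolding ev.hom_minus using R(1) unfolding mono_ev by simp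
    moreover have "degree (?M - R) < p" using dM R(2) by (rule degree_diff_less)
    ultimately have "?M - R = 0" using ev_independent by blast
    hence "wt ?M k" using R(3) by simp
    hence "p * r + N * s \<le> k" unfolding wt_monom using assms(1) by (simp add: degree_monom_eq monom_eq_0_iff)
    thus False using Suc by simp
  qed
qed

lemma lead_not_Bd: "lead t n \<Longrightarrow> t \<notin> Bd n"
proof
  assume "lead t n" and t: "t \<in> Bd n"
  then obtain c r s where h: "c \<noteq> 0" "s < p" "n = p * r + N * s" "t - mono c r s \<in> Bd n" unfolding lead_def by blast
  have "t - (t - mono c r s) \<in> Bd n" using t h(4) by (rule Bd_diff)
  thus False using mono_not_Bd[OF h(1,2), of r] h(3) by simp
qed

text \<open>As p does not divide N, the weight determines s modulo p. This is total ramification: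
  each pole order belongs to at most one reduced monomial, and the residue field is that of the
  constants.\<close>

lemma weight_inj:
  assumes "s < p" "s' < p" "p * r + N * s = p * r' + N * s'"
  shows "s = s'" "r = r'"
proof -
  have "[p * r + N * s = p * r' + N * s'] (mod p)" using assms(3) by simp
  hence "[N * s = N * s'] (mod p)" unfolding cong_def by simp
  moreover have "coprime N p" using not_dvd_N p(1) by (metis coprime_commute prime_imp_coprime)
  ultimately have "[s = s'] (mod p)" using cong_mult_lcancel_nat by blast
  thus s: "s = s'" using assms(1,2) by (simp add: cong_less_modulus_unique_nat)
  have "p * r = p * r'" using assms(3) unfolding s by simp
  thus "r = r'" using p(2) by simp
qed

text \<open>By \<open>weight_inj\<close> at most one coefficient of the normal form reaches weight
  n; subtracting its top monomial brings the rest below n.\<close>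

lemma lead_or:
  assumes "u \<in> Bd (Suc n)"
  shows "u \<in> Bd n \<or> lead u n"
proof -
  obtain R where R: "u = ev R" "degree R < p" "wt R n" using assms by (rule Bd_normal)
  have le: "p * degree (Polynomial.coeff R j) + N * j \<le> n" if "Polynomial.coeff R j \<noteq> 0" for j
    using R(3) that unfolding wt_def by blast
  have jp: "j < p" if "Polynomial.coeff R j \<noteq> 0" for j using le_degree[OF that] R(2) by simp
  show ?thesis
  proof (cases "\<exists>j. Polynomial.coeff R j \<noteq> 0 \<and> p * degree (Polynomial.coeff R j) + N * j = n")
    case False
    hence "u \<in> Bd n" unfolding Bd_def R(1) using le order.not_eq_order_implies_strict by blast
    thus ?thesis ..
  next
    case True
    then obtain j where j: "Polynomial.coeff R j \<noteq> 0" "p * degree (Polynomial.coeff R j) + N * j = n" by blast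
    define f where "f = Polynomial.coeff R j"
    define S where "S = R - Polynomial.monom (Polynomial.monom (lead_coeff f) (degree f)) j"
    have "p * degree (Polynomial.coeff S i) + N * i < n" if nz: "Polynomial.coeff S i \<noteq> 0" for i
    proof (cases "i = j")
      case True
      have c: "Polynomial.coeff S j = f - Polynomial.monom (lead_coeff f) (degree f)" unfolding S_def f_def by simp
      have "f - Polynomial.monom (lead_coeff f) (degree f) \<noteq> 0" using nz unfolding True c .
      hence "degree (f - Polynomial.monom (lead_coeff f) (degree f)) < degree f"
      proof -
        assume nz: "f - Polynomial.monom (lead_coeff f) (degree f) \<noteq> 0"
        have "degree (f - Polynomial.monom (lead_coeff f) (degree f)) \<le> degree f"
          by (intro degree_diff_le degree_monom_le) simp
        moreover have "degree (f - Polynomial.monom (lead_coeff f) (degree f)) \<noteq> degree f"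
        proof
          assume e: "degree (f - Polynomial.monom (lead_coeff f) (degree f)) = degree f"
          have "Polynomial.coeff (f - Polynomial.monom (lead_coeff f) (degree f)) (degree f) = 0" by simp
          hence "lead_coeff (f - Polynomial.monom (lead_coeff f) (degree f)) = 0" using e by metis
          thus False using nz by (metis leading_coeff_0_iff)
        qed
        ultimately show ?thesis by simp
      qed
      moreover have "p > 0" using p(2) by simp
      ultimately have "p * degree (f - Polynomial.monom (lead_coeff f) (degree f)) < p * degree f" by (rule mult_less_mono2)
      thus ?thesis using j(2) unfolding True c f_def[symmetric] by linarith
    next
      case False
      have c: "Polynomial.coeff S i = Polynomial.coeff R i" unfolding S_def using False by simp
      have nz': "Polynomial.coeff R i \<noteq> 0" using nz c by simp
      have "p * degree (Polynomial.coeff R i) + N * i \<noteq> n"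
        using weight_inj(1)[OF jp[OF nz'] jp[OF j(1)]] False j(2) by metis
      thus ?thesis unfolding c using le[OF nz'] by simp
    qed
    hence "ev S \<in> Bd n" unfolding Bd_def by blast
    moreover have "ev S = u - mono (lead_coeff f) (degree f) j" unfolding S_def ev.hom_minus R(1) mono_ev ..
    ultimately have "lead u n" unfolding lead_def using j jp[OF j(1)]
      by (intro exI[of _ "lead_coeff f"] exI[of _ "degree f"] exI[of _ j]) (simp add: f_def)
    thus ?thesis ..
  qed
qed

lemma lead_exists:
  assumes "ev U \<noteq> 0"
  obtains n where "lead (ev U) n"
proof -
  obtain n where n: "ev U \<in> Bd (Suc n)" using range_ev_Bd by blast
  have "ev U \<in> Bd k \<Longrightarrow> \<exists>n. lead (ev U) n" for k
  proof (induction k)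
    case 0
    thus ?case using assms by (simp add: Bd_0)
  next
    case (Suc k)
    thus ?case using lead_or by blast
  qed
  thus ?thesis using n that by blast
qed

lemma const_mult_Bd: "u \<in> Bd n \<Longrightarrow> \<iota> [:c:] * u \<in> Bd n"
  using Bd_mult[of "mono c 0 0" 0 u n] mono_Bd[of 0 0 0 c] by (simp add: mono_def)

lemma lead_proportional:
  assumes "lead t n" "lead u n"
  obtains c where "u - \<iota> [:c:] * t \<in> Bd n"
proof -
  obtain c r s where h: "c \<noteq> 0" "s < p" "n = p * r + N * s" "t - mono c r s \<in> Bd n" using assms(1) unfolding lead_def by blast
  obtain d r' s' where h': "d \<noteq> 0" "s' < p" "n = p * r' + N * s'" "u - mono d r' s' \<in> Bd n" using assms(2) unfolding lead_def by blast
  have e: "s' = s" "r' = r" using weight_inj[OF h'(2) h(2)] h(3) h'(3) by metis+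
  have "\<iota> [:d / c:] * mono c r s = mono d r s"
  proof -
    have "\<iota> [:d / c:] * \<iota> [:c:] = \<iota> [:d:]" using h(1) by (simp flip: \<iota>.hom_mult)
    thus ?thesis unfolding mono_def by (simp only: mult.assoc[symmetric])
  qed
  hence "u - \<iota> [:d / c:] * t = (u - mono d r s) - \<iota> [:d / c:] * (t - mono c r s)" by (simp add: right_diff_distrib)
  also have "\<dots> \<in> Bd n" using h(4) h'(4) unfolding e by (intro Bd_diff[of "u - mono d r s"] const_mult_Bd)
  finally show ?thesis by (rule that)
qed

lemma lead_nonzero: "lead t n \<Longrightarrow> t \<noteq> 0" using lead_not_Bd zero_Bd by blast

lemma lead_one: "lead 1 0"
  using lead_mono[of 1 0 0] by (simp add: mono_def flip: one_pCons)

text \<open>Quotients of elements of F_q[x, w] whose numerator has no larger pole order than the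
  denominator.\<close>

definition inf_ring :: "'k set" where
  "inf_ring = {u / t | u t. \<exists>n. lead t n \<and> u \<in> Bd (Suc n)}"

lemma inf_ringI: "lead t n \<Longrightarrow> u \<in> Bd (Suc n) \<Longrightarrow> u / t \<in> inf_ring"
  unfolding inf_ring_def by blast

lemma inf_ring_cases:
  assumes "z \<in> inf_ring"
  obtains u t n where "z = u / t" "lead t n" "u \<in> Bd (Suc n)"
  using assms unfolding inf_ring_def by blast

lemma Bd_K: "u \<in> Bd n \<Longrightarrow> u \<in> K" using Bd_range ev_in_K by blast

lemma inf_ring_valuation: "valuation_subring K inf_ring"
proof
  show "inf_ring \<subseteq> K" using inf_ring_cases K_divide Bd_K lead_Bd by (metis subsetI)
  show "1 \<in> inf_ring" using inf_ringI[OF lead_one lead_Bd[OF lead_one]] by simp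
  show "x / y \<in> K" if "x \<in> K" "y \<in> K" for x y using that by (rule K_divide)
  fix x y assume "x \<in> inf_ring" "y \<in> inf_ring"
  then obtain u t m v s n where h: "x = u / t" "lead t m" "u \<in> Bd (Suc m)" "y = v / s" "lead s n" "v \<in> Bd (Suc n)"
    by (metis inf_ring_cases)
  have nz: "t \<noteq> 0" "s \<noteq> 0" using lead_nonzero h by blast+
  have l: "lead (t * s) (m + n)" using h by (intro lead_mult)
  have "u * v \<in> Bd (m + Suc n)" using h(3,6) by (rule Bd_mult)
  hence "(u * v) / (t * s) \<in> inf_ring" using inf_ringI[OF l] by simp
  thus "x * y \<in> inf_ring" unfolding h by simp
  have "u * s \<in> Bd (m + Suc n)" using h(3) lead_Bd[OF h(5)] by (rule Bd_mult)
  moreover have "t * v \<in> Bd (m + Suc n)" using lead_Bd[OF h(2)] h(6) by (rule Bd_mult)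
  ultimately have "u * s - t * v \<in> Bd (m + Suc n)" by (rule Bd_diff)
  hence "(u * s - t * v) / (t * s) \<in> inf_ring" using inf_ringI[OF l] by simp
  thus "x - y \<in> inf_ring" unfolding h diff_frac_eq[OF nz] by (simp only: mult.commute)
next
  fix z assume z: "z \<in> K" "z \<noteq> 0"
  obtain U f where zf: "z = ev U / \<iota> f" "f \<noteq> 0" using z(1) by (rule K_cases)
  have "ev U \<noteq> 0" using z(2) zf(1) by auto
  then obtain m where m: "lead (ev U) m" by (rule lead_exists)
  have "ev [:f:] \<noteq> 0" using zf(2) by simp
  then obtain n where "lead (ev [:f:]) n" by (rule lead_exists)
  hence n: "lead (\<iota> f) n" by simp
  show "z \<in> inf_ring \<or> inverse z \<in> inf_ring"
  proof (cases "m \<le> n")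
    case True
    have "ev U \<in> Bd (Suc n)" using lead_Bd[OF m] True by (elim Bd_mono) simp
    thus ?thesis unfolding zf(1) using inf_ringI[OF n] by blast
  next
    case False
    have "\<iota> f \<in> Bd (Suc m)" using lead_Bd[OF n] False by (elim Bd_mono) simp
    hence "\<iota> f / ev U \<in> inf_ring" using inf_ringI[OF m] by blast
    thus ?thesis unfolding zf(1) by simp
  qed
qed

lemma inf_ring_m:
  assumes t: "lead t n" and u: "u \<in> Bd (Suc n)"
  shows "u / t \<in> valuation_subring.m inf_ring \<longleftrightarrow> u \<in> Bd n"
proof -
  interpret V: valuation_subring K inf_ring by (rule inf_ring_valuation)
  show ?thesis
  proof
    assume h: "u / t \<in> V.m"
    show "u \<in> Bd n"
    proof (rule ccontr)
      assume "u \<notin> Bd n"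
      hence l: "lead u n" using lead_or[OF u] by blast
      have "t / u \<in> inf_ring" using inf_ringI[OF l lead_Bd[OF t]] .
      moreover have "u / t \<noteq> 0" using lead_nonzero l t by simp
      ultimately show False using V.not_m_inverse[OF h] by simp
    qed
  next
    assume un: "u \<in> Bd n"
    have "inverse (u / t) \<notin> inf_ring" if "u \<noteq> 0"
    proof
      assume "inverse (u / t) \<in> inf_ring"
      then obtain v s k where vs: "inverse (u / t) = v / s" "lead s k" "v \<in> Bd (Suc k)" by (rule inf_ring_cases)
      have nz: "s \<noteq> 0" using lead_nonzero vs(2) by blast
      have "t / u = v / s" using vs(1) by simp
      hence "t * s = v * u" using nz that by (simp add: frac_eq_eq)
      moreover have "v * u \<in> Bd (k + n)" using vs(3) un by (rule Bd_mult)
      moreover have "lead (t * s) (n + k)" using t vs(2) by (rule lead_mult)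
      ultimately show False using lead_not_Bd by (simp add: add.commute)
    qed
    thus "u / t \<in> V.m" unfolding V.m_def using inf_ringI[OF t u] by auto
  qed
qed

lemma const_Bd: "\<iota> [:c:] \<in> Bd (Suc n)"
  using mono_Bd[of 0 0 n c] by (simp add: mono_def)

lemma inf_ring_const: "\<iota> [:c:] \<in> inf_ring"
  using inf_ringI[OF lead_one const_Bd, of c] by simp

lemma inf_ring_is_place: "is_place inf_ring" "xx \<notin> inf_ring"
proof -
  interpret V: valuation_subring K inf_ring by (rule inf_ring_valuation)
  show x: "xx \<notin> inf_ring"
  proof
    assume "xx \<in> inf_ring"
    then obtain u t n where h: "xx = u / t" "lead t n" "u \<in> Bd (Suc n)" by (rule inf_ring_cases)
    have "xx * t = u" using h(1) lead_nonzero[OF h(2)] by simp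
    moreover have "lead xx p" using lead_mono[of 1 1 0] by (simp add: mono_def flip: one_pCons)
    ultimately have "lead u (p + n)" using lead_mult h(2) by blast
    hence "u \<notin> Bd (p + n)" by (rule lead_not_Bd)
    moreover have "Suc n \<le> p + n" using p(2) by simp
    ultimately show False using Bd_mono[OF h(3)] by blast
  qed
  have "xx \<in> K" unfolding xx_def by (rule \<iota>_in_K)
  thus "is_place inf_ring" unfolding is_place_def F_def using x V.valuation_subring_axioms inf_ring_const by blast
qed

text \<open>Two functions of equal pole order have proportional leading terms, with a factor in F_q;
  a smaller numerator has residue 0.\<close>

lemma inf_ring_residue:
  assumes "z \<in> inf_ring"
  obtains c where "z - \<iota> [:c:] \<in> valuation_subring.m inf_ring"
proof -
  obtain u t n where h: "z = u / t" "lead t n" "u \<in> Bd (Suc n)" using assms by (rule inf_ring_cases)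
  have "\<exists>c. u - \<iota> [:c:] * t \<in> Bd n"
  proof (cases "u \<in> Bd n")
    case True
    thus ?thesis by (intro exI[of _ 0]) simp
  next
    case False
    hence "lead u n" using lead_or h(3) by blast
    thus ?thesis using lead_proportional[OF h(2)] by metis
  qed
  then obtain c where c: "u - \<iota> [:c:] * t \<in> Bd n" by blast
  have "u - \<iota> [:c:] * t \<in> Bd (Suc n)" using c by (rule Bd_mono) simp
  hence "(u - \<iota> [:c:] * t) / t \<in> valuation_subring.m inf_ring" using inf_ring_m[OF h(2)] c by blast
  moreover have "(u - \<iota> [:c:] * t) / t = z - \<iota> [:c:]"
    unfolding h(1) diff_divide_distrib using lead_nonzero[OF h(2)] by simp
  ultimately show ?thesis using that by metis
qed

lemma inf_ring_const_m: "\<iota> [:c:] \<in> valuation_subring.m inf_ring \<longleftrightarrow> c = 0"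
proof -
  interpret V: valuation_subring K inf_ring by (rule inf_ring_valuation)
  have "\<iota> [:c:] / 1 \<in> V.m \<longleftrightarrow> \<iota> [:c:] \<in> Bd 0" by (rule inf_ring_m[OF lead_one const_Bd])
  thus ?thesis by (simp add: Bd_0)
qed

lemma inf_ring_residue_card: "residue_card inf_ring = CARD('a)"
proof -
  interpret V: valuation_subring K inf_ring by (rule inf_ring_valuation)
  let ?c = "\<lambda>z. (\<lambda>y. y + z) ` V.m"
  have "?c ` inf_ring = range (\<lambda>c. ?c (\<iota> [:c:]))"
  proof
    show "?c ` inf_ring \<subseteq> range (\<lambda>c. ?c (\<iota> [:c:]))"
    proof (rule image_subsetI)
      fix z assume z: "z \<in> inf_ring"
      then obtain c where "z - \<iota> [:c:] \<in> V.m" by (rule inf_ring_residue)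
      hence "?c z = ?c (\<iota> [:c:])" using V.coset_eq_iff[OF z inf_ring_const] by simp
      thus "?c z \<in> range (\<lambda>c. ?c (\<iota> [:c:]))" by blast
    qed
    show "range (\<lambda>c. ?c (\<iota> [:c:])) \<subseteq> ?c ` inf_ring" using inf_ring_const by blast
  qed
  moreover have "inj (\<lambda>c. ?c (\<iota> [:c:]))"
  proof (rule injI)
    fix c d assume "?c (\<iota> [:c:]) = ?c (\<iota> [:d:])"
    hence "\<iota> [:c:] - \<iota> [:d:] \<in> V.m" using V.coset_eq_iff[OF inf_ring_const inf_ring_const] by simp
    hence "\<iota> [:c - d:] \<in> V.m" by (simp flip: \<iota>.hom_minus)
    thus "c = d" using inf_ring_const_m[of "c - d"] by simp
  qed
  ultimately show ?thesis unfolding residue_card_def by (simp add: card_image)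
qed

lemma ev_expand:
  "ev U = (\<Sum>j\<le>degree U. \<Sum>i\<le>degree (Polynomial.coeff U j). mono (Polynomial.coeff (Polynomial.coeff U j) i) i j)"
proof -
  have "ev U = ev (\<Sum>j\<le>degree U. Polynomial.monom (Polynomial.coeff U j) j)" by (simp add: poly_as_sum_of_monoms)
  also have "\<dots> = (\<Sum>j\<le>degree U. \<iota> (Polynomial.coeff U j) * w ^ j)" by (simp add: ev.hom_sum)
  also have "\<dots> = (\<Sum>j\<le>degree U. \<Sum>i\<le>degree (Polynomial.coeff U j). mono (Polynomial.coeff (Polynomial.coeff U j) i) i j)"
  proof (rule sum.cong[OF refl])
    fix j
    let ?f = "Polynomial.coeff U j"
    have "\<iota> ?f = \<iota> (\<Sum>i\<le>degree ?f. Polynomial.monom (Polynomial.coeff ?f i) i)" by (simp add: poly_as_sum_of_monoms)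
    also have "\<dots> = (\<Sum>i\<le>degree ?f. \<iota> [:Polynomial.coeff ?f i:] * xx ^ i)" by (simp add: \<iota>.hom_sum \<iota>_monom)
    finally show "\<iota> ?f * w ^ j = (\<Sum>i\<le>degree ?f. mono (Polynomial.coeff ?f i) i j)" by (simp add: sum_distrib_right mono_def)
  qed
  finally show ?thesis .
qed

lemma (in valuation_subring) m_sum: "finite I \<Longrightarrow> (\<And>i. i \<in> I \<Longrightarrow> f i \<in> m) \<Longrightarrow> (\<Sum>i\<in>I. f i) \<in> m"
  by (induction I rule: finite_induct) (simp_all add: zero_m m_add)

lemma (in valuation_subring) one_minus_unit:
  assumes "z \<in> m"
  shows "1 - z \<in> V" "1 - z \<noteq> 0" "inverse (1 - z) \<in> V"
proof -
  show v: "1 - z \<in> V" using diff one m_sub assms by blast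
  have "1 - z \<notin> m"
  proof
    assume "1 - z \<in> m"
    hence "(1 - z) + z \<in> m" using assms by (rule m_add)
    thus False using one_m by simp
  qed
  thus "1 - z \<noteq> 0" "inverse (1 - z) \<in> V" using unit v by blast+
qed

text \<open>If x has a pole, so has w, and w^p = g x^N with a unit g. The p-th power of a quotient
  of monomials is then a unit times a power of x given by the weights, so the weights decide which
  quotients lie in the ideal. Expanding into monomials, the ideal of \<open>inf_ring\<close> is
  contained in that of V; and elements of \<open>inf_ring\<close> are constants modulo their
  ideal.\<close>

lemma infinite_place:
  assumes pl: "is_place V" and xV: "xx \<notin> V"
  shows "V = inf_ring"
proof -
  interpret V: valuation_subring K V using pl unfolding is_place_def by blast
  interpret W: valuation_subring K inf_ring by (rule inf_ring_valuation)
  have FV: "\<iota> [:c:] \<in> V" for c using pl unfolding is_place_def F_def by blast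
  have x0: "xx \<noteq> 0" using xV V.zero by metis
  have w0: "w \<noteq> 0"
  proof
    assume "w = 0"
    hence "\<iota> h = 0" using w' p(2) by (simp add: zero_power)
    thus False using degree_h by simp
  qed
  have xK: "xx \<in> K" unfolding xx_def by (rule \<iota>_in_K)
  have xm: "inverse xx \<in> V.m" using V.inverse_m[OF xK xV] .
  have xpm: "inverse xx ^ Suc k \<in> V.m" for k
    using V.m_mult[OF V.power[OF V.m_sub[OF xm], of k] xm] by (simp add: mult.commute)
  have ca: "\<iota> [:inverse a:] * \<iota> [:a:] = 1" using a0 by (simp flip: \<iota>.hom_mult one_pCons)
  have ih: "\<iota> h = \<iota> [:a:] * xx ^ N" unfolding h_def \<iota>_monom ..
  have wV: "w \<notin> V"
  proof
    assume "w \<in> V"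
    hence "w ^ p - w \<in> V" by (intro V.diff V.power)
    hence "\<iota> [:inverse a:] * (\<iota> [:a:] * xx ^ N) \<in> V" using V.mult[OF FV] unfolding w' ih by simp
    hence "xx ^ N \<in> V" unfolding mult.assoc[symmetric] ca by simp
    hence "xx ^ N * inverse xx ^ N \<in> V.m" using V.m_mult xpm[of "N - 1"] N_pos by simp
    moreover have "xx ^ N * inverse xx ^ N = 1" unfolding power_mult_distrib[symmetric] using x0 by simp
    ultimately show False using V.one_m by simp
  qed
  have wm: "inverse w \<in> V.m" using V.inverse_m[OF w_in_K wV] .
  have wpm: "inverse w ^ (p - 1) \<in> V.m"
  proof -
    have "inverse w ^ (p - 2) * inverse w \<in> V.m" using V.m_mult[OF V.power[OF V.m_sub[OF wm]] wm] .
    moreover have "p - 1 = Suc (p - 2)" using p(2) by simp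
    ultimately show ?thesis by (simp add: mult.commute)
  qed
  note un = V.one_minus_unit[OF wpm]
  \<comment> \<open>From w^p (1 - (1 / w)^(p-1)) = a x^N, whose bracket is 1 modulo the ideal and
    hence a unit.\<close>
  define g where "g = \<iota> [:a:] * inverse (1 - inverse w ^ (p - 1))"
  have g: "g \<in> V" unfolding g_def by (intro V.mult FV un)
  have gi: "inverse g \<in> V"
  proof -
    have "inverse (\<iota> [:a:]) = \<iota> [:inverse a:]" using ca by (metis inverse_unique mult.commute)
    hence "inverse g = \<iota> [:inverse a:] * (1 - inverse w ^ (p - 1))" unfolding g_def by simp
    thus ?thesis using V.mult[OF FV un(1)] by simp
  qed
  have wp: "w ^ p = g * xx ^ N"
  proof -
    have "w ^ p * inverse w ^ (p - 1) = w * (w ^ (p - 1) * inverse w ^ (p - 1))"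
      using p(2) by (cases p) (simp_all add: mult.assoc)
    also have "w ^ (p - 1) * inverse w ^ (p - 1) = 1" unfolding power_mult_distrib[symmetric] using w0 by simp
    finally have "w ^ p * (1 - inverse w ^ (p - 1)) = \<iota> h" unfolding right_diff_distrib w' by simp
    hence "w ^ p = \<iota> h * inverse (1 - inverse w ^ (p - 1))" using un(2) by (metis mult.assoc mult_1_right right_inverse)
    thus ?thesis unfolding ih g_def by (simp only: mult_ac)
  qed
  have g0: "g \<noteq> 0" using wp w0 by auto
  \<comment> \<open>Only p-th powers of monomials reduce to powers of x, so membership in the ideal
    has to be tested on p-th powers.\<close>
  have quot: "z \<in> V.m" if z: "z \<in> K" "z ^ p \<in> V.m" for z
  proof -
    have "z \<in> V"
    proof (rule ccontr)
      assume n: "z \<notin> V"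
      hence z0: "z \<noteq> 0" using V.zero by metis
      have i: "inverse z \<in> V" using V.m_sub V.inverse_m[OF z(1) n] by blast
      have "inverse z ^ p * z ^ p \<in> V.m" using V.m_mult[OF V.power[OF i] z(2)] .
      moreover have "inverse z ^ p * z ^ p = 1" unfolding power_mult_distrib[symmetric] using z0 by simp
      ultimately show False using V.one_m by simp
    qed
    thus ?thesis using V.m_power z(2) by blast
  qed
  have mm: "mono c r s / mono d r' s' \<in> V.m" if d: "d \<noteq> 0" and lt: "p * r + N * s < p * r' + N * s'" for c r s d r' s'
  proof -
    define k where "k = p * r' + N * s' - (p * r + N * s)"
    have k: "p * r' + N * s' = (p * r + N * s) + k" "k > 0" using lt by (simp_all add: k_def)
    define z where "z = (xx ^ r * w ^ s) / (xx ^ r' * w ^ s')"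
    have pw: "(xx ^ r * w ^ s) ^ p = g ^ s * xx ^ (p * r + N * s)" for r s
    proof -
      have "(xx ^ r * w ^ s) ^ p = xx ^ (p * r) * (w ^ p) ^ s"
        by (simp only: power_mult_distrib power_mult[symmetric] mult.commute)
      also have "\<dots> = g ^ s * xx ^ (p * r + N * s)"
        unfolding wp power_mult_distrib power_add power_mult[symmetric] by (simp only: mult_ac)
      finally show ?thesis .
    qed
    have "z ^ p = (g ^ s * xx ^ (p * r + N * s)) / (g ^ s' * xx ^ (p * r' + N * s'))"
      unfolding z_def power_divide pw ..
    also have "\<dots> = g ^ s * inverse g ^ s' * inverse xx ^ k"
      unfolding k(1) power_add using x0 g0 by (simp add: power_inverse field_simps)
    also have "\<dots> \<in> V.m"
    proof -
      have "inverse xx ^ k \<in> V.m" using xpm[of "k - 1"] k(2) by simp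
      thus ?thesis by (rule V.m_mult[rotated]) (intro V.mult V.power g gi)
    qed
    finally have "z ^ p \<in> V.m" .
    moreover have "z \<in> K"
    proof -
      have xw: "xx ^ r * w ^ s \<in> K" for r s
      proof -
        have "mono 1 r s \<in> K" unfolding mono_ev by (rule ev_in_K)
        thus ?thesis unfolding mono_def by (simp flip: one_pCons)
      qed
      show ?thesis unfolding z_def by (intro K_divide xw)
    qed
    ultimately have zm: "z \<in> V.m" using quot by blast
    have "inverse (\<iota> [:d:]) = \<iota> [:inverse d:]"
    proof (rule inverse_unique)
      show "\<iota> [:d:] * \<iota> [:inverse d:] = 1" using d by (simp flip: \<iota>.hom_mult one_pCons)
    qed
    hence "mono c r s / mono d r' s' = (\<iota> [:c:] * \<iota> [:inverse d:]) * z"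
      unfolding mono_def z_def divide_inverse by (simp add: mult_ac)
    thus ?thesis using V.m_mult[OF V.mult[OF FV FV] zm] by simp
  qed
  have Bm: "u / mono d r s \<in> V.m" if u: "u \<in> Bd (p * r + N * s)" and d: "d \<noteq> 0" for u d r s
  proof -
    obtain R where R: "u = ev R" "\<forall>j. Polynomial.coeff R j \<noteq> 0 \<longrightarrow> p * degree (Polynomial.coeff R j) + N * j < p * r + N * s"
      using u unfolding Bd_def by blast
    have "u / mono d r s = (\<Sum>j\<le>degree R. \<Sum>i\<le>degree (Polynomial.coeff R j). mono (Polynomial.coeff (Polynomial.coeff R j) i) i j / mono d r s)"
      unfolding R(1) by (subst ev_expand) (simp only: sum_divide_distrib)
    also have "\<dots> \<in> V.m"
    proof (intro V.m_sum finite_atMost)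
      fix j i assume i: "i \<in> {..degree (Polynomial.coeff R j)}"
      show "mono (Polynomial.coeff (Polynomial.coeff R j) i) i j / mono d r s \<in> V.m"
      proof (cases "Polynomial.coeff R j = 0")
        case True
        hence "mono (Polynomial.coeff (Polynomial.coeff R j) i) i j = 0" by (simp add: mono_def)
        thus ?thesis using V.zero_m by simp
      next
        case False
        have "p * i \<le> p * degree (Polynomial.coeff R j)" using i by simp
        hence "p * i + N * j < p * r + N * s" using R(2)[rule_format, OF False] by linarith
        thus ?thesis using mm d by blast
      qed
    qed
    finally show ?thesis .
  qed
  have tm: "u / t \<in> V.m" if t: "lead t n" and u: "u \<in> Bd n" for u t n
  proof -
    obtain c r s where h: "c \<noteq> 0" "n = p * r + N * s" "t - mono c r s \<in> Bd n" using t unfolding lead_def by blast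
    have M0: "mono c r s \<noteq> 0"
    proof -
      have "mono c r s = \<iota> [:c:] * (xx ^ r * w ^ s)" by (simp add: mono_def)
      thus ?thesis using h(1) x0 w0 by simp
    qed
    have "(t - mono c r s) / mono c r s \<in> V.m" using Bm h by blast
    hence m1: "1 - t / mono c r s \<in> V.m"
      using V.m_uminus[of "(t - mono c r s) / mono c r s"] M0 by (simp add: diff_divide_distrib)
    have "inverse (1 - (1 - t / mono c r s)) \<in> V" using V.one_minus_unit(3)[OF m1] .
    hence "mono c r s / t \<in> V" by simp
    moreover have "u / mono c r s \<in> V.m" using Bm h u by blast
    ultimately have "(mono c r s / t) * (u / mono c r s) \<in> V.m" by (rule V.m_mult)
    thus ?thesis using M0 by simp
  qed
  have m_sub: "z \<in> V.m" if z: "z \<in> W.m" for z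
  proof -
    obtain u t n where h: "z = u / t" "lead t n" "u \<in> Bd (Suc n)" using W.m_sub[OF z] by (rule inf_ring_cases)
    have "u \<in> Bd n" using z unfolding h(1) inf_ring_m[OF h(2,3)] .
    thus ?thesis unfolding h(1) using tm h(2) by blast
  qed
  have "inf_ring = V"
  proof (rule valuation_subring_eqI[OF W.valuation_subring_axioms V.valuation_subring_axioms])
    show "inf_ring \<subseteq> V"
    proof
      fix z assume "z \<in> inf_ring"
      then obtain c where "z - \<iota> [:c:] \<in> W.m" by (rule inf_ring_residue)
      hence "(z - \<iota> [:c:]) + \<iota> [:c:] \<in> V" using m_sub V.m_sub V.add FV by blast
      thus "z \<in> V" by simp
    qed
  qed (rule m_sub)
  thus ?thesis ..
qed

theorem places_eq: "{V. is_place V} = insert inf_ring (pt_ring ` curve)"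
proof (intro equalityI subsetI)
  fix V assume "V \<in> {V. is_place V}"
  thus "V \<in> insert inf_ring (pt_ring ` curve)" using finite_place infinite_place by (cases "xx \<in> V") blast+
qed (use inf_ring_is_place pt_ring_is_place in auto)

text \<open>An element algebraic over the constants lies in every valuation ring, as does its inverse;
  subtracting its residue at infinity it must therefore become zero.\<close>

lemma algebraic_imp_const:
  assumes y: "y \<in> K" and g: "g \<noteq> 0" "ev2 (\<lambda>c. \<iota> [:c:]) y g = 0"
  shows "y \<in> F"
proof -
  interpret V: valuation_subring K inf_ring by (rule inf_ring_valuation)
  interpret c: inj_idom_hom "\<lambda>c. \<iota> [:c:]"
    by unfold_locales (simp_all flip: \<iota>.hom_add \<iota>.hom_mult one_pCons)
  interpret m: map_poly_inj_idom_hom "\<lambda>c. \<iota> [:c:]" ..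
  have nm: "\<iota> [:c:] * v \<notin> V.m \<or> c = 0" if "v = 1" for c v using that inf_ring_const_m[of c] by simp
  have yV: "y \<in> inf_ring"
  proof (rule ccontr)
    assume n: "y \<notin> inf_ring"
    hence y0: "y \<noteq> 0" using V.zero by metis
    have v: "inverse y \<in> V.m" using V.inverse_m[OF y n] .
    define d where "d = degree g"
    have "0 = inverse y ^ d * poly (map_poly (\<lambda>c. \<iota> [:c:]) g) y" using g(2) unfolding ev2_def by simp
    also have "\<dots> = (\<Sum>i\<le>d. \<iota> [:Polynomial.coeff g i:] * (inverse y ^ d * y ^ i))"
      unfolding poly_altdef d_def by (simp add: sum_distrib_left mult_ac)
    also have "\<dots> = (\<Sum>i\<le>d. \<iota> [:Polynomial.coeff g i:] * inverse y ^ (d - i))"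
    proof (rule sum.cong[OF refl])
      fix i assume "i \<in> {..d}"
      hence "d = (d - i) + i" by simp
      hence "inverse y ^ d = inverse y ^ (d - i) * inverse y ^ i" by (metis power_add)
      moreover have "inverse y ^ i * y ^ i = 1" unfolding power_mult_distrib[symmetric] using y0 by simp
      ultimately show "\<iota> [:Polynomial.coeff g i:] * (inverse y ^ d * y ^ i) = \<iota> [:Polynomial.coeff g i:] * inverse y ^ (d - i)"
        by (simp only: mult.assoc mult_1_right)
    qed
    also have "\<dots> = \<iota> [:Polynomial.coeff g d:] + (\<Sum>i<d. \<iota> [:Polynomial.coeff g i:] * inverse y ^ (d - i))"
      unfolding lessThan_Suc_atMost[symmetric] by simp
    finally have "\<iota> [:Polynomial.coeff g d:] = - (\<Sum>i<d. \<iota> [:Polynomial.coeff g i:] * inverse y ^ (d - i))"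
      by (simp add: eq_neg_iff_add_eq_0)
    also have "\<dots> \<in> V.m"
    proof (intro V.m_uminus V.m_sum finite_lessThan)
      fix i assume "i \<in> {..<d}"
      hence "d - i = Suc (d - i - 1)" by simp
      hence "inverse y ^ (d - i) = inverse y ^ (d - i - 1) * inverse y" by (metis power_Suc2)
      moreover have "\<iota> [:Polynomial.coeff g i:] * (inverse y ^ (d - i - 1) * inverse y) \<in> V.m"
        by (intro V.m_mult inf_ring_const V.power v V.m_sub[OF v])
      ultimately show "\<iota> [:Polynomial.coeff g i:] * inverse y ^ (d - i) \<in> V.m" by simp
    qed
    finally show False using inf_ring_const_m g(1) by (simp add: d_def)
  qed
  then obtain c where z: "y - \<iota> [:c:] \<in> V.m" by (rule inf_ring_residue)
  define z where "z = y - \<iota> [:c:]"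
  define f where "f = pcompose g [:c, 1:]"
  have fz: "poly (map_poly (\<lambda>c. \<iota> [:c:]) f) z = 0"
  proof -
    have "map_poly (\<lambda>c. \<iota> [:c:]) f = pcompose (map_poly (\<lambda>c. \<iota> [:c:]) g) [:\<iota> [:c:], 1:]"
      unfolding f_def c.map_poly_pcompose by (simp add: map_poly_pCons_0 flip: one_pCons)
    thus ?thesis using g(2) unfolding ev2_def z_def by (simp add: poly_pcompose)
  qed
  have f0: "f \<noteq> 0" unfolding f_def using g(1) pcompose_eq_0[of g "[:c, 1:]"] by auto
  have "z = 0"
  proof (rule ccontr)
    assume z0: "z \<noteq> 0"
    define d where "d = (LEAST i. Polynomial.coeff f i \<noteq> 0)"
    have "\<exists>i. Polynomial.coeff f i \<noteq> 0" using f0 by (metis leading_coeff_0_iff)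
    hence d: "Polynomial.coeff f d \<noteq> 0" unfolding d_def by (rule LeastI_ex)
    have less: "Polynomial.coeff f i = 0" if "i < d" for i using that not_less_Least unfolding d_def by blast
    have dd: "d \<le> degree f" using d by (rule le_degree)
    have "0 = (\<Sum>i\<le>degree f. \<iota> [:Polynomial.coeff f i:] * z ^ i)" using fz unfolding poly_altdef by simp
    also have "\<dots> = (\<Sum>i\<in>{d..degree f}. \<iota> [:Polynomial.coeff f i:] * z ^ i)"
      by (rule sum.mono_neutral_right) (auto simp: less)
    also have "\<dots> = (\<Sum>i\<in>{d..degree f}. z ^ d * (\<iota> [:Polynomial.coeff f i:] * z ^ (i - d)))"
    proof (rule sum.cong[OF refl])
      fix i assume "i \<in> {d..degree f}"
      hence "z ^ i = z ^ d * z ^ (i - d)" by (simp flip: power_add)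
      thus "\<iota> [:Polynomial.coeff f i:] * z ^ i = z ^ d * (\<iota> [:Polynomial.coeff f i:] * z ^ (i - d))" by (simp only: mult_ac)
    qed
    also have "\<dots> = z ^ d * (\<Sum>i\<in>{d..degree f}. \<iota> [:Polynomial.coeff f i:] * z ^ (i - d))" by (rule sum_distrib_left[symmetric])
    finally have "(\<Sum>i\<in>{d..degree f}. \<iota> [:Polynomial.coeff f i:] * z ^ (i - d)) = 0" using z0 by simp
    moreover have "{d..degree f} = insert d {Suc d..degree f}" using dd by auto
    ultimately have "\<iota> [:Polynomial.coeff f d:] + (\<Sum>i\<in>{Suc d..degree f}. \<iota> [:Polynomial.coeff f i:] * z ^ (i - d)) = 0" by simp
    hence "\<iota> [:Polynomial.coeff f d:] = - (\<Sum>i\<in>{Suc d..degree f}. \<iota> [:Polynomial.coeff f i:] * z ^ (i - d))"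
      by (simp only: eq_neg_iff_add_eq_0)
    also have "\<dots> \<in> V.m"
    proof (intro V.m_uminus V.m_sum finite_atLeastAtMost)
      fix i assume "i \<in> {Suc d..degree f}"
      hence "i - d = Suc (i - d - 1)" by auto
      hence "z ^ (i - d) = z ^ (i - d - 1) * z" by (metis power_Suc2)
      moreover have zm: "z \<in> V.m" using z unfolding z_def .
      moreover have "\<iota> [:Polynomial.coeff f i:] * (z ^ (i - d - 1) * z) \<in> V.m"
        by (intro V.m_mult inf_ring_const V.power zm V.m_sub[OF zm])
      ultimately show "\<iota> [:Polynomial.coeff f i:] * z ^ (i - d) \<in> V.m" by simp
    qed
    finally show False using inf_ring_const_m d by simp
  qed
  hence "y = \<iota> [:c:]" by (simp add: z_def)
  thus ?thesis unfolding F_def by blast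
qed

end


section \<open>Euler products\<close>

text \<open>A multiset over \<open>insert x A\<close> is a multiplicity of x together with a
  multiset over \<open>A\<close>, which gives a geometric series times \<open>G\<close>.\<close>

lemma multiset_insert_step:
  fixes f :: "'x \<Rightarrow> 'b::{real_normed_field,banach}"
  assumes "x \<notin> A" and z: "norm (f x) < 1"
    and G: "((\<lambda>D. \<Prod>y\<in>#D. f y) has_sum G) {D. set_mset D \<subseteq> A}"
    and sm: "(\<lambda>(n, D). f x ^ n * (\<Prod>y\<in>#D. f y)) summable_on UNIV \<times> {D. set_mset D \<subseteq> A}"
  shows "((\<lambda>D. \<Prod>y\<in>#D. f y) has_sum (1 / (1 - f x) * G)) {D. set_mset D \<subseteq> insert x A}"
proof -
  let ?h = "\<lambda>(n, D). replicate_mset n x + D"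
  let ?P = "UNIV \<times> {D. set_mset D \<subseteq> A}"
  have inj: "inj_on ?h ?P"
  proof (rule inj_onI, clarsimp)
    fix n D m E assume h: "set_mset D \<subseteq> A" "set_mset E \<subseteq> A" "replicate_mset n x + D = replicate_mset m x + E"
    have "count D x = 0" "count E x = 0" using h(1,2) assms(1) by (auto simp: count_eq_zero_iff)
    hence "n = m" using arg_cong[OF h(3), of "\<lambda>M. count M x"] by simp
    thus "n = m \<and> D = E" using h(3) by simp
  qed
  have im: "?h ` ?P = {D. set_mset D \<subseteq> insert x A}"
  proof
    show "?h ` ?P \<subseteq> {D. set_mset D \<subseteq> insert x A}" by (auto dest: in_replicate_mset[THEN iffD1] split: if_splits)
    show "{D. set_mset D \<subseteq> insert x A} \<subseteq> ?h ` ?P"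
    proof
      fix D assume "D \<in> {D. set_mset D \<subseteq> insert x A}"
      hence D: "set_mset D \<subseteq> insert x A" by simp
      have "D = filter_mset (\<lambda>y. y = x) D + filter_mset (\<lambda>y. y \<noteq> x) D" by (rule multiset_partition)
      also have "filter_mset (\<lambda>y. y = x) D = replicate_mset (count D x) x" by (rule filter_eq_replicate_mset)
      finally have "D = ?h (count D x, filter_mset (\<lambda>y. y \<noteq> x) D)" by simp
      moreover have "(count D x, filter_mset (\<lambda>y. y \<noteq> x) D) \<in> ?P" using D by auto
      ultimately show "D \<in> ?h ` ?P" by blast
    qed
  qed
  have e: "((\<lambda>D. \<Prod>y\<in>#D. f y) \<circ> ?h) = (\<lambda>(n, D). f x ^ n * (\<Prod>y\<in>#D. f y))"
    by (rule ext) auto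
  have geo: "((\<lambda>n. f x ^ n) has_sum (1 / (1 - f x))) UNIV"
    by (rule norm_summable_imp_has_sum) (use z in \<open>auto simp: norm_power summable_geometric intro: geometric_sums\<close>)
  have "((\<lambda>(n, D). f x ^ n * (\<Prod>y\<in>#D. f y)) has_sum (1 / (1 - f x) * G)) ?P"
  proof (rule has_sum_SigmaI[where g = "\<lambda>n. f x ^ n * G"])
    show "((\<lambda>D. case (n, D) of (n, D) \<Rightarrow> f x ^ n * (\<Prod>y\<in>#D. f y)) has_sum f x ^ n * G) {D. set_mset D \<subseteq> A}" for n
      using has_sum_cmult_right[OF G] by simp
    show "((\<lambda>n. f x ^ n * G) has_sum 1 / (1 - f x) * G) UNIV" by (rule has_sum_cmult_left[OF geo])
  qed (rule sm)
  thus ?thesis unfolding im[symmetric] has_sum_reindex[OF inj] e .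
qed

text \<open>For nonnegative terms, summability of the double family follows from the iterated sums.
  This case provides the absolute convergence on which the general one rests.\<close>

lemma euler_finite_real:
  fixes r :: "'x \<Rightarrow> real"
  assumes "finite A" "\<And>x. x \<in> A \<Longrightarrow> 0 \<le> r x \<and> r x < 1"
  shows "((\<lambda>D. \<Prod>y\<in>#D. r y) has_sum (\<Prod>x\<in>A. 1 / (1 - r x))) {D. set_mset D \<subseteq> A}"
  using assms
proof (induction A rule: finite_induct)
  case empty
  have "{D :: 'x multiset. set_mset D \<subseteq> {}} = {{#}}" by auto
  thus ?case by (simp add: has_sum_finite_iff)
next
  case (insert x A)
  have IH: "((\<lambda>D. \<Prod>y\<in>#D. r y) has_sum (\<Prod>x\<in>A. 1 / (1 - r x))) {D. set_mset D \<subseteq> A}"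
    using insert by blast
  have rx: "0 \<le> r x" "r x < 1" using insert.prems by blast+
  have nn: "(\<Prod>y\<in>#D. r y) \<ge> 0" if "set_mset D \<subseteq> A" for D
    using that insert.prems by (induction D) auto
  have "(\<lambda>(n::nat, D). r x ^ n * (\<Prod>y\<in>#D. r y)) summable_on UNIV \<times> {D. set_mset D \<subseteq> A}"
  proof (rule summable_on_SigmaI[where g = "\<lambda>n. r x ^ n * (\<Prod>x\<in>A. 1 / (1 - r x))"])
    have "(\<lambda>n. r x ^ n) summable_on UNIV"
      using rx by (intro norm_summable_imp_summable_on) (simp add: norm_power summable_geometric)
    thus "(\<lambda>n. r x ^ n * (\<Prod>x\<in>A. 1 / (1 - r x))) summable_on UNIV" by (rule summable_on_cmult_left)
  qed (use rx nn in \<open>auto intro: has_sum_cmult_right[OF IH]\<close>)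
  from multiset_insert_step[OF insert.hyps(2) _ IH this] rx show ?case
    using insert.hyps by simp
qed

lemma norm_prod_mset: "norm (\<Prod>y\<in>#D. f y) = (\<Prod>y\<in>#D. norm (f y :: 'b::real_normed_field))"
  by (induction D) (simp_all add: norm_mult)

text \<open>Finitely many multisets involve a finite set of primes, so their partial sum is at most
  a finite Euler product. Its factors satisfy 1 / (1 - r) \<le> exp (2 r) for r \<le> 1/2, because 1
  \<le> (1 - r) (1 + 2 r).\<close>

lemma euler_abs_summable:
  fixes f :: "'x \<Rightarrow> 'b::{real_normed_field,banach}"
  assumes sm: "(\<lambda>x. norm (f x)) summable_on U" and le: "\<And>x. x \<in> U \<Longrightarrow> norm (f x) \<le> 1/2"
  shows "(\<lambda>D. norm (\<Prod>y\<in>#D. f y)) summable_on {D. set_mset D \<subseteq> U}"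
proof (rule nonneg_bdd_above_summable_on)
  have "sum (\<lambda>D. norm (\<Prod>y\<in>#D. f y)) B \<le> exp (2 * infsum (\<lambda>x. norm (f x)) U)"
    if B: "B \<subseteq> {D. set_mset D \<subseteq> U}" "finite B" for B
  proof -
    define A where "A = (\<Union>D\<in>B. set_mset D)"
    have A: "finite A" "A \<subseteq> U" using B by (auto simp: A_def)
    have hs: "((\<lambda>D. \<Prod>y\<in>#D. norm (f y)) has_sum (\<Prod>x\<in>A. 1 / (1 - norm (f x)))) {D. set_mset D \<subseteq> A}"
    proof (rule euler_finite_real[OF A(1)])
      fix x assume "x \<in> A"
      hence "norm (f x) \<le> 1/2" using A le by blast
      thus "0 \<le> norm (f x) \<and> norm (f x) < 1" by simp
    qed
    have "sum (\<lambda>D. norm (\<Prod>y\<in>#D. f y)) B = sum (\<lambda>D. \<Prod>y\<in>#D. norm (f y)) B" by (simp only: norm_prod_mset)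
    also have "\<dots> \<le> infsum (\<lambda>D. \<Prod>y\<in>#D. norm (f y)) {D. set_mset D \<subseteq> A}"
    proof (rule finite_sum_le_infsum)
      show "(\<lambda>D. \<Prod>y\<in>#D. norm (f y)) summable_on {D. set_mset D \<subseteq> A}" using hs by (rule has_sum_imp_summable)
      show "finite B" by fact
      show "B \<subseteq> {D. set_mset D \<subseteq> A}" unfolding A_def by blast
      show "0 \<le> (\<Prod>y\<in>#D. norm (f y))" for D by (simp flip: norm_prod_mset)
    qed
    also have "\<dots> = (\<Prod>x\<in>A. 1 / (1 - norm (f x)))" using hs by (rule infsumI)
    also have "\<dots> \<le> (\<Prod>x\<in>A. exp (2 * norm (f x)))"
    proof (rule prod_mono)
      fix x assume "x \<in> A"
      hence r: "norm (f x) \<le> 1/2" using A le by blast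
      define r where "r = norm (f x)"
      have r': "0 \<le> r" "r \<le> 1/2" using r by (simp_all add: r_def)
      have "0 \<le> r * (1 - 2 * r)" using r' by (intro mult_nonneg_nonneg) simp_all
      hence "1 \<le> (1 - r) * (1 + 2 * r)" by (simp add: algebra_simps)
      also have "\<dots> \<le> (1 - r) * exp (2 * r)" using r' exp_ge_add_one_self[of "2 * r"] by (intro mult_left_mono) simp_all
      finally have "1 / (1 - r) \<le> exp (2 * r)" using r' by (simp add: pos_divide_le_eq mult.commute)
      thus "0 \<le> 1 / (1 - norm (f x)) \<and> 1 / (1 - norm (f x)) \<le> exp (2 * norm (f x))" using r' by (simp add: r_def)
    qed
    also have "\<dots> = exp (2 * (\<Sum>x\<in>A. norm (f x)))" using A(1) by (simp add: exp_sum sum_distrib_left)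
    also have "\<dots> \<le> exp (2 * infsum (\<lambda>x. norm (f x)) U)"
      using finite_sum_le_infsum[OF sm A] by simp
    finally show ?thesis .
  qed
  thus "bdd_above (sum (\<lambda>D. norm (\<Prod>y\<in>#D. f y)) ` {B. B \<subseteq> {D. set_mset D \<subseteq> U} \<and> finite B})"
    by (intro bdd_aboveI2[where M = "exp (2 * infsum (\<lambda>x. norm (f x)) U)"]) simp
qed simp

lemma euler_finite:
  fixes f :: "'x \<Rightarrow> 'b::{real_normed_field,banach}"
  assumes "finite A" "\<And>x. x \<in> A \<Longrightarrow> norm (f x) \<le> 1/2"
  shows "((\<lambda>D. \<Prod>y\<in>#D. f y) has_sum (\<Prod>x\<in>A. 1 / (1 - f x))) {D. set_mset D \<subseteq> A}"
  using assms
proof (induction A rule: finite_induct)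
  case empty
  have "{D :: 'x multiset. set_mset D \<subseteq> {}} = {{#}}" by auto
  thus ?case by (simp add: has_sum_finite_iff)
next
  case (insert x A)
  have IH: "((\<lambda>D. \<Prod>y\<in>#D. f y) has_sum (\<Prod>x\<in>A. 1 / (1 - f x))) {D. set_mset D \<subseteq> A}"
    using insert by blast
  have rx: "norm (f x) \<le> 1/2" using insert.prems by blast
  have s1: "(\<lambda>D. norm (\<Prod>y\<in>#D. f y)) summable_on {D. set_mset D \<subseteq> A}"
    using insert by (intro euler_abs_summable) auto
  have "(\<lambda>nD. norm (case nD of (n::nat, D) \<Rightarrow> f x ^ n * (\<Prod>y\<in>#D. f y))) summable_on UNIV \<times> {D. set_mset D \<subseteq> A}"
  proof (rule summable_on_SigmaI[where g = "\<lambda>n. norm (f x) ^ n * infsum (\<lambda>D. norm (\<Prod>y\<in>#D. f y)) {D. set_mset D \<subseteq> A}"])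
    have "(\<lambda>n. norm (f x) ^ n) summable_on UNIV"
      using rx by (intro norm_summable_imp_summable_on) (simp add: norm_power summable_geometric)
    thus "(\<lambda>n. norm (f x) ^ n * infsum (\<lambda>D. norm (\<Prod>y\<in>#D. f y)) {D. set_mset D \<subseteq> A}) summable_on UNIV" by (rule summable_on_cmult_left)
  qed (auto simp: norm_mult norm_power intro: has_sum_cmult_right[OF has_sum_infsum[OF s1]])
  hence "(\<lambda>(n, D). f x ^ n * (\<Prod>y\<in>#D. f y)) summable_on UNIV \<times> {D. set_mset D \<subseteq> A}"
    by (rule abs_summable_summable)
  from multiset_insert_step[OF insert.hyps(2) _ IH this] rx show ?case
    using insert.hyps by simp
qed

text \<open>The limit is taken along all finite sets of primes. For a large set, its finite product
  and \<open>S\<close> are both within e / 2 of one and the same partial sum, the one over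
  \<open>B0 \<union> B1\<close>.\<close>

theorem euler_product:
  fixes f :: "'x \<Rightarrow> 'b::{real_normed_field,banach}"
  assumes le: "\<And>x. x \<in> U \<Longrightarrow> norm (f x) \<le> 1/2"
    and S: "((\<lambda>D. \<Prod>y\<in>#D. f y) has_sum S) {D. set_mset D \<subseteq> U}"
  shows "((\<lambda>A. \<Prod>x\<in>A. 1 / (1 - f x)) \<longlongrightarrow> S) (finite_subsets_at_top U)"
proof (rule tendstoI)
  fix e :: real assume e: "e > 0"
  let ?g = "\<lambda>D. \<Prod>y\<in>#D. f y"
  have "eventually (\<lambda>B. dist (sum ?g B) S < e / 2) (finite_subsets_at_top {D. set_mset D \<subseteq> U})"
    using S e unfolding has_sum_def by (intro tendstoD) simp_all
  then obtain B0 where B0: "finite B0" "B0 \<subseteq> {D. set_mset D \<subseteq> U}"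
    "\<And>B. finite B \<Longrightarrow> B0 \<subseteq> B \<Longrightarrow> B \<subseteq> {D. set_mset D \<subseteq> U} \<Longrightarrow> dist (sum ?g B) S < e / 2"
    unfolding eventually_finite_subsets_at_top by auto
  define A0 where "A0 = (\<Union>D\<in>B0. set_mset D)"
  have A0: "finite A0" "A0 \<subseteq> U" using B0 by (auto simp: A0_def)
  have "dist (\<Prod>x\<in>A. 1 / (1 - f x)) S < e" if A: "finite A" "A0 \<subseteq> A" "A \<subseteq> U" for A
  proof -
    let ?Y = "{D. set_mset D \<subseteq> A}"
    have "((\<lambda>D. \<Prod>y\<in>#D. f y) has_sum (\<Prod>x\<in>A. 1 / (1 - f x))) ?Y"
      using A le by (intro euler_finite) auto
    hence ev: "eventually (\<lambda>B. dist (sum ?g B) (\<Prod>x\<in>A. 1 / (1 - f x)) < e / 2) (finite_subsets_at_top ?Y)"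
      using e unfolding has_sum_def by (intro tendstoD) simp_all
    then obtain B1 where B1: "finite B1" "B1 \<subseteq> ?Y"
      "\<And>B. finite B \<Longrightarrow> B1 \<subseteq> B \<Longrightarrow> B \<subseteq> ?Y \<Longrightarrow> dist (sum ?g B) (\<Prod>x\<in>A. 1 / (1 - f x)) < e / 2"
      unfolding eventually_finite_subsets_at_top by auto
    have sub: "B0 \<subseteq> ?Y" using A(2) by (auto simp: A0_def)
    have "dist (sum ?g (B0 \<union> B1)) (\<Prod>x\<in>A. 1 / (1 - f x)) < e / 2" using B0 B1 sub by (intro B1(3)) auto
    moreover have "dist (sum ?g (B0 \<union> B1)) S < e / 2"
    proof (rule B0(3))
      show "B0 \<union> B1 \<subseteq> {D. set_mset D \<subseteq> U}" using B0(2) B1(2) A(3) by blast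
    qed (use B0 B1 in auto)
    ultimately show ?thesis by (metis dist_triangle_half_r dist_commute)
  qed
  thus "eventually (\<lambda>A. dist (\<Prod>x\<in>A. 1 / (1 - f x)) S < e) (finite_subsets_at_top U)"
    unfolding eventually_finite_subsets_at_top using A0 by blast
qed


section \<open>Decomposition of places\<close>

lemma sum_lessThan_add:
  fixes f :: "nat \<Rightarrow> 'c::comm_monoid_add"
  shows "(\<Sum>k<a + b. f k) = (\<Sum>k<a. f k) + (\<Sum>j<b. f (a + j))"
  by (induction b) (simp_all add: add.assoc)

lemma sum_lessThan_mult:
  fixes f :: "nat \<Rightarrow> 'c::comm_monoid_add"
  shows "(\<Sum>k<m * d. f k) = (\<Sum>i<d. \<Sum>j<m. f (m * i + j))"
proof (induction d)
  case (Suc d)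
  have "m * Suc d = m * d + m" by simp
  thus ?case using Suc by (simp only: sum_lessThan_add sum.lessThan_Suc)
qed simp

text \<open>The powers of a nontrivial p-th root of unity are the roots of X^p - 1; its
  factorisation is evaluated at 1 / z.\<close>

lemma prod_one_minus_root_powers:
  fixes \<rho> z :: complex
  assumes "prime p" and 1: "\<rho> ^ p = 1" "\<rho> \<noteq> 1"
  shows "(\<Prod>c<p. 1 - \<rho> ^ c * z) = 1 - z ^ p"
proof -
  note p = assms(1)
  have p0: "p > 0" using p prime_gt_0_nat by blast
  have \<rho>0: "\<rho> \<noteq> 0" using 1 p0 by (auto simp: zero_power)
  have ne1: "\<rho> ^ k \<noteq> 1" if k: "0 < k" "k < p" for k
  proof
    assume k1: "\<rho> ^ k = 1"
    have "\<not> p dvd k" using k dvd_imp_le by force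
    hence "coprime k p" using p prime_imp_coprime coprime_commute by blast
    moreover have "p \<noteq> 1" using p by auto
    ultimately obtain x y where xy: "k * x = p * y + 1" using coprime_bezout_strong by metis
    have "\<rho> ^ (k * x) = \<rho> ^ (p * y) * \<rho>" unfolding xy by simp
    hence "1 = \<rho>" unfolding power_mult k1 1 by simp
    thus False using 1 by simp
  qed
  have inj: "inj_on (\<lambda>c. \<rho> ^ c) {..<p}"
  proof -
    have "\<rho> ^ i \<noteq> \<rho> ^ j" if "i < j" "j < p" for i j
    proof
      assume e: "\<rho> ^ i = \<rho> ^ j"
      have "\<rho> ^ j = \<rho> ^ i * \<rho> ^ (j - i)" using that by (simp flip: power_add)
      hence "\<rho> ^ (j - i) = 1" using e \<rho>0 by simp
      thus False using ne1[of "j - i"] that by simp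
    qed
    thus ?thesis unfolding inj_on_def by (metis lessThan_iff linorder_neqE_nat)
  qed
  let ?P = "\<Prod>c<p. [:- (\<rho> ^ c), 1:]" and ?M = "Polynomial.monom 1 p - 1 :: complex poly"
  have dP: "degree ?P = p" by (subst degree_prod_eq_sum_degree) auto
  have lP: "lead_coeff ?P = 1" by (rule monic_prod) auto
  have eq: "?P = ?M"
  proof (rule poly_eqI_degree_lead_coeff[where A = "(\<lambda>c. \<rho> ^ c) ` {..<p}" and n = p])
    show "p \<le> card ((\<lambda>c. \<rho> ^ c) ` {..<p})" unfolding card_image[OF inj] by simp
    show "degree ?P \<le> p" using dP by simp
    show "degree ?M \<le> p" by (intro degree_diff_le degree_monom_le) simp
    show "Polynomial.coeff ?P p = Polynomial.coeff ?M p" using lP p0 unfolding dP by simp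
    fix y assume "y \<in> (\<lambda>c. \<rho> ^ c) ` {..<p}"
    then obtain c where c: "y = \<rho> ^ c" "c < p" by blast
    have "poly ?P y = 0" unfolding poly_prod c(1) using c(2) by (intro prod_zero) auto
    moreover have "y ^ p = 1" unfolding c(1) using 1 by (metis mult.commute power_mult power_one)
    ultimately show "poly ?P y = poly ?M y" by (simp add: poly_monom)
  qed
  have ev: "(\<Prod>c<p. y - \<rho> ^ c) = y ^ p - 1" for y
    using arg_cong[OF eq, of "\<lambda>P. poly P y"] by (simp add: poly_prod poly_monom)
  show ?thesis
  proof (cases "z = 0")
    case False
    have "(\<Prod>c<p. 1 - \<rho> ^ c * z) = (\<Prod>c<p. z * (1 / z - \<rho> ^ c))"
      using False by (intro prod.cong refl) (simp add: right_diff_distrib mult.commute)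
    also have "\<dots> = z ^ p * ((1 / z) ^ p - 1)" unfolding prod.distrib ev by simp
    also have "\<dots> = 1 - z ^ p" using False by (simp add: right_diff_distrib power_divide)
    finally show ?thesis .
  qed (use p0 in simp)
qed

context artin_schreier
begin

lemma power_pp_add: "(x + y :: 'a alg_closure) ^ (p ^ k) = x ^ (p ^ k) + y ^ (p ^ k)"
  unfolding p_def by (rule power_CHAR_add)

lemma power_pp_sum: "finite I \<Longrightarrow> (\<Sum>i\<in>I. f i :: 'a alg_closure) ^ (p ^ k) = (\<Sum>i\<in>I. f i ^ (p ^ k))"
proof (induction I rule: finite_induct)
  case empty
  have "p ^ k > 0" using p(2) by simp
  thus ?case by (simp add: zero_power)
qed (simp add: power_pp_add)

lemma snd_power_p:
  assumes "P \<in> curve"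
  shows "snd P ^ (p ^ k) = snd P + (\<Sum>j<k. (to_ac a * fst P ^ N) ^ (p ^ j))"
proof (induction k)
  case (Suc k)
  have "snd P ^ p = snd P + to_ac a * fst P ^ N" using assms unfolding curve_def by (simp add: algebra_simps)
  have "snd P ^ (p ^ Suc k) = (snd P ^ p) ^ (p ^ k)" by (simp only: power_Suc power_mult)
  also have "\<dots> = (snd P + to_ac a * fst P ^ N) ^ (p ^ k)" using \<open>snd P ^ p = _\<close> by simp
  also have "\<dots> = snd P ^ (p ^ k) + (to_ac a * fst P ^ N) ^ (p ^ k)" by (rule power_pp_add)
  finally show ?case unfolding Suc by (simp add: add.assoc)
qed simp

text \<open>Iterating \<beta>^p = \<beta> + a \<alpha>^N up to the exponent q^d = p^(m d) adds the
  p-power conjugates of a \<alpha>^N. Writing the exponents as m i + j, they form the trace in two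
  stages: to F_q, where it is \<open>a\<close> times the power sum over the orbit, and on to the
  prime field. This is the Artin symbol of the orbit.\<close>

lemma trace_frob:
  assumes P: "P \<in> curve"
  defines "Q \<equiv> orb frob (fst P)"
  shows "(frob ^^ card Q) (snd P) = snd P + to_ac (abs_trace (a * orb_trace N Q))"
proof -
  let ?m = "finite_field_dim TYPE('a)" and ?d = "card Q" and ?c = "to_ac a * fst P ^ N"
  have qp: "CARD('a) = p ^ ?m" unfolding p_def by (rule finite_field_dim(1))
  have Qo: "Q \<in> orbs" unfolding Q_def orbs_def by blast
  have d: "period frob (fst P) = ?d" unfolding Q_def frob.card_orb ..
  have "(frob ^^ ?d) (snd P) = snd P ^ (CARD('a) ^ ?d)" by (rule funpow_frob)
  also have "\<dots> = snd P ^ (p ^ (?m * ?d))" unfolding qp power_mult ..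
  also have "\<dots> = snd P + (\<Sum>k<?m * ?d. ?c ^ (p ^ k))" by (rule snd_power_p[OF P])
  also have "(\<Sum>k<?m * ?d. ?c ^ (p ^ k)) = (\<Sum>i<?d. \<Sum>j<?m. ?c ^ (p ^ (?m * i + j)))" by (rule sum_lessThan_mult)
  also have "\<dots> = (\<Sum>j<?m. \<Sum>i<?d. (?c ^ (CARD('a) ^ i)) ^ (p ^ j))"
    by (subst sum.swap) (simp only: qp power_add power_mult)
  also have "\<dots> = (\<Sum>j<?m. (\<Sum>i<?d. ?c ^ (CARD('a) ^ i)) ^ (p ^ j))" by (simp only: power_pp_sum[OF finite_lessThan])
  also have "(\<Sum>i<?d. ?c ^ (CARD('a) ^ i)) = to_ac (a * orb_trace N Q)"
  proof -
    have ca: "to_ac a ^ (CARD('a) ^ i) = to_ac a" for i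
    proof -
      have "(frob ^^ i) (to_ac a) = to_ac a" by (induction i) simp_all
      thus ?thesis unfolding funpow_frob .
    qed
    have "(\<Sum>y\<in>Q. y ^ N) = (\<Sum>i<?d. ((frob ^^ i) (fst P)) ^ N)"
    proof -
      have im: "Q = (\<lambda>n. (frob ^^ n) (fst P)) ` {..<?d}"
        using frob.orb_eq[of "fst P"] unfolding d Q_def[symmetric] .
      have inj: "inj_on (\<lambda>n. (frob ^^ n) (fst P)) {..<?d}" using frob.inj_on_orb[of "fst P"] unfolding d .
      have "(\<Sum>y\<in>Q. y ^ N) = (\<Sum>y\<in>(\<lambda>n. (frob ^^ n) (fst P)) ` {..<?d}. y ^ N)" using im by (rule arg_cong)
      thus ?thesis unfolding sum.reindex[OF inj] o_def .
    qed
    also have "\<dots> = (\<Sum>i<?d. (fst P ^ N) ^ (CARD('a) ^ i))"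
      unfolding funpow_frob by (simp only: power_mult[symmetric] mult.commute)
    finally have s: "(\<Sum>y\<in>Q. y ^ N) = (\<Sum>i<?d. (fst P ^ N) ^ (CARD('a) ^ i))" .
    have "to_ac a * (\<Sum>y\<in>Q. y ^ N) = (\<Sum>i<?d. ?c ^ (CARD('a) ^ i))"
      unfolding s sum_distrib_left power_mult_distrib ca ..
    thus ?thesis unfolding to_ac_mult to_ac_orb_trace[OF Qo] ..
  qed
  also have "(\<Sum>j<?m. to_ac (a * orb_trace N Q) ^ (p ^ j)) = to_ac (abs_trace (a * orb_trace N Q))"
    unfolding abs_trace_def p_def by (simp add: to_ac.hom_sum to_ac.hom_power)
  finally show ?thesis .
qed

lemma period_fst_dvd: "period frob (fst P) dvd period frob2 (P :: 'a alg_closure \<times> 'a alg_closure)"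
  unfolding frob.funpow_eq_iff[symmetric] funpow_frob2_fst_snd(1)[symmetric] frob2.period(2) ..

lemma of_nat_ac_inj: "inj_on (of_nat :: nat \<Rightarrow> 'a alg_closure) {..<p}"
  using inj_shift[of "(0, 0)"] by simp

lemma of_nat_ac_eq_0: "(of_nat n :: 'a alg_closure) = 0 \<longleftrightarrow> p dvd n"
  unfolding of_nat_eq_0_iff_char_dvd CHAR_ac ..

text \<open>A power of Frobenius makes the x-coordinates equal without changing the local ring. The
  w-coordinates then differ by a solution of y^p = y, an element of the prime field.\<close>

lemma fiber_points:
  assumes P: "P \<in> curve" and R: "R \<in> curve" and e: "orb frob (fst R) = orb frob (fst P)"
  obtains i where "i < p" "pt_ring R = pt_ring (shift i P)"
proof -
  have "fst P \<in> orb frob (fst R)" unfolding e by simp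
  then obtain k where k: "fst P = (frob ^^ k) (fst R)" unfolding orb_def by blast
  define R' where "R' = (frob2 ^^ k) R"
  have R': "R' \<in> curve" "fst R' = fst P" unfolding R'_def using frob2_curve[OF R] k funpow_frob2_fst_snd by simp_all
  define y where "y = snd R' - snd P"
  have "snd R' ^ p - snd R' = snd P ^ p - snd P" using R' P unfolding curve_def by simp
  moreover have "snd R' = snd P + y" by (simp add: y_def)
  ultimately have yp: "y ^ p = y" by (simp add: power_p_add algebra_simps)
  have p2: "p \<ge> 2" by (rule p)
  have "of_nat ` {..<p} = {y :: 'a alg_closure. y ^ p = y}"
  proof (rule card_seteq)
    show "finite {y :: 'a alg_closure. y ^ p = y}" by (rule card_fixed_points_power_le(1)[OF p2])
    show "of_nat ` {..<p} \<subseteq> {y :: 'a alg_closure. y ^ p = y}" using of_nat_power_p by auto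
    show "card {y :: 'a alg_closure. y ^ p = y} \<le> card ((of_nat :: nat \<Rightarrow> 'a alg_closure) ` {..<p})"
      unfolding card_image[OF of_nat_ac_inj] using card_fixed_points_power_le(2)[OF p2, where ?'b="'a alg_closure"] by simp
  qed
  then obtain i where i: "i < p" "y = of_nat i" using yp by blast
  have "R' = shift i P" unfolding shift_def using R'(2) i(2) by (simp add: y_def prod_eq_iff algebra_simps)
  moreover have "R' \<in> orb frob2 R" unfolding R'_def orb_def by blast
  hence "pt_ring R = pt_ring R'" by (rule pt_ring_orbit[OF R R'(1), THEN iffD2])
  ultimately show ?thesis using that i by simp
qed

lemma pt_ring_fiber_unique:
  assumes "P \<in> curve" "R \<in> curve" "pt_ring P = pt_ring R"
  shows "orb frob (fst P) = orb frob (fst R)"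
proof -
  obtain k where "R = (frob2 ^^ k) P" using assms unfolding pt_ring_orbit[OF assms(1,2)] orb_def by blast
  hence "fst R \<in> orb frob (fst P)" unfolding orb_def funpow_frob2 by auto
  thus ?thesis using frob.orb_eqI by blast
qed

text \<open>With d the degree of the orbit and t its trace, the d-th power of Frobenius takes
  \<open>shift i P\<close> to \<open>shift (i + t) P\<close>. If p divides t, the fiber gives p
  places of norm q^d; otherwise it is one orbit, a single place of norm q^(d p), and the product
  over c is 1 - u^(d p) as well. \<phi> stands for n \<mapsto> n^(-s).\<close>

lemma fiber_product:
  fixes \<phi> :: "nat \<Rightarrow> complex" and u :: complex
  assumes P: "P \<in> curve" and \<phi>: "\<And>n. \<phi> (CARD('a) ^ n) = u ^ n"
  defines "Q \<equiv> orb frob (fst P)"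
  shows "(\<Prod>V\<in>(\<lambda>i. pt_ring (shift i P)) ` {..<p}. 1 - \<phi> (residue_card V)) =
    (\<Prod>c<p. 1 - add_char (a * orb_trace N Q) ^ c * u ^ card Q)"
proof -
  let ?d = "card Q"
  let ?tr = "abs_trace (a * orb_trace N Q)" and ?\<rho> = "add_char (a * orb_trace N Q)"
  have d: "period frob (fst P) = ?d" unfolding Q_def frob.card_orb ..
  have dpos: "?d > 0" unfolding d[symmetric] by (rule frob.period(1))
  have sc: "shift i P \<in> curve" for i using shift_curve[OF P] .
  obtain t where t: "of_nat t = ?tr" by (rule abs_trace_prime_subfield)
  have step: "(frob2 ^^ ?d) (shift i P) = shift (i + t) P" for i
  proof -
    have "(frob ^^ ?d) (fst P) = fst P" using frob.funpow_eq_iff[of ?d "fst P"] d by simp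
    moreover have "(frob ^^ ?d) (snd P) = snd P + of_nat t"
      using trace_frob[OF P] unfolding Q_def[symmetric] t[symmetric] by simp
    ultimately have "(frob2 ^^ ?d) P = shift t P" unfolding funpow_frob2 shift_def by simp
    thus ?thesis unfolding frob2_shift by (simp add: shift_def add_ac)
  qed
  have steps: "(frob2 ^^ (?d * k)) (shift i P) = shift (i + t * k) P" for k i
  proof (induction k)
    case (Suc k)
    have "(frob2 ^^ (?d * Suc k)) (shift i P) = (frob2 ^^ ?d) ((frob2 ^^ (?d * k)) (shift i P))"
      by (simp add: funpow_add)
    thus ?case unfolding Suc step by (simp add: add_ac)
  qed simp
  have shift_eq: "shift i P = shift j P \<longleftrightarrow> (of_nat i :: 'a alg_closure) = of_nat j" for i j
    unfolding shift_def by simp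
  have dd: "?d dvd n" if "fst ((frob2 ^^ n) (shift i P)) = fst P" for n i
    using that unfolding funpow_frob2_fst_snd(1) by (simp add: shift_def frob.funpow_eq_iff d)
  show ?thesis
  proof (cases "?\<rho> = 1")
    case True
    hence "?tr = 0" by (simp add: add_char_eq_1_iff)
    hence "(of_nat t :: 'a alg_closure) = 0" using t to_ac_of_nat[of t] by (metis to_ac_0)
    hence pt: "p dvd t" unfolding of_nat_ac_eq_0 .
    have fx: "(frob2 ^^ (?d * k)) (shift i P) = shift i P" for i k
    proof -
      have "p dvd t * k" using pt by simp
      hence "(of_nat (t * k) :: 'a alg_closure) = 0" unfolding of_nat_ac_eq_0 .
      thus ?thesis unfolding steps shift_eq of_nat_add by simp
    qed
    have per: "period frob2 (shift i P) = ?d" for i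
    proof (rule dvd_antisym)
      show "period frob2 (shift i P) dvd ?d" using fx[of 1 i] unfolding frob2.funpow_eq_iff by simp
      show "?d dvd period frob2 (shift i P)"
        by (rule dd[of _ i]) (simp add: frob2.period(2) shift_def)
    qed
    have inj: "inj_on (\<lambda>i. pt_ring (shift i P)) {..<p}"
    proof (rule inj_onI)
      fix i j assume ij: "i \<in> {..<p}" "j \<in> {..<p}" "pt_ring (shift i P) = pt_ring (shift j P)"
      then obtain k where k: "shift j P = (frob2 ^^ k) (shift i P)"
        unfolding pt_ring_orbit[OF sc sc] orb_def by blast
      hence "fst ((frob2 ^^ k) (shift i P)) = fst P" by (metis shift_def fst_conv)
      hence "?d dvd k" by (rule dd)
      then obtain l where "k = ?d * l" by (rule dvdE)
      hence "shift j P = shift i P" using k fx by simp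
      thus "i = j" unfolding shift_eq using ij of_nat_ac_inj by (metis inj_onD)
    qed
    have "(\<Prod>V\<in>(\<lambda>i. pt_ring (shift i P)) ` {..<p}. 1 - \<phi> (residue_card V)) = (\<Prod>i<p. 1 - u ^ ?d)"
      by (subst prod.reindex[OF inj]) (simp add: pt_ring_residue_card[OF sc] per \<phi>)
    thus ?thesis unfolding True by simp
  next
    case False
    hence "?tr \<noteq> 0" by (simp add: add_char_eq_1_iff)
    hence nt: "\<not> p dvd t" unfolding t[symmetric] of_nat_eq_0_iff_char_dvd p_def .
    hence cop: "coprime t p" using p(1) by (metis coprime_commute prime_imp_coprime)
    have fx: "(frob2 ^^ (?d * k)) P = P \<longleftrightarrow> p dvd k" for k
    proof -
      have "(frob2 ^^ (?d * k)) P = P \<longleftrightarrow> (of_nat (t * k) :: 'a alg_closure) = 0"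
        using steps[of k 0] shift_eq[of "t * k" 0] by simp
      also have "\<dots> \<longleftrightarrow> p dvd t * k" by (rule of_nat_ac_eq_0)
      also have "\<dots> \<longleftrightarrow> p dvd k" using p(1) nt by (simp add: prime_dvd_mult_iff)
      finally show ?thesis .
    qed
    have per: "period frob2 P = ?d * p"
    proof (rule dvd_antisym)
      show "period frob2 P dvd ?d * p" unfolding frob2.funpow_eq_iff[symmetric] fx by simp
      obtain k where k: "period frob2 P = ?d * k"
        using period_fst_dvd[of P] unfolding d by (rule dvdE)
      have "p dvd k" unfolding fx[symmetric] k[symmetric] by (rule frob2.period(2))
      thus "?d * p dvd period frob2 P" unfolding k by simp
    qed
    \<comment> \<open>\<open>t\<close> is invertible modulo p, so every shift is a multiple of the
      shift by \<open>t\<close>, which Frobenius realises.\<close>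
    have all: "pt_ring (shift i P) = pt_ring P" for i
    proof -
      obtain k where "[t * k = i] (mod p)" using cong_solve_coprime_nat[OF cop] cong_scalar_right
        by (metis cong_mult_self_left mult.assoc mult_1 One_nat_def)
      hence "[t * k = i] (mod CHAR('a alg_closure))" unfolding CHAR_ac .
      hence "(of_nat (t * k) :: 'a alg_closure) = of_nat i" unfolding of_nat_eq_iff_cong_CHAR .
      hence "shift i P = shift (t * k) P" unfolding shift_eq by simp
      also have "\<dots> = (frob2 ^^ (?d * k)) P" using steps[of k 0] by simp
      finally have "shift i P \<in> orb frob2 P" unfolding orb_def by blast
      thus ?thesis by (rule pt_ring_orbit[OF P sc, THEN iffD2, symmetric])
    qed
    have "(\<lambda>i. pt_ring (shift i P)) ` {..<p} = {pt_ring P}" unfolding all using p(2) by (simp add: image_constant_conv lessThan_empty_iff)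
    hence "(\<Prod>V\<in>(\<lambda>i. pt_ring (shift i P)) ` {..<p}. 1 - \<phi> (residue_card V)) = 1 - u ^ (?d * p)"
      by (simp add: pt_ring_residue_card[OF P] per \<phi>)
    also have "\<dots> = 1 - (u ^ ?d) ^ p" by (simp only: power_mult)
    also have "\<dots> = (\<Prod>c<p. 1 - ?\<rho> ^ c * u ^ ?d)"
      by (rule prod_one_minus_root_powers[OF p(1), symmetric]) (use False add_char_power_CHAR p_def in auto)
    finally show ?thesis .
  qed
qed

text \<open>One chosen point of the curve over each orbit of x-coordinates; its shifts generate the
  fiber.\<close>

definition base_point :: "'a alg_closure set \<Rightarrow> 'a alg_closure \<times> 'a alg_closure" where
  "base_point Q = (SOME P. P \<in> curve \<and> orb frob (fst P) = Q)"

lemma base_point: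
  assumes "Q \<in> orbs"
  shows "base_point Q \<in> curve" "orb frob (fst (base_point Q)) = Q"
proof -
  obtain \<alpha> where "Q = orb frob \<alpha>" using assms unfolding orbs_def by blast
  moreover obtain \<beta> where "(\<alpha>, \<beta>) \<in> curve" by (rule curve_point_exists)
  ultimately have "\<exists>P. P \<in> curve \<and> orb frob (fst P) = Q" by (intro exI[of _ "(\<alpha>, \<beta>)"]) simp
  from someI_ex[OF this] show "base_point Q \<in> curve" "orb frob (fst (base_point Q)) = Q"
    unfolding base_point_def by blast+
qed

definition fiber :: "'a alg_closure set \<Rightarrow> 'k set set" where
  "fiber Q = (\<lambda>i. pt_ring (shift i (base_point Q))) ` {..<p}"

lemma finite_places_eq: "pt_ring ` curve = (\<Union>Q\<in>orbs. fiber Q)"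
proof
  show "pt_ring ` curve \<subseteq> (\<Union>Q\<in>orbs. fiber Q)"
  proof (rule image_subsetI)
    fix P assume P: "P \<in> curve"
    let ?Q = "orb frob (fst P)"
    have Q: "?Q \<in> orbs" unfolding orbs_def by blast
    obtain i where "i < p" "pt_ring P = pt_ring (shift i (base_point ?Q))"
      using fiber_points[OF base_point(1)[OF Q] P] base_point(2)[OF Q] by metis
    thus "pt_ring P \<in> (\<Union>Q\<in>orbs. fiber Q)" unfolding fiber_def using Q by blast
  qed
  show "(\<Union>Q\<in>orbs. fiber Q) \<subseteq> pt_ring ` curve"
    unfolding fiber_def using base_point(1) shift_curve by blast
qed

lemma fiber_disjoint:
  assumes "Q \<in> orbs" "Q' \<in> orbs" "Q \<noteq> Q'"
  shows "fiber Q \<inter> fiber Q' = {}"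
proof (rule ccontr)
  assume "fiber Q \<inter> fiber Q' \<noteq> {}"
  then obtain i j where "pt_ring (shift i (base_point Q)) = pt_ring (shift j (base_point Q'))"
    unfolding fiber_def by blast
  hence "orb frob (fst (shift i (base_point Q))) = orb frob (fst (shift j (base_point Q')))"
    by (rule pt_ring_fiber_unique[OF shift_curve[OF base_point(1)[OF assms(1)]] shift_curve[OF base_point(1)[OF assms(2)]]])
  hence "orb frob (fst (base_point Q)) = orb frob (fst (base_point Q'))" by (simp add: shift_def)
  thus False using base_point(2) assms by simp
qed

lemma fiber_residue_card:
  assumes "Q \<in> orbs" "V \<in> fiber Q"
  obtains k where "k > 0" "residue_card V = CARD('a) ^ (card Q * k)"
proof -
  obtain i where i: "V = pt_ring (shift i (base_point Q))" using assms(2) unfolding fiber_def by blast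
  let ?R = "shift i (base_point Q)"
  have R: "?R \<in> curve" using base_point(1)[OF assms(1)] by (rule shift_curve)
  have "period frob (fst ?R) = card Q"
    using base_point(2)[OF assms(1)] unfolding frob.card_orb[symmetric] by (simp add: shift_def)
  then obtain k where k: "period frob2 ?R = card Q * k" using period_fst_dvd[of ?R] by (metis dvdE)
  hence "k > 0" using frob2.period(1)[of ?R] by (cases k) simp_all
  thus ?thesis using that k pt_ring_residue_card[OF R] unfolding i by metis
qed

text \<open>Over an orbit lie at most p places, of degrees divisible by that of the orbit, so p
  times the sum over orbits dominates.\<close>

lemma places_abs_summable:
  fixes \<phi> :: "nat \<Rightarrow> complex" and u :: complex
  assumes \<phi>: "\<And>n. \<phi> (CARD('a) ^ n) = u ^ n" and u: "norm u * real CARD('a) < 1"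
  shows "(\<lambda>V. norm (\<phi> (residue_card V))) summable_on {V. is_place V}"
proof -
  let ?g = "\<lambda>(Q, i). pt_ring (shift i (base_point Q))"
  have q2: "real CARD('a) \<ge> 1" using CARD_gt_1[where ?'a='a] by simp
  have "norm u * 1 \<le> norm u * real CARD('a)" using q2 by (intro mult_left_mono) simp_all
  hence u1: "norm u \<le> 1" using u by simp
  have im: "?g ` (orbs \<times> {..<p}) = pt_ring ` curve"
    unfolding finite_places_eq fiber_def by force
  \<comment> \<open>Over an inert orbit the p shifts give the same place. \<open>S\<close> retains
    one index pair for each place.\<close>
  obtain S where S: "S \<subseteq> orbs \<times> {..<p}" "pt_ring ` curve = ?g ` S" "inj_on ?g S"
    using im subset_image_inj[of "pt_ring ` curve" ?g "orbs \<times> {..<p}"] by auto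
  have "(\<lambda>(Q, i). norm u ^ card Q) summable_on (orbs :: 'a alg_closure set set) \<times> {..<p}"
  proof (rule summable_on_SigmaI[where g = "\<lambda>Q. real p * norm u ^ card Q"])
    show "((\<lambda>i. case (Q, i) of (Q, i) \<Rightarrow> norm u ^ card Q) has_sum real p * norm u ^ card Q) {..<p}" for Q :: "'a alg_closure set"
      by (simp add: has_sum_finite_iff)
    show "(\<lambda>Q. real p * norm u ^ card Q) summable_on (orbs :: 'a alg_closure set set)"
      using abs_summable_orbs[OF u] by (rule summable_on_cmult_right)
  qed auto
  hence "(\<lambda>(Q, i). norm u ^ card Q) summable_on S" using S(1) by (rule summable_on_subset_banach)
  moreover have "norm (\<phi> (residue_card (?g z))) \<le> (\<lambda>(Q, i). norm u ^ card Q) z" if "z \<in> S" for z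
  proof -
    obtain Q i where z: "z = (Q, i)" "Q \<in> orbs" "i < p" using S(1) \<open>z \<in> S\<close> by auto
    have "?g z \<in> fiber Q" unfolding z fiber_def using z(3) by auto
    then obtain k where k: "k > 0" "residue_card (?g z) = CARD('a) ^ (card Q * k)"
      using fiber_residue_card[OF z(2)] by metis
    have "card Q \<le> card Q * k" using k(1) by simp
    hence "norm u ^ (card Q * k) \<le> norm u ^ card Q" using u1 by (intro power_decreasing) simp_all
    moreover have "norm (\<phi> (residue_card (?g z))) = norm u ^ (card Q * k)" unfolding k(2) \<phi> norm_power ..
    moreover have "(\<lambda>(Q, i). norm u ^ card Q) z = norm u ^ card Q" using z(1) by simp
    ultimately show ?thesis by linarith
  qed
  ultimately have "(\<lambda>z. norm (\<phi> (residue_card (?g z)))) summable_on S"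
    by (rule Infinite_Sum.abs_summable_on_comparison_test')
  hence "(\<lambda>V. norm (\<phi> (residue_card V))) summable_on ?g ` S"
    by (subst summable_on_reindex[OF S(3)]) (simp add: o_def)
  hence "(\<lambda>V. norm (\<phi> (residue_card V))) summable_on {V. is_place V}"
    unfolding places_eq S(2) by (simp add: summable_on_insert_iff)
  thus ?thesis .
qed

lemma inf_ring_not_finite: "inf_ring \<notin> pt_ring ` curve"
  using pt_ring_is_place(2) inf_ring_is_place(2) by auto

lemma residue_card_place:
  assumes "is_place V"
  obtains n where "n > 0" "residue_card V = CARD('a) ^ n"
proof -
  have "V = inf_ring \<or> V \<in> pt_ring ` curve" using assms places_eq by blast
  thus ?thesis
  proof
    assume "V = inf_ring"
    thus ?thesis using that[of 1] inf_ring_residue_card by simp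
  next
    assume "V \<in> pt_ring ` curve"
    then obtain P where P: "P \<in> curve" "V = pt_ring P" by blast
    show ?thesis
      by (rule that[of "period frob2 P"]) (use pt_ring_residue_card[OF P(1)] frob2.period(1)[of P] P(2) in simp_all)
  qed
qed

text \<open>For c = 0 the character is trivial and the series is the zeta function of the affine
  line; for 0 < c < p, the multiple of \<open>a\<close> is nonzero and the series breaks
  off.\<close>

lemma L_series_has_sum:
  fixes u :: complex
  assumes u: "norm u * real CARD('a) < 1" and c: "c < p"
  shows "((\<lambda>d. char_sum N (of_nat c * a) d * u ^ d) has_sum
    (if c = 0 then 1 / (1 - of_nat CARD('a) * u) else (\<Sum>d<N. char_sum N (of_nat c * a) d * u ^ d))) UNIV"
proof (cases "c = 0")
  case True
  have n: "norm (of_nat CARD('a) * u) < 1" using u by (simp add: norm_mult mult.commute)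
  have "((\<lambda>d. (of_nat CARD('a) * u) ^ d) has_sum (1 / (1 - of_nat CARD('a) * u))) UNIV"
    by (rule norm_summable_imp_has_sum) (use n in \<open>auto simp: norm_power summable_geometric intro: geometric_sums\<close>)
  thus ?thesis using True by (simp add: char_sum_0 power_mult_distrib)
next
  case False
  have "(of_nat c :: 'a) \<noteq> 0"
    using False c dvd_imp_le[of p c] unfolding of_nat_eq_0_iff_char_dvd p_def[symmetric] by auto
  hence "of_nat N * (of_nat c * a) \<noteq> 0" using N by simp
  then interpret L: additive_L N "of_nat c * a" by unfold_locales
  have "((\<lambda>d. char_sum N (of_nat c * a) d * u ^ d) has_sum (\<Sum>d<N. char_sum N (of_nat c * a) d * u ^ d)) {..<N}"
    by (simp add: has_sum_finite_iff)
  also have "?this \<longleftrightarrow> ((\<lambda>d. char_sum N (of_nat c * a) d * u ^ d) has_sum (\<Sum>d<N. char_sum N (of_nat c * a) d * u ^ d)) UNIV"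
    by (rule has_sum_cong_neutral) (auto simp: L.char_sum_eq_0)
  finally show ?thesis using False by simp
qed

end


context artin_schreier
begin

text \<open>Finite sets A of orbits correspond to the finite sets \<open>T A\<close> of all places
  over A and infinity, and these are cofinal among the finite sets of places. On such sets the Euler
  product splits by \<open>fiber_product\<close> into one product for each c < p, c = 0 being the
  affine line, while the place at infinity contributes 1 / (1 - u).\<close>

theorem zeta_series:
  fixes \<phi> :: "nat \<Rightarrow> complex" and u :: complex
  assumes \<phi>: "\<And>n. \<phi> (CARD('a) ^ n) = u ^ n" and u: "norm u * real CARD('a) < 1"
  shows "((\<lambda>D. \<Prod>V\<in>#D. \<phi> (residue_card V)) has_sum
    ((\<Prod>c\<in>{1..<p}. \<Sum>d<N. char_sum N (of_nat c * a) d * u ^ d) / ((1 - u) * (1 - of_nat CARD('a) * u))))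
    {D. set_mset D \<subseteq> {V. is_place V}}"
proof -
  let ?X = "{V. is_place V}" and ?O = "orbs :: 'a alg_closure set set"
  let ?f = "\<lambda>V. \<phi> (residue_card V)"
  let ?\<rho> = "\<lambda>Q. add_char (a * orb_trace N Q)"
  have "real CARD('a) \<ge> 2" using CARD_gt_1[where ?'a='a] by simp
  hence "norm u * 2 \<le> norm u * real CARD('a)" by (intro mult_left_mono) simp_all
  hence uh: "norm u \<le> 1/2" using u by simp
  have un: "norm u ^ n \<le> 1/2" if "n > 0" for n
  proof -
    have "norm u ^ n \<le> norm u ^ 1" using that uh by (intro power_decreasing) auto
    thus ?thesis using uh by simp
  qed
  have le: "norm (?f V) \<le> 1/2" if V: "V \<in> ?X" for V
  proof -
    have "is_place V" using V by simp
    then obtain n where n: "n > 0" "residue_card V = CARD('a) ^ n" by (rule residue_card_place)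
    have "norm (?f V) = norm u ^ n" unfolding n(2) \<phi> norm_power ..
    thus ?thesis using un[OF n(1)] by simp
  qed
  have "(\<lambda>D. norm (\<Prod>V\<in>#D. ?f V)) summable_on {D. set_mset D \<subseteq> ?X}"
    by (rule euler_abs_summable[OF places_abs_summable[where \<phi> = \<phi> and u = u, OF \<phi> u] le])
  hence "(\<lambda>D. \<Prod>V\<in>#D. ?f V) summable_on {D. set_mset D \<subseteq> ?X}" by (rule abs_summable_summable)
  then obtain S where S: "((\<lambda>D. \<Prod>V\<in>#D. ?f V) has_sum S) {D. set_mset D \<subseteq> ?X}"
    unfolding summable_on_def by blast
  have lim: "((\<lambda>A. \<Prod>V\<in>A. 1 / (1 - ?f V)) \<longlongrightarrow> S) (finite_subsets_at_top ?X)"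
    by (rule euler_product[OF le S])
  define T where "T A = insert inf_ring (\<Union>Q\<in>A. fiber Q)" for A
  have fin_fiber: "finite (fiber Q)" for Q unfolding fiber_def by simp
  have flt: "filterlim T (finite_subsets_at_top ?X) (finite_subsets_at_top ?O)"
    unfolding filterlim_iff
  proof (intro allI impI)
    fix P assume "eventually P (finite_subsets_at_top ?X)"
    then obtain X0 where X0: "finite X0" "X0 \<subseteq> ?X" "\<And>Y. finite Y \<Longrightarrow> X0 \<subseteq> Y \<Longrightarrow> Y \<subseteq> ?X \<Longrightarrow> P Y"
      unfolding eventually_finite_subsets_at_top by auto
    have "\<forall>V\<in>X0 - {inf_ring}. \<exists>Q. Q \<in> ?O \<and> V \<in> fiber Q"
      using X0(2) unfolding places_eq finite_places_eq by blast
    from bchoice[OF this] obtain q where q: "\<forall>V\<in>X0 - {inf_ring}. q V \<in> ?O \<and> V \<in> fiber (q V)" by blast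
    have "P (T A)" if A: "finite A" "q ` (X0 - {inf_ring}) \<subseteq> A" "A \<subseteq> ?O" for A
    proof (rule X0(3))
      show "finite (T A)" unfolding T_def using A(1) fin_fiber by simp
      show "X0 \<subseteq> T A" unfolding T_def using q A(2) by blast
      show "T A \<subseteq> ?X" unfolding T_def places_eq finite_places_eq using A(3) by blast
    qed
    hence all: "\<forall>A. finite A \<and> q ` (X0 - {inf_ring}) \<subseteq> A \<and> A \<subseteq> ?O \<longrightarrow> P (T A)" by simp
    have "finite (q ` (X0 - {inf_ring}))" "q ` (X0 - {inf_ring}) \<subseteq> ?O" using X0(1) q by blast+
    thus "eventually (\<lambda>A. P (T A)) (finite_subsets_at_top ?O)"
      unfolding eventually_finite_subsets_at_top using all by (intro exI[of _ "q ` (X0 - {inf_ring})"] conjI)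
  qed
  have lim1: "((\<lambda>A. \<Prod>V\<in>T A. 1 / (1 - ?f V)) \<longlongrightarrow> S) (finite_subsets_at_top ?O)"
    by (rule filterlim_compose[OF lim flt])
  define Lc where "Lc c = (if c = 0 then 1 / (1 - of_nat CARD('a) * u) else (\<Sum>d<N. char_sum N (of_nat c * a) d * u ^ d))" for c
  have lim2: "((\<lambda>A. \<Prod>Q\<in>A. 1 / (1 - ?\<rho> Q ^ c * u ^ card Q)) \<longlongrightarrow> Lc c) (finite_subsets_at_top ?O)" if c: "c < p" for c
  proof (rule euler_product)
    fix Q :: "'a alg_closure set" assume "Q \<in> orbs"
    hence "card Q > 0" by (rule card_orbs_pos)
    thus "norm (?\<rho> Q ^ c * u ^ card Q) \<le> 1/2" using un by (simp add: norm_mult norm_power)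
  next
    have "add_char (of_nat c * a * orb_trace N Q) = ?\<rho> Q ^ c" for Q
      unfolding mult.assoc by (rule add_char_of_nat_mult)
    thus "((\<lambda>D. \<Prod>Q\<in>#D. ?\<rho> Q ^ c * u ^ card Q) has_sum Lc c) {D. set_mset D \<subseteq> ?O}"
      using L_series_orbits[OF u N_pos L_series_has_sum[OF u c]] unfolding Lc_def by (simp only:)
  qed
  have eqA: "(\<Prod>V\<in>T A. 1 / (1 - ?f V)) = 1 / (1 - u) * (\<Prod>c<p. \<Prod>Q\<in>A. 1 / (1 - ?\<rho> Q ^ c * u ^ card Q))"
    if A: "finite A" "A \<subseteq> ?O" for A
  proof -
    have fQ: "(\<Prod>V\<in>fiber Q. 1 / (1 - ?f V)) = (\<Prod>c<p. 1 / (1 - ?\<rho> Q ^ c * u ^ card Q))" if "Q \<in> A" for Q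
    proof -
      have Q: "Q \<in> orbs" using that A by blast
      have "(\<Prod>V\<in>fiber Q. 1 - ?f V) = (\<Prod>c<p. 1 - ?\<rho> Q ^ c * u ^ card Q)"
        using fiber_product[where \<phi> = \<phi> and u = u, OF base_point(1)[OF Q] \<phi>] unfolding base_point(2)[OF Q] fiber_def .
      thus ?thesis unfolding prod_dividef by simp
    qed
    have ni: "inf_ring \<notin> (\<Union>Q\<in>A. fiber Q)" using A(2) inf_ring_not_finite unfolding finite_places_eq by blast
    have e1: "(\<Prod>V\<in>T A. 1 / (1 - ?f V)) = 1 / (1 - ?f inf_ring) * (\<Prod>V\<in>(\<Union>Q\<in>A. fiber Q). 1 / (1 - ?f V))"
      unfolding T_def by (rule prod.insert[OF _ ni]) (use A(1) fin_fiber in simp)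
    have "(\<Prod>V\<in>(\<Union>Q\<in>A. fiber Q). 1 / (1 - ?f V)) = (\<Prod>Q\<in>A. \<Prod>V\<in>fiber Q. 1 / (1 - ?f V))"
    proof (rule prod.UNION_disjoint[OF A(1)])
      show "\<forall>Q\<in>A. finite (fiber Q)" using fin_fiber by simp
      show "\<forall>Q\<in>A. \<forall>Q'\<in>A. Q \<noteq> Q' \<longrightarrow> fiber Q \<inter> fiber Q' = {}" using A(2) fiber_disjoint by blast
    qed
    also have "\<dots> = (\<Prod>Q\<in>A. \<Prod>c<p. 1 / (1 - ?\<rho> Q ^ c * u ^ card Q))" using fQ by (rule prod.cong[OF refl])
    also have "\<dots> = (\<Prod>c<p. \<Prod>Q\<in>A. 1 / (1 - ?\<rho> Q ^ c * u ^ card Q))" by (rule prod.swap)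
    finally have e2: "(\<Prod>V\<in>(\<Union>Q\<in>A. fiber Q). 1 / (1 - ?f V)) = (\<Prod>c<p. \<Prod>Q\<in>A. 1 / (1 - ?\<rho> Q ^ c * u ^ card Q))" .
    have e3: "?f inf_ring = u" unfolding inf_ring_residue_card using \<phi>[of 1] by simp
    show ?thesis unfolding e1 e2 e3 ..
  qed
  define L where "L A = (\<Prod>V\<in>T A. 1 / (1 - ?f V))" for A
  define R where "R A = (\<Prod>c<p. \<Prod>Q\<in>A. 1 / (1 - ?\<rho> Q ^ c * u ^ card Q))" for A
  have limR: "(R \<longlongrightarrow> (\<Prod>c<p. Lc c)) (finite_subsets_at_top ?O)"
    unfolding R_def using lim2 by (intro tendsto_prod) simp
  have m1: "((\<lambda>A. 1 / (1 - u) * R A) \<longlongrightarrow> 1 / (1 - u) * (\<Prod>c<p. Lc c)) (finite_subsets_at_top ?O)"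
    by (rule tendsto_mult_left[OF limR])
  have LR: "L A = 1 / (1 - u) * R A" if "finite A" "A \<subseteq> ?O" for A
    unfolding L_def R_def by (rule eqA[OF that])
  have m2: "eventually (\<lambda>A. L A = 1 / (1 - u) * R A) (finite_subsets_at_top ?O)"
    using LR by (rule eventually_finite_subsets_at_top_weakI)
  have m3: "(L \<longlongrightarrow> S) (finite_subsets_at_top ?O)" unfolding L_def by (rule lim1)
  have m4: "((\<lambda>A. 1 / (1 - u) * R A) \<longlongrightarrow> S) (finite_subsets_at_top ?O)"
    by (rule Lim_transform_eventually[OF m3 m2])
  have S1: "S = 1 / (1 - u) * (\<Prod>c<p. Lc c)"
    by (rule tendsto_unique[OF finite_subsets_at_top_neq_bot m4 m1])
  have S2: "(\<Prod>c<p. Lc c) = Lc 0 * (\<Prod>c\<in>{1..<p}. Lc c)"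
  proof -
    have i: "{..<p} = insert 0 {1..<p}" using p(2) by auto
    show ?thesis unfolding i by (rule prod.insert) simp_all
  qed
  have S3: "(\<Prod>c\<in>{1..<p}. Lc c) = (\<Prod>c\<in>{1..<p}. \<Sum>d<N. char_sum N (of_nat c * a) d * u ^ d)"
    by (rule prod.cong[OF refl]) (simp add: Lc_def)
  have S4: "Lc 0 = 1 / (1 - of_nat CARD('a) * u)" by (simp add: Lc_def)
  have S5: "S = (\<Prod>c\<in>{1..<p}. \<Sum>d<N. char_sum N (of_nat c * a) d * u ^ d) / ((1 - u) * (1 - of_nat CARD('a) * u))"
    unfolding S1 S2 S3 S4 by (simp only: times_divide_times_eq times_divide_eq_left times_divide_eq_right divide_divide_eq_left mult_1_left mult_1_right mult_ac)
  show ?thesis using S unfolding S5 .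
qed

end


section \<open>Meromorphic continuation\<close>

lemma nicely_meromorphic_remove_sings:
  assumes "f nicely_meromorphic_on UNIV"
  shows "remove_sings f z = f z"
proof -
  have "(is_pole f z \<and> f z = 0) \<or> f \<midarrow>z\<rightarrow> f z" using assms unfolding nicely_meromorphic_on_def by blast
  thus ?thesis using remove_sings_at_pole remove_sings_eqI by metis
qed

text \<open>With singularities removed, the difference vanishes near 2 and so everywhere, by the
  identity theorem. The functions then agree on a punctured neighbourhood of each point, which
  determines the value of a nicely meromorphic function.\<close>

lemma nicely_meromorphic_unique:
  assumes f: "f nicely_meromorphic_on UNIV" and g: "g nicely_meromorphic_on UNIV"
    and eq: "\<And>s. Re s > 1 \<Longrightarrow> f s = g s"
  shows "f = g"
proof
  fix z
  define d where "d = (\<lambda>s. f s - g s)"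
  have mer: "f meromorphic_on UNIV" "g meromorphic_on UNIV" using f g unfolding nicely_meromorphic_on_def by blast+
  hence dm: "d meromorphic_on UNIV" unfolding d_def by (rule meromorphic_on_diff)
  have ev: "eventually (\<lambda>s. remove_sings d s = d s) (at w)" for w
    by (rule eventually_remove_sings_eq_at)
       (rule meromorphic_on_isolated_singularity[OF meromorphic_on_subset[OF dm]], simp)
  have "open {s. Re s > 1}" by (rule open_halfspace_Re_gt)
  hence "eventually (\<lambda>s. s \<in> {s. Re s > 1}) (at 2)" by (intro eventually_at_in_open') simp_all
  hence "eventually (\<lambda>s. remove_sings d s = 0) (at 2)"
    using ev[of 2] by eventually_elim (simp add: d_def eq)
  hence "frequently (\<lambda>s. remove_sings d s = 0) (at 2)" by (intro eventually_frequently) simp_all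
  hence z: "remove_sings d w = 0" for w
    by (rule frequently_eq_meromorphic_imp_constant[OF _ remove_sings_nicely_meromorphic[OF dm]]) (simp_all add: connected_UNIV)
  have "eventually (\<lambda>s. f s = g s) (at z)"
    using ev[of z] by eventually_elim (use z in \<open>simp add: d_def\<close>)
  hence "remove_sings f z = remove_sings g z" by (rule remove_sings_cong) simp
  thus "f z = g z" using nicely_meromorphic_remove_sings f g by simp
qed

text \<open>\<open>remove_sings\<close> assigns the conventional values at the poles and leaves the
  function unchanged where it is analytic.\<close>

lemma zeta_K_eq:
  assumes f: "f meromorphic_on UNIV" and an: "\<And>s. Re s > 1 \<Longrightarrow> f analytic_on {s}"
    and eq: "\<And>s. Re s > 1 \<Longrightarrow> f s = (\<Sum>\<^sub>\<infinity>D \<in> effective_divisors F K. of_nat (divisor_norm K D) powr (- s))"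
  shows "zeta_K F K = remove_sings f"
  unfolding zeta_K_def
proof (rule the_equality)
  show 1: "remove_sings f nicely_meromorphic_on UNIV \<and> (\<forall>s. Re s > 1 \<longrightarrow>
        remove_sings f s = (\<Sum>\<^sub>\<infinity>D \<in> effective_divisors F K. of_nat (divisor_norm K D) powr (- s)))"
    using remove_sings_nicely_meromorphic[OF f] an eq by simp
  fix g assume "g nicely_meromorphic_on UNIV \<and> (\<forall>s. Re s > 1 \<longrightarrow>
        g s = (\<Sum>\<^sub>\<infinity>D \<in> effective_divisors F K. of_nat (divisor_norm K D) powr (- s)))"
  thus "g = remove_sings f" using 1 by (intro nicely_meromorphic_unique) simp_all
qed

lemma of_nat_mult_powr: "of_nat (m * n) powr (z::complex) = of_nat m powr z * of_nat n powr z"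
  unfolding of_nat_mult by (rule powr_times_real) simp_all

lemma of_nat_power_powr: "of_nat (m ^ n) powr (z::complex) = (of_nat m powr z) ^ n"
  by (induction n) (simp_all only: power_0 power_Suc of_nat_mult_powr, simp)

lemma divisor_norm_powr: "of_nat (divisor_norm K D) powr (z::complex) = (\<Prod>V\<in>#D. of_nat (place_norm K V) powr z)"
  unfolding divisor_norm_def
proof (induction D)
  case (add V D)
  have "(\<Prod>V\<in>#add_mset V D. place_norm K V) = place_norm K V * (\<Prod>V\<in>#D. place_norm K V)" by simp
  thus ?case using add by (simp only: of_nat_mult_powr) simp
qed simp

section \<open>Invariance of the zeta function under isomorphisms\<close>

locale field_isom = R: field R + S: field S for R :: "'r ring" and S :: "'s ring" and h +
  assumes iso: "h \<in> ring_iso R S"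
begin

sublocale hom: ring_hom_ring R S h
  using iso unfolding ring_iso_def by (intro ring_hom_ringI2 R.ring_axioms S.ring_axioms) simp

lemma bij: "bij_betw h (carrier R) (carrier S)" using iso unfolding ring_iso_def by blast
lemma inj: "inj_on h (carrier R)" using bij by (rule bij_betw_imp_inj_on)
lemma surj: "h ` carrier R = carrier S" using bij by (rule bij_betw_imp_surj_on)

lemma h_eq_zero: "x \<in> carrier R \<Longrightarrow> h x = \<zero>\<^bsub>S\<^esub> \<longleftrightarrow> x = \<zero>\<^bsub>R\<^esub>"
  using inj R.zero_closed hom.hom_zero by (metis inj_onD)

lemma h_inv:
  assumes x: "x \<in> carrier R" "x \<noteq> \<zero>\<^bsub>R\<^esub>"
  shows "h (inv\<^bsub>R\<^esub> x) = inv\<^bsub>S\<^esub> (h x)"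
proof -
  have u: "x \<in> Units R" using x R.field_Units by simp
  have "h x \<otimes>\<^bsub>S\<^esub> h (inv\<^bsub>R\<^esub> x) = h (x \<otimes>\<^bsub>R\<^esub> inv\<^bsub>R\<^esub> x)" using x(1) u by (intro hom.hom_mult[symmetric]) simp_all
  also have "\<dots> = \<one>\<^bsub>S\<^esub>" using u by simp
  finally have "h x \<otimes>\<^bsub>S\<^esub> h (inv\<^bsub>R\<^esub> x) = \<one>\<^bsub>S\<^esub>" .
  thus ?thesis using x(1) u by (intro S.comm_inv_char[symmetric]) simp_all
qed

lemma image_place:
  assumes V: "V \<in> places F R"
  shows "h ` V \<in> places (h ` F) S"
proof -
  have sub: "subring V R" "F \<subset> V" "V \<subset> carrier R"
    and val: "\<And>z. z \<in> carrier R - {\<zero>\<^bsub>R\<^esub>} \<Longrightarrow> z \<in> V \<or> inv\<^bsub>R\<^esub> z \<in> V"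
    using V unfolding places_def by blast+
  note E = subringE[OF sub(1)]
  have "subring (h ` V) S"
  proof (rule S.subringI)
    show "h ` V \<subseteq> carrier S" using sub(3) surj by blast
    show "\<one>\<^bsub>S\<^esub> \<in> h ` V" using E(3) hom.hom_one by (metis imageI)
    fix y assume "y \<in> h ` V"
    then obtain x where x: "x \<in> V" "y = h x" by blast
    have "\<ominus>\<^bsub>S\<^esub> y = h (\<ominus>\<^bsub>R\<^esub> x)" using x E(1) by (simp add: subsetD)
    thus "\<ominus>\<^bsub>S\<^esub> y \<in> h ` V" using E(5) x by blast
    fix y' assume "y' \<in> h ` V"
    then obtain x' where x': "x' \<in> V" "y' = h x'" by blast
    have c: "x \<in> carrier R" "x' \<in> carrier R" using x x' E(1) by blast+
    have "y \<otimes>\<^bsub>S\<^esub> y' = h (x \<otimes>\<^bsub>R\<^esub> x')" unfolding x x' using c by simp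
    thus "y \<otimes>\<^bsub>S\<^esub> y' \<in> h ` V" using E(6) x x' by blast
    have "y \<oplus>\<^bsub>S\<^esub> y' = h (x \<oplus>\<^bsub>R\<^esub> x')" unfolding x x' using c by simp
    thus "y \<oplus>\<^bsub>S\<^esub> y' \<in> h ` V" using E(7) x x' by blast
  qed
  moreover have strict: "h ` A \<subset> h ` B" if "A \<subset> B" "B \<subseteq> carrier R" for A B
  proof -
    have "h ` A \<noteq> h ` B" using that inj_on_image_eq_iff[OF inj, of A B] by blast
    thus ?thesis using that(1) by blast
  qed
  hence "h ` F \<subset> h ` V" using sub(2,3) by simp
  moreover have "h ` V \<subset> carrier S" using strict[OF sub(3)] unfolding surj by simp
  moreover have "z \<in> h ` V \<or> inv\<^bsub>S\<^esub> z \<in> h ` V" if z: "z \<in> carrier S - {\<zero>\<^bsub>S\<^esub>}" for z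
  proof -
    obtain x where x: "x \<in> carrier R" "z = h x" using z surj by blast
    have x0: "x \<noteq> \<zero>\<^bsub>R\<^esub>" using z x h_eq_zero by auto
    have "x \<in> V \<or> inv\<^bsub>R\<^esub> x \<in> V" using val x x0 by blast
    thus ?thesis unfolding x(2) h_inv[OF x(1) x0, symmetric] by blast
  qed
  ultimately show ?thesis unfolding places_def by blast
qed

lemma image_place_ideal:
  assumes V: "V \<subseteq> carrier R"
  shows "place_ideal S (h ` V) = h ` place_ideal R V"
proof -
  have inv: "h x \<otimes>\<^bsub>S\<^esub> h y = \<one>\<^bsub>S\<^esub> \<longleftrightarrow> x \<otimes>\<^bsub>R\<^esub> y = \<one>\<^bsub>R\<^esub>" if "x \<in> V" "y \<in> V" for x y
  proof -
    have c: "x \<in> carrier R" "y \<in> carrier R" using that V by blast+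
    have "h x \<otimes>\<^bsub>S\<^esub> h y = \<one>\<^bsub>S\<^esub> \<longleftrightarrow> h (x \<otimes>\<^bsub>R\<^esub> y) = h \<one>\<^bsub>R\<^esub>" using c by simp
    also have "\<dots> \<longleftrightarrow> x \<otimes>\<^bsub>R\<^esub> y = \<one>\<^bsub>R\<^esub>" using inj c by (intro inj_on_eq_iff[OF inj]) simp_all
    finally show ?thesis .
  qed
  have "h x \<in> Units (S\<lparr>carrier := h ` V\<rparr>) \<longleftrightarrow> x \<in> Units (R\<lparr>carrier := V\<rparr>)" if "x \<in> V" for x
    unfolding Units_def using that inv by auto
  thus ?thesis unfolding place_ideal_def by blast
qed

text \<open>Residue classes are subsets of the field, and an injective map is injective on
  subsets.\<close>

lemma image_place_norm:
  assumes V: "subring V R"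
  shows "place_norm S (h ` V) = place_norm R V"
proof -
  have Vc: "V \<subseteq> carrier R" using subringE(1)[OF V] .
  let ?m = "place_ideal R V"
  have m: "?m \<subseteq> V" unfolding place_ideal_def by blast
  let ?c = "\<lambda>a. \<Union>x\<in>?m. {x \<oplus>\<^bsub>R\<^esub> a}"
  have 1: "carrier ((R\<lparr>carrier := V\<rparr>) Quot ?m) = ?c ` V"
    unfolding FactRing_def A_RCOSETS_def' a_r_coset_def' by auto
  have 2: "carrier ((S\<lparr>carrier := h ` V\<rparr>) Quot (h ` ?m)) = (\<lambda>a. \<Union>x\<in>?m. {h x \<oplus>\<^bsub>S\<^esub> h a}) ` V"
    unfolding FactRing_def A_RCOSETS_def' a_r_coset_def' by auto
  have "(\<Union>x\<in>?m. {h x \<oplus>\<^bsub>S\<^esub> h a}) = h ` ?c a" if "a \<in> V" for a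
  proof -
    have "h (x \<oplus>\<^bsub>R\<^esub> a) = h x \<oplus>\<^bsub>S\<^esub> h a" if "x \<in> ?m" for x
      using that \<open>a \<in> V\<close> m Vc by (intro hom.hom_add) blast+
    hence "(\<Union>x\<in>?m. {h x \<oplus>\<^bsub>S\<^esub> h a}) = (\<Union>x\<in>?m. {h (x \<oplus>\<^bsub>R\<^esub> a)})" by simp
    thus ?thesis by (simp only: image_UN image_insert image_empty)
  qed
  hence 3: "(\<lambda>a. \<Union>x\<in>?m. {h x \<oplus>\<^bsub>S\<^esub> h a}) ` V = (\<lambda>A. h ` A) ` (?c ` V)"
    unfolding image_image by (intro image_cong refl)
  have sub: "?c ` V \<subseteq> Pow (carrier R)" using m Vc by auto
  have "inj_on (\<lambda>A. h ` A) (Pow (carrier R))" using inj by (rule inj_on_image_Pow)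
  hence "inj_on (\<lambda>A. h ` A) (?c ` V)" using sub by (rule inj_on_subset)
  hence "card ((\<lambda>A. h ` A) ` (?c ` V)) = card (?c ` V)" by (rule card_image)
  thus ?thesis unfolding place_norm_def image_place_ideal[OF Vc] 1 2 3 .
qed

end

lemma field_isom_inverse:
  assumes "field_isom R S h"
  shows "field_isom S R (inv_into (carrier R) h)"
proof -
  interpret field_isom R S h by fact
  show ?thesis by unfold_locales (rule ring_iso_set_sym[OF R.ring_axioms iso])
qed

text \<open>The inclusion from left to right is \<open>image_place\<close> for the inverse
  isomorphism.\<close>

lemma (in field_isom) places_image:
  assumes F: "F \<subseteq> carrier R"
  shows "places (h ` F) S = (\<lambda>V. h ` V) ` places F R"
proof
  let ?g = "inv_into (carrier R) h"
  interpret I: field_isom S R ?g by (rule field_isom_inverse) (rule field_isom_axioms)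
  have gh: "?g ` (h ` A) = A" if "A \<subseteq> carrier R" for A using that by (rule inv_into_image_cancel[OF inj])
  have hg: "h ` (?g ` B) = B" if "B \<subseteq> carrier S" for B
    using that surj by (intro image_inv_into_cancel) simp_all
  show "places (h ` F) S \<subseteq> (\<lambda>V. h ` V) ` places F R"
  proof
    fix W assume W: "W \<in> places (h ` F) S"
    hence "?g ` W \<in> places (?g ` (h ` F)) R" by (rule I.image_place)
    hence "?g ` W \<in> places F R" unfolding gh[OF F] .
    moreover have "W \<subseteq> carrier S" using W unfolding places_def by blast
    hence "W = h ` (?g ` W)" using hg by simp
    ultimately show "W \<in> (\<lambda>V. h ` V) ` places F R" by blast
  qed
  show "(\<lambda>V. h ` V) ` places F R \<subseteq> places (h ` F) S" using image_place by blast
qed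

text \<open>The two Dirichlet series agree after reindexing the divisors, and zeta is defined
  through its series.\<close>

theorem (in field_isom) zeta_K_image:
  assumes F: "F \<subseteq> carrier R"
  shows "zeta_K (h ` F) S = zeta_K F R"
proof -
  let ?f = "image_mset (\<lambda>V. h ` V)" and ?g = "image_mset (\<lambda>W. inv_into (carrier R) h ` W)"
  have sub: "V \<subseteq> carrier R" "subring V R" if "V \<in> places F R" for V using that unfolding places_def by blast+
  have gf: "?g (?f D) = D" if D: "D \<in> effective_divisors F R" for D
  proof -
    have "?g (?f D) = image_mset (\<lambda>V. V) D"
      unfolding image_mset.compositionality o_def
    proof (rule image_mset_cong)
      fix V assume "V \<in># D"
      hence "V \<subseteq> carrier R" using D sub(1) unfolding effective_divisors_def by blast
      thus "inv_into (carrier R) h ` (h ` V) = V" by (rule inv_into_image_cancel[OF inj])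
    qed
    thus ?thesis by simp
  qed
  have inj': "inj_on ?f (effective_divisors F R)" using gf by (rule inj_on_inverseI)
  have im: "?f ` effective_divisors F R = effective_divisors (h ` F) S"
  proof
    show "?f ` effective_divisors F R \<subseteq> effective_divisors (h ` F) S"
      unfolding effective_divisors_def places_image[OF F] by (auto intro!: imageI)
    show "effective_divisors (h ` F) S \<subseteq> ?f ` effective_divisors F R"
    proof
      fix D assume "D \<in> effective_divisors (h ` F) S"
      hence D: "set_mset D \<subseteq> (\<lambda>V. h ` V) ` places F R" unfolding effective_divisors_def places_image[OF F] by simp
      have "inv_into (carrier R) h ` W \<in> places F R" if W: "W \<in># D" for W
      proof -
        obtain V where V: "V \<in> places F R" "W = h ` V" using D W by blast
        show ?thesis unfolding V(2) inv_into_image_cancel[OF inj sub(1)[OF V(1)]] by (rule V(1))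
      qed
      hence "?g D \<in> effective_divisors F R" unfolding effective_divisors_def by auto
      moreover have "?f (?g D) = D"
      proof -
        have "?f (?g D) = image_mset (\<lambda>V. V) D"
          unfolding image_mset.compositionality o_def
        proof (rule image_mset_cong)
          fix W assume "W \<in># D"
          then obtain V where V: "V \<in> places F R" "W = h ` V" using D by blast
          show "h ` (inv_into (carrier R) h ` W) = W"
            unfolding V(2) inv_into_image_cancel[OF inj sub(1)[OF V(1)]] ..
        qed
        thus ?thesis by simp
      qed
      ultimately show "D \<in> ?f ` effective_divisors F R" by (metis imageI)
    qed
  qed
  have n: "divisor_norm S (?f D) = divisor_norm R D" if D: "D \<in> effective_divisors F R" for D
  proof -
    have "image_mset (\<lambda>V. place_norm S (h ` V)) D = image_mset (place_norm R) D"
    proof (rule image_mset_cong)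
      fix V assume "V \<in># D"
      hence "V \<in> places F R" using D unfolding effective_divisors_def by blast
      thus "place_norm S (h ` V) = place_norm R V" by (intro image_place_norm sub(2))
    qed
    thus ?thesis unfolding divisor_norm_def image_mset.compositionality o_def by simp
  qed
  have "(\<Sum>\<^sub>\<infinity>D \<in> effective_divisors (h ` F) S. of_nat (divisor_norm S D) powr (- s)) =
      (\<Sum>\<^sub>\<infinity>D \<in> effective_divisors F R. of_nat (divisor_norm R D) powr (- s))" for s :: complex
    unfolding im[symmetric] infsum_reindex[OF inj'] o_def by (rule infsum_cong) (simp add: n)
  thus ?thesis unfolding zeta_K_def by simp
qed

text \<open>The constants are the fixed points of the \<open>q\<close>-power map, so an isomorphism respects them.\<close>

lemma (in field_isom) image_fixed_points:
  "h ` {x \<in> carrier R. x [^]\<^bsub>R\<^esub> (n::nat) = x} = {y \<in> carrier S. y [^]\<^bsub>S\<^esub> n = y}"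
proof -
  have pw: "h (x [^]\<^bsub>R\<^esub> n) = h x [^]\<^bsub>S\<^esub> n" if "x \<in> carrier R" for x using that by (rule hom.hom_nat_pow)
  have "h x [^]\<^bsub>S\<^esub> n = h x \<longleftrightarrow> x [^]\<^bsub>R\<^esub> n = x" if "x \<in> carrier R" for x
    unfolding pw[OF that, symmetric] using that by (intro inj_on_eq_iff[OF inj]) simp_all
  thus ?thesis unfolding surj[symmetric] by auto
qed


section \<open>The function field as a global function field\<close>

lemma analytic_on_poly_compose: "f analytic_on A \<Longrightarrow> (\<lambda>s. poly P (f s)) analytic_on A"
  by (induction P) (simp_all add: analytic_on_add analytic_on_mult)

context artin_schreier
begin

lemma field_K: "field (sub_rec K)"
  by (rule sub_rec_field) (rule K_closed K_inverse; assumption?)+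

lemma inv_K: "x \<in> K \<Longrightarrow> x \<noteq> 0 \<Longrightarrow> inv\<^bsub>sub_rec K\<^esub> x = inverse x"
proof -
  assume x: "x \<in> K" "x \<noteq> 0"
  interpret R: field "sub_rec K" by (rule field_K)
  show ?thesis by (rule R.comm_inv_char) (use x K_inverse in simp_all)
qed

lemma minus_K: "x \<in> K \<Longrightarrow> \<ominus>\<^bsub>sub_rec K\<^esub> x = - x"
proof -
  assume x: "x \<in> K"
  interpret R: field "sub_rec K" by (rule field_K)
  show ?thesis by (rule R.minus_equality) (use x K_closed(6) in simp_all)
qed

lemma const_in_F: "\<iota> [:c:] \<in> F" unfolding F_def by blast
lemma F_K: "F \<subseteq> K" unfolding F_def using \<iota>_in_K by blast
lemma xx_in_K: "xx \<in> K" unfolding xx_def by (rule \<iota>_in_K)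

lemma inverse_const: "inverse (\<iota> [:c:]) = \<iota> [:inverse c:]"
proof (cases "c = 0")
  case False
  show ?thesis by (rule inverse_unique) (use False in \<open>simp flip: \<iota>.hom_mult one_pCons\<close>)
qed simp

lemma xx_not_in_F: "xx \<notin> F"
proof
  assume "xx \<in> F"
  then obtain c where "\<iota> [:0, 1:] = \<iota> [:c:]" unfolding F_def xx_def by blast
  hence "[:0, 1:] = [:c:]" by (rule \<iota>.injectivity)
  thus False by simp
qed

lemma inverse_xx_not_in_F: "inverse xx \<notin> F"
proof
  assume "inverse xx \<in> F"
  then obtain c where "inverse xx = \<iota> [:c:]" unfolding F_def by blast
  hence "xx = \<iota> [:inverse c:]" using inverse_const[of c] by (metis inverse_inverse_eq)
  thus False using xx_not_in_F const_in_F by simp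
qed

text \<open>The strict inclusion of the constants is automatic: x or 1 / x lies in each valuation
  ring, and neither is constant.\<close>

lemma places_K: "places F (sub_rec K) = {V. is_place V}"
proof (intro equalityI subsetI)
  fix V assume "V \<in> places F (sub_rec K)"
  hence V: "subring V (sub_rec K)" "F \<subset> V" "V \<subset> K"
    and val: "\<And>z. z \<in> K \<Longrightarrow> z \<noteq> 0 \<Longrightarrow> z \<in> V \<or> inv\<^bsub>sub_rec K\<^esub> z \<in> V"
    unfolding places_def by auto
  note E = subringE[OF V(1), unfolded sub_rec_simps]
  have "valuation_subring K V"
  proof
    fix x y assume xy: "x \<in> V" "y \<in> V"
    hence "- y \<in> V" using E(5)[of y] minus_K[of y] V(3) by auto
    hence "x + - y \<in> V" using E(7) xy by blast
    thus "x - y \<in> V" by simp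
    show "x * y \<in> V" using E(6) xy by blast
  next
    fix z assume "z \<in> K" "z \<noteq> 0"
    thus "z \<in> V \<or> inverse z \<in> V" using val[of z] inv_K[of z] by simp
  next
    show "V \<subseteq> K" using V(3) by blast
    show "1 \<in> V" by (rule E(3))
    show "x / y \<in> K" if "x \<in> K" "y \<in> K" for x y using that by (rule K_divide)
  qed
  thus "V \<in> {V. is_place V}" unfolding is_place_def using V by blast
next
  fix V assume "V \<in> {V. is_place V}"
  hence V: "valuation_subring K V" "F \<subseteq> V" "V \<noteq> K" unfolding is_place_def by blast+
  interpret V: valuation_subring K V by fact
  interpret R: field "sub_rec K" by (rule field_K)
  have "subring V (sub_rec K)"
  proof (rule R.subringI)
    fix x assume x: "x \<in> V"
    have "x \<in> K" using x V.sub by blast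
    thus "\<ominus>\<^bsub>sub_rec K\<^esub> x \<in> V" using minus_K V.uminus[OF x] by simp
  qed (simp_all add: V.sub V.one V.add V.mult)
  moreover have "F \<noteq> V"
  proof
    assume "F = V"
    moreover have "xx \<noteq> 0" using xx_not_in_F const_in_F[of 0] by (metis \<iota>.hom_zero pCons_0_0)
    ultimately show False using V.val[OF xx_in_K] xx_not_in_F inverse_xx_not_in_F by blast
  qed
  moreover have "z \<in> V \<or> inv\<^bsub>sub_rec K\<^esub> z \<in> V" if "z \<in> K - {0}" for z
    using that V.val[of z] inv_K[of z] by simp
  ultimately show "V \<in> places F (sub_rec K)"
    unfolding places_def using V(2,3) V.sub by auto
qed

lemma place_norm_K:
  assumes "is_place V"
  shows "place_norm (sub_rec K) V = residue_card V"
proof -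
  interpret V: valuation_subring K V using assms unfolding is_place_def by blast
  have "z \<in> Units (sub_rec K\<lparr>carrier := V\<rparr>) \<longleftrightarrow> z \<noteq> 0 \<and> inverse z \<in> V" if z: "z \<in> V" for z
  proof -
    have "z \<in> Units (sub_rec K\<lparr>carrier := V\<rparr>) \<longleftrightarrow> (\<exists>y\<in>V. y * z = 1 \<and> z * y = 1)"
      unfolding Units_def sub_rec_def using z by simp
    also have "\<dots> \<longleftrightarrow> z \<noteq> 0 \<and> inverse z \<in> V"
    proof
      assume "\<exists>y\<in>V. y * z = 1 \<and> z * y = 1"
      then obtain y where y: "y \<in> V" "z * y = 1" by blast
      thus "z \<noteq> 0 \<and> inverse z \<in> V" using inverse_unique[OF y(2)] by auto
    next
      assume "z \<noteq> 0 \<and> inverse z \<in> V"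
      thus "\<exists>y\<in>V. y * z = 1 \<and> z * y = 1" by (intro bexI[of _ "inverse z"]) simp_all
    qed
    finally show ?thesis .
  qed
  hence m: "place_ideal (sub_rec K) V = V.m" unfolding place_ideal_def V.m_def by blast
  have "carrier ((sub_rec K\<lparr>carrier := V\<rparr>) Quot V.m) = (\<lambda>z. (\<lambda>y. y + z) ` V.m) ` V"
    unfolding FactRing_def A_RCOSETS_def' a_r_coset_def' sub_rec_def by auto
  thus ?thesis unfolding place_norm_def m residue_card_def by simp
qed

lemma c_hom: "comm_ring_hom (\<lambda>c. \<iota> [:c:])"
  by unfold_locales (simp_all flip: \<iota>.hom_add \<iota>.hom_mult one_pCons)

lemma ev2_const_K: "y \<in> K \<Longrightarrow> ev2 (\<lambda>c. \<iota> [:c:]) y f \<in> K"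
proof (induction f)
  case 0
  show ?case unfolding ev2_0[OF c_hom] by (rule K_closed)
next
  case (pCons c f)
  show ?case unfolding ev2_pCons[OF c_hom] by (intro K_closed \<iota>_in_K pCons)
qed

lemma ev2_const_xx: "ev2 (\<lambda>c. \<iota> [:c:]) xx f = \<iota> f"
proof (induction f)
  case 0
  show ?case unfolding ev2_0[OF c_hom] by simp
next
  case (pCons c f)
  show ?case unfolding ev2_pCons[OF c_hom] \<iota>_pCons[of c f] pCons(2) ..
qed

text \<open>Formulated for an isomorphic copy, since in the end the elements have to be natural
  numbers. The powers of w below p span the field over F_q(x), and
  \<open>algebraic_imp_const\<close> shows that the constants are algebraically closed in
  it.\<close>

theorem global_function_field_image:
  fixes S :: "'s ring"
  assumes "field_isom (sub_rec K) S g"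
  shows "global_function_field CARD('a) (g ` F) S"
proof -
  interpret I: field_isom "sub_rec K" S g by fact
  have add: "g (x + y) = g x \<oplus>\<^bsub>S\<^esub> g y" and mult: "g (x * y) = g x \<otimes>\<^bsub>S\<^esub> g y" if "x \<in> K" "y \<in> K" for x y
    using I.hom.hom_add[of x y] I.hom.hom_mult[of x y] that by simp_all
  have one: "g 1 = \<one>\<^bsub>S\<^esub>" and zero: "g 0 = \<zero>\<^bsub>S\<^esub>" using I.hom.hom_one I.hom.hom_zero by simp_all
  have minus: "\<ominus>\<^bsub>S\<^esub> g x = g (- x)" if "x \<in> K" for x using I.hom.hom_a_inv[of x] that minus_K[OF that] by simp
  have inv: "inv\<^bsub>S\<^esub> g x = g (inverse x)" if "x \<in> K" "x \<noteq> 0" for x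
    using I.h_inv[of x] that inv_K[OF that] by simp
  have pow: "g x [^]\<^bsub>S\<^esub> (n::nat) = g (x ^ n)" if "x \<in> K" for x n
    using I.hom.hom_nat_pow[of x n] that by (simp add: sub_rec_nat_pow)
  have eq0: "g x = \<zero>\<^bsub>S\<^esub> \<longleftrightarrow> x = 0" if "x \<in> K" for x using I.h_eq_zero[of x] that by simp
  have gK: "g x \<in> carrier S" if "x \<in> K" for x using I.hom.hom_closed[of x] that by simp
  have surj: "carrier S = g ` K" using I.surj by simp
  have FS: "g ` F \<subseteq> carrier S" using F_K gK by blast
  have subF: "subring (g ` F) S"
  proof (rule I.S.subringI)
    show "\<one>\<^bsub>S\<^esub> \<in> g ` F" using one const_in_F[of 1] by (metis \<iota>.hom_one imageI one_pCons)
    fix u v assume "u \<in> g ` F" "v \<in> g ` F"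
    then obtain c d where h: "u = g (\<iota> [:c:])" "v = g (\<iota> [:d:])" unfolding F_def by blast
    have "u \<otimes>\<^bsub>S\<^esub> v = g (\<iota> [:c * d:])" unfolding h mult[OF \<iota>_in_K \<iota>_in_K, symmetric] \<iota>.hom_mult[symmetric] by (simp add: mult.commute)
    thus "u \<otimes>\<^bsub>S\<^esub> v \<in> g ` F" using const_in_F by blast
    have "u \<oplus>\<^bsub>S\<^esub> v = g (\<iota> [:c + d:])" unfolding h add[OF \<iota>_in_K \<iota>_in_K, symmetric] by (simp flip: \<iota>.hom_add)
    thus "u \<oplus>\<^bsub>S\<^esub> v \<in> g ` F" using const_in_F by blast
  next
    fix u assume "u \<in> g ` F"
    then obtain c where h: "u = g (\<iota> [:c:])" unfolding F_def by blast
    have "\<ominus>\<^bsub>S\<^esub> u = g (\<iota> [:- c:])" unfolding h minus[OF \<iota>_in_K] by (simp flip: \<iota>.hom_uminus)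
    thus "\<ominus>\<^bsub>S\<^esub> u \<in> g ` F" using const_in_F by blast
  qed (rule FS)
  have sfF: "subfield (g ` F) S"
  proof (rule I.S.subfieldI'[OF subF])
    fix u assume u: "u \<in> g ` F - {\<zero>\<^bsub>S\<^esub>}"
    then obtain c where h: "u = g (\<iota> [:c:])" unfolding F_def by blast
    have nz: "\<iota> [:c:] \<noteq> 0" using u h zero by auto
    have "inv\<^bsub>S\<^esub> u = g (\<iota> [:inverse c:])" unfolding h inv[OF \<iota>_in_K nz] inverse_const ..
    thus "inv\<^bsub>S\<^esub> u \<in> g ` F" using const_in_F by blast
  qed
  \<comment> \<open>Coefficient lists, highest coefficient first, are matched with polynomials of
    polynomial type. The last clause transfers the nonvanishing of the leading coefficient.\<close>
  have eval: "set ps \<subseteq> g ` F \<Longrightarrow> \<exists>f. I.S.eval ps (g y) = g (ev2 (\<lambda>c. \<iota> [:c:]) y f) \<and>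
      (\<forall>i\<ge>length ps. Polynomial.coeff f i = 0) \<and> (ps \<noteq> [] \<longrightarrow> hd ps = g (\<iota> [:Polynomial.coeff f (length ps - 1):]))"
    if y: "y \<in> K" for y ps
  proof (induction ps)
    case Nil
    show ?case by (intro exI[of _ 0]) (simp add: ev2_0[OF c_hom] zero)
  next
    case (Cons b ps)
    then obtain f where f: "I.S.eval ps (g y) = g (ev2 (\<lambda>c. \<iota> [:c:]) y f)" "\<forall>i\<ge>length ps. Polynomial.coeff f i = 0" by auto
    obtain c where c: "b = g (\<iota> [:c:])" using Cons.prems unfolding F_def by auto
    have yn: "y ^ n \<in> K" for n by (induction n) (simp_all add: K_closed y)
    interpret e: comm_ring_hom "ev2 (\<lambda>c. \<iota> [:c:]) y" by (rule ev2_hom[OF c_hom])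
    have "I.S.eval (b # ps) (g y) = g (\<iota> [:c:] * y ^ length ps) \<oplus>\<^bsub>S\<^esub> g (ev2 (\<lambda>c. \<iota> [:c:]) y f)"
      by (simp add: f(1) c pow[OF y] mult[OF \<iota>_in_K yn])
    also have "\<dots> = g (\<iota> [:c:] * y ^ length ps + ev2 (\<lambda>c. \<iota> [:c:]) y f)"
      by (rule add[symmetric]) (intro K_closed \<iota>_in_K yn ev2_const_K y)+
    also have "\<iota> [:c:] * y ^ length ps + ev2 (\<lambda>c. \<iota> [:c:]) y f = ev2 (\<lambda>c. \<iota> [:c:]) y (Polynomial.monom c (length ps) + f)"
      unfolding e.hom_add ev2_monom[OF c_hom] ..
    finally show ?case using f(2) c
      by (intro exI[of _ "Polynomial.monom c (length ps) + f"]) simp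
  qed
  have algebraic: "\<exists>f. f \<noteq> 0 \<and> ev2 (\<lambda>c. \<iota> [:c:]) y f = 0"
    if y: "y \<in> K" and alg: "\<not> I.S.transcendental (g ` F) (g y)" for y
  proof -
    have alg': "(I.S.algebraic over (g ` F)) (g y)" using alg unfolding over_def by simp
    obtain ps where ps: "ps \<in> carrier ((g ` F) [X]\<^bsub>S\<^esub>)" "ps \<noteq> []" "I.S.eval ps (g y) = \<zero>\<^bsub>S\<^esub>"
      using I.S.algebraicE[OF subF gK[OF y] alg'] by blast
    have pol: "set ps \<subseteq> g ` F" "hd ps \<noteq> \<zero>\<^bsub>S\<^esub>" using ps(1,2) unfolding univ_poly_def polynomial_def by auto
    obtain f where f: "I.S.eval ps (g y) = g (ev2 (\<lambda>c. \<iota> [:c:]) y f)" "hd ps = g (\<iota> [:Polynomial.coeff f (length ps - 1):])"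
      using eval[OF y pol(1)] ps(2) by blast
    have "f \<noteq> 0" using f(2) pol(2) zero by auto
    moreover have "ev2 (\<lambda>c. \<iota> [:c:]) y f = 0" using ps(3) unfolding f(1) eq0[OF ev2_const_K[OF y]] .
    ultimately show ?thesis by blast
  qed
  have trans: "I.S.transcendental (g ` F) (g xx)"
  proof (rule ccontr)
    assume "\<not> I.S.transcendental (g ` F) (g xx)"
    then obtain f where "f \<noteq> 0" "ev2 (\<lambda>c. \<iota> [:c:]) xx f = 0" using algebraic[OF xx_in_K] by blast
    thus False unfolding ev2_const_xx by simp
  qed
  let ?G = "generate_field S (insert (g xx) (g ` F))"
  have Gsub: "insert (g xx) (g ` F) \<subseteq> carrier S" using FS gK[OF xx_in_K] by simp
  have sfG: "subfield ?G S" by (rule I.S.generate_field_is_subfield[OF Gsub])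
  note GE = subringE[OF subfieldE(1)[OF sfG]]
  have incl: "z \<in> ?G" if "z \<in> insert (g xx) (g ` F)" for z using that by (rule generate_field.incl)
  have G\<iota>: "g (\<iota> f) \<in> ?G" for f
  proof (induction f)
    case 0
    show ?case using GE(2) zero by simp
  next
    case (pCons c f)
    have "g (\<iota> (pCons c f)) = g (\<iota> [:c:]) \<oplus>\<^bsub>S\<^esub> (g xx \<otimes>\<^bsub>S\<^esub> g (\<iota> f))"
      unfolding \<iota>_pCons[of c f] using add mult K_closed(5) \<iota>_in_K xx_in_K by simp
    thus ?case using GE(6,7) incl pCons(2) const_in_F by simp
  qed
  have Ginv: "g (inverse (\<iota> f)) \<in> ?G" if "f \<noteq> 0" for f
  proof -
    have nz: "\<iota> f \<noteq> 0" using that by simp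
    hence "g (\<iota> f) \<in> ?G - {\<zero>\<^bsub>S\<^esub>}" using G\<iota> eq0[OF \<iota>_in_K] by simp
    thus ?thesis using I.S.subfield_m_inv(1)[OF sfG] inv[OF \<iota>_in_K nz] by force
  qed
  let ?Us = "map (\<lambda>j. g (w ^ j)) [0..<p]"
  have wK: "w ^ j \<in> K" for j by (induction j) (simp_all add: K_closed w_in_K)
  have Us: "set ?Us \<subseteq> carrier S" using gK[OF wK] by auto
  have "carrier S = I.S.Span ?G ?Us"
  proof
    show "I.S.Span ?G ?Us \<subseteq> carrier S" by (rule I.S.Span_subgroup_props(1)[OF sfG Us])
    show "carrier S \<subseteq> I.S.Span ?G ?Us"
    proof
      fix z assume "z \<in> carrier S"
      then obtain y where y: "y \<in> K" "z = g y" using surj by blast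
      obtain U0 f where U0: "y = ev U0 / \<iota> f" "f \<noteq> 0" using y(1) by (rule K_cases)
      obtain n where n: "wt U0 n" by (rule wt_exists)
      obtain Q U where QU: "U0 = asP * Q + U" "degree U < p" using reduce[OF n] by blast
      have eU: "ev U0 = ev U" unfolding QU(1) ev.hom_add ev.hom_mult by simp
      define c where "c j = \<iota> (Polynomial.coeff U j) * inverse (\<iota> f)" for j
      have cK: "c j \<in> K" for j unfolding c_def by (intro K_closed \<iota>_in_K K_inverse)
      have cG: "g (c j) \<in> ?G" for j
        unfolding c_def mult[OF \<iota>_in_K K_inverse[OF \<iota>_in_K]] by (intro GE(6) G\<iota> Ginv U0(2))
      have dU: "degree U \<le> p - 1" using QU(2) by simp
      have "ev U = ev (\<Sum>j\<le>p - 1. Polynomial.monom (Polynomial.coeff U j) j)"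
        using poly_as_sum_of_monoms'[OF dU] by simp
      also have "\<dots> = (\<Sum>j\<le>p - 1. \<iota> (Polynomial.coeff U j) * w ^ j)" by (simp add: ev.hom_sum)
      also have "{..p - 1} = {..<p}" using p(2) by auto
      finally have ye: "y = (\<Sum>j<p. c j * w ^ j)"
        unfolding U0(1) eU c_def divide_inverse by (simp add: sum_distrib_left mult_ac)
      have "n \<le> p \<Longrightarrow> g (\<Sum>j<n. c j * w ^ j) \<in> I.S.Span ?G ?Us \<and> (\<Sum>j<n. c j * w ^ j) \<in> K" for n
      proof (induction n)
        case 0
        show ?case using I.S.Span_subgroup_props(2)[OF sfG Us] zero K_closed(1) by simp
      next
        case (Suc n)
        have IH: "g (\<Sum>j<n. c j * w ^ j) \<in> I.S.Span ?G ?Us" "(\<Sum>j<n. c j * w ^ j) \<in> K" using Suc by simp_all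
        have cw: "c n * w ^ n \<in> K" by (rule K_closed(5)[OF cK wK])
        have "g (w ^ n) \<in> I.S.Span ?G ?Us" using I.S.Span_base_incl[OF sfG Us] Suc.prems by auto
        hence "g (c n) \<otimes>\<^bsub>S\<^esub> g (w ^ n) \<in> I.S.Span ?G ?Us" by (rule I.S.Span_smult_closed[OF sfG Us cG])
        hence "g (\<Sum>j<n. c j * w ^ j) \<oplus>\<^bsub>S\<^esub> g (c n * w ^ n) \<in> I.S.Span ?G ?Us"
          unfolding mult[OF cK wK] by (rule I.S.Span_subgroup_props(3)[OF sfG Us IH(1)])
        thus ?case using add[OF IH(2) cw] K_closed(3)[OF IH(2) cw] by simp
      qed
      thus "z \<in> I.S.Span ?G ?Us" unfolding y(2) ye by blast
    qed
  qed
  hence fd: "I.S.finite_dimension ?G (carrier S)" using I.S.Span_finite_dimension[OF sfG Us] by simp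
  have closed: "y \<in> g ` F" if y: "y \<in> carrier S" and alg: "\<not> I.S.transcendental (g ` F) y" for y
  proof -
    obtain z where z: "z \<in> K" "y = g z" using y surj by blast
    obtain f where "f \<noteq> 0" "ev2 (\<lambda>c. \<iota> [:c:]) z f = 0" using algebraic[OF z(1) alg[unfolded z(2)]] by blast
    hence "z \<in> F" by (rule algebraic_imp_const[OF z(1)])
    thus ?thesis unfolding z(2) by blast
  qed
  have "field S" by (rule I.S.field_axioms)
  hence ff: "function_field_over (g ` F) S"
    unfolding function_field_over_def using sfF trans fd closed gK[OF xx_in_K] by blast
  have injK: "inj_on g K" using I.inj by simp
  have "inj (\<lambda>c. \<iota> [:c:])" by (rule injI) (auto dest: \<iota>.injectivity)
  hence "card F = CARD('a)" unfolding F_def by (rule card_image)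
  hence "card (g ` F) = CARD('a)" using card_image[OF inj_on_subset[OF injK F_K]] by simp
  moreover have "finite (g ` F)" unfolding F_def by simp
  ultimately show ?thesis unfolding global_function_field_def using ff by blast
qed

text \<open>The q constants already exhaust the roots of X^q - X in the ambient field.\<close>

lemma F_fixed_points: "F = {x \<in> carrier (sub_rec K). x [^]\<^bsub>sub_rec K\<^esub> CARD('a) = x}"
proof -
  have q2: "CARD('a) \<ge> 2" using CARD_gt_1[where ?'a='a] by simp
  have fin: "finite {y::'k. y ^ CARD('a) = y}" by (rule card_fixed_points_power_le(1)[OF q2])
  have Fs: "F \<subseteq> {y \<in> K. y ^ CARD('a) = y}"
  proof
    fix y assume "y \<in> F"
    then obtain c where c: "y = \<iota> [:c:]" unfolding F_def by blast
    have "to_ac (c ^ CARD('a)) = to_ac c" using frob_to_ac[of c] by (simp add: to_ac.hom_power)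
    hence "c ^ CARD('a) = c" by (rule to_ac.injectivity)
    moreover have "[:c:] ^ n = [:c ^ n:]" for n by (induction n) (simp_all add: one_pCons)
    ultimately have "y ^ CARD('a) = y" unfolding c \<iota>.hom_power[symmetric] by simp
    thus "y \<in> {y \<in> K. y ^ CARD('a) = y}" using \<open>y \<in> F\<close> F_K by blast
  qed
  have "inj (\<lambda>c. \<iota> [:c:])" by (rule injI) (auto dest: \<iota>.injectivity)
  hence cF: "card F = CARD('a)" unfolding F_def by (rule card_image)
  have "card {y \<in> K. y ^ CARD('a) = y} \<le> card {y::'k. y ^ CARD('a) = y}" by (rule card_mono[OF fin]) blast
  also have "\<dots> \<le> card F" unfolding cF by (rule card_fixed_points_power_le(2)[OF q2])
  finally have "F = {y \<in> K. y ^ CARD('a) = y}"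
    using Fs fin by (intro card_subset_eq) (auto intro: finite_subset[OF _ fin] antisym card_mono)
  thus ?thesis by (simp add: sub_rec_nat_pow)
qed

definition zeta_num :: "complex poly" where
  "zeta_num = (\<Prod>c\<in>{1..<p}. \<Sum>d<N. Polynomial.monom (char_sum N (of_nat c * a) d) d)"

definition zeta_rat :: "complex \<Rightarrow> complex" where
  "zeta_rat u = poly zeta_num u / ((1 - u) * (1 - of_nat CARD('a) * u))"

lemma zeta_series_K:
  assumes s: "Re s > 1"
  shows "(\<Sum>\<^sub>\<infinity>D \<in> effective_divisors F (sub_rec K). of_nat (divisor_norm (sub_rec K) D) powr (- s)) =
    zeta_rat (of_nat CARD('a) powr (- s))"
proof -
  let ?u = "of_nat CARD('a) powr (- s)" and ?\<phi> = "\<lambda>n::nat. of_nat n powr (- s)"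
  have q1: "real CARD('a) > 1" using CARD_gt_1[where ?'a='a] by simp
  have "norm ?u = exp (- Re s * ln (real CARD('a)))"
    using q1 by (subst norm_powr_real) simp_all
  hence "norm ?u * real CARD('a) = exp (- Re s * ln (real CARD('a))) * exp (ln (real CARD('a)))" using q1 by simp
  also have "\<dots> = exp ((1 - Re s) * ln (real CARD('a)))" unfolding exp_add[symmetric] by (simp add: algebra_simps)
  also have "\<dots> < 1" using s q1 by (simp add: mult_neg_pos)
  finally have u: "norm ?u * real CARD('a) < 1" .
  have \<phi>: "?\<phi> (CARD('a) ^ n) = ?u ^ n" for n by (rule of_nat_power_powr)
  have "((\<lambda>D. \<Prod>V\<in>#D. ?\<phi> (residue_card V)) has_sum zeta_rat ?u) {D. set_mset D \<subseteq> {V. is_place V}}"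
    using zeta_series[where \<phi> = ?\<phi> and u = ?u, OF \<phi> u]
    unfolding zeta_rat_def zeta_num_def poly_prod poly_sum poly_monom .
  hence 1: "(\<Sum>\<^sub>\<infinity>D\<in>{D. set_mset D \<subseteq> {V. is_place V}}. \<Prod>V\<in>#D. ?\<phi> (residue_card V)) = zeta_rat ?u" by (rule infsumI)
  have "(\<Sum>\<^sub>\<infinity>D \<in> effective_divisors F (sub_rec K). of_nat (divisor_norm (sub_rec K) D) powr (- s)) =
    (\<Sum>\<^sub>\<infinity>D\<in>{D. set_mset D \<subseteq> {V. is_place V}}. \<Prod>V\<in>#D. ?\<phi> (residue_card V))"
    unfolding effective_divisors_def places_K
  proof (rule infsum_cong)
    fix D assume "D \<in> {D. set_mset D \<subseteq> {V. is_place V}}"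
    hence "image_mset (\<lambda>V. ?\<phi> (place_norm (sub_rec K) V)) D = image_mset (\<lambda>V. ?\<phi> (residue_card V)) D"
      by (intro image_mset_cong) (auto simp: place_norm_K)
    thus "of_nat (divisor_norm (sub_rec K) D) powr (- s) = (\<Prod>V\<in>#D. ?\<phi> (residue_card V))"
      unfolding divisor_norm_powr by simp
  qed
  thus ?thesis unfolding 1 .
qed

text \<open>A rational function of q^(-s) is meromorphic in s, so it is the continuation of the
  series that it equals for Re s > 1. The assumptions on s keep away from zeros of the
  denominator.\<close>

theorem zeta_K_K:
  assumes s: "of_nat CARD('a) powr (- s) \<noteq> 1" "of_nat CARD('a) * of_nat CARD('a) powr (- s) \<noteq> 1"
  shows "zeta_K F (sub_rec K) s = zeta_rat (of_nat CARD('a) powr (- s))"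
proof -
  define l :: complex where "l = Ln (of_nat CARD('a))"
  define E :: "complex \<Rightarrow> complex" where "E s = exp (- s * l)" for s
  have E: "of_nat CARD('a) powr (- s) = E s" for s by (simp add: E_def powr_def l_def)
  have Ea: "E analytic_on A" for A unfolding E_def by (intro analytic_intros)
  have num: "(\<lambda>s. poly zeta_num (E s)) analytic_on A" for A
    using Ea by (rule analytic_on_poly_compose)
  have den: "(\<lambda>s. (1 - E s) * (1 - of_nat CARD('a) * E s)) analytic_on A" for A
    by (intro analytic_intros Ea)
  have mer: "(\<lambda>s. zeta_rat (E s)) meromorphic_on UNIV"
    unfolding zeta_rat_def by (intro meromorphic_on_divide analytic_on_imp_meromorphic_on num den)
  have an: "(\<lambda>s. zeta_rat (E s)) analytic_on {s}" if "E s \<noteq> 1" "of_nat CARD('a) * E s \<noteq> 1" for s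
    unfolding zeta_rat_def by (intro analytic_on_divide num den) (use that in auto)
  have ne: "E s \<noteq> 1" "of_nat CARD('a) * E s \<noteq> 1" if "Re s > 1" for s
  proof -
    have q1: "real CARD('a) > 1" using CARD_gt_1[where ?'a='a] by simp
    have n: "norm (E s) = exp (- Re s * ln (real CARD('a)))"
      unfolding E[symmetric] using q1 by (subst norm_powr_real) simp_all
    have "norm (E s) < 1" unfolding n using that q1 by simp
    thus "E s \<noteq> 1" by auto
    have "norm (of_nat CARD('a) * E s) = exp (ln (real CARD('a))) * exp (- Re s * ln (real CARD('a)))"
      unfolding norm_mult n using q1 by simp
    also have "\<dots> = exp ((1 - Re s) * ln (real CARD('a)))" unfolding exp_add[symmetric] by (simp add: algebra_simps)
    also have "\<dots> < 1" using that q1 by (simp add: mult_neg_pos)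
    finally show "of_nat CARD('a) * E s \<noteq> 1" by auto
  qed
  have "zeta_K F (sub_rec K) = remove_sings (\<lambda>s. zeta_rat (E s))"
    by (rule zeta_K_eq[OF mer]) (simp_all add: an ne zeta_series_K E)
  thus ?thesis using an[of s] s unfolding E by simp
qed

end


section \<open>A finite field of prescribed order\<close>

text \<open>The derivative of X^n - X is - 1 where n is zero in the field, so all n roots are
  simple.\<close>

lemma card_power_fixed_points:
  fixes n :: nat
  assumes n: "n \<ge> 2" and char: "of_nat n = (0::'b::alg_closed_field)"
  shows "card {y::'b. y ^ n = y} = n"
proof -
  define f :: "'b poly" where "f = Polynomial.monom 1 n - Polynomial.monom 1 1"
  have c: "Polynomial.coeff f n = 1" using n unfolding f_def by simp
  have d: "degree f = n"
  proof (rule antisym)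
    show "degree f \<le> n" unfolding f_def using n by (intro degree_diff_le) (auto simp: degree_monom_eq)
    show "n \<le> degree f" using c by (intro le_degree) simp
  qed
  have f0: "f \<noteq> 0" using c by auto
  have root: "poly f y = 0 \<longleftrightarrow> y ^ n = y" for y by (simp add: f_def poly_monom)
  have pd: "pderiv f = - 1" by (simp add: f_def pderiv_diff pderiv_monom char one_pCons monom_0)
  have ord: "Polynomial.order y f = 1" if y: "y ^ n = y" for y
  proof (rule antisym)
    show "Polynomial.order y f \<le> 1"
    proof (rule ccontr)
      assume "\<not> Polynomial.order y f \<le> 1"
      hence "[:- y, 1:] ^ 2 dvd f" using f0 by (simp add: order_divides)
      then obtain r where r: "f = [:- y, 1:] ^ 2 * r" by (elim dvdE)
      define l where "l = [:- y, 1:]"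
      have "poly l y = 0" by (simp add: l_def)
      hence "poly (pderiv f) y = 0" unfolding r l_def[symmetric] by (simp add: power2_eq_square pderiv_mult)
      thus False unfolding pd by simp
    qed
    have "Polynomial.order y f \<noteq> 0" using f0 y root order_root by blast
    thus "1 \<le> Polynomial.order y f" by simp
  qed
  have fin: "finite {y. poly f y = 0}" using f0 by (rule poly_roots_finite)
  have "proots f = mset_set {y. poly f y = 0}"
  proof (rule multiset_eqI)
    fix y
    show "count (proots f) y = count (mset_set {y. poly f y = 0}) y"
    proof (cases "poly f y = 0")
      case True
      thus ?thesis using f0 fin ord[of y] root by (simp add: count_proots)
    next
      case False
      thus ?thesis using f0 fin by (simp add: count_proots order_0I)
    qed
  qed
  hence "size (proots f) = card {y. poly f y = 0}" by simp
  moreover have "size (proots f) = degree f"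
  proof -
    obtain A where A: "size A = degree f" "f = Polynomial.smult (lead_coeff f) (\<Prod>x\<in>#A. [:- x, 1:])"
      using alg_closed_imp_factorization[OF f0] by blast
    have "proots (\<Prod>x\<in>#A. [:- x, 1:]) = A"
    proof (induction A)
      case (add x A)
      have "(\<Prod>x\<in>#A. [:- x, 1:]) \<noteq> 0" by (auto simp: prod_mset_zero_iff)
      thus ?case using add by (simp add: proots_mult del: mult_pCons_left)
    qed simp
    hence "proots f = A" using f0 A(2) proots_smult[of "lead_coeff f" "\<Prod>x\<in>#A. [:- x, 1:]"] by (metis leading_coeff_0_iff)
    thus ?thesis using A(1) by simp
  qed
  ultimately show ?thesis using d root by simp
qed

text \<open>The development above is about a type of class \<open>finite_field\<close>. Whenever the claim fails
  for some prime power, it fails for the following one, of which such a type can be defined.\<close>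

definition counterexample :: "nat \<Rightarrow> bool" where
  "counterexample q \<longleftrightarrow> primepow q \<and> q mod 4 = 1 \<and> (\<exists>B>0. northcott_property q (1/2) B)"

definition field_order :: nat where
  "field_order = (SOME q. primepow q \<and> q mod 4 = 1 \<and> ((\<exists>q. counterexample q) \<longrightarrow> counterexample q))"

lemma field_order:
  "primepow field_order" "field_order mod 4 = 1"
  "counterexample q \<Longrightarrow> counterexample field_order"
proof -
  have "\<exists>q. primepow q \<and> q mod 4 = 1 \<and> ((\<exists>q. counterexample q) \<longrightarrow> counterexample q)"
  proof (cases "\<exists>q. counterexample q")
    case True
    thus ?thesis unfolding counterexample_def by blast
  next
    case False
    have "prime (5::nat)" by simp
    hence "primepow (5::nat)" by (rule primepow_prime)
    thus ?thesis using False by (intro exI[of _ 5]) simp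
  qed
  from someI_ex[OF this] show "primepow field_order" "field_order mod 4 = 1"
    "counterexample q \<Longrightarrow> counterexample field_order"
    unfolding field_order_def by blast+
qed

definition field_char :: nat where
  "field_char = (SOME p. prime p \<and> (\<exists>k>0. field_order = p ^ k))"

lemma field_char: "prime field_char" "\<exists>k>0. field_order = field_char ^ k"
proof -
  have "\<exists>p. prime p \<and> (\<exists>k>0. field_order = p ^ k)"
    using field_order(1) unfolding primepow_def by blast
  from someI_ex[OF this] show "prime field_char" "\<exists>k>0. field_order = field_char ^ k"
    unfolding field_char_def by blast+
qed

section \<open>The finite field as a type\<close>

text \<open>\<open>mod_ring\<close> takes its modulus from the cardinality of a type; this one makes
  it the prime field of the required characteristic.\<close>

typedef prime_index = "{0..<field_char}"
  using prime_gt_0_nat[OF field_char(1)] by (intro exI[of _ 0]) simp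

lemma CARD_prime_index: "CARD(prime_index) = field_char"
  using type_definition.card[OF type_definition_prime_index] by simp

instance prime_index :: prime_card
  by standard (simp add: CARD_prime_index field_char(1))

type_synonym splitting = "prime_index mod_ring alg_closure"

lemma CHAR_splitting: "CHAR(splitting) = field_char"
  by (simp add: CARD_prime_index)

lemma field_order_ge_2: "field_order \<ge> 2"
  using primepow_gt_Suc_0[OF field_order(1)] by simp

lemma of_nat_field_order: "(of_nat field_order :: splitting) = 0"
proof -
  obtain k where k: "k > 0" "field_order = field_char ^ k" using field_char(2) by blast
  have "field_char dvd field_char ^ k" using k(1) by (intro dvd_power) simp
  thus ?thesis unfolding of_nat_eq_0_iff_char_dvd CHAR_splitting k(2) .
qed

lemma splitting_power_add: "(x + y :: splitting) ^ field_order = x ^ field_order + y ^ field_order"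
proof -
  obtain k where k: "field_order = field_char ^ k" using field_char(2) by blast
  have pr: "prime CHAR(splitting)" unfolding CHAR_splitting by (rule field_char(1))
  show ?thesis unfolding k by (rule freshmans_dream'[OF pr], unfold CHAR_splitting, rule refl)
qed

text \<open>In the algebraic closure of the prime field, the fixed points of y \<mapsto> y^q form a
  subfield, as q is a power of the characteristic, and there are q of them.\<close>

typedef galois_field = "{y :: splitting. y ^ field_order = y}"
  using field_order_ge_2 by (intro exI[of _ 1]) simp

lemma CARD_galois_field: "CARD(galois_field) = field_order"
  using type_definition.card[OF type_definition_galois_field]
    card_power_fixed_points[OF field_order_ge_2 of_nat_field_order] by simp

lemma Rep_galois_field_power: "Rep_galois_field x ^ field_order = Rep_galois_field x"
  using Rep_galois_field[of x] by simp

lemma odd_field_order: "odd field_order"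
  using field_order(2) by presburger

lemma splitting_power_uminus: "(- x :: splitting) ^ field_order = - (x ^ field_order)"
  using odd_field_order by (rule power_minus_odd)

instantiation galois_field :: field
begin

definition "0 = Abs_galois_field 0"
definition "1 = Abs_galois_field 1"
definition "x + y = Abs_galois_field (Rep_galois_field x + Rep_galois_field y)"
definition "x - y = Abs_galois_field (Rep_galois_field x - Rep_galois_field y)"
definition "- x = Abs_galois_field (- Rep_galois_field x)"
definition "x * y = Abs_galois_field (Rep_galois_field x * Rep_galois_field y)"
definition "x div y = Abs_galois_field (Rep_galois_field x / Rep_galois_field y)"
definition "inverse x = Abs_galois_field (inverse (Rep_galois_field x))"

lemma Rep_galois_field_simps:
  "Rep_galois_field 0 = 0" "Rep_galois_field 1 = 1"
  "Rep_galois_field (x + y) = Rep_galois_field x + Rep_galois_field y"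
  "Rep_galois_field (x - y) = Rep_galois_field x - Rep_galois_field y"
  "Rep_galois_field (- x) = - Rep_galois_field x"
  "Rep_galois_field (x * y) = Rep_galois_field x * Rep_galois_field y"
  "Rep_galois_field (x div y) = Rep_galois_field x / Rep_galois_field y"
  "Rep_galois_field (inverse x) = inverse (Rep_galois_field x)"
proof -
  have sub: "(u - v) ^ field_order = u ^ field_order - v ^ field_order" for u v :: splitting
    using splitting_power_add[of u "- v"] splitting_power_uminus[of v] by simp
  note A = Abs_galois_field_inverse
  have pos: "field_order > 0" using field_order_ge_2 by simp
  show "Rep_galois_field 0 = 0" unfolding zero_galois_field_def by (rule A) (use pos in \<open>simp add: zero_power\<close>)
  show "Rep_galois_field 1 = 1" unfolding one_galois_field_def by (rule A) simp
  show "Rep_galois_field (x + y) = Rep_galois_field x + Rep_galois_field y"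
    unfolding plus_galois_field_def by (rule A) (simp add: splitting_power_add Rep_galois_field_power)
  show "Rep_galois_field (x - y) = Rep_galois_field x - Rep_galois_field y"
    unfolding minus_galois_field_def by (rule A) (simp add: sub Rep_galois_field_power)
  show "Rep_galois_field (- x) = - Rep_galois_field x"
    unfolding uminus_galois_field_def by (rule A) (simp add: splitting_power_uminus Rep_galois_field_power)
  show "Rep_galois_field (x * y) = Rep_galois_field x * Rep_galois_field y"
    unfolding times_galois_field_def by (rule A) (simp add: power_mult_distrib Rep_galois_field_power)
  show "Rep_galois_field (x div y) = Rep_galois_field x / Rep_galois_field y"
    unfolding divide_galois_field_def by (rule A) (simp add: power_divide Rep_galois_field_power)
  show "Rep_galois_field (inverse x) = inverse (Rep_galois_field x)"
    unfolding inverse_galois_field_def by (rule A) (simp add: power_inverse Rep_galois_field_power)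
qed

instance
  by standard (simp_all add: Rep_galois_field_inject[symmetric] Rep_galois_field_simps algebra_simps divide_inverse)

end

instance galois_field :: finite_field
proof
  show "finite (UNIV :: galois_field set)"
    using CARD_galois_field field_order_ge_2 by (intro card_ge_0_finite) simp
qed


section \<open>Fields whose zeta function vanishes at the central point\<close>

text \<open>Elements of the function field are quotients of such polynomials; countability permits
  moving it to the natural numbers.\<close>

lemma countable_poly_poly: "countable (UNIV :: 'a::finite_field poly poly set)"
proof -
  have "countable (UNIV :: 'a list list set)" by simp
  hence "countable ((\<lambda>l. Poly (map Poly l)) ` (UNIV :: 'a list list set))" by (rule countable_image)
  moreover have "U \<in> (\<lambda>l. Poly (map Poly l)) ` UNIV" for U :: "'a poly poly"
  proof (rule image_eqI)
    have "map Poly (map Polynomial.coeffs (Polynomial.coeffs U)) = Polynomial.coeffs U" by (simp add: o_def)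
    thus "U = Poly (map Poly (map Polynomial.coeffs (Polynomial.coeffs U)))" by simp
  qed simp
  ultimately show ?thesis by (metis UNIV_eq_I)
qed

lemma (in artin_schreier) countable_K: "countable K"
proof -
  have "countable ((\<lambda>(U, V). ev U / ev V) ` (UNIV \<times> UNIV))"
    using countable_poly_poly by (intro countable_image countable_SIGMA) simp_all
  moreover have "K \<subseteq> (\<lambda>(U, V). ev U / ev V) ` (UNIV \<times> UNIV)"
  proof
    fix z assume "z \<in> K"
    then obtain U f where "z = ev U / \<iota> f" by (rule K_cases)
    hence "z = (\<lambda>(U, V). ev U / ev V) (U, [:f:])" by simp
    thus "z \<in> (\<lambda>(U, V). ev U / ev V) ` (UNIV \<times> UNIV)" by blast
  qed
  ultimately show ?thesis by (rule countable_subset[rotated])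
qed

definition zeta_fraction :: "nat \<Rightarrow> complex poly \<Rightarrow> complex \<Rightarrow> complex" where
  "zeta_fraction q Z s = poly Z (of_nat q powr (- s)) /
     ((1 - of_nat q powr (- s)) * (1 - of_nat q * of_nat q powr (- s)))"

text \<open>What has to be known of a field once its construction is forgotten: the vanishing of
  zeta, the constants as fixed points, and enough values of zeta to recover the numerator and with
  it its degree.\<close>

definition central_zero_field :: "nat \<Rightarrow> nat \<Rightarrow> nat ring \<Rightarrow> nat set \<Rightarrow> complex poly \<Rightarrow> bool" where
  "central_zero_field q n S F Z \<longleftrightarrow> field S \<and> global_function_field q F S \<and> zeta_K F S (1/2) = 0 \<and>
     F = {x \<in> carrier S. x [^]\<^bsub>S\<^esub> q = x} \<and> degree Z = n \<and>
     (\<forall>x::real. x > 1 \<longrightarrow> zeta_K F S (of_real x) = zeta_fraction q Z (of_real x))"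

lemma powr_of_nat_real: "q > 0 \<Longrightarrow> of_nat q powr (- of_real x :: complex) = of_real (real q powr (- x))"
  using powr_of_real[of "real q" "- x"] by simp

lemma powr_less_inverse:
  assumes "q > 1" "x > 1"
  shows "real q * real q powr (- x) < 1" "real q powr (- x) < 1"
proof -
  have "real q * real q powr (- x) = real q powr (1 - x)" using powr_add[of "real q" 1 "- x"] assms(1) by simp
  also have "\<dots> < real q powr 0" using assms by (intro powr_less_mono) simp_all
  finally show "real q * real q powr (- x) < 1" using assms(1) by simp
  have "real q powr (- x) < real q powr 0" using assms by (intro powr_less_mono) simp_all
  thus "real q powr (- x) < 1" using assms(1) by simp
qed

text \<open>A root \<open>w\<close> is found in the algebraic closure of F_q(x). At s = 1/2 the
  variable u is 1 / sqrt q, where the factor c = 1 of the numerator vanishes by the choice of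
  \<open>a\<close>.\<close>

lemma exists_central_zero_field:
  assumes q4: "CARD('a::finite_field) mod 4 = 1" and N: "N = 2 * M" "odd M" "\<not> CHAR('a) dvd N"
  obtains S F Z where "central_zero_field CARD('a) ((CHAR('a) - 1) * (N - 1)) S F Z"
proof -
  interpret cz: central_zero N M "TYPE('a)" by standard (fact N q4)+
  let ?q = "CARD('a)"
  obtain a :: 'a where a: "a \<noteq> 0" "poly (cz.L_poly a) (1 / of_real (sqrt (real ?q))) = 0"
    by (rule cz.L_poly_central_zero)
  define p where "p = CHAR('a)"
  have p2: "p \<ge> 2" unfolding p_def by (auto intro: prime_ge_2_nat)
  let ?h = "to_ac (to_fract (Polynomial.monom a N)) :: 'a poly fract alg_closure"
  define f where "f = Polynomial.monom 1 p - Polynomial.monom 1 1 - [:?h:]"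
  have "Polynomial.coeff f p = 1" using p2 unfolding f_def coeff_diff coeff_monom by (simp add: coeff_eq_0)
  hence "degree f \<ge> p" by (intro le_degree) simp
  hence "degree f > 0" using p2 by simp
  then obtain w where "poly f w = 0" using alg_closed_imp_poly_has_root by blast
  hence w: "w ^ p - w = ?h" by (simp add: f_def poly_monom)
  have addL: "additive_L N a" by (rule cz.additive_L[OF a(1)])
  interpret A: artin_schreier N a "to_ac :: 'a poly fract \<Rightarrow> _" w p
    by (intro artin_schreier.intro addL to_ac.inj_idom_hom_axioms artin_schreier_axioms.intro p_def w)
  let ?R = "sub_rec A.K"
  interpret R: field ?R by (rule A.field_K)
  define g where "g = to_nat_on A.K"
  have injg: "inj_on g (carrier ?R)" unfolding g_def using A.countable_K by (simp add: inj_on_to_nat_on)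
  let ?S = "image_ring g ?R"
  have fS: "field ?S" by (rule R.inj_imp_image_ring_is_field[OF injg])
  have giso: "g \<in> ring_iso ?R ?S" by (rule inj_imp_image_ring_iso[OF injg])
  have fi: "field_isom ?R ?S g" by (intro field_isom.intro field_isom_axioms.intro R.field_axioms fS giso)
  interpret I: field_isom ?R ?S g by (rule fi)
  have q1: "?q > 1" by (rule CARD_gt_1)
  have ze: "zeta_K (g ` A.F) ?S = zeta_K A.F ?R" by (rule I.zeta_K_image) (use A.F_K in simp)
  have ca: "of_nat c * a \<noteq> 0" if "c \<in> {1..<p}" for c
  proof -
    have "\<not> p dvd c" using that dvd_imp_le[of p c] by auto
    hence "(of_nat c :: 'a) \<noteq> 0" unfolding of_nat_eq_0_iff_char_dvd p_def .
    thus ?thesis using a(1) by simp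
  qed
  have Lp: "(\<Sum>d<N. Polynomial.monom (char_sum N (of_nat c * a) d) d) = cz.L_poly (of_nat c * a)" for c
    unfolding cz.L_poly_def ..
  have half: "of_nat ?q powr (- (1/2) :: complex) = 1 / of_real (sqrt (real ?q))"
  proof -
    have 1: "of_nat ?q powr (- of_real (1/2) :: complex) = of_real (real ?q powr (- (1/2)))"
      using q1 by (intro powr_of_nat_real) simp
    have 2: "real ?q powr (- (1/2)) = 1 / sqrt (real ?q)"
      unfolding powr_minus powr_half_sqrt[OF of_nat_0_le_iff] by (rule inverse_eq_divide)
    show ?thesis using 1 unfolding 2 by simp
  qed
  have "zeta_K A.F ?R (1/2) = 0"
  proof -
    define r where "r = sqrt (real ?q)"
    have r: "r > 1" "r * r = real ?q" unfolding r_def using q1 by simp_all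
    have qr: "(of_nat ?q :: complex) = of_real (r * r)" unfolding r(2) by simp
    \<comment> \<open>s = 1/2 is not a pole: 1 / sqrt q and q / sqrt q = sqrt q both differ from
      1.\<close>
    have ne: "(1 / of_real r :: complex) \<noteq> 1" "of_nat ?q * (1 / of_real r :: complex) \<noteq> 1"
    proof -
      have "(1 / of_real r :: complex) = of_real (1 / r)" by simp
      moreover have "1 / r \<noteq> 1" using r(1) by simp
      ultimately show "(1 / of_real r :: complex) \<noteq> 1" by (simp only: of_real_eq_1_iff not_False_eq_True)
      have "of_nat ?q * (1 / of_real r :: complex) = of_real r" unfolding qr using r(1) by simp
      thus "of_nat ?q * (1 / of_real r :: complex) \<noteq> 1" using r(1) by simp
    qed
    have "zeta_K A.F ?R (1/2) = A.zeta_rat (1 / of_real r)"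
      using ne by (intro A.zeta_K_K[of "1/2", unfolded half r_def[symmetric]])
    moreover have "poly A.zeta_num (1 / of_real r) = 0"
    proof -
      have "1 \<in> {1..<p}" using p2 by simp
      moreover have "poly (cz.L_poly (of_nat 1 * a)) (1 / of_real r) = 0" using a(2) by (simp add: r_def)
      ultimately have "\<exists>c\<in>{1..<p}. poly (cz.L_poly (of_nat c * a)) (1 / of_real r) = 0" by (rule bexI[rotated])
      thus ?thesis unfolding A.zeta_num_def Lp poly_prod by (intro prod_zero) simp_all
    qed
    hence "A.zeta_rat (1 / of_real r) = 0" unfolding A.zeta_rat_def by simp
    ultimately show ?thesis by (rule trans)
  qed
  moreover have "degree A.zeta_num = (p - 1) * (N - 1)"
  proof -
    have dg: "degree (cz.L_poly (of_nat c * a)) = N - 1" if "c \<in> {1..<p}" for c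
      by (rule cz.degree_L_poly[OF ca[OF that]])
    have "cz.L_poly (of_nat c * a) \<noteq> 0" if c: "c \<in> {1..<p}" for c
    proof
      assume "cz.L_poly (of_nat c * a) = 0"
      hence "Polynomial.coeff (cz.L_poly (of_nat c * a)) 0 = 0" by simp
      thus False unfolding cz.coeff_L_poly[OF ca[OF c]] by simp
    qed
    hence "degree A.zeta_num = (\<Sum>c\<in>{1..<p}. degree (cz.L_poly (of_nat c * a)))"
      unfolding A.zeta_num_def Lp by (intro degree_prod_eq_sum_degree) blast
    thus ?thesis using dg by simp
  qed
  moreover have "zeta_K A.F ?R (of_real x) = zeta_fraction ?q A.zeta_num (of_real x)" if x: "x > 1" for x :: real
  proof -
    have u: "of_nat ?q powr (- of_real x :: complex) = of_real (real ?q powr (- x))"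
      using q1 by (intro powr_of_nat_real) simp
    note lt = powr_less_inverse[OF q1 x]
    have "(of_real (real ?q powr (- x)) :: complex) \<noteq> 1" by (simp only: of_real_eq_1_iff less_imp_neq[OF lt(2)] not_False_eq_True)
    moreover have e: "of_nat ?q * (of_real (real ?q powr (- x)) :: complex) = of_real (real ?q * real ?q powr (- x))" by simp
    have "of_nat ?q * (of_real (real ?q powr (- x)) :: complex) \<noteq> 1" unfolding e by (simp only: of_real_eq_1_iff less_imp_neq[OF lt(1)] not_False_eq_True)
    ultimately show ?thesis unfolding zeta_fraction_def u A.zeta_rat_def[symmetric]
      by (intro A.zeta_K_K[of "of_real x", unfolded u])
  qed
  moreover have "g ` A.F = {x \<in> carrier ?S. x [^]\<^bsub>?S\<^esub> ?q = x}"
    using I.image_fixed_points[of ?q] A.F_fixed_points by simp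
  ultimately have "central_zero_field ?q ((p - 1) * (N - 1)) ?S (g ` A.F) A.zeta_num"
    unfolding central_zero_field_def ze using fS A.global_function_field_image[OF fi] by (intro conjI allI impI)
  thus ?thesis unfolding p_def by (rule that)
qed

text \<open>An isomorphism maps constants to constants and so preserves zeta. The numerators then
  agree at q^(-x) for all real x > 1, infinitely many points at which the denominator is
  nonzero.\<close>

lemma central_zero_field_degree:
  assumes q: "q > 1" and A: "central_zero_field q m S F Z" and B: "central_zero_field q n T G Y" and iso: "S \<simeq> T"
  shows "m = n"
proof -
  have fS: "field S" "field T" and FG: "F = {x \<in> carrier S. x [^]\<^bsub>S\<^esub> q = x}" "G = {x \<in> carrier T. x [^]\<^bsub>T\<^esub> q = x}"
    and deg: "degree Z = m" "degree Y = n"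
    and ze: "\<And>x::real. x > 1 \<Longrightarrow> zeta_K F S (of_real x) = zeta_fraction q Z (of_real x)"
      "\<And>x::real. x > 1 \<Longrightarrow> zeta_K G T (of_real x) = zeta_fraction q Y (of_real x)"
    using A B unfolding central_zero_field_def by blast+
  obtain k where k: "k \<in> ring_iso S T" using iso unfolding is_ring_iso_def by blast
  interpret I: field_isom S T k by (intro field_isom.intro field_isom_axioms.intro fS k)
  have "k ` F = G" unfolding FG by (rule I.image_fixed_points)
  moreover have "F \<subseteq> carrier S" unfolding FG by blast
  ultimately have zz: "zeta_K G T = zeta_K F S" using I.zeta_K_image by blast
  let ?u = "\<lambda>x::real. of_real (real q powr (- x)) :: complex"
  have root: "poly (Z - Y) (?u x) = 0" if x: "x > 1" for x
  proof -
    have u: "of_nat q powr (- of_real x :: complex) = ?u x" using q by (intro powr_of_nat_real) simp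
    note lt = powr_less_inverse[OF q x]
    have 1: "1 - ?u x \<noteq> 0" unfolding right_minus_eq by (rule not_sym) (simp only: of_real_eq_1_iff less_imp_neq[OF lt(2)] not_False_eq_True)
    have e: "of_nat q * ?u x = of_real (real q * real q powr (- x))" by simp
    have 2: "1 - of_nat q * ?u x \<noteq> 0" unfolding right_minus_eq e by (rule not_sym) (simp only: of_real_eq_1_iff less_imp_neq[OF lt(1)] not_False_eq_True)
    have "zeta_fraction q Z (of_real x) = zeta_fraction q Y (of_real x)"
      using ze[OF x] unfolding zz by simp
    hence "poly Z (?u x) = poly Y (?u x)" unfolding zeta_fraction_def u using 1 2 by simp
    thus ?thesis by simp
  qed
  have "inj_on ?u {1<..}"
  proof (rule inj_onI)
    fix x y :: real assume "?u x = ?u y"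
    hence "real q powr (- x) = real q powr (- y)" by (simp only: of_real_eq_iff)
    thus "x = y" using q by (simp add: powr_inj)
  qed
  moreover have "infinite {1::real<..}" by (rule infinite_Ioi)
  ultimately have "infinite (?u ` {1<..})" using finite_imageD by blast
  moreover have "?u ` {1<..} \<subseteq> {z. poly (Z - Y) z = 0}" using root by blast
  ultimately have "infinite {z. poly (Z - Y) z = 0}" using finite_subset by blast
  hence "Z - Y = 0" using poly_roots_finite by blast
  thus ?thesis using deg by simp
qed

text \<open>A zeta value of 0 meets every bound, so infinitely many fields distinguished by the
  degrees of their numerators all belong to the set.\<close>

theorem infinite_northcott_set:
  assumes q4: "CARD('a::finite_field) mod 4 = 1" and B: "B \<ge> 0"
  shows "infinite (northcott_set CARD('a) (1/2) B)"
proof -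
  let ?q = "CARD('a)" and ?p = "CHAR('a)"
  have q1: "?q > 1" by (rule CARD_gt_1)
  have pp: "prime ?p" by simp
  have p2: "?p \<noteq> 2"
  proof
    assume "?p = 2"
    hence "even ?q" using finite_field_dim[where ?'a='a] by simp
    thus False using q4 by presburger
  qed
  \<comment> \<open>\<open>M j\<close> is odd and congruent to 1 modulo p; since p is odd, p does
    not divide 2 M.\<close>
  define M where "M j = 1 + 2 * ?p * j" for j
  define n where "n j = (?p - 1) * (2 * M j - 1)" for j
  have "\<exists>S F Z. central_zero_field ?q (n j) S F Z" for j
  proof -
    have "odd (M j)" unfolding M_def by simp
    moreover have "\<not> ?p dvd 2 * M j"
    proof
      assume "?p dvd 2 * M j"
      moreover have "2 * M j = 2 + ?p * (4 * j)" by (simp add: M_def)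
      ultimately have "?p dvd 2" by (metis dvd_add_left_iff dvd_triv_left)
      thus False using p2 pp primes_dvd_imp_eq two_is_prime_nat by blast
    qed
    ultimately show ?thesis using exists_central_zero_field[OF q4 refl] unfolding n_def by metis
  qed
  then obtain S F Z where czf: "\<And>j. central_zero_field ?q (n j) (S j) (F j) (Z j)" by metis
  have inj: "inj (\<lambda>j. field_iso_class (S j))"
  proof (rule injI)
    fix i j assume e: "field_iso_class (S i) = field_iso_class (S j)"
    have "field (S j)" using czf unfolding central_zero_field_def by blast
    hence "S j \<in> field_iso_class (S j)" unfolding field_iso_class_def using ring_iso_refl by simp
    hence "S j \<in> field_iso_class (S i)" unfolding e .
    hence "S i \<simeq> S j" unfolding field_iso_class_def by simp
    hence "n i = n j" by (rule central_zero_field_degree[OF q1 czf czf])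
    moreover have "?p - 1 > 0" using prime_ge_2_nat[OF pp] by simp
    ultimately have "2 * M i - 1 = 2 * M j - 1" unfolding n_def by simp
    hence "?p * i = ?p * j" unfolding M_def by simp
    thus "i = j" using prime_gt_0_nat[OF pp] by simp
  qed
  have "range (\<lambda>j. field_iso_class (S j)) \<subseteq> northcott_set ?q (1/2) B"
  proof (rule image_subsetI)
    fix j
    have "global_function_field ?q (F j) (S j)" "zeta_K (F j) (S j) (1/2) = 0"
      using czf[of j] unfolding central_zero_field_def by blast+
    moreover from this B have "cmod (zeta_K (F j) (S j) (1/2)) \<le> B" by simp
    ultimately show "field_iso_class (S j) \<in> northcott_set ?q (1/2) B" unfolding northcott_set_def by blast
  qed
  thus ?thesis using inj range_inj_infinite infinite_super by blast
qed

theorem theorem5p6: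
  fixes q :: nat and B :: real
  assumes "primepow q" and "q mod 4 = 1" and "B > 0"
  shows "\<not> northcott_property q (1/2) B"
proof
  assume "northcott_property q (1/2) B"
  hence "counterexample q" unfolding counterexample_def using assms by blast
  hence "counterexample field_order" by (rule field_order(3))
  then obtain C where C: "C > 0" "northcott_property field_order (1/2) C" unfolding counterexample_def by blast
  have "infinite (northcott_set CARD(galois_field) (1/2) C)"
    by (rule infinite_northcott_set) (use C(1) field_order(2) in \<open>simp_all add: CARD_galois_field\<close>)
  thus False using C(2) unfolding northcott_property_def CARD_galois_field by simp
qed

end
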